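(* Let $\mathfrak g,G,f_i,\Gamma^i,q_i,\mathfrak h,\mathfrak m_i,M_i,\chi_i,\mu_i,I_i$ ($i=1,2$) be as in the context, let $(e_2,h_2,f_2)$ be a $\Gamma^2$-triple and let $S_2=\chi_2+\operatorname{Ker}\operatorname{ad}^*(e_2)$ be the corresponding Slodowy slice. Assume: (1) there is a direct sum decomposition $\mathfrak m_2=\mathfrak m_1\oplus\mathfrak m_0$, where $\mathfrak m_0$ is an $\mathfrak h$-stable Lie subalgebra of $\mathfrak m_2$ and $\mathfrak m_1$ is an ideal of $\mathfrak m_2$; (2) the nilpotent element $f_0:=f_2-f_1$ and the Lie algebra $\mathfrak m_0$ are contained in $\mathfrak g^{(1)}_0$; (3) the semisimple element $q_0:=q_2-q_1$ commutes with $f_1$. Let $M_0$ be the unipotent subgroup of $G$ with Lie algebra $\mathfrak m_0$, acting on $\mu_1^{-1}(0)/M_1$ by $g\cdot[\xi]=[\operatorname{Ad}^*(g)\xi]$, a Hamiltonian action with moment map $\mu_0:[\xi]\mapsto(\xi-\chi_2)|_{\mathfrak m_0}$. Then the Hamiltonian reduction $\mu_0^{-1}(0)/M_0$ is a well-defined Poisson variety isomorphic to $S_2$, and the inclusion $\mu_2^{-1}(0)\subset\mu_1^{-1}(0)$ induces an isomorphism of Poisson varieties $$\mu_2^{-1}(0)/M_2\;\cong\;\mu_0^{-1}(0)/M_0 .$$ The corresponding homomorphism on coordinate rings $$\Psi:\bigl(\mathcal P(\mathfrak g,f_1)/I_0\bigr)^{\operatorname{ad}(\mathfrak m_0)}\to\mathcal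 P(\mathfrak g,f_2),\qquad (X\bmod I_1)\bmod I_0\mapsto X\bmod I_2,$$ is an isomorphism of Poisson algebras, where $I_0$ is the ideal of $\mathcal P(\mathfrak g,f_1)$ generated by the elements $(y-\chi_2(y))\bmod I_1$, $y\in\mathfrak m_0$.
   Context: The ground field is $\mathbb C$. $\mathfrak g$ is a finite-dimensional simple Lie algebra, $G$ a connected algebraic group with Lie algebra $\mathfrak g$, $(\cdot\mid\cdot)$ a nondegenerate invariant symmetric bilinear form on $\mathfrak g$, and $\Phi:\mathfrak g\to\mathfrak g^*$, $x\mapsto(x\mid\cdot)$. $\operatorname{Ad}^*$, $\operatorname{ad}^*$ are the coadjoint actions on $\mathfrak g^*$. Good gradings. For nilpotent $f\in\mathfrak g$, a good grading for $f$ is a $\mathbb Z$-grading $\Gamma:\mathfrak g=\bigoplus_j\mathfrak g_j$ with $[\mathfrak g_i,\mathfrak g_j]\subset\mathfrak g_{i+j}$, $f\in\mathfrak g_{-2}$, and $\operatorname{ad}(f):\mathfrak g_j\to\mathfrak g_{j-2}$ injective for $j\ge1$ and surjective for $j\le1$. There is a semisimple $q_\Gamma\in\mathfrak g$ with $\mathfrak g_j=\{x:[q_\Gamma,x]=jx\}$. A $\Gamma$-triple is an $\mathfrak{sl}_2$-triple $(e,h,f)$ with $h\in\mathfrak g_0$, $e\in\mathfrak g_2$. Put $\chi=\Phi(f)$. The form $\chi([\cdot,\cdot])$ is symplectic on $\mathfrak g_1$; choosing a Lagrangian subspace $\mathfrak l\subset\mathfrak g_1$, the associated good algebra is the nilpotent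 Lie subalgebra $\mathfrak m=\mathfrak l\oplus\bigoplus_{i\ge2}\mathfrak g_i$; $\chi|_{\mathfrak m}$ is a character of $\mathfrak m$. $M$ is the connected unipotent subgroup of $G$ with Lie algebra $\mathfrak m$; it acts on $\mathfrak g^*$ by $\operatorname{Ad}^*$ with moment map $\mu:\mathfrak g^*\to\mathfrak m^*$, $\xi\mapsto(\xi-\chi)|_{\mathfrak m}$. Reduction. $\mathbb C[\mathfrak g^*]=\mathcal S(\mathfrak g)$ (symmetric algebra) has the Poisson bracket extending the Lie bracket. $\mathbb C[\mu^{-1}(0)]=\mathcal S(\mathfrak g)/I$ with $I$ the ideal generated by $y-\chi(y)$, $y\in\mathfrak m$. The quotient $\mu^{-1}(0)/M$ is the affine variety with coordinate ring $\mathcal P(\mathfrak g,f):=(\mathcal S(\mathfrak g)/I)^{\operatorname{ad}(\mathfrak m)}$, a Poisson algebra with bracket $\{X\bmod I,Y\bmod I\}=\{X,Y\}\bmod I$. By a theorem of Gan–Ginzburg, restriction of functions to the Slodowy slice $S_f=\chi+\operatorname{Ker}\operatorname{ad}^*(e)\subset\mu^{-1}(0)$ gives an isomorphism $\mathcal P(\mathfrak g,f)\cong\mathbb C[S_f]$, through which $S_f$ is a Poisson variety. $[\xi]$ denotes the class of $\xi\in\mu^{-1}(0)$ in $\mu^{-1}(0)/M$. Data. $f_1,f_2\in\mathfrak g$ are nilpotent; for $i=1,2$, $\Gamma^i:\mathfrak g=\bigoplus_j\mathfrak g^{(i)}_j$ is a good grading for $f_i$ with semisimple element $q_i$, where $q_1,q_2$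 lie in a common Cartan subalgebra $\mathfrak h$; $\chi_i=\Phi(f_i)$; $\mathfrak m_i$ is a good algebra for $(f_i,\Gamma^i)$ (some choice of Lagrangian subspace of $\mathfrak g^{(i)}_1$), with group $M_i$, moment map $\mu_i$ and ideal $I_i\subset\mathcal S(\mathfrak g)$ generated by $y-\chi_i(y)$, $y\in\mathfrak m_i$. Second stage. The reduction $\mu_0^{-1}(0)/M_0$ has coordinate ring $(\mathcal P(\mathfrak g,f_1)/I_0)^{\operatorname{ad}(\mathfrak m_0)}$, the set of classes $X\bmod I_0$ with $\{y\bmod I_1,X\}\in I_0$ for all $y\in\mathfrak m_0$, with bracket $\{X\bmod I_0,Y\bmod I_0\}=\{X,Y\}\bmod I_0$. *)

theory Defs
  imports "HOL-Analysis.Analysis" "HOL-Algebra.Generated_Rings" "HOL-Algebra.QuotRing" "HOL-Algebra.Module"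
begin

section \<open>Lie algebras over the complex numbers\<close>

locale complex_lie_algebra = vector_space sc
  for sc :: "complex \<Rightarrow> 'g::ab_group_add \<Rightarrow> 'g" +
  fixes br :: "'g \<Rightarrow> 'g \<Rightarrow> 'g"
  assumes br_add_left: "br (x + y) z = br x z + br y z"
    and br_add_right: "br x (y + z) = br x y + br x z"
    and br_scale_left: "br (sc c x) y = sc c (br x y)"
    and br_scale_right: "br x (sc c y) = sc c (br x y)"
    and br_self: "br x x = 0"
    and jacobi: "br x (br y z) + br y (br z x) + br z (br x y) = 0"

definition lie_ideal ::
  "(complex \<Rightarrow> 'g::ab_group_add \<Rightarrow> 'g) \<Rightarrow> ('g \<Rightarrow> 'g \<Rightarrow> 'g) \<Rightarrow> 'g set \<Rightarrow> 'g set \<Rightarrow> bool" where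
  "lie_ideal sc br J L \<longleftrightarrow> Modules.module.subspace sc J \<and> J \<subseteq> L \<and> (\<forall>x\<in>L. \<forall>y\<in>J. br x y \<in> J)"

definition lie_subalgebra ::
  "(complex \<Rightarrow> 'g::ab_group_add \<Rightarrow> 'g) \<Rightarrow> ('g \<Rightarrow> 'g \<Rightarrow> 'g) \<Rightarrow> 'g set \<Rightarrow> bool" where
  "lie_subalgebra sc br L \<longleftrightarrow> Modules.module.subspace sc L \<and> (\<forall>x\<in>L. \<forall>y\<in>L. br x y \<in> L)"

locale fd_simple_lie_algebra = complex_lie_algebra +
  assumes finite_dim: "\<exists>A. finite A \<and> Modules.module.span sc A = UNIV"
    and nonabelian: "\<exists>x y. br x y \<noteq> 0"
    and no_ideals: "lie_ideal sc br J UNIV \<Longrightarrow> J = {0} \<or> J = UNIV"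

fun lower_central ::
  "(complex \<Rightarrow> 'g::ab_group_add \<Rightarrow> 'g) \<Rightarrow> ('g \<Rightarrow> 'g \<Rightarrow> 'g) \<Rightarrow> 'g set \<Rightarrow> nat \<Rightarrow> 'g set" where
  "lower_central sc br L 0 = L"
| "lower_central sc br L (Suc n) =
     Modules.module.span sc {br x y | x y. x \<in> L \<and> y \<in> lower_central sc br L n}"

definition cartan_subalgebra ::
  "(complex \<Rightarrow> 'g::ab_group_add \<Rightarrow> 'g) \<Rightarrow> ('g \<Rightarrow> 'g \<Rightarrow> 'g) \<Rightarrow> 'g set \<Rightarrow> bool" where
  "cartan_subalgebra sc br L \<longleftrightarrow>
     lie_subalgebra sc br L \<and> (\<exists>n. lower_central sc br L n = {0}) \<and> {x. \<forall>y\<in>L. br x y \<in> L} = L"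

definition nilpotent_element :: "('g \<Rightarrow> 'g::ab_group_add \<Rightarrow> 'g) \<Rightarrow> 'g \<Rightarrow> bool" where
  "nilpotent_element br f \<longleftrightarrow> (\<exists>n. \<forall>x. (br f ^^ n) x = 0)"

definition semisimple_element ::
  "(complex \<Rightarrow> 'g::ab_group_add \<Rightarrow> 'g) \<Rightarrow> ('g \<Rightarrow> 'g \<Rightarrow> 'g) \<Rightarrow> 'g \<Rightarrow> bool" where
  "semisimple_element sc br q \<longleftrightarrow> Modules.module.span sc {x. \<exists>c. br q x = sc c x} = UNIV"

definition nondeg_invariant_form ::
  "(complex \<Rightarrow> 'g::ab_group_add \<Rightarrow> 'g) \<Rightarrow> ('g \<Rightarrow> 'g \<Rightarrow> 'g) \<Rightarrow> ('g \<Rightarrow> 'g \<Rightarrow> complex) \<Rightarrow> bool" where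
  "nondeg_invariant_form sc br form \<longleftrightarrow>
     (\<forall>x. Vector_Spaces.linear sc (*) (form x)) \<and> (\<forall>x y. form x y = form y x) \<and>
     (\<forall>x y z. form (br x y) z = form x (br y z)) \<and> (\<forall>x. (\<forall>y. form x y = 0) \<longrightarrow> x = 0)"


section \<open>Good gradings and good algebras\<close>

definition Z_grading ::
  "(complex \<Rightarrow> 'g::ab_group_add \<Rightarrow> 'g) \<Rightarrow> ('g \<Rightarrow> 'g \<Rightarrow> 'g) \<Rightarrow> (int \<Rightarrow> 'g set) \<Rightarrow> bool" where
  "Z_grading sc br \<Gamma> \<longleftrightarrow>
     (\<forall>j. Modules.module.subspace sc (\<Gamma> j)) \<and>
     (\<forall>x. \<exists>!c. (\<forall>j. c j \<in> \<Gamma> j) \<and> finite {j. c j \<noteq> 0} \<and> x = (\<Sum>j | c j \<noteq> 0. c j)) \<and>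
     (\<forall>i j. \<forall>x\<in>\<Gamma> i. \<forall>y\<in>\<Gamma> j. br x y \<in> \<Gamma> (i + j))"

definition good_grading ::
  "(complex \<Rightarrow> 'g::ab_group_add \<Rightarrow> 'g) \<Rightarrow> ('g \<Rightarrow> 'g \<Rightarrow> 'g) \<Rightarrow> 'g \<Rightarrow> (int \<Rightarrow> 'g set) \<Rightarrow> bool" where
  "good_grading sc br f \<Gamma> \<longleftrightarrow>
     Z_grading sc br \<Gamma> \<and> f \<in> \<Gamma> (-2) \<and>
     (\<forall>j\<ge>1. inj_on (br f) (\<Gamma> j)) \<and> (\<forall>j\<le>1. br f ` \<Gamma> j = \<Gamma> (j - 2))"

definition grading_element ::
  "(complex \<Rightarrow> 'g::ab_group_add \<Rightarrow> 'g) \<Rightarrow> ('g \<Rightarrow> 'g \<Rightarrow> 'g) \<Rightarrow> (int \<Rightarrow> 'g set) \<Rightarrow> 'g \<Rightarrow> bool" where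
  "grading_element sc br \<Gamma> q \<longleftrightarrow>
     semisimple_element sc br q \<and> (\<forall>j. \<Gamma> j = {x. br q x = sc (of_int j) x})"

definition graded_sl2_triple ::
  "(complex \<Rightarrow> 'g::ab_group_add \<Rightarrow> 'g) \<Rightarrow> ('g \<Rightarrow> 'g \<Rightarrow> 'g) \<Rightarrow> (int \<Rightarrow> 'g set) \<Rightarrow> 'g \<Rightarrow> 'g \<Rightarrow> 'g \<Rightarrow> bool" where
  "graded_sl2_triple sc br \<Gamma> e h f \<longleftrightarrow>
     br h e = sc 2 e \<and> br h f = sc (-2) f \<and> br e f = h \<and> h \<in> \<Gamma> 0 \<and> e \<in> \<Gamma> 2"

definition good_algebra ::
  "(complex \<Rightarrow> 'g::ab_group_add \<Rightarrow> 'g) \<Rightarrow> ('g \<Rightarrow> 'g \<Rightarrow> 'g) \<Rightarrow> ('g \<Rightarrow> complex) \<Rightarrow> (int \<Rightarrow> 'g set) \<Rightarrow> 'g set \<Rightarrow> bool" where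
  "good_algebra sc br chi \<Gamma> m \<longleftrightarrow>
     (\<exists>l. Modules.module.subspace sc l \<and> l \<subseteq> \<Gamma> 1 \<and>
          l = {x \<in> \<Gamma> 1. \<forall>y\<in>l. chi (br x y) = 0} \<and>
          m = Modules.module.span sc (l \<union> (\<Union>i\<in>{2..}. \<Gamma> i)))"


section \<open>Affine Poisson varieties\<close>

definition complex_ring :: "complex ring" where
  "complex_ring = \<lparr>carrier = UNIV, mult = (*), one = 1, zero = 0, add = (+)\<rparr>"

record ('a, 'b) poisson = "('a, 'b) module" +
  pbracket :: "'b \<Rightarrow> 'b \<Rightarrow> 'b"

locale poisson_algebra = algebra complex_ring A
  for A :: "(complex, 'b) poisson" (structure) +
  assumes pb_closed: "\<lbrakk>X \<in> carrier A; Y \<in> carrier A\<rbrakk> \<Longrightarrow> pbracket A X Y \<in> carrier A"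
    and pb_add: "\<lbrakk>X \<in> carrier A; Y \<in> carrier A; Z \<in> carrier A\<rbrakk> \<Longrightarrow>
      pbracket A (X \<oplus> Y) Z = pbracket A X Z \<oplus> pbracket A Y Z"
    and pb_smult: "\<lbrakk>X \<in> carrier A; Y \<in> carrier A\<rbrakk> \<Longrightarrow> pbracket A (c \<odot> X) Y = c \<odot> pbracket A X Y"
    and pb_antisym: "\<lbrakk>X \<in> carrier A; Y \<in> carrier A\<rbrakk> \<Longrightarrow> pbracket A X Y = \<ominus> pbracket A Y X"
    and pb_jacobi: "\<lbrakk>X \<in> carrier A; Y \<in> carrier A; Z \<in> carrier A\<rbrakk> \<Longrightarrow>
      pbracket A X (pbracket A Y Z) \<oplus> pbracket A Y (pbracket A Z X) \<oplus> pbracket A Z (pbracket A X Y) = \<zero>"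
    and pb_leibniz: "\<lbrakk>X \<in> carrier A; Y \<in> carrier A; Z \<in> carrier A\<rbrakk> \<Longrightarrow>
      pbracket A X (Y \<otimes> Z) = pbracket A X Y \<otimes> Z \<oplus> Y \<otimes> pbracket A X Z"

definition poisson_iso :: "(complex, 'b) poisson \<Rightarrow> (complex, 'c) poisson \<Rightarrow> ('b \<Rightarrow> 'c) set" where
  "poisson_iso A B = {\<psi> \<in> ring_iso A B.
     (\<forall>c. \<forall>X\<in>carrier A. \<psi> (c \<odot>\<^bsub>A\<^esub> X) = c \<odot>\<^bsub>B\<^esub> \<psi> X) \<and>
     (\<forall>X\<in>carrier A. \<forall>Y\<in>carrier A. \<psi> (pbracket A X Y) = pbracket B (\<psi> X) (\<psi> Y))}"

text \<open>A (candidate) variety is a set of points, a coordinate algebra and the pairing between the two.\<close>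

record ('p, 'b) pvariety =
  points :: "'p set"
  coord_alg :: "(complex, 'b) poisson"
  evl :: "'b \<Rightarrow> 'p \<Rightarrow> complex"

definition complex_characters :: "(complex, 'b) poisson \<Rightarrow> ('b \<Rightarrow> complex) set" where
  "complex_characters A =
     {h \<in> ring_hom A complex_ring. \<forall>c. \<forall>X\<in>carrier A. h (c \<odot>\<^bsub>A\<^esub> X) = c * h X}"

text \<open>The coordinate algebra is finitely generated, has no nonzero element vanishing at all points
  (so it is reduced), and the points are its maximal spectrum.\<close>

definition affine_poisson_variety :: "('p, 'b) pvariety \<Rightarrow> bool" where
  "affine_poisson_variety V \<longleftrightarrow>
     (let A = coord_alg V in
      poisson_algebra A \<and>
      (\<exists>F. finite F \<and> F \<subseteq> carrier A \<and> generate_ring A (range (\<lambda>c. c \<odot>\<^bsub>A\<^esub> \<one>\<^bsub>A\<^esub>) \<union> F) = carrier A) \<and>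
      (\<forall>X\<in>carrier A. (\<forall>p\<in>points V. evl V X p = 0) \<longrightarrow> X = \<zero>\<^bsub>A\<^esub>) \<and>
      (\<forall>p\<in>points V. (\<lambda>X. evl V X p) \<in> complex_characters A) \<and>
      (\<forall>h\<in>complex_characters A. \<exists>!p. p \<in> points V \<and> (\<forall>X\<in>carrier A. h X = evl V X p)))"

text \<open>An isomorphism of Poisson varieties is a map of points together with its comorphism.\<close>

definition pvariety_iso ::
  "('p, 'b) pvariety \<Rightarrow> ('q, 'c) pvariety \<Rightarrow> ('p \<Rightarrow> 'q) \<Rightarrow> ('c \<Rightarrow> 'b) \<Rightarrow> bool" where
  "pvariety_iso V W \<iota> \<psi> \<longleftrightarrow>
     affine_poisson_variety V \<and> affine_poisson_variety W \<and>
     bij_betw \<iota> (points V) (points W) \<and> \<psi> \<in> poisson_iso (coord_alg W) (coord_alg V) \<and>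
     (\<forall>X\<in>carrier (coord_alg W). \<forall>p\<in>points V. evl V (\<psi> X) p = evl W X (\<iota> p))"


section \<open>The Poisson variety dual to a Lie algebra\<close>

inductive_set poly_functions :: "('p \<Rightarrow> complex) set \<Rightarrow> ('p \<Rightarrow> complex) set"
  for C :: "('p \<Rightarrow> complex) set" where
  const: "(\<lambda>_. c) \<in> poly_functions C"
| coord: "F \<in> C \<Longrightarrow> F \<in> poly_functions C"
| add: "\<lbrakk>F \<in> poly_functions C; H \<in> poly_functions C\<rbrakk> \<Longrightarrow> (\<lambda>p. F p + H p) \<in> poly_functions C"
| mult: "\<lbrakk>F \<in> poly_functions C; H \<in> poly_functions C\<rbrakk> \<Longrightarrow> (\<lambda>p. F p * H p) \<in> poly_functions C"

definition dual_space :: "(complex \<Rightarrow> 'g::ab_group_add \<Rightarrow> 'g) \<Rightarrow> ('g \<Rightarrow> complex) set" where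
  "dual_space sc = {\<xi>. Vector_Spaces.linear sc (*) \<xi>}"

definition regular_functions :: "('g \<Rightarrow> complex) set \<Rightarrow> (('g \<Rightarrow> complex) \<Rightarrow> complex) set" where
  "regular_functions S = (\<lambda>F. restrict F S) ` poly_functions (range (\<lambda>x \<xi>. \<xi> x))"

definition function_algebra ::
  "'p set \<Rightarrow> ('p \<Rightarrow> complex) set \<Rightarrow> (('p \<Rightarrow> complex) \<Rightarrow> ('p \<Rightarrow> complex) \<Rightarrow> ('p \<Rightarrow> complex))
     \<Rightarrow> (complex, 'p \<Rightarrow> complex) poisson" where
  "function_algebra S Fs b =
     \<lparr>carrier = Fs, mult = (\<lambda>F H. \<lambda>p\<in>S. F p * H p), one = (\<lambda>p\<in>S. 1), zero = (\<lambda>p\<in>S. 0),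
      add = (\<lambda>F H. \<lambda>p\<in>S. F p + H p), smult = (\<lambda>c F. \<lambda>p\<in>S. c * F p), pbracket = b\<rparr>"

text \<open>The differential of a function on the dual space, as an element of the Lie algebra
  (the bidual).\<close>

definition differential ::
  "(complex \<Rightarrow> 'g::ab_group_add \<Rightarrow> 'g) \<Rightarrow> (('g \<Rightarrow> complex) \<Rightarrow> complex) \<Rightarrow> ('g \<Rightarrow> complex) \<Rightarrow> 'g" where
  "differential sc F \<xi> =
     (THE x. \<forall>\<eta>\<in>dual_space sc. ((\<lambda>t. F (\<lambda>y. \<xi> y + t * \<eta> y)) has_field_derivative \<eta> x) (at 0))"

definition lie_poisson ::
  "(complex \<Rightarrow> 'g::ab_group_add \<Rightarrow> 'g) \<Rightarrow> ('g \<Rightarrow> 'g \<Rightarrow> 'g) \<Rightarrow>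
     (('g \<Rightarrow> complex) \<Rightarrow> complex) \<Rightarrow> (('g \<Rightarrow> complex) \<Rightarrow> complex) \<Rightarrow> ('g \<Rightarrow> complex) \<Rightarrow> complex" where
  "lie_poisson sc br F H =
     (\<lambda>\<xi>\<in>dual_space sc. \<xi> (br (differential sc F \<xi>) (differential sc H \<xi>)))"

text \<open>The symmetric algebra of the Lie algebra, as the algebra of polynomial functions on the dual.\<close>

definition sym_alg ::
  "(complex \<Rightarrow> 'g::ab_group_add \<Rightarrow> 'g) \<Rightarrow> ('g \<Rightarrow> 'g \<Rightarrow> 'g) \<Rightarrow> (complex, ('g \<Rightarrow> complex) \<Rightarrow> complex) poisson" where
  "sym_alg sc br =
     function_algebra (dual_space sc) (regular_functions (dual_space sc)) (lie_poisson sc br)"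

definition lin ::
  "(complex \<Rightarrow> 'g::ab_group_add \<Rightarrow> 'g) \<Rightarrow> 'g \<Rightarrow> ('g \<Rightarrow> complex) \<Rightarrow> complex" where
  "lin sc y = (\<lambda>\<xi>\<in>dual_space sc. \<xi> y)"

definition lin_shift ::
  "(complex \<Rightarrow> 'g::ab_group_add \<Rightarrow> 'g) \<Rightarrow> ('g \<Rightarrow> complex) \<Rightarrow> 'g \<Rightarrow> ('g \<Rightarrow> complex) \<Rightarrow> complex" where
  "lin_shift sc chi y = (\<lambda>\<xi>\<in>dual_space sc. \<xi> y - chi y)"

text \<open>\<^const>\<open>lie_poisson\<close> makes \<^const>\<open>sym_alg\<close> a Poisson algebra and extends the Lie bracket.\<close>

context complex_lie_algebra
begin

abbreviation "dual \<equiv> dual_space sc"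
abbreviation "evals \<equiv> range (\<lambda>(x::'g) (\<xi>::'g \<Rightarrow> complex). \<xi> x)"
abbreviation "reg \<equiv> regular_functions dual"
abbreviation "d \<equiv> differential sc"

lemma vs_complex: "vector_space ((*) :: complex \<Rightarrow> complex \<Rightarrow> complex)"
  by unfold_locales (auto simp: algebra_simps)

lemma dual_iff:
  "\<xi> \<in> dual \<longleftrightarrow> (\<forall>x y. \<xi> (x + y) = \<xi> x + \<xi> y) \<and> (\<forall>c x. \<xi> (sc c x) = c * \<xi> x)"
proof -
  have "vector_space sc" ..
  then show ?thesis
    using vs_complex by (auto simp: dual_space_def Vector_Spaces.linear_iff)
qed

lemma dual_line: "\<xi> \<in> dual \<Longrightarrow> \<eta> \<in> dual \<Longrightarrow> (\<lambda>y. \<xi> y + t * \<eta> y) \<in> dual"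
  by (auto simp: dual_iff algebra_simps)

lemma dual_0: "\<xi> \<in> dual \<Longrightarrow> \<xi> 0 = 0"
  by (metis add_cancel_right_right dual_iff)

lemma dual_minus: "\<xi> \<in> dual \<Longrightarrow> \<xi> (- x) = - \<xi> x"
  by (metis add_eq_0_iff dual_0 dual_iff)

lemma dual_separates:
  assumes "\<And>\<eta>. \<eta> \<in> dual \<Longrightarrow> \<eta> x = \<eta> y"
  shows "x = y"
proof (rule ccontr)
  assume ne: "x \<noteq> y"
  interpret vp: vector_space_pair sc "(*) :: complex \<Rightarrow> complex \<Rightarrow> complex"
    by (intro vector_space_pair.intro vs_complex vector_space_axioms)
  have "independent {x - y}"
    using ne by (simp add: independent_insert)
  from vp.linear_independent_extend[OF this, of "\<lambda>_. 1"]
  obtain g where g: "Vector_Spaces.linear sc (*) g" "g (x - y) = 1" by auto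
  then have gd: "g \<in> dual" by (simp add: dual_space_def)
  have "g (x - y + y) = g (x - y) + g y" using gd by (simp only: dual_iff)
  with assms[OF gd] g(2) show False by simp
qed

definition has_diff :: "(('g \<Rightarrow> complex) \<Rightarrow> complex) \<Rightarrow> ('g \<Rightarrow> complex) \<Rightarrow> 'g \<Rightarrow> bool" where
  "has_diff F \<xi> x \<longleftrightarrow> (\<forall>\<eta>\<in>dual. ((\<lambda>t. F (\<lambda>y. \<xi> y + t * \<eta> y)) has_field_derivative \<eta> x) (at 0))"

lemma differential_eqI:
  assumes "has_diff F \<xi> x" shows "d F \<xi> = x"
  unfolding differential_def
proof (rule the_equality)
  show "\<forall>\<eta>\<in>dual. ((\<lambda>t. F (\<lambda>y. \<xi> y + t * \<eta> y)) has_field_derivative \<eta> x) (at 0)"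
    using assms unfolding has_diff_def .
  fix z
  assume "\<forall>\<eta>\<in>dual. ((\<lambda>t. F (\<lambda>y. \<xi> y + t * \<eta> y)) has_field_derivative \<eta> z) (at 0)"
  then have z: "has_diff F \<xi> z" unfolding has_diff_def .
  show "z = x"
  proof (rule dual_separates)
    fix \<eta> assume "\<eta> \<in> dual"
    then show "\<eta> z = \<eta> x"
      using assms z unfolding has_diff_def by (blast intro: DERIV_unique)
  qed
qed

lemma has_diff_restrict: "\<xi> \<in> dual \<Longrightarrow> has_diff (restrict F dual) \<xi> x \<longleftrightarrow> has_diff F \<xi> x"
  by (simp add: has_diff_def dual_line)

lemma has_diff_const: "has_diff (\<lambda>_. c) \<xi> 0"
  by (simp add: has_diff_def dual_0)

lemma has_diff_eval: "has_diff (\<lambda>\<xi>. \<xi> x) \<xi> x"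
  by (auto simp: has_diff_def intro!: derivative_eq_intros)

lemma has_diff_add: "has_diff F \<xi> x \<Longrightarrow> has_diff H \<xi> y \<Longrightarrow> has_diff (\<lambda>p. F p + H p) \<xi> (x + y)"
  by (auto simp: has_diff_def dual_iff intro!: DERIV_add)

lemma has_diff_mult:
  "has_diff F \<xi> x \<Longrightarrow> has_diff H \<xi> y \<Longrightarrow> has_diff (\<lambda>p. F p * H p) \<xi> (sc (H \<xi>) x + sc (F \<xi>) y)"
proof (unfold has_diff_def, intro ballI)
  fix \<eta> assume *: "\<eta> \<in> dual"
    "\<forall>\<eta>\<in>dual. ((\<lambda>t. F (\<lambda>y. \<xi> y + t * \<eta> y)) has_field_derivative \<eta> x) (at 0)"
    "\<forall>\<eta>\<in>dual. ((\<lambda>t. H (\<lambda>y. \<xi> y + t * \<eta> y)) has_field_derivative \<eta> y) (at 0)"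
  have "\<eta> (sc (H \<xi>) x + sc (F \<xi>) y) = \<eta> x * H \<xi> + \<eta> y * F \<xi>"
    using *(1) by (simp add: dual_iff)
  with DERIV_mult[OF *(2)[rule_format, OF *(1)] *(3)[rule_format, OF *(1)]]
  show "((\<lambda>t. F (\<lambda>y. \<xi> y + t * \<eta> y) * H (\<lambda>y. \<xi> y + t * \<eta> y)) has_field_derivative
      \<eta> (sc (H \<xi>) x + sc (F \<xi>) y)) (at 0)"
    by simp
qed

lemma poly_has_diff: "F \<in> poly_functions evals \<Longrightarrow> \<exists>x. has_diff F \<xi> x"
proof (induction rule: poly_functions.induct)
  case (const c) show ?case by (rule exI, rule has_diff_const)
next
  case (coord F)
  then obtain x where "F = (\<lambda>\<xi>. \<xi> x)" by (elim rangeE)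
  then show ?case using has_diff_eval[of x \<xi>] by (simp only:) (rule exI)
next
  case (add F H)
  then show ?case by (elim exE) (rule exI, rule has_diff_add)
next
  case (mult F H)
  then show ?case by (elim exE) (rule exI, rule has_diff_mult)
qed

lemma reg_poly: "F \<in> reg \<Longrightarrow> \<exists>F'\<in>poly_functions evals. F = restrict F' dual"
  unfolding regular_functions_def by blast

lemma poly_reg: "F \<in> poly_functions evals \<Longrightarrow> restrict F dual \<in> reg"
  unfolding regular_functions_def by blast

lemma reg_has_diff: "F \<in> reg \<Longrightarrow> \<xi> \<in> dual \<Longrightarrow> has_diff F \<xi> (d F \<xi>)"
proof -
  assume *: "F \<in> reg" "\<xi> \<in> dual"
  then obtain F' where F': "F = restrict F' dual" "F' \<in> poly_functions evals"
    using reg_poly by blast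
  obtain x where "has_diff F' \<xi> x"
    using poly_has_diff[OF F'(2), of \<xi>] by (rule exE)
  then have "has_diff F \<xi> x" by (simp add: F'(1) has_diff_restrict[OF *(2)])
  then show ?thesis using differential_eqI[of F \<xi> x] by simp
qed

lemma lin_in_reg: "lin sc x \<in> reg"
proof -
  have "(\<lambda>\<xi>. \<xi> x) \<in> evals" by (rule rangeI)
  then show ?thesis unfolding lin_def by (rule poly_reg[OF poly_functions.coord])
qed

lemma const_in_reg: "(\<lambda>\<xi>\<in>dual. c) \<in> reg"
  by (rule poly_reg[OF poly_functions.const])

lemma add_in_reg: "F \<in> reg \<Longrightarrow> H \<in> reg \<Longrightarrow> (\<lambda>\<xi>\<in>dual. F \<xi> + H \<xi>) \<in> reg"
proof -
  assume "F \<in> reg" "H \<in> reg"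
  then obtain F' H' where F': "F' \<in> poly_functions evals" "F = restrict F' dual"
    and H': "H' \<in> poly_functions evals" "H = restrict H' dual"
    using reg_poly by blast
  have "(\<lambda>\<xi>\<in>dual. F \<xi> + H \<xi>) = restrict (\<lambda>p. F' p + H' p) dual"
    by (rule restrict_ext) (simp add: F'(2) H'(2))
  then show ?thesis
    using poly_reg[OF poly_functions.add[OF F'(1) H'(1)]] by simp
qed

lemma mult_in_reg: "F \<in> reg \<Longrightarrow> H \<in> reg \<Longrightarrow> (\<lambda>\<xi>\<in>dual. F \<xi> * H \<xi>) \<in> reg"
proof -
  assume "F \<in> reg" "H \<in> reg"
  then obtain F' H' where F': "F' \<in> poly_functions evals" "F = restrict F' dual"
    and H': "H' \<in> poly_functions evals" "H = restrict H' dual"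
    using reg_poly by blast
  have "(\<lambda>\<xi>\<in>dual. F \<xi> * H \<xi>) = restrict (\<lambda>p. F' p * H' p) dual"
    by (rule restrict_ext) (simp add: F'(2) H'(2))
  then show ?thesis
    using poly_reg[OF poly_functions.mult[OF F'(1) H'(1)]] by simp
qed

lemma smult_in_reg: "F \<in> reg \<Longrightarrow> (\<lambda>\<xi>\<in>dual. c * F \<xi>) \<in> reg"
proof -
  assume "F \<in> reg"
  from mult_in_reg[OF const_in_reg[of c] this] show ?thesis
    by (metis (no_types, lifting) restrict_apply' restrict_ext)
qed

lemma reg_ext: "F \<in> reg \<Longrightarrow> H \<in> reg \<Longrightarrow> (\<And>\<xi>. \<xi> \<in> dual \<Longrightarrow> F \<xi> = H \<xi>) \<Longrightarrow> F = H"
  by (metis reg_poly restrict_apply' restrict_ext)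

lemma reg_induct [consumes 1, case_names const lin add mult]:
  assumes "F \<in> reg"
    and "\<And>c. P (\<lambda>\<xi>\<in>dual. c)" "\<And>x. P (lin sc x)"
    and "\<And>F H. F \<in> reg \<Longrightarrow> H \<in> reg \<Longrightarrow> P F \<Longrightarrow> P H \<Longrightarrow> P (\<lambda>\<xi>\<in>dual. F \<xi> + H \<xi>)"
    and "\<And>F H. F \<in> reg \<Longrightarrow> H \<in> reg \<Longrightarrow> P F \<Longrightarrow> P H \<Longrightarrow> P (\<lambda>\<xi>\<in>dual. F \<xi> * H \<xi>)"
  shows "P F"
proof -
  have "P (restrict F dual)" if "F \<in> poly_functions evals" for F
    using that
  proof (induction rule: poly_functions.induct)
    case (const c)
    then show ?case using assms(2) .
  next
    case (coord F)
    then show ?case using assms(3) by (auto simp only: lin_def)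
  next
    case (add F H)
    have "restrict F dual \<in> reg" "restrict H dual \<in> reg"
      using add poly_reg by blast+
    moreover have "(\<lambda>\<xi>\<in>dual. restrict F dual \<xi> + restrict H dual \<xi>) = (\<lambda>\<xi>\<in>dual. F \<xi> + H \<xi>)"
      by (rule restrict_ext) simp
    ultimately show ?case using assms(4) add.IH by metis
  next
    case (mult F H)
    have "restrict F dual \<in> reg" "restrict H dual \<in> reg"
      using mult poly_reg by blast+
    moreover have "(\<lambda>\<xi>\<in>dual. restrict F dual \<xi> * restrict H dual \<xi>) = (\<lambda>\<xi>\<in>dual. F \<xi> * H \<xi>)"
      by (rule restrict_ext) simp
    ultimately show ?case using assms(5) mult.IH by metis
  qed
  then show ?thesis using assms(1) reg_poly by blast
qed

lemma d_const: "\<xi> \<in> dual \<Longrightarrow> d (\<lambda>\<xi>\<in>dual. c) \<xi> = 0"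
  by (intro differential_eqI) (simp add: has_diff_restrict has_diff_const)

lemma d_lin: "\<xi> \<in> dual \<Longrightarrow> d (lin sc x) \<xi> = x"
  unfolding lin_def by (intro differential_eqI) (simp add: has_diff_restrict has_diff_eval)

lemma d_add:
  "F \<in> reg \<Longrightarrow> H \<in> reg \<Longrightarrow> \<xi> \<in> dual \<Longrightarrow> d (\<lambda>\<xi>\<in>dual. F \<xi> + H \<xi>) \<xi> = d F \<xi> + d H \<xi>"
  by (intro differential_eqI) (simp add: has_diff_restrict has_diff_add reg_has_diff)

lemma d_mult:
  "F \<in> reg \<Longrightarrow> H \<in> reg \<Longrightarrow> \<xi> \<in> dual \<Longrightarrow>
    d (\<lambda>\<xi>\<in>dual. F \<xi> * H \<xi>) \<xi> = sc (H \<xi>) (d F \<xi>) + sc (F \<xi>) (d H \<xi>)"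
  by (intro differential_eqI) (simp add: has_diff_restrict has_diff_mult reg_has_diff)

abbreviation "pb \<equiv> lie_poisson sc br"

lemma br_zero: "br 0 x = 0" "br x 0 = 0"
  using br_add_left[of 0 0 x] br_add_right[of x 0 0] by auto

lemma br_swap: "br x y = - br y x"
proof -
  have "br (x + y) (x + y) = br x x + br y x + (br x y + br y y)"
    by (simp only: br_add_left br_add_right add_ac)
  then have "br y x + br x y = 0" by (simp add: br_self)
  then show ?thesis by (simp add: eq_neg_iff_add_eq_0 add.commute)
qed

lemma pb_at: "\<xi> \<in> dual \<Longrightarrow> pb F H \<xi> = \<xi> (br (d F \<xi>) (d H \<xi>))"
  by (simp add: lie_poisson_def)

lemma pb_outside: "\<xi> \<notin> dual \<Longrightarrow> pb F H \<xi> = undefined"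
  by (simp add: lie_poisson_def)

lemma pb_swap_at: "\<xi> \<in> dual \<Longrightarrow> pb F H \<xi> = - pb H F \<xi>"
  by (metis br_swap dual_minus pb_at)

lemma pb_swap: "pb F H = (\<lambda>\<xi>\<in>dual. - pb H F \<xi>)"
proof
  fix \<xi> show "pb F H \<xi> = (\<lambda>\<xi>\<in>dual. - pb H F \<xi>) \<xi>"
    by (cases "\<xi> \<in> dual") (simp_all add: pb_outside pb_swap_at[of \<xi> F H])
qed

lemma pb_const_left: "pb (\<lambda>\<xi>\<in>dual. c) H = (\<lambda>\<xi>\<in>dual. 0)"
  by (auto simp: fun_eq_iff pb_outside pb_at d_const br_zero dual_0)

lemma pb_lin_lin: "pb (lin sc x) (lin sc y) = lin sc (br x y)"
proof
  fix \<xi> show "pb (lin sc x) (lin sc y) \<xi> = lin sc (br x y) \<xi>"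
  proof (cases "\<xi> \<in> dual")
    case True
    then show ?thesis by (simp only: pb_at d_lin) (simp add: lin_def)
  next
    case False
    then show ?thesis unfolding pb_outside[OF False] by (simp add: lin_def)
  qed
qed

lemma pb_add_left:
  "F \<in> reg \<Longrightarrow> F' \<in> reg \<Longrightarrow> pb (\<lambda>\<xi>\<in>dual. F \<xi> + F' \<xi>) H = (\<lambda>\<xi>\<in>dual. pb F H \<xi> + pb F' H \<xi>)"
  by (auto simp: fun_eq_iff pb_outside pb_at d_add br_add_left dual_iff)

lemma pb_mult_left:
  "F \<in> reg \<Longrightarrow> F' \<in> reg \<Longrightarrow>
    pb (\<lambda>\<xi>\<in>dual. F \<xi> * F' \<xi>) H = (\<lambda>\<xi>\<in>dual. F \<xi> * pb F' H \<xi> + F' \<xi> * pb F H \<xi>)"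
  by (auto simp: fun_eq_iff pb_outside pb_at d_mult br_add_left br_scale_left dual_iff)

lemma pb_mult_left_sum:
  "F \<in> reg \<Longrightarrow> F' \<in> reg \<Longrightarrow> pb (\<lambda>\<xi>\<in>dual. F \<xi> * F' \<xi>) H =
    (\<lambda>\<xi>\<in>dual. (\<lambda>\<xi>\<in>dual. F \<xi> * pb F' H \<xi>) \<xi> + (\<lambda>\<xi>\<in>dual. F' \<xi> * pb F H \<xi>) \<xi>)"
  unfolding pb_mult_left by (rule restrict_ext) simp

lemma pb_in_reg:
  assumes "F \<in> reg" "H \<in> reg" shows "pb F H \<in> reg"
proof -
  have 1: "pb F (lin sc x) \<in> reg" if "F \<in> reg" for F x
    using that
  proof (induction rule: reg_induct)
    case (const c) show ?case unfolding pb_const_left by (rule const_in_reg)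
  next
    case (lin x) show ?case by (simp add: pb_lin_lin lin_in_reg)
  next
    case (add F H) show ?case unfolding pb_add_left[OF add(1,2)] by (rule add_in_reg[OF add(3,4)])
  next
    case (mult F H)
    show ?case unfolding pb_mult_left_sum[OF mult(1,2)] by (intro add_in_reg mult_in_reg mult)
  qed
  have neg: "(\<lambda>\<xi>\<in>dual. - K \<xi>) \<in> reg" if "K \<in> reg" for K
    using smult_in_reg[OF that, of "-1"] by simp
  have "pb H F \<in> reg" if "H \<in> reg" for H
    using that
  proof (induction rule: reg_induct)
    case (const c) show ?case unfolding pb_const_left by (rule const_in_reg)
  next
    case (lin x) show ?case unfolding pb_swap[of "lin sc x" F] by (rule neg[OF 1[OF assms(1)]])
  next
    case (add F H) show ?case unfolding pb_add_left[OF add(1,2)] by (rule add_in_reg[OF add(3,4)])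
  next
    case (mult F H)
    show ?case unfolding pb_mult_left_sum[OF mult(1,2)] by (intro add_in_reg mult_in_reg mult)
  qed
  from neg[OF this[OF assms(2)]] show ?thesis unfolding pb_swap[of F H] .
qed

definition jac :: "(('g \<Rightarrow> complex) \<Rightarrow> complex) \<Rightarrow> (('g \<Rightarrow> complex) \<Rightarrow> complex) \<Rightarrow>
    (('g \<Rightarrow> complex) \<Rightarrow> complex) \<Rightarrow> ('g \<Rightarrow> complex) \<Rightarrow> complex" where
  "jac F H K \<xi> = pb F (pb H K) \<xi> + pb H (pb K F) \<xi> + pb K (pb F H) \<xi>"

lemma jac_rotate: "jac F H K \<xi> = jac H K F \<xi>"
  by (simp add: jac_def)

lemma pb_add_right_at:
  "F \<in> reg \<Longrightarrow> F' \<in> reg \<Longrightarrow> \<xi> \<in> dual \<Longrightarrow> pb H (\<lambda>\<xi>\<in>dual. F \<xi> + F' \<xi>) \<xi> = pb H F \<xi> + pb H F' \<xi>"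
  by (auto simp: pb_at d_add br_add_right dual_iff)

lemma pb_mult_right_at:
  "F \<in> reg \<Longrightarrow> F' \<in> reg \<Longrightarrow> \<xi> \<in> dual \<Longrightarrow>
    pb H (\<lambda>\<xi>\<in>dual. F \<xi> * F' \<xi>) \<xi> = F \<xi> * pb H F' \<xi> + F' \<xi> * pb H F \<xi>"
  by (auto simp: pb_at d_mult br_add_right br_scale_right dual_iff)

lemma jac_step:
  assumes "F \<in> reg" and HK: "H \<in> reg" "K \<in> reg" and \<xi>: "\<xi> \<in> dual"
    and lin: "\<And>x. jac (lin sc x) H K \<xi> = 0"
  shows "jac F H K \<xi> = 0"
  using assms(1)
proof (induction rule: reg_induct)
  case (const c)
  have "pb K (\<lambda>\<xi>\<in>dual. c) = (\<lambda>\<xi>\<in>dual. 0)" for K c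
    by (auto simp: fun_eq_iff pb_at pb_outside d_const br_zero dual_0)
  then show ?case
    unfolding jac_def pb_const_left using \<xi> by (simp only: restrict_apply' add_0)
next
  case (lin x) show ?case by fact
next
  case (add F F')
  let ?FF = "\<lambda>\<xi>\<in>dual. F \<xi> + F' \<xi>"
  have r: "pb K ?FF = (\<lambda>\<xi>\<in>dual. pb K F \<xi> + pb K F' \<xi>)"
    using add pb_add_right_at by (auto simp: fun_eq_iff pb_outside)
  have l: "pb ?FF H = (\<lambda>\<xi>\<in>dual. pb F H \<xi> + pb F' H \<xi>)"
    using add by (simp add: pb_add_left)
  have 1: "pb ?FF (pb H K) \<xi> = pb F (pb H K) \<xi> + pb F' (pb H K) \<xi>"
    using add \<xi> by (simp add: pb_add_left)
  have 2: "pb H (pb K ?FF) \<xi> = pb H (pb K F) \<xi> + pb H (pb K F') \<xi>"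
    unfolding r using add HK \<xi> by (simp add: pb_add_right_at pb_in_reg)
  have 3: "pb K (pb ?FF H) \<xi> = pb K (pb F H) \<xi> + pb K (pb F' H) \<xi>"
    unfolding l using add HK \<xi> by (simp add: pb_add_right_at pb_in_reg)
  have "jac ?FF H K \<xi> = jac F H K \<xi> + jac F' H K \<xi>"
    unfolding jac_def 1 2 3 by simp
  then show ?case by (simp only: add add_0)
next
  case (mult F F')
  let ?FF = "\<lambda>\<xi>\<in>dual. F \<xi> * F' \<xi>"
  have r: "pb K ?FF = (\<lambda>\<xi>\<in>dual. (\<lambda>\<xi>\<in>dual. F \<xi> * pb K F' \<xi>) \<xi> + (\<lambda>\<xi>\<in>dual. F' \<xi> * pb K F \<xi>) \<xi>)"
    using mult pb_mult_right_at by (auto simp: fun_eq_iff pb_outside)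
  have l: "pb ?FF H = (\<lambda>\<xi>\<in>dual. (\<lambda>\<xi>\<in>dual. F \<xi> * pb F' H \<xi>) \<xi> + (\<lambda>\<xi>\<in>dual. F' \<xi> * pb F H \<xi>) \<xi>)"
    using mult by (auto simp: fun_eq_iff pb_outside pb_mult_left)
  have 1: "pb ?FF (pb H K) \<xi> = F \<xi> * pb F' (pb H K) \<xi> + F' \<xi> * pb F (pb H K) \<xi>"
    using mult \<xi> by (simp add: pb_mult_left)
  have 2: "pb H (pb K ?FF) \<xi> = F \<xi> * pb H (pb K F') \<xi> + pb K F' \<xi> * pb H F \<xi>
      + F' \<xi> * pb H (pb K F) \<xi> + pb K F \<xi> * pb H F' \<xi>"
    unfolding r pb_add_right_at[OF mult_in_reg[OF mult(1) pb_in_reg[OF HK(2) mult(2)]]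
        mult_in_reg[OF mult(2) pb_in_reg[OF HK(2) mult(1)]] \<xi>]
      pb_mult_right_at[OF mult(1) pb_in_reg[OF HK(2) mult(2)] \<xi>]
      pb_mult_right_at[OF mult(2) pb_in_reg[OF HK(2) mult(1)] \<xi>] by simp
  have 3: "pb K (pb ?FF H) \<xi> = F \<xi> * pb K (pb F' H) \<xi> + pb F' H \<xi> * pb K F \<xi>
      + F' \<xi> * pb K (pb F H) \<xi> + pb F H \<xi> * pb K F' \<xi>"
    unfolding l pb_add_right_at[OF mult_in_reg[OF mult(1) pb_in_reg[OF mult(2) HK(1)]]
        mult_in_reg[OF mult(2) pb_in_reg[OF mult(1) HK(1)]] \<xi>]
      pb_mult_right_at[OF mult(1) pb_in_reg[OF mult(2) HK(1)] \<xi>]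
      pb_mult_right_at[OF mult(2) pb_in_reg[OF mult(1) HK(1)] \<xi>] by simp
  have "jac ?FF H K \<xi> = F \<xi> * jac F' H K \<xi> + F' \<xi> * jac F H K \<xi>"
    unfolding jac_def 1 2 3 using pb_swap_at[OF \<xi>, of F H] pb_swap_at[OF \<xi>, of F' H]
    by (simp add: algebra_simps)
  then show ?case by (simp only: mult mult_zero_right add_0)
qed

lemma jac_zero:
  assumes "F \<in> reg" "H \<in> reg" "K \<in> reg" "\<xi> \<in> dual"
  shows "jac F H K \<xi> = 0"
proof -
  have "jac (lin sc x) (lin sc y) (lin sc z) \<xi> = 0" for x y z
  proof -
    have "jac (lin sc x) (lin sc y) (lin sc z) \<xi> = \<xi> (br x (br y z) + br y (br z x) + br z (br x y))"
      using assms(4) by (simp add: jac_def pb_lin_lin) (simp add: lin_def dual_iff)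
    then show ?thesis using assms(4) by (simp add: jacobi dual_0)
  qed
  then have "jac (lin sc x) (lin sc y) K \<xi> = 0" for x y
    by (metis assms(3,4) jac_rotate jac_step lin_in_reg)
  then have "jac (lin sc x) H K \<xi> = 0" for x
    by (metis assms(2-4) jac_rotate jac_step lin_in_reg)
  then show ?thesis using jac_step assms by blast
qed

lemma sym_alg_simps:
  "carrier (sym_alg sc br) = reg" "mult (sym_alg sc br) F H = (\<lambda>p\<in>dual. F p * H p)"
  "one (sym_alg sc br) = (\<lambda>p\<in>dual. 1)" "zero (sym_alg sc br) = (\<lambda>p\<in>dual. 0)"
  "add (sym_alg sc br) F H = (\<lambda>p\<in>dual. F p + H p)" "smult (sym_alg sc br) c F = (\<lambda>p\<in>dual. c * F p)"
  "pbracket (sym_alg sc br) = pb"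
  by (simp_all add: sym_alg_def function_algebra_def)

lemma pb_smult_left: "F \<in> reg \<Longrightarrow> pb (\<lambda>\<xi>\<in>dual. c * F \<xi>) H = (\<lambda>\<xi>\<in>dual. c * pb F H \<xi>)"
proof -
  assume F: "F \<in> reg"
  have 1: "(\<lambda>\<xi>\<in>dual. c * F \<xi>) = (\<lambda>\<xi>\<in>dual. (\<lambda>\<xi>\<in>dual. c) \<xi> * F \<xi>)"
    by (rule restrict_ext) simp
  show ?thesis
    unfolding 1 pb_mult_left[OF const_in_reg[of c] F] pb_const_left by (rule restrict_ext) simp
qed

lemma complex_ring_cring: "cring complex_ring"
  by (intro cringI abelian_groupI comm_monoidI)
     (auto simp: complex_ring_def algebra_simps intro: exI[of _ "- x" for x])

lemma sym_alg_cring: "cring (sym_alg sc br)"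
proof (intro cringI abelian_groupI comm_monoidI; (unfold sym_alg_simps)?)
  fix F assume F: "F \<in> reg"
  show "\<exists>H\<in>reg. (\<lambda>p\<in>dual. H p + F p) = (\<lambda>p\<in>dual. 0)"
    by (rule bexI[OF _ smult_in_reg[OF F, of "-1"]]) (auto simp: fun_eq_iff)
next
  fix F assume F: "F \<in> reg"
  show "(\<lambda>p\<in>dual. (\<lambda>p\<in>dual. 0) p + F p) = F"
    by (rule reg_ext[OF add_in_reg[OF const_in_reg F] F]) simp
  show "(\<lambda>p\<in>dual. (\<lambda>p\<in>dual. 1) p * F p) = F"
    by (rule reg_ext[OF mult_in_reg[OF const_in_reg F] F]) simp
qed (auto simp: const_in_reg add_in_reg mult_in_reg fun_eq_iff algebra_simps)

lemma sym_alg_uminus: "F \<in> reg \<Longrightarrow> a_inv (sym_alg sc br) F = (\<lambda>p\<in>dual. - F p)"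
proof -
  assume F: "F \<in> reg"
  interpret cring "sym_alg sc br" by (rule sym_alg_cring)
  have "(\<lambda>p\<in>dual. - F p) \<in> reg" using smult_in_reg[OF F, of "-1"] by simp
  then show ?thesis
    using F by (intro minus_equality) (auto simp: sym_alg_simps fun_eq_iff)
qed

theorem sym_alg_poisson: "poisson_algebra (sym_alg sc br)"
proof (intro poisson_algebra.intro algebraI poisson_algebra_axioms.intro complex_ring_cring sym_alg_cring;
    unfold sym_alg_simps)
  fix F assume F: "F \<in> reg"
  show "(\<lambda>p\<in>dual. \<one>\<^bsub>complex_ring\<^esub> * F p) = F"
    by (rule reg_ext[OF smult_in_reg[OF F] F]) (simp add: complex_ring_def)
next
  fix F H assume "F \<in> reg" "H \<in> reg"
  then show "pb F H = a_inv (sym_alg sc br) (pb H F)"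
    by (simp add: sym_alg_uminus pb_in_reg pb_swap[of F H])
next
  fix F H K assume *: "F \<in> reg" "H \<in> reg" "K \<in> reg"
  show "(\<lambda>p\<in>dual. (\<lambda>p\<in>dual. pb F (pb H K) p + pb H (pb K F) p) p + pb K (pb F H) p) = (\<lambda>p\<in>dual. 0)"
    using jac_zero[OF *] by (auto simp: fun_eq_iff jac_def)
  show "pb F (\<lambda>p\<in>dual. H p * K p) =
      (\<lambda>p\<in>dual. (\<lambda>p\<in>dual. pb F H p * K p) p + (\<lambda>p\<in>dual. H p * pb F K p) p)"
    using * by (auto simp: fun_eq_iff pb_outside pb_mult_right_at algebra_simps)
qed (auto simp: smult_in_reg pb_in_reg pb_smult_left pb_add_left complex_ring_def fun_eq_iff algebra_simps)

end


definition dual_variety ::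
  "(complex \<Rightarrow> 'g::ab_group_add \<Rightarrow> 'g) \<Rightarrow> ('g \<Rightarrow> 'g \<Rightarrow> 'g) \<Rightarrow> ('g \<Rightarrow> complex, ('g \<Rightarrow> complex) \<Rightarrow> complex) pvariety" where
  "dual_variety sc br = \<lparr>points = dual_space sc, coord_alg = sym_alg sc br, evl = (\<lambda>X \<xi>. X \<xi>)\<rparr>"


section \<open>Linear algebraic groups and the coadjoint action\<close>

definition mscale :: "complex \<Rightarrow> complex^'n^'n \<Rightarrow> complex^'n^'n" where
  "mscale c A = (\<chi> i j. c * A $ i $ j)"

definition matrix_polys :: "(complex^'n^'n \<Rightarrow> complex) set" where
  "matrix_polys = poly_functions {\<lambda>A. A $ i $ j | i j. True}"

definition GL_regular_functions :: "(complex^'n^'n \<Rightarrow> complex) set" where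
  "GL_regular_functions =
     poly_functions ({\<lambda>A. A $ i $ j | i j. True} \<union> {\<lambda>A. matrix_inv A $ i $ j | i j. True})"

definition GL_closed :: "(complex^'n^'n) set \<Rightarrow> bool" where
  "GL_closed S \<longleftrightarrow> (\<exists>Ps \<subseteq> matrix_polys. S = {A. invertible A \<and> (\<forall>P\<in>Ps. P A = 0)})"

definition connected_algebraic_group :: "(complex^'n^'n) set \<Rightarrow> bool" where
  "connected_algebraic_group G \<longleftrightarrow>
     GL_closed G \<and> mat 1 \<in> G \<and> (\<forall>A\<in>G. \<forall>B\<in>G. A ** B \<in> G) \<and> (\<forall>A\<in>G. matrix_inv A \<in> G) \<and>
     \<not> (\<exists>S T. GL_closed S \<and> GL_closed T \<and> S \<noteq> {} \<and> T \<noteq> {} \<and> S \<inter> T = {} \<and> S \<union> T = G)"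

definition unipotent_matrix :: "complex^'n^'n \<Rightarrow> bool" where
  "unipotent_matrix A \<longleftrightarrow> (\<exists>k. (((**) (A - mat 1)) ^^ k) (mat 1) = 0)"

text \<open>The Zariski tangent space at the identity.\<close>

definition lie_algebra_of :: "(complex^'n^'n) set \<Rightarrow> (complex^'n^'n) set" where
  "lie_algebra_of G =
     {X. \<forall>P\<in>matrix_polys. (\<forall>A\<in>G. P A = 0) \<longrightarrow>
        ((\<lambda>t. P (mat 1 + mscale t X)) has_field_derivative 0) (at 0)}"

text \<open>\<open>\<phi>\<close> identifies the abstract Lie algebra with the Lie algebra of \<open>G\<close>.\<close>

definition lie_algebra_identification ::
  "(complex \<Rightarrow> 'g::ab_group_add \<Rightarrow> 'g) \<Rightarrow> ('g \<Rightarrow> 'g \<Rightarrow> 'g) \<Rightarrow> (complex^'n^'n) set \<Rightarrow> ('g \<Rightarrow> complex^'n^'n) \<Rightarrow> bool" where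
  "lie_algebra_identification sc br G \<phi> \<longleftrightarrow>
     Vector_Spaces.linear sc mscale \<phi> \<and> inj \<phi> \<and> range \<phi> = lie_algebra_of G \<and>
     (\<forall>x y. \<phi> (br x y) = \<phi> x ** \<phi> y - \<phi> y ** \<phi> x)"

definition connected_unipotent_subgroup ::
  "(complex^'n^'n) set \<Rightarrow> ('g \<Rightarrow> complex^'n^'n) \<Rightarrow> 'g set \<Rightarrow> (complex^'n^'n) set \<Rightarrow> bool" where
  "connected_unipotent_subgroup G \<phi> m M \<longleftrightarrow>
     M \<subseteq> G \<and> connected_algebraic_group M \<and> (\<forall>A\<in>M. unipotent_matrix A) \<and> lie_algebra_of M = \<phi> ` m"

definition Ad :: "('g \<Rightarrow> complex^'n^'n) \<Rightarrow> complex^'n^'n \<Rightarrow> 'g \<Rightarrow> 'g" where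
  "Ad \<phi> g x = inv_into UNIV \<phi> (g ** \<phi> x ** matrix_inv g)"

definition coAd :: "('g \<Rightarrow> complex^'n^'n) \<Rightarrow> complex^'n^'n \<Rightarrow> ('g \<Rightarrow> complex) \<Rightarrow> 'g \<Rightarrow> complex" where
  "coAd \<phi> g \<xi> = (\<lambda>x. \<xi> (Ad \<phi> (matrix_inv g) x))"

definition orbit :: "'h set \<Rightarrow> ('h \<Rightarrow> 'p \<Rightarrow> 'p) \<Rightarrow> 'p \<Rightarrow> 'p set" where
  "orbit H act p = (\<lambda>g. act g p) ` H"

text \<open>
  An algebraic action of the group \<open>H\<close>, with Lie algebra \<open>m\<close>, on the affine Poisson variety \<open>V\<close>
  by Poisson automorphisms with equivariant moment map \<open>\<mu>\<close>: for \<open>y \<in> m\<close> the \<open>y\<close>-component of \<open>\<mu>\<close>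
  is a regular function \<open>k\<close>, and \<open>{k, F}\<close> is the derivative of \<open>t \<mapsto> F (exp (- t y) \<cdot> p)\<close> at \<open>0\<close>
  (for the dual of a Lie algebra this is \<open>{y, z} = [y, z]\<close>). The curve \<open>\<gamma>\<close> below has tangent vector \<open>y\<close> at the identity,
  so that \<open>t \<mapsto> F (\<gamma> t \<cdot> p)\<close> has derivative \<open>- {k, F} (p)\<close>.\<close>

definition hamiltonian_action ::
  "('p, 'b) pvariety \<Rightarrow> ('g \<Rightarrow> complex^'n^'n) \<Rightarrow> 'g set \<Rightarrow> (complex^'n^'n) set \<Rightarrow>
     (complex^'n^'n \<Rightarrow> 'p \<Rightarrow> 'p) \<Rightarrow> ('p \<Rightarrow> 'g \<Rightarrow> complex) \<Rightarrow> bool" where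
  "hamiltonian_action V \<phi> m H act \<mu> \<longleftrightarrow>
     (\<forall>p\<in>points V. act (mat 1) p = p \<and>
        (\<forall>g\<in>H. act g p \<in> points V \<and> (\<forall>h\<in>H. act (g ** h) p = act g (act h p)))) \<and>
     (\<forall>F\<in>carrier (coord_alg V). \<exists>(n::nat) a b.
        (\<forall>i<n. a i \<in> GL_regular_functions \<and> b i \<in> carrier (coord_alg V)) \<and>
        (\<forall>g\<in>H. \<forall>p\<in>points V. evl V F (act g p) = (\<Sum>i<n. a i g * evl V (b i) p))) \<and>
     (\<forall>g\<in>H. \<exists>\<psi>. pvariety_iso V V (act g) \<psi>) \<and>
     (\<forall>g\<in>H. \<forall>p\<in>points V. \<forall>y\<in>m. \<mu> (act g p) y = \<mu> p (Ad \<phi> (matrix_inv g) y)) \<and>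
     (\<forall>y\<in>m. \<exists>k\<in>carrier (coord_alg V).
        (\<forall>p\<in>points V. evl V k p = \<mu> p y) \<and>
        (\<forall>F\<in>carrier (coord_alg V). \<forall>p\<in>points V. \<forall>\<gamma> :: complex \<Rightarrow> complex^'n^'n.
           range \<gamma> \<subseteq> H \<and> \<gamma> 0 = mat 1 \<and>
           (\<forall>i j. ((\<lambda>t. \<gamma> t $ i $ j) has_field_derivative \<phi> y $ i $ j) (at 0)) \<longrightarrow>
           ((\<lambda>t. evl V F (act (\<gamma> t) p)) has_field_derivative - evl V (pbracket (coord_alg V) k F) p) (at 0)))"


section \<open>Hamiltonian reduction\<close>

text \<open>The Poisson algebra of \<open>Y\<close>-invariants of \<open>A / J\<close>; the operations on cosets follow
  the library's \<^const>\<open>rcoset_mult\<close>.\<close>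

definition reduced_algebra ::
  "(complex, 'b) poisson \<Rightarrow> 'b set \<Rightarrow> 'b set \<Rightarrow> (complex, 'b set) poisson" where
  "reduced_algebra A J Y =
     \<lparr>carrier = {J +>\<^bsub>A\<^esub> X | X. X \<in> carrier A \<and> (\<forall>y\<in>Y. pbracket A y X \<in> J)},
      mult = mult (A Quot J), one = one (A Quot J), zero = zero (A Quot J), add = add (A Quot J),
      smult = (\<lambda>c B. \<Union>X\<in>B. J +>\<^bsub>A\<^esub> (c \<odot>\<^bsub>A\<^esub> X)),
      pbracket = (\<lambda>B C. \<Union>X\<in>B. \<Union>Z\<in>C. J +>\<^bsub>A\<^esub> pbracket A X Z)\<rparr>"

text \<open>\<open>Z\<close> is the zero fibre of a moment map, \<open>J\<close> its ideal, and \<open>Y\<close> are the Hamiltonians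
  generating the action of \<open>H\<close>. Points are \<open>H\<close>-orbits in \<open>Z\<close>.\<close>

definition hamiltonian_reduction ::
  "('p, 'b) pvariety \<Rightarrow> 'p set \<Rightarrow> 'h set \<Rightarrow> ('h \<Rightarrow> 'p \<Rightarrow> 'p) \<Rightarrow> 'b set \<Rightarrow> 'b set \<Rightarrow> ('p set, 'b set) pvariety" where
  "hamiltonian_reduction V Z H act J Y =
     \<lparr>points = orbit H act ` Z,
      coord_alg = reduced_algebra (coord_alg V) J Y,
      evl = (\<lambda>B Q. the_elem (\<Union>X\<in>B. evl V X ` Q))\<rparr>"

definition reduction_well_defined ::
  "('p, 'b) pvariety \<Rightarrow> 'p set \<Rightarrow> 'h set \<Rightarrow> ('h \<Rightarrow> 'p \<Rightarrow> 'p) \<Rightarrow> 'b set \<Rightarrow> 'b set \<Rightarrow> bool" where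
  "reduction_well_defined V Z H act J Y \<longleftrightarrow>
     (let R = hamiltonian_reduction V Z H act J Y in
      ideal J (coord_alg V) \<and> Z \<subseteq> points V \<and> (\<forall>g\<in>H. \<forall>p\<in>Z. act g p \<in> Z) \<and>
      (\<forall>B\<in>carrier (coord_alg R). \<forall>X\<in>B. \<forall>p\<in>Z. evl R B (orbit H act p) = evl V X p) \<and>
      (\<forall>B\<in>carrier (coord_alg R). \<forall>C\<in>carrier (coord_alg R). \<forall>X\<in>B. \<forall>X'\<in>C.
         pbracket (coord_alg R) B C = J +>\<^bsub>coord_alg V\<^esub> pbracket (coord_alg V) X X') \<and>
      affine_poisson_variety R)"

definition moment_fibre ::
  "(complex \<Rightarrow> 'g::ab_group_add \<Rightarrow> 'g) \<Rightarrow> ('g \<Rightarrow> complex) \<Rightarrow> 'g set \<Rightarrow> ('g \<Rightarrow> complex) set" where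
  "moment_fibre sc chi m = {\<xi> \<in> dual_space sc. \<forall>y\<in>m. \<xi> y - chi y = 0}"

definition moment_ideal ::
  "(complex \<Rightarrow> 'g::ab_group_add \<Rightarrow> 'g) \<Rightarrow> ('g \<Rightarrow> 'g \<Rightarrow> 'g) \<Rightarrow> ('g \<Rightarrow> complex) \<Rightarrow> 'g set
     \<Rightarrow> (('g \<Rightarrow> complex) \<Rightarrow> complex) set" where
  "moment_ideal sc br chi m = genideal (sym_alg sc br) (lin_shift sc chi ` m)"

definition slodowy_reduction ::
  "(complex \<Rightarrow> 'g::ab_group_add \<Rightarrow> 'g) \<Rightarrow> ('g \<Rightarrow> 'g \<Rightarrow> 'g) \<Rightarrow> ('g \<Rightarrow> complex^'n^'n) \<Rightarrow>
     ('g \<Rightarrow> complex) \<Rightarrow> 'g set \<Rightarrow> (complex^'n^'n) set \<Rightarrow>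
     (('g \<Rightarrow> complex) set, (('g \<Rightarrow> complex) \<Rightarrow> complex) set) pvariety" where
  "slodowy_reduction sc br \<phi> chi m M =
     hamiltonian_reduction (dual_variety sc br) (moment_fibre sc chi m) M (coAd \<phi>)
       (moment_ideal sc br chi m) (lin sc ` m)"

definition slodowy_slice ::
  "(complex \<Rightarrow> 'g::ab_group_add \<Rightarrow> 'g) \<Rightarrow> ('g \<Rightarrow> 'g \<Rightarrow> 'g) \<Rightarrow> ('g \<Rightarrow> complex) \<Rightarrow> 'g \<Rightarrow> ('g \<Rightarrow> complex) set" where
  "slodowy_slice sc br chi e = {(\<lambda>x. chi x + \<eta> x) | \<eta>. \<eta> \<in> dual_space sc \<and> (\<forall>x. - \<eta> (br e x) = 0)}"

text \<open>Restriction of functions from the zero fibre of the moment map to a slice \<open>S\<close>.\<close>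

definition slice_restriction ::
  "('g \<Rightarrow> complex) set \<Rightarrow> (('g \<Rightarrow> complex) \<Rightarrow> complex) set \<Rightarrow> ('g \<Rightarrow> complex) \<Rightarrow> complex" where
  "slice_restriction S B = (\<lambda>s\<in>S. the_elem ((\<lambda>X. X s) ` B))"

text \<open>The Poisson bracket on the slice is transported from the reduced algebra \<open>P\<close> along
  the restriction isomorphism.\<close>

definition slice_variety ::
  "('g \<Rightarrow> complex) set \<Rightarrow> (complex, (('g \<Rightarrow> complex) \<Rightarrow> complex) set) poisson \<Rightarrow>
     ('g \<Rightarrow> complex, ('g \<Rightarrow> complex) \<Rightarrow> complex) pvariety" where
  "slice_variety S P =
     (let r = slice_restriction S; r' = inv_into (carrier P) r in
      \<lparr>points = S,
       coord_alg = function_algebra S (regular_functions S) (\<lambda>a b. r (pbracket P (r' a) (r' b))),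
       evl = (\<lambda>a s. a s)\<rparr>)"

text \<open>The second stage. A group \<open>M0\<close> acts on classes by \<open>g \<cdot> [\<xi>] = [Ad* (g) \<xi>]\<close>, which is the image of
  the class under \<open>Ad* (g)\<close>, with moment map \<open>[\<xi>] \<mapsto> \<xi> - chi\<close> restricted to \<open>m0\<close>.\<close>

definition class_action ::
  "('g \<Rightarrow> complex^'n^'n) \<Rightarrow> complex^'n^'n \<Rightarrow> ('g \<Rightarrow> complex) set \<Rightarrow> ('g \<Rightarrow> complex) set" where
  "class_action \<phi> g Q = coAd \<phi> g ` Q"

definition class_moment ::
  "('g \<Rightarrow> complex) \<Rightarrow> 'g set \<Rightarrow> ('g \<Rightarrow> complex) set \<Rightarrow> 'g \<Rightarrow> complex" where
  "class_moment chi m Q = the_elem ((\<lambda>\<xi>. \<lambda>y\<in>m. \<xi> y - chi y) ` Q)"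

end

theory Submission
  imports Defs "HOL-Complex_Analysis.Cauchy_Integral_Formula"
begin

text \<open>
  Identify the Lie algebra with its dual. For \<open>m\<close> a good algebra, \<open>f + m\<^sup>\<bottom> \<supseteq> f + s\<close> for a graded complement
  \<open>s\<close> of \<open>[f, m]\<close> in \<open>m\<^sup>\<bottom>\<close> (the Slodowy slice is one choice). Killing the \<open>[f, m]\<close>-components degree by degree with
  elements \<open>exp u\<close>, \<open>u \<in> m\<close>, is a polynomial procedure that moves every point of the fibre to the unique point of
  its \<open>M\<close>-orbit in the slice. So the invariants are the functions on the slice, which makes the reduction an affine
  variety; the moment ideal is a full vanishing ideal, so all identities between functions may be checked at points.

  In two stages, \<open>q1\<close> and \<open>q2\<close> commute, so taking the degree-0 part for the first grading respects the filtration of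
  the second. Each step \<open>exp u\<close> with \<open>u \<in> m2\<close> can therefore be replaced by \<open>exp x exp y\<close> with \<open>x \<in> m1\<close> and \<open>y \<in> m0\<close>
  of the same order. Hence \<open>M2\<close>-orbits in the fibre \<open>Z2\<close> are the \<open>M0\<close>-orbits of \<open>M1\<close>-orbits, and a function invariant
  under \<open>M1\<close> on \<open>Z1\<close> and under \<open>M0\<close> on \<open>Z2\<close> is the same as an \<open>M2\<close>-invariant one on \<open>Z2\<close>. The ideal \<open>I0\<close> is a vanishing
  ideal because its preimage in the symmetric algebra contains the generators of \<open>I2\<close>.\<close>

section \<open>One-parameter subgroups of matrix groups\<close>

text \<open>The groups are given only as Zariski closed sets of matrices with prescribed tangent
  spaces, so \<open>M\<close> and \<open>m\<close> must first be linked: unipotence puts each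
  element of \<open>M\<close> on a polynomial one-parameter subgroup, and closedness puts the
  exponentials of \<open>m\<close> into \<open>M\<close>. From then on the action is expressed by
  the finite sums \<open>ead x\<close> with \<open>x\<close> in \<open>m\<close>. The descent runs
  on filtrations, since elements of \<open>m\<close> are inhomogeneous: \<open>exp u\<close> with
  \<open>u\<close> of order \<open>i\<close> moves \<open>z\<close> by \<open>br u f\<close>, of
  order \<open>i - 2\<close>, up to an error of order \<open>i - 1\<close>. Any move with this
  leading term will do, and this is what lets two factors replace \<open>exp u\<close> in the second
  stage without factoring the group. Slices are treated axiomatically because an sl2-triple is given
  for \<open>f2\<close> only: the first stage takes a graded complement built from projections, the
  second the centralizer of \<open>e2\<close>. Functions on the first reduction are obtained from
  all polynomials by composing with the retraction onto its slice, an algebra homomorphism; ideals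
  and closedness are transported along it.\<close>

lemma matrix_add_rdistrib: "((A::'a::semiring_1^'n^'m) + B) ** C = A ** C + B ** C"
  by (simp add: matrix_matrix_mult_def vec_eq_iff distrib_right sum.distrib)

lemma matrix_mult_minus_left: "(- (A::'a::ring_1^'n^'m)) ** C = - (A ** C)"
  by (simp add: matrix_matrix_mult_def vec_eq_iff sum_negf)

lemma matrix_diff_ldistrib: "(A::'a::ring_1^'n^'m) ** (B - C) = A ** B - A ** C"
  by (simp add: matrix_matrix_mult_def vec_eq_iff right_diff_distrib sum_subtractf)

lemma matrix_diff_rdistrib: "((A::'a::ring_1^'n^'m) - B) ** C = A ** C - B ** C"
  by (simp add: matrix_matrix_mult_def vec_eq_iff left_diff_distrib sum_subtractf)

lemma matrix_mult_zero: "(0::'a::semiring_1^'n^'m) ** C = 0" "(A::'a::semiring_1^'n^'m) ** 0 = 0"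
  by (simp_all add: matrix_matrix_mult_def vec_eq_iff)

lemma mscale_nth [simp]: "mscale c A $ i $ j = c * A $ i $ j"
  by (simp add: mscale_def)

lemma mscale_mult: "mscale c A ** B = mscale c (A ** B)" "A ** mscale c B = mscale c (A ** B)"
  by (simp_all add: matrix_matrix_mult_def vec_eq_iff sum_distrib_left mult_ac)

lemma vector_space_mscale: "vector_space (mscale :: complex \<Rightarrow> complex^'n^'n \<Rightarrow> complex^'n^'n)"
  by unfold_locales (simp_all add: vec_eq_iff algebra_simps)

lemma matrix_inv_eqI:
  fixes A :: "'a::semiring_1^'n^'n"
  assumes "A ** B = mat 1" "B ** A = mat 1"
  shows "matrix_inv A = B" "invertible A"
proof -
  have "matrix_inv A = B ** A ** matrix_inv A" by (simp add: assms)
  also have "\<dots> = B" unfolding matrix_inv_def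
    by (metis (mono_tags, lifting) assms matrix_mul_assoc matrix_mul_rid someI)
  finally show "matrix_inv A = B" .
  show "invertible A" using assms unfolding invertible_def by blast
qed

lemma matrix_inv_mult:
  fixes A :: "'a::semiring_1^'n^'n"
  assumes "invertible A"
  shows "A ** matrix_inv A = mat 1" "matrix_inv A ** A = mat 1"
  using assms matrix_inv_eqI unfolding invertible_def by metis+

lemma matrix_inv_prod:
  fixes A B :: "'a::semiring_1^'n^'n"
  assumes "invertible A" "invertible B"
  shows "matrix_inv (A ** B) = matrix_inv B ** matrix_inv A"
  by (intro matrix_inv_eqI(1)) (metis assms matrix_inv_mult matrix_mul_assoc matrix_mul_rid)+

text \<open>Entrywise, because this is the tangency condition that \<open>hamiltonian_action\<close>
  puts on its curves, and because it only involves complex functions of one variable.\<close>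

definition mderiv :: "(complex \<Rightarrow> complex^'n^'n) \<Rightarrow> complex^'n^'n \<Rightarrow> complex \<Rightarrow> bool" where
  "mderiv \<gamma> D t \<longleftrightarrow> (\<forall>i j. ((\<lambda>s. \<gamma> s $ i $ j) has_field_derivative D $ i $ j) (at t))"

lemma mderiv_const: "mderiv (\<lambda>_. A) 0 t"
  by (simp add: mderiv_def)

lemma mderiv_mult:
  assumes "mderiv a A t" "mderiv b B t"
  shows "mderiv (\<lambda>s. a s ** b s) (A ** b t + a t ** B) t"
  unfolding mderiv_def
proof (intro allI)
  fix i j
  have "((\<lambda>s. \<Sum>k\<in>UNIV. a s $ i $ k * b s $ k $ j) has_field_derivative
      (\<Sum>k\<in>UNIV. A $ i $ k * b t $ k $ j + B $ k $ j * a t $ i $ k)) (at t)"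
    using assms by (intro DERIV_sum DERIV_mult) (auto simp: mderiv_def)
  then show "((\<lambda>s. (a s ** b s) $ i $ j) has_field_derivative (A ** b t + a t ** B) $ i $ j) (at t)"
    by (simp add: matrix_matrix_mult_def sum.distrib mult.commute)
qed

lemma mderiv_flip: "mderiv \<gamma> D (- t) \<Longrightarrow> mderiv (\<lambda>s. \<gamma> (- s)) (- D) t"
  unfolding mderiv_def
  using DERIV_chain2[where g = uminus and x = t] by (fastforce intro: derivative_eq_intros)

lemma mderiv_line: "mderiv (\<lambda>t. A + mscale t X) X s"
  by (auto simp: mderiv_def intro!: derivative_eq_intros)

lemma mderiv_zero_const:
  assumes "\<And>t. mderiv \<gamma> 0 t"
  shows "\<gamma> t = \<gamma> 0"
proof -
  have "\<gamma> t $ i $ j = \<gamma> 0 $ i $ j" for i j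
    using assms has_field_derivative_zero_constant[of UNIV "\<lambda>s. \<gamma> s $ i $ j"]
    by (simp add: mderiv_def) metis
  then show ?thesis by (simp add: vec_eq_iff)
qed

text \<open>The exponential curve of \<open>X\<close>, encoded by its two differential equations
  rather than as a homomorphism: both forms are needed to differentiate conjugates of other curves
  by it.\<close>

definition one_param :: "(complex \<Rightarrow> complex^'n^'n) \<Rightarrow> complex^'n^'n \<Rightarrow> bool" where
  "one_param \<gamma> X \<longleftrightarrow> \<gamma> 0 = mat 1 \<and> (\<forall>t. mderiv \<gamma> (\<gamma> t ** X) t \<and> mderiv \<gamma> (X ** \<gamma> t) t)"

text \<open>The derivative of the product telescopes to zero because \<open>E' = X E - E X\<close>.
  With \<open>E\<close> constant this gives inverses and uniqueness; with \<open>E\<close> the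
  matrix of \<open>exp (t ad x) y\<close> it gives
  \<open>Ad (exp t x) = exp (t ad x)\<close>.\<close>

lemma one_param_conj_curve:
  assumes g: "one_param \<gamma> X" and d: "one_param \<delta> X"
    and E: "\<And>t. mderiv E (X ** E t - E t ** X) t"
  shows "\<gamma> (- t) ** E t ** \<delta> t = E 0"
proof -
  have "mderiv (\<lambda>s. \<gamma> (- s) ** E s ** \<delta> s)
     ((- (\<gamma> (- s) ** X) ** E s + \<gamma> (- s) ** (X ** E s - E s ** X)) ** \<delta> s + \<gamma> (- s) ** E s ** (X ** \<delta> s)) s" for s
    using g d E by (intro mderiv_mult mderiv_flip) (auto simp: one_param_def)
  moreover have "(- (\<gamma> (- s) ** X) ** E s + \<gamma> (- s) ** (X ** E s - E s ** X)) ** \<delta> s + \<gamma> (- s) ** E s ** (X ** \<delta> s) = 0" for s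
    by (simp add: matrix_add_rdistrib matrix_diff_ldistrib matrix_diff_rdistrib matrix_mult_minus_left matrix_mul_assoc)
  ultimately have "\<gamma> (- t) ** E t ** \<delta> t = \<gamma> (- 0) ** E 0 ** \<delta> 0"
    using mderiv_zero_const[of "\<lambda>s. \<gamma> (- s) ** E s ** \<delta> s" t] by simp
  then show ?thesis using g d by (simp add: one_param_def)
qed

lemma one_param_inverse:
  assumes "one_param \<gamma> X"
  shows "\<gamma> (- t) ** \<gamma> t = mat 1" "\<gamma> t ** \<gamma> (- t) = mat 1"
proof -
  have *: "\<gamma> (- t) ** \<gamma> t = mat 1" for t
    using one_param_conj_curve[OF assms assms, of "\<lambda>_. mat 1"] by (simp add: mderiv_const)
  show "\<gamma> (- t) ** \<gamma> t = mat 1" "\<gamma> t ** \<gamma> (- t) = mat 1"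
    using *[of t] *[of "- t"] by simp_all
qed

lemma one_param_matrix_inv:
  assumes "one_param \<gamma> X"
  shows "matrix_inv (\<gamma> t) = \<gamma> (- t)" "invertible (\<gamma> t)"
  using matrix_inv_eqI[OF one_param_inverse(2,1)[OF assms]] by simp_all

lemma one_param_unique:
  assumes "one_param \<gamma> X" "one_param \<delta> X"
  shows "\<gamma> = \<delta>"
proof
  fix t
  have "\<gamma> (- t) ** \<delta> t = mat 1"
    using one_param_conj_curve[OF assms, of "\<lambda>_. mat 1"] by (simp add: mderiv_const)
  then show "\<gamma> t = \<delta> t"
    by (metis assms(1) matrix_mul_assoc matrix_mul_lid matrix_mul_rid one_param_inverse(2))
qed

lemma one_param_conj:
  fixes g h :: "complex^'n^'n"
  assumes "one_param \<gamma> X" "g ** h = mat 1" "h ** g = mat 1"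
  shows "one_param (\<lambda>t. g ** \<gamma> t ** h) (g ** X ** h)"
  unfolding one_param_def
proof (intro conjI allI)
  show "g ** \<gamma> 0 ** h = mat 1" using assms by (simp add: one_param_def)
  fix t
  have *: "mderiv (\<lambda>t. g ** \<gamma> t ** h) (g ** D ** h) t" if "mderiv \<gamma> D t" for D
    using mderiv_mult[OF mderiv_mult[OF mderiv_const[of g] that] mderiv_const[of h]]
    by (simp add: matrix_mult_zero)
  have "g ** \<gamma> t ** h ** (g ** X ** h) = g ** (\<gamma> t ** X) ** h"
    "g ** X ** h ** (g ** \<gamma> t ** h) = g ** (X ** \<gamma> t) ** h"
    by (metis assms(3) matrix_mul_assoc matrix_mul_rid)+
  then show "mderiv (\<lambda>t. g ** \<gamma> t ** h) (g ** \<gamma> t ** h ** (g ** X ** h)) t"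
    "mderiv (\<lambda>t. g ** \<gamma> t ** h) (g ** X ** h ** (g ** \<gamma> t ** h)) t"
    using assms(1) * by (simp_all add: one_param_def)
qed

section \<open>The matrix exponential\<close>

fun mpow :: "complex^'n^'n \<Rightarrow> nat \<Rightarrow> complex^'n^'n" where
  "mpow X 0 = mat 1"
| "mpow X (Suc k) = X ** mpow X k"

lemma mpow_Suc_right: "mpow X (Suc k) = mpow X k ** X"
  by (induction k) (simp, metis mpow.simps(2) matrix_mul_assoc)

text \<open>The sum of the moduli of all entries dominates every row sum, which is all that the
  induction needs for a geometric bound.\<close>

lemma mpow_bound: "cmod (mpow X k $ i $ j) \<le> (\<Sum>i\<in>UNIV. \<Sum>j\<in>UNIV. cmod (X $ i $ j)) ^ k"
proof (induction k arbitrary: i j)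
  case 0 show ?case by (simp add: mat_def)
next
  case (Suc k)
  let ?C = "\<Sum>i\<in>UNIV. \<Sum>j\<in>UNIV. cmod (X $ i $ j)"
  have "cmod (mpow X (Suc k) $ i $ j) \<le> (\<Sum>l\<in>UNIV. cmod (X $ i $ l) * cmod (mpow X k $ l $ j))"
    by (simp add: matrix_matrix_mult_def) (rule order_trans[OF norm_sum], simp add: norm_mult)
  also have "\<dots> \<le> (\<Sum>l\<in>UNIV. cmod (X $ i $ l) * ?C ^ k)"
    by (intro sum_mono mult_left_mono Suc) auto
  also have "\<dots> = (\<Sum>l\<in>UNIV. cmod (X $ i $ l)) * ?C ^ k" by (simp add: sum_distrib_right)
  also have "\<dots> \<le> ?C * ?C ^ k"
    by (intro mult_right_mono member_le_sum zero_le_power sum_nonneg) auto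
  finally show ?case by simp
qed

text \<open>The time is kept as a separate argument so that every entry is a power series in
  \<open>t\<close> and can be differentiated termwise.\<close>

definition mexp :: "complex^'n^'n \<Rightarrow> complex \<Rightarrow> complex^'n^'n" where
  "mexp X t = (\<chi> i j. \<Sum>k. mpow X k $ i $ j / fact k * t ^ k)"

lemma mexp_summable: "summable (\<lambda>k. mpow X k $ i $ j / fact k * t ^ k)"
proof (rule summable_comparison_test'[where N = 0])
  let ?C = "\<Sum>i\<in>UNIV. \<Sum>j\<in>UNIV. cmod (X $ i $ j)"
  show "summable (\<lambda>k. (?C * cmod t) ^ k / fact k)"
    using summable_exp[of "?C * cmod t"] by (simp add: field_simps)
  fix k
  have "cmod (mpow X k $ i $ j / fact k * t ^ k) = cmod (mpow X k $ i $ j) * (cmod t ^ k / fact k)"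
    by (simp add: norm_mult norm_divide norm_power)
  also have "\<dots> \<le> ?C ^ k * (cmod t ^ k / fact k)"
    by (intro mult_right_mono mpow_bound) auto
  finally show "norm (mpow X k $ i $ j / fact k * t ^ k) \<le> (?C * cmod t) ^ k / fact k"
    by (simp add: power_mult_distrib)
qed

lemma mexp_deriv_aux:
  "((\<lambda>t. mexp X t $ i $ j) has_field_derivative (\<Sum>k. mpow X (Suc k) $ i $ j / fact k * t ^ k)) (at t)"
proof -
  have "diffs (\<lambda>k. mpow X k $ i $ j / fact k) = (\<lambda>k. mpow X (Suc k) $ i $ j / fact k)"
    by (auto simp: diffs_def fun_eq_iff divide_simps simp del: of_nat_Suc)
  then show ?thesis
    using termdiffs_strong_converges_everywhere[of "\<lambda>k. mpow X k $ i $ j / fact k" t, OF mexp_summable]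
    by (simp only: mexp_def vec_lambda_beta)
qed

lemma one_param_mexp: "one_param (mexp X) X"
  unfolding one_param_def mderiv_def
proof (intro conjI allI)
  have "mexp X 0 $ i $ j = mat 1 $ i $ j" for i j
    using suminf_finite[of "{0}" "\<lambda>k. mpow X k $ i $ j / fact k * 0 ^ k"] by (simp add: mexp_def)
  then show "mexp X 0 = mat 1" by (simp add: vec_eq_iff)
  fix t i j
  have "(\<Sum>k. mpow X (Suc k) $ i $ j / fact k * t ^ k) =
      (\<Sum>k. \<Sum>l\<in>UNIV. X $ i $ l * (mpow X k $ l $ j / fact k * t ^ k))"
    by (simp add: matrix_matrix_mult_def sum_distrib_right sum_divide_distrib mult.assoc)
  also have "\<dots> = (\<Sum>l\<in>UNIV. \<Sum>k. X $ i $ l * (mpow X k $ l $ j / fact k * t ^ k))"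
    by (rule suminf_sum, rule summable_mult, rule mexp_summable)
  also have "\<dots> = (X ** mexp X t) $ i $ j"
    unfolding suminf_mult[OF mexp_summable] by (simp add: matrix_matrix_mult_def mexp_def)
  finally show "((\<lambda>s. mexp X s $ i $ j) has_field_derivative (X ** mexp X t) $ i $ j) (at t)"
    by (rule DERIV_cong[OF mexp_deriv_aux])
  have "(\<Sum>k. mpow X (Suc k) $ i $ j / fact k * t ^ k) =
      (\<Sum>k. \<Sum>l\<in>UNIV. X $ l $ j * (mpow X k $ i $ l / fact k * t ^ k))"
    unfolding mpow_Suc_right
    by (simp add: matrix_matrix_mult_def sum_distrib_right sum_distrib_left sum_divide_distrib mult_ac)
  also have "\<dots> = (\<Sum>l\<in>UNIV. \<Sum>k. X $ l $ j * (mpow X k $ i $ l / fact k * t ^ k))"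
    by (rule suminf_sum, rule summable_mult, rule mexp_summable)
  also have "\<dots> = (mexp X t ** X) $ i $ j"
    unfolding suminf_mult[OF mexp_summable] by (simp add: matrix_matrix_mult_def mexp_def mult.commute)
  finally show "((\<lambda>s. mexp X s $ i $ j) has_field_derivative (mexp X t ** X) $ i $ j) (at t)"
    by (rule DERIV_cong[OF mexp_deriv_aux])
qed

section \<open>Polynomial functions of matrices and their derivatives\<close>

lemma poly_functions_sum:
  assumes "finite I" "\<And>i. i \<in> I \<Longrightarrow> F i \<in> poly_functions C"
  shows "(\<lambda>p. \<Sum>i\<in>I. F i p) \<in> poly_functions C"
  using assms by (induction I rule: finite_induct) (auto intro: poly_functions.intros)

lemma poly_functions_compose:
  assumes "P \<in> poly_functions C" "\<And>F. F \<in> C \<Longrightarrow> (\<lambda>p. F (h p)) \<in> poly_functions C'"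
  shows "(\<lambda>p. P (h p)) \<in> poly_functions C'"
  using assms(1) by induction (auto intro: poly_functions.intros assms(2))

lemma matrix_polys_entry: "(\<lambda>A. A $ i $ j) \<in> matrix_polys"
  unfolding matrix_polys_def by (rule poly_functions.coord) auto

lemma matrix_polys_const: "(\<lambda>_. c) \<in> matrix_polys"
  unfolding matrix_polys_def by (rule poly_functions.const)

lemma matrix_polys_compose:
  assumes "P \<in> matrix_polys" "\<And>i j. (\<lambda>A. h A $ i $ j) \<in> matrix_polys"
  shows "(\<lambda>A. P (h A)) \<in> matrix_polys"
  using poly_functions_compose[of P "{\<lambda>A. A $ i $ j | i j. True}" h] assms
  unfolding matrix_polys_def by blast

lemma matrix_polys_mult_entry:
  assumes "\<And>i j. (\<lambda>A. h A $ i $ j) \<in> matrix_polys" "\<And>i j. (\<lambda>A. k A $ i $ j) \<in> matrix_polys"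
  shows "(\<lambda>A. (h A ** k A) $ i $ j) \<in> matrix_polys"
  unfolding matrix_matrix_mult_def matrix_polys_def using assms
  by (auto simp: matrix_polys_def intro!: poly_functions_sum poly_functions.mult)

lemma matrix_polys_left: "P \<in> matrix_polys \<Longrightarrow> (\<lambda>B. P (A ** B)) \<in> matrix_polys"
  by (rule matrix_polys_compose, assumption, rule matrix_polys_mult_entry,
      rule matrix_polys_const, rule matrix_polys_entry)

lemma matrix_polys_right: "P \<in> matrix_polys \<Longrightarrow> (\<lambda>B. P (B ** A)) \<in> matrix_polys"
  by (rule matrix_polys_compose, assumption, rule matrix_polys_mult_entry,
      rule matrix_polys_entry, rule matrix_polys_const)

text \<open>The derivative along a curve is read off from the point and the velocity alone. The
  second conjunct says that differentiating along the left-invariant field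
  \<open>A \<mapsto> A X\<close> stays among polynomials, so that it can be iterated along an
  exponential curve.\<close>

lemma matrix_polys_deriv:
  assumes "P \<in> matrix_polys"
  shows "\<exists>D. (\<forall>\<gamma> X t. mderiv \<gamma> X t \<longrightarrow> ((\<lambda>s. P (\<gamma> s)) has_field_derivative D (\<gamma> t) X) (at t)) \<and>
             (\<forall>X. (\<lambda>A. D A (A ** X)) \<in> matrix_polys)"
  using assms unfolding matrix_polys_def
proof induction
  case (const c)
  show ?case by (rule exI[of _ "\<lambda>_ _. 0"]) (auto intro: poly_functions.intros)
next
  case (coord F)
  then obtain i j where F: "F = (\<lambda>A. A $ i $ j)" by auto
  have "(\<lambda>A. (A ** X) $ i $ j) \<in> matrix_polys" for X
    by (rule matrix_polys_mult_entry) (auto intro: matrix_polys_entry matrix_polys_const)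
  then show ?case
    by (intro exI[of _ "\<lambda>_ X. X $ i $ j"]) (auto simp: F mderiv_def matrix_polys_def)
next
  case (add F H)
  then obtain D E where D: "\<forall>\<gamma> X t. mderiv \<gamma> X t \<longrightarrow> ((\<lambda>s. F (\<gamma> s)) has_field_derivative D (\<gamma> t) X) (at t)"
      "\<forall>\<gamma> X t. mderiv \<gamma> X t \<longrightarrow> ((\<lambda>s. H (\<gamma> s)) has_field_derivative E (\<gamma> t) X) (at t)"
    and P: "\<forall>X. (\<lambda>A. D A (A ** X)) \<in> poly_functions {\<lambda>A. A $ i $ j | i j. True}"
      "\<forall>X. (\<lambda>A. E A (A ** X)) \<in> poly_functions {\<lambda>A. A $ i $ j | i j. True}" by blast
  show ?case
    by (rule exI[of _ "\<lambda>A X. D A X + E A X"]) (intro conjI allI impI DERIV_add poly_functions.add D(1)[rule_format] D(2)[rule_format] P(1)[rule_format] P(2)[rule_format], assumption+)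
next
  case (mult F H)
  then obtain D E where D: "\<forall>\<gamma> X t. mderiv \<gamma> X t \<longrightarrow> ((\<lambda>s. F (\<gamma> s)) has_field_derivative D (\<gamma> t) X) (at t)"
      "\<forall>\<gamma> X t. mderiv \<gamma> X t \<longrightarrow> ((\<lambda>s. H (\<gamma> s)) has_field_derivative E (\<gamma> t) X) (at t)"
    and P: "\<forall>X. (\<lambda>A. D A (A ** X)) \<in> poly_functions {\<lambda>A. A $ i $ j | i j. True}"
      "\<forall>X. (\<lambda>A. E A (A ** X)) \<in> poly_functions {\<lambda>A. A $ i $ j | i j. True}" by blast
  show ?case
    by (rule exI[of _ "\<lambda>A X. D A X * H A + E A X * F A"])
      (intro conjI allI impI DERIV_mult poly_functions.add poly_functions.mult mult.hyps
        D(1)[rule_format] D(2)[rule_format] P(1)[rule_format] P(2)[rule_format], assumption+)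
qed

text \<open>Moves a derivative from one curve to another with the same point and velocity. The
  definition of \<open>lie_algebra_of\<close> uses straight lines, which may leave the group; this
  makes it testable on curves inside.\<close>

lemma mderiv_poly_cong:
  assumes "P \<in> matrix_polys" "mderiv \<gamma> X t" "mderiv \<delta> X s"
    "((\<lambda>s. P (\<gamma> s)) has_field_derivative c) (at t)" "\<gamma> t = \<delta> s"
  shows "((\<lambda>s. P (\<delta> s)) has_field_derivative c) (at s)"
proof -
  obtain D where D: "\<And>\<gamma> X t. mderiv \<gamma> X t \<Longrightarrow> ((\<lambda>s. P (\<gamma> s)) has_field_derivative D (\<gamma> t) X) (at t)"
    using matrix_polys_deriv[OF assms(1)] by blast
  have "c = D (\<gamma> t) X" using assms(4) D[OF assms(2)] by (rule DERIV_unique)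
  then show ?thesis using D[OF assms(3)] assms(5) by simp
qed

section \<open>Tangent spaces of closed matrix groups\<close>

lemma lie_algebra_ofI:
  assumes "mderiv \<gamma> X 0" "\<gamma> 0 = mat 1" "range \<gamma> \<subseteq> M"
  shows "X \<in> lie_algebra_of M"
  unfolding lie_algebra_of_def
proof (intro CollectI ballI impI)
  fix P assume P: "P \<in> matrix_polys" "\<forall>A\<in>M. P A = 0"
  have "P (\<gamma> s) = 0" for s using P(2) assms(3) by blast
  then have "((\<lambda>s. P (\<gamma> s)) has_field_derivative 0) (at 0)" by simp
  then show "((\<lambda>t. P (mat 1 + mscale t X)) has_field_derivative 0) (at 0)"
    by (rule mderiv_poly_cong[OF P(1) assms(1) mderiv_line]) (simp add: assms(2) vec_eq_iff)
qed

lemma lie_algebra_ofD: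
  assumes "X \<in> lie_algebra_of M" "P \<in> matrix_polys" "\<forall>A\<in>M. P A = 0" "mderiv \<gamma> X t" "\<gamma> t = mat 1"
  shows "((\<lambda>s. P (\<gamma> s)) has_field_derivative 0) (at t)"
proof (rule mderiv_poly_cong[OF assms(2) mderiv_line assms(4)])
  show "((\<lambda>t. P (mat 1 + mscale t X)) has_field_derivative 0) (at 0)"
    using assms(1-3) unfolding lie_algebra_of_def by blast
qed (simp add: assms(5) vec_eq_iff)

lemma GL_closed_memberI:
  assumes "GL_closed M" "invertible A" "\<And>P. P \<in> matrix_polys \<Longrightarrow> \<forall>B\<in>M. P B = 0 \<Longrightarrow> P A = 0"
  shows "A \<in> M"
  using assms unfolding GL_closed_def by blast

lemma GL_closed_invertible: "GL_closed M \<Longrightarrow> A \<in> M \<Longrightarrow> invertible A"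
  unfolding GL_closed_def by blast

text \<open>Left translation by \<open>M\<close> preserves the vanishing ideal of \<open>M\<close>, hence so does the invariant
  vector field \<open>A \<mapsto> A X\<close>: every derivative of a polynomial in that ideal along \<open>mexp X\<close> vanishes at 0.\<close>

lemma mexp_in_group:
  assumes M: "GL_closed M" "mat 1 \<in> M" "\<And>A B. A \<in> M \<Longrightarrow> B \<in> M \<Longrightarrow> A ** B \<in> M"
    and X: "X \<in> lie_algebra_of M"
  shows "mexp X t \<in> M"
proof (rule GL_closed_memberI[OF M(1) one_param_matrix_inv(2)[OF one_param_mexp]])
  fix P :: "complex^'a^'a \<Rightarrow> complex"
  define I where "I = {P \<in> matrix_polys. \<forall>A\<in>M. P A = 0}"
  have e0: "mexp X 0 = mat 1" and eX: "mderiv (mexp X) (mexp X t ** X) t" for t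
    using one_param_mexp[of X] by (simp_all add: one_param_def)
  then have e1: "mderiv (mexp X) X 0" using eX[of 0] by simp
  have step: "\<exists>Q\<in>I. \<forall>t. ((\<lambda>s. P (mexp X s)) has_field_derivative Q (mexp X t)) (at t)" if "P \<in> I" for P
  proof -
    have Pm: "P \<in> matrix_polys" using that by (simp add: I_def)
    obtain D where D: "\<forall>\<gamma> X t. mderiv \<gamma> X t \<longrightarrow> ((\<lambda>s. P (\<gamma> s)) has_field_derivative D (\<gamma> t) X) (at t)"
      "\<forall>X. (\<lambda>A. D A (A ** X)) \<in> matrix_polys"
      using matrix_polys_deriv[OF Pm] by blast
    have "D A (A ** X) = 0" if "A \<in> M" for A
    proof -
      have "(\<lambda>B. P (A ** B)) \<in> matrix_polys" using Pm by (rule matrix_polys_left)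
      moreover have "\<forall>B\<in>M. P (A ** B) = 0" using \<open>P \<in> I\<close> that M(3) by (auto simp: I_def)
      ultimately have 1: "((\<lambda>s. P (A ** mexp X s)) has_field_derivative 0) (at 0)"
        using lie_algebra_ofD[OF X, of "\<lambda>B. P (A ** B)" "mexp X" 0] e1 e0 by blast
      have "mderiv (\<lambda>s. A ** mexp X s) (A ** X) 0"
        using mderiv_mult[OF mderiv_const[of A] e1] by (simp add: matrix_mult_zero)
      then have "((\<lambda>s. P (A ** mexp X s)) has_field_derivative D (A ** mexp X 0) (A ** X)) (at 0)"
        by (rule D(1)[rule_format, of "\<lambda>s. A ** mexp X s" "A ** X" 0])
      with 1 have "D (A ** mexp X 0) (A ** X) = 0" using DERIV_unique by blast
      then show ?thesis by (simp add: e0)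
    qed
    moreover have "((\<lambda>s. P (mexp X s)) has_field_derivative D (mexp X t) (mexp X t ** X)) (at t)" for t
      by (rule D(1)[rule_format, OF eX])
    ultimately show ?thesis
      using D(2) by (intro bexI[of _ "\<lambda>A. D A (A ** X)"]) (auto simp: I_def)
  qed
  assume P: "P \<in> matrix_polys" "\<forall>B\<in>M. P B = 0"
  have der: "\<exists>Q\<in>I. \<forall>t. (deriv ^^ k) (\<lambda>s. P (mexp X s)) t = Q (mexp X t)" for k
  proof (induction k)
    case 0
    show ?case using P by (auto simp: I_def)
  next
    case (Suc k)
    then obtain Q where Q: "Q \<in> I" "(deriv ^^ k) (\<lambda>s. P (mexp X s)) = (\<lambda>t. Q (mexp X t))" by auto
    obtain R where "R \<in> I" "\<forall>t. ((\<lambda>s. Q (mexp X s)) has_field_derivative R (mexp X t)) (at t)"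
      using step[OF Q(1)] by blast
    then show ?case by (auto simp: Q(2) intro!: DERIV_imp_deriv)
  qed
  have "(deriv ^^ k) (\<lambda>s. P (mexp X s)) 0 = 0" for k
  proof -
    obtain Q where "Q \<in> I" "(deriv ^^ k) (\<lambda>s. P (mexp X s)) 0 = Q (mexp X 0)"
      using der[of k] by blast
    then show ?thesis using M(2) by (simp add: e0 I_def)
  qed
  moreover have "(\<lambda>s. P (mexp X s)) holomorphic_on UNIV"
    using step[of P] P by (auto simp: I_def holomorphic_on_def field_differentiable_def)
  ultimately show "P (mexp X t) = 0"
    using holomorphic_fun_eq_0_on_connected[of "\<lambda>s. P (mexp X s)" UNIV 0 t]
    by (simp add: connected_UNIV)
qed

text \<open>Zariski density of the natural numbers: an identity that is polynomial in
  \<open>t\<close> has to be checked only where the curve runs through natural powers of a group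
  element.\<close>

lemma poly_zero_at_nats:
  fixes p :: "complex poly"
  assumes "\<And>n. poly p (of_nat n) = 0"
  shows "p = 0"
proof (rule ccontr)
  assume "p \<noteq> 0"
  then have "finite {x. poly p x = 0}" by (rule poly_roots_finite)
  moreover have "range (of_nat :: nat \<Rightarrow> complex) \<subseteq> {x. poly p x = 0}" using assms by auto
  ultimately have "finite (range (of_nat :: nat \<Rightarrow> complex))" by (rule rev_finite_subset)
  then have "finite (UNIV :: nat set)" using inj_of_nat by (rule finite_imageD)
  then show False by simp
qed

lemma matrix_polys_poly:
  assumes "P \<in> matrix_polys" "\<And>i j. \<exists>p. \<forall>t. A t $ i $ j = poly p t"
  shows "\<exists>p. \<forall>t. P (A t) = poly p t"
  using assms(1) unfolding matrix_polys_def
proof induction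
  case (const c) show ?case by (rule exI[of _ "[:c:]"]) simp
next
  case (coord F) then show ?case using assms(2) by auto
next
  case (add F H)
  then obtain p q where "\<forall>t. F (A t) = poly p t" "\<forall>t. H (A t) = poly q t" by blast
  then show ?case by (intro exI[of _ "p + q"]) simp
next
  case (mult F H)
  then obtain p q where "\<forall>t. F (A t) = poly p t" "\<forall>t. H (A t) = poly q t" by blast
  then show ?case by (intro exI[of _ "p * q"]) simp
qed

text \<open>With \<open>A = 1 + N\<close> and \<open>N\<close> nilpotent, the binomial series for
  \<open>A\<close> to the power \<open>t\<close> is a polynomial in \<open>t\<close>. Its values at
  natural numbers are powers of \<open>A\<close>, so the addition law and membership in the closed
  set \<open>M\<close> extend from natural numbers to all \<open>t\<close>.\<close>

lemma unipotent_one_param: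
  assumes M: "GL_closed M" "mat 1 \<in> M" "\<And>A B. A \<in> M \<Longrightarrow> B \<in> M \<Longrightarrow> A ** B \<in> M"
    and A: "A \<in> M" "unipotent_matrix A"
  obtains \<gamma> X where "one_param \<gamma> X" "range \<gamma> \<subseteq> M" "\<gamma> 1 = A" "X \<in> lie_algebra_of M"
proof -
  define N where "N = A - mat 1"
  have iter: "(((**) N) ^^ k) (mat 1) = mpow N k" for k by (induction k) simp_all
  obtain K where K0: "mpow N K = 0" using A(2) iter unfolding unipotent_matrix_def N_def by auto
  have K: "mpow N k = 0" if "k \<ge> K" for k
    using that by (induction rule: dec_induct) (simp_all add: K0 matrix_mult_zero)
  \<comment> \<open>Summation up to \<open>K\<close>, where \<open>mpow N K\<close> already
    vanishes, leaves room for the index shift in Pascal's rule.\<close>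
  define \<gamma> where "\<gamma> t = (\<chi> i j. \<Sum>k<Suc K. (t gchoose k) * mpow N k $ i $ j)" for t
  define pg :: "nat \<Rightarrow> complex poly" where "pg k = Polynomial.smult (1 / fact k) (\<Prod>i = 0..<k. [:- of_nat i, 1:])" for k
  have pg: "poly (pg k) t = t gchoose k" for k and t :: complex
    by (simp add: pg_def gbinomial_prod_rev poly_prod)
  define q where "q i j = (\<Sum>k<Suc K. Polynomial.smult (mpow N k $ i $ j) (pg k))" for i j
  have q: "\<gamma> t $ i $ j = poly (q i j) t" for t i j
    by (simp add: \<gamma>_def q_def poly_sum pg mult.commute)
  have g0: "\<gamma> 0 = mat 1"
    by (simp add: \<gamma>_def vec_eq_iff sum.lessThan_Suc_shift del: sum.lessThan_Suc)
  have g1: "\<gamma> (t + 1) = \<gamma> t ** A" for t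
  proof -
    have "\<gamma> (t + 1) $ i $ j = (\<gamma> t + \<gamma> t ** N) $ i $ j" for i j
    proof -
      have "\<gamma> (t + 1) $ i $ j = mat 1 $ i $ j + (\<Sum>k<K. (t gchoose k) * mpow N (Suc k) $ i $ j + (t gchoose Suc k) * mpow N (Suc k) $ i $ j)"
        unfolding \<gamma>_def by (simp add: sum.lessThan_Suc_shift gbinomial_Suc_Suc distrib_right del: sum.lessThan_Suc)
      also have "\<dots> = (\<Sum>k<Suc K. (t gchoose k) * mpow N (Suc k) $ i $ j) + (mat 1 $ i $ j + (\<Sum>k<K. (t gchoose Suc k) * mpow N (Suc k) $ i $ j))"
        using K[of "Suc K"] by (simp add: sum.distrib)
      also have "mat 1 $ i $ j + (\<Sum>k<K. (t gchoose Suc k) * mpow N (Suc k) $ i $ j) = \<gamma> t $ i $ j"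
        unfolding \<gamma>_def by (simp add: sum.lessThan_Suc_shift del: sum.lessThan_Suc)
      also have "(\<Sum>k<Suc K. (t gchoose k) * mpow N (Suc k) $ i $ j) = (\<gamma> t ** N) $ i $ j"
      proof -
        have "(\<Sum>k<Suc K. (t gchoose k) * mpow N (Suc k) $ i $ j) =
            (\<Sum>k<Suc K. \<Sum>l\<in>UNIV. (t gchoose k) * mpow N k $ i $ l * N $ l $ j)"
          unfolding mpow_Suc_right
          by (simp add: matrix_matrix_mult_def sum_distrib_left mult.assoc del: sum.lessThan_Suc)
        also have "\<dots> = (\<Sum>l\<in>UNIV. \<Sum>k<Suc K. (t gchoose k) * mpow N k $ i $ l * N $ l $ j)"
          by (rule sum.swap)
        also have "\<dots> = (\<gamma> t ** N) $ i $ j"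
          by (simp add: \<gamma>_def matrix_matrix_mult_def sum_distrib_right del: sum.lessThan_Suc)
        finally show ?thesis .
      qed
      finally show ?thesis by simp
    qed
    then show ?thesis
      by (simp add: vec_eq_iff N_def matrix_diff_ldistrib)
  qed
  have gn: "\<gamma> (t + of_nat n) = \<gamma> t ** \<gamma> (of_nat n)" for t n
  proof (induction n)
    case (Suc n)
    have "\<gamma> (t + of_nat (Suc n)) = \<gamma> (t + of_nat n) ** A" using g1[of "t + of_nat n"] by (simp add: add_ac)
    also have "\<dots> = \<gamma> t ** \<gamma> (of_nat (Suc n))"
      using g1[of "of_nat n"] by (simp add: Suc matrix_mul_assoc add.commute)
    finally show ?case .
  qed (simp add: g0)
  have gadd: "\<gamma> (t + s) = \<gamma> t ** \<gamma> s" for t s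
  proof -
    have "\<gamma> (t + s) $ i $ j = (\<gamma> t ** \<gamma> s) $ i $ j" for i j
    proof -
      \<comment> \<open>The difference of the two sides of the addition law, as a polynomial in
        \<open>s\<close> with \<open>t\<close> fixed; at natural \<open>s\<close> it is zero by
        \<open>gn\<close>.\<close>
      let ?p = "pcompose (q i j) [:t, 1:] - (\<Sum>k\<in>UNIV. Polynomial.smult (\<gamma> t $ i $ k) (q k j))"
      have p: "poly ?p s = \<gamma> (t + s) $ i $ j - (\<gamma> t ** \<gamma> s) $ i $ j" for s
        by (simp add: q poly_pcompose poly_sum matrix_matrix_mult_def)
      have "?p = 0" by (rule poly_zero_at_nats) (simp only: p gn, simp)
      then show ?thesis using p[of s] by simp
    qed
    then show ?thesis by (simp add: vec_eq_iff)
  qed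
  have gnM: "\<gamma> (of_nat n) \<in> M" for n
  proof (induction n)
    case (Suc n) then show ?case using g1[of "of_nat n"] M(3) A(1) by (simp add: add.commute)
  qed (simp add: g0 M(2))
  have inv: "invertible (\<gamma> t)" for t
    by (rule matrix_inv_eqI(2)[of _ "\<gamma> (- t)"]) (simp_all add: gadd[symmetric] g0)
  have gM: "\<gamma> t \<in> M" for t
  proof (rule GL_closed_memberI[OF M(1) inv])
    fix P assume P: "P \<in> matrix_polys" "\<forall>B\<in>M. P B = 0"
    obtain p where p: "\<forall>t. P (\<gamma> t) = poly p t" using matrix_polys_poly[OF P(1), of \<gamma>] q by blast
    have "p = 0" by (rule poly_zero_at_nats) (metis p P(2) gnM)
    then show "P (\<gamma> t) = 0" using p by simp
  qed
  define X where "X = (\<chi> i j. poly (pderiv (q i j)) 0)"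
  have X: "mderiv \<gamma> X 0" by (simp add: mderiv_def q X_def poly_DERIV)
  have "one_param \<gamma> X"
    unfolding one_param_def
  proof (intro conjI allI)
    fix t
    have *: "mderiv \<gamma> D t" if "mderiv (\<lambda>s. \<gamma> (t + s)) D 0" for D
      using that DERIV_shift[of "\<lambda>s. \<gamma> s $ _ $ _" _ 0 t] by (simp add: mderiv_def add.commute)
    show "mderiv \<gamma> (\<gamma> t ** X) t"
      using mderiv_mult[OF mderiv_const[of "\<gamma> t"] X] by (intro *) (simp add: gadd matrix_mult_zero)
    show "mderiv \<gamma> (X ** \<gamma> t) t"
      using mderiv_mult[OF X mderiv_const[of "\<gamma> t"]]
      by (intro *) (simp add: add.commute[of t] gadd matrix_mult_zero)
  qed (rule g0)
  moreover have "\<gamma> 1 = A" using g1[of 0] by (simp add: g0)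
  moreover have "X \<in> lie_algebra_of M" using lie_algebra_ofI[OF X g0] gM by auto
  ultimately show ?thesis using that gM by blast
qed

text \<open>If \<open>P\<close> vanishes on \<open>M\<close>, so does
  \<open>B \<mapsto> P (g ** B ** h)\<close>, and its derivative at the identity in direction
  \<open>X\<close> is that of \<open>P\<close> in direction \<open>g ** X ** h\<close>.\<close>

lemma conj_lie_algebra:
  assumes M: "\<And>A B. A \<in> M \<Longrightarrow> B \<in> M \<Longrightarrow> A ** B \<in> M"
    and g: "g \<in> M" "h \<in> M" "g ** h = mat 1" and X: "X \<in> lie_algebra_of M"
  shows "g ** X ** h \<in> lie_algebra_of M"
  unfolding lie_algebra_of_def
proof (intro CollectI ballI impI)
  fix P assume P: "P \<in> matrix_polys" "\<forall>A\<in>M. P A = 0"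
  have "(\<lambda>B. P (g ** B ** h)) \<in> matrix_polys"
    using matrix_polys_left[OF matrix_polys_right[OF P(1), of h], of g] .
  moreover have "\<forall>A\<in>M. P (g ** A ** h) = 0" using P(2) M g by blast
  ultimately have "((\<lambda>s. P (g ** (mat 1 + mscale s X) ** h)) has_field_derivative 0) (at 0)"
    by (rule lie_algebra_ofD[OF X _ _ mderiv_line]) (simp add: vec_eq_iff)
  then show "((\<lambda>s. P (mat 1 + mscale s (g ** X ** h))) has_field_derivative 0) (at 0)"
    by (simp add: matrix_add_ldistrib matrix_add_rdistrib mscale_mult g(3))
qed

section \<open>Gradings and slices\<close>

locale lie_form = complex_lie_algebra sc br
  for sc :: "complex \<Rightarrow> 'g::ab_group_add \<Rightarrow> 'g" and br :: "'g \<Rightarrow> 'g \<Rightarrow> 'g" +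
  fixes form :: "'g \<Rightarrow> 'g \<Rightarrow> complex"
  assumes finite_span: "\<exists>A. finite A \<and> span A = UNIV"
    and nondeg_form: "nondeg_invariant_form sc br form"
begin

lemma linear_br: "Vector_Spaces.linear sc sc (br x)"
  by (simp add: Vector_Spaces.linear_iff vector_space_axioms br_add_right br_scale_right)

lemma br_minus: "br (- x) y = - br x y" "br x (- y) = - br x y"
  using br_add_left[of x "- x" y] br_add_right[of x y "- y"] by (simp_all add: br_zero eq_neg_iff_add_eq_0 add.commute)

lemma br_diff: "br (x - y) z = br x z - br y z" "br x (y - z) = br x y - br x z"
  using br_add_left[of x "- y" z] br_add_right[of x y "- z"] by (simp_all add: br_minus)

lemma br_sum: "br (sum f I) y = (\<Sum>i\<in>I. br (f i) y)" "br x (sum f I) = (\<Sum>i\<in>I. br x (f i))"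
  by (induction I rule: infinite_finite_induct) (simp_all add: br_zero br_add_left br_add_right)

lemma form_dual: "form x \<in> dual"
  using nondeg_form unfolding nondeg_invariant_form_def dual_space_def by blast

lemma form_sym: "form x y = form y x"
  using nondeg_form unfolding nondeg_invariant_form_def by blast

lemma form_br: "form (br x y) z = form x (br y z)"
  using nondeg_form unfolding nondeg_invariant_form_def by blast

text \<open>Skewness of \<open>ad x\<close>, written with \<open>- x\<close> on the right so that
  iteration yields \<open>exp (ad (- x))\<close> as the adjoint of
  \<open>exp (ad x)\<close>.\<close>

lemma form_br_left: "form (br x y) z = form y (br (- x) z)"
proof -
  have "form (br x y) z = form (br y (- x)) z" using br_swap[of x y] by (simp add: br_minus)
  then show ?thesis by (simp add: form_br)
qed

lemma form_nondeg: "(\<And>y. form x y = 0) \<Longrightarrow> x = 0"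
  using nondeg_form unfolding nondeg_invariant_form_def by blast

lemma form_add: "form x (y + z) = form x y + form x z" "form (x + y) z = form x z + form y z"
  using form_dual dual_iff form_sym by metis+

lemma form_scale: "form x (sc c z) = c * form x z" "form (sc c x) z = c * form x z"
  using form_dual dual_iff form_sym by metis+

lemma form_zero: "form x 0 = 0" "form 0 x = 0"
  using form_dual dual_0 form_sym by metis+

lemma form_minus: "form x (- y) = - form x y" "form (- x) y = - form x y"
  using form_dual dual_minus form_sym by metis+

lemma form_diff: "form x (y - z) = form x y - form x z" "form (x - y) z = form x z - form y z"
  using form_add[of x y "- z"] form_add(2)[of x "- y" z] by (simp_all add: form_minus)

lemma form_sum: "form x (sum f I) = (\<Sum>i\<in>I. form x (f i))" "form (sum f I) x = (\<Sum>i\<in>I. form (f i) x)"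
  by (induction I rule: infinite_finite_induct) (simp_all add: form_zero form_add)

lemma form_eqI: "(\<And>y. form x y = form x' y) \<Longrightarrow> x = x'"
  using form_nondeg[of "x - x'"] by (simp add: form_diff)

definition Bs :: "'g set" where "Bs = (SOME B. finite B \<and> independent B \<and> span B = UNIV)"

lemma Bs: "finite Bs" "independent Bs" "span Bs = UNIV"
proof -
  obtain A where A: "finite A" "span A = UNIV" using finite_span by blast
  obtain B where B: "B \<subseteq> A" "independent B" "A \<subseteq> span B" using maximal_independent_subset by metis
  have "span B = UNIV" using A(2) B(3) by (metis span_mono span_span top.extremum_uniqueI)
  then have "\<exists>B. finite B \<and> independent B \<and> span B = UNIV"
    using A(1) B(1,2) finite_subset by blast
  from someI_ex[OF this] show "finite Bs" "independent Bs" "span Bs = UNIV"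
    unfolding Bs_def by blast+
qed

sublocale fd: finite_dimensional_vector_space sc Bs
  by unfold_locales (rule Bs)+

lemma vs_pair: "vector_space_pair sc sc" ..

lemma expand: "x = (\<Sum>b\<in>Bs. sc (representation Bs x b) b)"
  using sum_representation_eq[OF Bs(2), of x Bs] by (simp add: Bs)

lemma coord_dual: "(\<lambda>x. representation Bs x b) \<in> dual"
  by (simp add: dual_iff representation_add representation_scale Bs)

lemma dual_sum: "\<xi> \<in> dual \<Longrightarrow> \<xi> (sum f I) = (\<Sum>i\<in>I. \<xi> (f i))"
  by (induction I rule: infinite_finite_induct) (simp_all add: dual_0 dual_iff)

lemma form_surj: "\<xi> \<in> dual \<Longrightarrow> \<exists>x. form x = \<xi>"
proof -
  assume \<xi>: "\<xi> \<in> dual"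
  \<comment> \<open>The values of \<open>form x\<close> on the basis serve as coordinates of a
    vector of the same space, so that \<open>T\<close> is an endomorphism, for which injectivity
    implies surjectivity.\<close>
  define T where "T x = (\<Sum>b\<in>Bs. sc (form x b) b)" for x
  have lin: "Vector_Spaces.linear sc sc T"
    by (simp add: Vector_Spaces.linear_iff vector_space_axioms T_def form_add form_scale
        scale_left_distrib sum.distrib scale_sum_right)
  have coeff: "\<forall>b\<in>Bs. F b = F' b" if "(\<Sum>b\<in>Bs. sc (F b) b) = (\<Sum>b\<in>Bs. sc (F' b) b)" for F F'
  proof -
    have "(\<Sum>b\<in>Bs. sc (F b - F' b) b) = 0"
      using that by (simp add: scale_left_diff_distrib sum_subtractf)
    then have "\<forall>b\<in>Bs. F b - F' b = 0"
      using Bs(2) unfolding independent_explicit_finite_subsets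
      by (meson Bs(1) order_refl)
    then show ?thesis by simp
  qed
  have on_basis: "\<eta> = \<eta>'" if "\<forall>b\<in>Bs. \<eta> b = \<eta>' b" "\<eta> \<in> dual" "\<eta>' \<in> dual" for \<eta> \<eta>'
  proof
    fix x
    have *: "\<eta> x = (\<Sum>b\<in>Bs. representation Bs x b * \<eta> b)" if "\<eta> \<in> dual" for \<eta>
      by (subst expand[of x]) (use that in \<open>simp add: dual_sum dual_iff\<close>)
    show "\<eta> x = \<eta>' x" using that by (simp add: *)
  qed
  have "inj T"
  proof (rule injI)
    fix x y assume "T x = T y"
    then have "\<forall>b\<in>Bs. form x b = form y b" unfolding T_def by (rule coeff)
    then have "form x = form y" by (rule on_basis) (rule form_dual)+
    then show "x = y" by (metis form_eqI)
  qed
  then have "surj T" using fd.linear_inj_imp_surj[OF lin] by blast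
  then obtain x where "T x = (\<Sum>b\<in>Bs. sc (\<xi> b) b)" by (metis surjD)
  then have "\<forall>b\<in>Bs. form x b = \<xi> b" unfolding T_def by (rule coeff)
  then have "form x = \<xi>" by (rule on_basis) (rule form_dual \<xi>)+
  then show ?thesis ..
qed

definition sharp :: "('g \<Rightarrow> complex) \<Rightarrow> 'g" where "sharp \<xi> = (THE x. form x = \<xi>)"

lemma sharp_form: "sharp (form x) = x"
  unfolding sharp_def by (rule the_equality) (auto intro: form_eqI simp: fun_eq_iff)

lemma form_sharp: "\<xi> \<in> dual \<Longrightarrow> form (sharp \<xi>) = \<xi>"
  using form_surj sharp_form by metis

lemma adjoint_exists:
  assumes "Vector_Spaces.linear sc sc T"
  shows "\<exists>x'. \<forall>y. form (T y) x = form y x'"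
proof -
  have "(\<lambda>y. form (T y) x) \<in> dual"
    using assms by (simp add: dual_iff Vector_Spaces.linear_iff form_add form_scale)
  from form_surj[OF this] obtain x' where "form x' = (\<lambda>y. form (T y) x)" ..
  then have "\<forall>y. form (T y) x = form y x'" by (metis form_sym)
  then show ?thesis ..
qed

subsection \<open>Exponentials of nilpotent derivations\<close>

text \<open>\<open>exp (ad x)\<close> for nilpotent \<open>ad x\<close>. Summing over the nonzero
  terms avoids a choice of nilpotency degree; \<open>ead_eq\<close> then allows any sufficiently
  long range.\<close>

definition ead :: "'g \<Rightarrow> 'g \<Rightarrow> 'g" where
  "ead x y = (\<Sum>k | (br x ^^ k) y \<noteq> 0. sc (1 / fact k) ((br x ^^ k) y))"

lemma ead_eq:
  assumes "\<And>y. (br x ^^ K) y = 0"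
  shows "ead x y = (\<Sum>k<K. sc (1 / fact k) ((br x ^^ k) y))"
proof -
  have "(br x ^^ k) y = 0" if "k \<ge> K" for k
  proof -
    have "(br x ^^ k) y = (br x ^^ K) ((br x ^^ (k - K)) y)"
      using that by (metis funpow_add comp_apply le_add_diff_inverse)
    then show ?thesis using assms by simp
  qed
  then show ?thesis
    unfolding ead_def by (intro sum.mono_neutral_left) (auto simp: not_le[symmetric])
qed

lemma funpow_br_linear:
  "(br x ^^ k) (y + z) = (br x ^^ k) y + (br x ^^ k) z" "(br x ^^ k) (sc c y) = sc c ((br x ^^ k) y)"
  "(br (sc c x) ^^ k) y = sc (c ^ k) ((br x ^^ k) y)" "(br x ^^ k) 0 = 0"
  by (induction k) (simp_all add: br_add_right br_scale_right br_scale_left br_zero)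

lemma funpow_br_minus: "(br (- x) ^^ k) y = sc ((-1) ^ k) ((br x ^^ k) y)"
  using funpow_br_linear(3)[where c = "-1"] by simp

lemma form_funpow_br: "form ((br x ^^ k) y) z = form y ((br (- x) ^^ k) z)"
proof (induction k arbitrary: z)
  case (Suc k)
  have "form ((br x ^^ Suc k) y) z = form ((br x ^^ k) y) (br (- x) z)"
    by (simp add: form_br_left br_minus)
  then show ?case unfolding Suc by (simp add: funpow_swap1)
qed simp

lemma nilpotent_element_scale:
  "nilpotent_element br x \<Longrightarrow> nilpotent_element br (sc c x)"
  "nilpotent_element br x \<Longrightarrow> nilpotent_element br (- x)"
  unfolding nilpotent_element_def by (metis funpow_br_linear(3) scale_zero_right, metis funpow_br_minus scale_zero_right)

lemma form_ead:
  assumes "nilpotent_element br x"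
  shows "form (ead x y) z = form y (ead (- x) z)"
proof -
  obtain K where K: "\<And>y. (br x ^^ K) y = 0" using assms unfolding nilpotent_element_def by blast
  then have K': "\<And>y. (br (- x) ^^ K) y = 0" by (simp add: funpow_br_minus)
  show ?thesis
    by (simp add: ead_eq[OF K] ead_eq[OF K'] form_sum form_scale form_funpow_br)
qed

lemma ead_zero: "ead 0 y = y"
  using ead_eq[where K = "Suc 0" and x = 0 and y = y] by (simp add: br_zero)

subsection \<open>Linear maps splitting a complement\<close>

lemma projection_exists:
  assumes "subspace V"
  obtains p where "Vector_Spaces.linear sc sc p" "range p \<subseteq> V" "\<And>v. v \<in> V \<Longrightarrow> p v = v"
proof -
  interpret vp: vector_space_pair sc sc by (rule vs_pair)
  have "Vector_Spaces.linear sc sc (\<lambda>x. x)"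
    by (simp add: Vector_Spaces.linear_iff vector_space_axioms)
  from vp.linear_exists_left_inverse_on[OF this assms]
  show ?thesis using that by (auto simp: inj_on_def)
qed

end

subsection \<open>Gradings\<close>

locale lie_graded = lie_form sc br form
  for sc :: "complex \<Rightarrow> 'g::ab_group_add \<Rightarrow> 'g" and br form +
  fixes \<Gamma> :: "int \<Rightarrow> 'g set" and q :: 'g
  assumes grading: "Z_grading sc br \<Gamma>" and grading_el: "grading_element sc br \<Gamma> q"
begin

text \<open>The homogeneous component of degree \<open>k\<close>, read off from the unique
  decomposition that \<open>Z_grading\<close> provides.\<close>

definition cp :: "int \<Rightarrow> 'g \<Rightarrow> 'g" where
  "cp k x = (THE c. (\<forall>j. c j \<in> \<Gamma> j) \<and> finite {j. c j \<noteq> 0} \<and> x = (\<Sum>j | c j \<noteq> 0. c j)) k"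

lemma subspace_\<Gamma>: "subspace (\<Gamma> j)"
  using grading by (simp add: Z_grading_def)

lemma \<Gamma>_br: "x \<in> \<Gamma> i \<Longrightarrow> y \<in> \<Gamma> j \<Longrightarrow> br x y \<in> \<Gamma> (i + j)"
  using grading by (simp add: Z_grading_def)

lemma \<Gamma>_eigen: "x \<in> \<Gamma> j \<longleftrightarrow> br q x = sc (of_int j) x"
  using grading_el by (simp add: grading_element_def)

lemma cp_props: "cp j x \<in> \<Gamma> j" "finite {j. cp j x \<noteq> 0}" "x = (\<Sum>j | cp j x \<noteq> 0. cp j x)"
proof -
  have "\<exists>!c. (\<forall>j. c j \<in> \<Gamma> j) \<and> finite {j. c j \<noteq> 0} \<and> x = (\<Sum>j | c j \<noteq> 0. c j)"
    using grading by (simp add: Z_grading_def)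
  from theI'[OF this] show "cp j x \<in> \<Gamma> j" "finite {j. cp j x \<noteq> 0}" "x = (\<Sum>j | cp j x \<noteq> 0. cp j x)"
    unfolding cp_def by blast+
qed

lemma cp_unique:
  assumes "\<And>j. c j \<in> \<Gamma> j" "finite I" "\<And>j. j \<notin> I \<Longrightarrow> c j = 0" "x = (\<Sum>j\<in>I. c j)"
  shows "cp k x = c k"
proof -
  have ex: "\<exists>!c. (\<forall>j. c j \<in> \<Gamma> j) \<and> finite {j. c j \<noteq> 0} \<and> x = (\<Sum>j | c j \<noteq> 0. c j)"
    using grading by (simp add: Z_grading_def)
  have sub: "{j. c j \<noteq> 0} \<subseteq> I" using assms(3) by blast
  have "x = (\<Sum>j | c j \<noteq> 0. c j)"
    unfolding assms(4) by (rule sum.mono_neutral_right[OF assms(2) sub]) auto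
  then have *: "(\<forall>j. c j \<in> \<Gamma> j) \<and> finite {j. c j \<noteq> 0} \<and> x = (\<Sum>j | c j \<noteq> 0. c j)"
    using assms(1) finite_subset[OF sub assms(2)] by blast
  have "(THE c. (\<forall>j. c j \<in> \<Gamma> j) \<and> finite {j. c j \<noteq> 0} \<and> x = (\<Sum>j | c j \<noteq> 0. c j)) = c"
    using ex by (rule the1_equality) (rule *)
  then show ?thesis unfolding cp_def by simp
qed

lemma \<Gamma>_zero: "0 \<in> \<Gamma> j" using subspace_\<Gamma> subspace_0 by blast

lemma cp_hom: "x \<in> \<Gamma> j \<Longrightarrow> cp k x = (if k = j then x else 0)"
  by (rule cp_unique[where I = "{j}" and c = "\<lambda>k. if k = j then x else 0"]) (auto simp: \<Gamma>_zero)

lemma cp_expand: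
  assumes "finite I" "\<And>j. j \<notin> I \<Longrightarrow> cp j x = 0"
  shows "x = (\<Sum>j\<in>I. cp j x)"
proof -
  have "(\<Sum>j | cp j x \<noteq> 0. cp j x) = (\<Sum>j\<in>I. cp j x)"
    using assms by (intro sum.mono_neutral_left) auto
  then show ?thesis using cp_props(3) by simp
qed

lemma cp_add: "cp k (x + y) = cp k x + cp k y"
proof (rule cp_unique[where c = "\<lambda>k. cp k x + cp k y"])
  let ?I = "{j. cp j x \<noteq> 0} \<union> {j. cp j y \<noteq> 0}"
  show fin: "finite ?I" using cp_props(2) by simp
  show "x + y = (\<Sum>j\<in>?I. cp j x + cp j y)"
    unfolding sum.distrib using cp_expand[OF fin, of x] cp_expand[OF fin, of y] by simp
qed (auto intro: subspace_add[OF subspace_\<Gamma>] cp_props)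

lemma cp_scale: "cp k (sc c x) = sc c (cp k x)"
proof (rule cp_unique[where c = "\<lambda>k. sc c (cp k x)"])
  show "finite {j. cp j x \<noteq> 0}" by (rule cp_props)
  show "sc c x = (\<Sum>j | cp j x \<noteq> 0. sc c (cp j x))"
    unfolding scale_sum_right[symmetric] using cp_props(3)[of x] by simp
qed (auto intro: subspace_scale[OF subspace_\<Gamma>] cp_props)

lemma cp_zero: "cp k 0 = 0" using cp_scale[of k 0 0] by simp

lemma cp_minus: "cp k (- x) = - cp k x"
  using cp_scale[of k "-1" x] by simp

lemma cp_diff: "cp k (x - y) = cp k x - cp k y"
  using cp_add[of k x "- y"] by (simp add: cp_minus)

lemma cp_sum: "cp k (sum f I) = (\<Sum>i\<in>I. cp k (f i))"
  by (induction I rule: infinite_finite_induct) (simp_all add: cp_zero cp_add)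

text \<open>Finite dimension enters here: the components of finitely many basis vectors involve
  finitely many degrees. The resulting bound \<open>N\<close> is what terminates the later
  inductions on the order.\<close>

lemma cp_bound: "\<exists>N::nat. \<forall>k x. \<bar>k\<bar> > int N \<longrightarrow> cp k x = 0"
proof -
  let ?F = "\<Union>b\<in>Bs. {j. cp j b \<noteq> 0}"
  have "finite ?F" using Bs(1) cp_props(2) by blast
  then obtain N where N: "\<forall>j\<in>?F. nat \<bar>j\<bar> \<le> N"
    using finite_nat_set_iff_bounded_le[of "(\<lambda>j. nat \<bar>j\<bar>) ` ?F"] by auto
  have "cp k x = 0" if "\<bar>k\<bar> > int N" for k x
  proof -
    have "cp k b = 0" if "b \<in> Bs" for b
      using N that \<open>\<bar>k\<bar> > int N\<close> by force
    then show ?thesis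
      by (subst expand[of x]) (simp add: cp_sum cp_scale)
  qed
  then show ?thesis by blast
qed

definition N :: nat where "N = (SOME N. \<forall>k x. \<bar>k\<bar> > int N \<longrightarrow> cp k x = 0)"

lemma cp_outside: "\<bar>k\<bar> > int N \<Longrightarrow> cp k x = 0"
  using someI_ex[OF cp_bound] unfolding N_def by blast

definition rng :: "int set" where "rng = {- int N..int N}"

lemma cp_expand_rng: "x = (\<Sum>k\<in>rng. cp k x)"
  by (rule cp_expand) (auto simp: rng_def intro!: cp_outside)

lemma cp_ext: "(\<And>k. cp k x = cp k y) \<Longrightarrow> x = y"
  using cp_expand_rng[of x] cp_expand_rng[of y] by simp

lemma cp_br:
  assumes "y \<in> \<Gamma> j"
  shows "cp k (br x y) = br (cp (k - j) x) y" "cp k (br y x) = br y (cp (k - j) x)"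
proof -
  have *: "cp k (br (cp i x) y) = (if i = k - j then br (cp i x) y else 0)" for i
    using cp_hom[OF \<Gamma>_br[OF cp_props(1) assms], of k i x] by (auto simp: algebra_simps)
  have "cp k (br x y) = (\<Sum>i\<in>rng. cp k (br (cp i x) y))"
    by (subst cp_expand_rng[of x]) (simp add: br_sum cp_sum)
  also have "\<dots> = (if k - j \<in> rng then br (cp (k - j) x) y else 0)"
    unfolding * by (simp add: sum.delta[of rng] rng_def eq_commute)
  also have "\<dots> = br (cp (k - j) x) y"
    by (auto simp: rng_def cp_outside br_zero)
  finally show 1: "cp k (br x y) = br (cp (k - j) x) y" .
  show "cp k (br y x) = br y (cp (k - j) x)"
    using 1 by (metis br_swap cp_minus)
qed

text \<open>Invariance makes \<open>ad q\<close> skew for the form, so \<open>i + j\<close> times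
  the pairing of elements of degrees \<open>i\<close> and \<open>j\<close> is zero.\<close>

lemma form_\<Gamma>: "x \<in> \<Gamma> i \<Longrightarrow> y \<in> \<Gamma> j \<Longrightarrow> i + j \<noteq> 0 \<Longrightarrow> form x y = 0"
proof -
  assume "x \<in> \<Gamma> i" "y \<in> \<Gamma> j" and ne: "i + j \<noteq> 0"
  then have "form (br q x) y = of_int i * form x y" "form x (br q y) = of_int j * form x y"
    by (simp_all add: \<Gamma>_eigen form_scale)
  moreover have "form (br q x) y = - form x (br q y)"
    by (metis br_swap form_br form_minus(2))
  ultimately have "of_int i * form x y = - (of_int j * form x y)" by simp
  then have "(of_int i + of_int j) * form x y = 0" by (simp add: distrib_right)
  then show ?thesis using ne by (metis mult_eq_0_iff of_int_add of_int_eq_0_iff)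
qed

lemma form_cp: "form (cp i x) y = form x (cp (- i) y)"
proof -
  have *: "form (cp i x) (cp (- i) y) = form (cp i x) y" for i x y
  proof -
    have "form (cp i x) y = (\<Sum>j\<in>rng. form (cp i x) (cp j y))"
      by (subst cp_expand_rng[of y]) (simp add: form_sum)
    also have "\<dots> = (\<Sum>j\<in>rng. if j = - i then form (cp i x) (cp (- i) y) else 0)"
    proof (rule sum.cong[OF refl])
      fix j show "form (cp i x) (cp j y) = (if j = - i then form (cp i x) (cp (- i) y) else 0)"
        using form_\<Gamma>[OF cp_props(1) cp_props(1), of i j x y] by (cases "j = - i") auto
    qed
    also have "\<dots> = form (cp i x) (cp (- i) y)"
      by (auto simp: rng_def cp_outside form_zero)
    finally show ?thesis by simp
  qed
  show ?thesis using *[of i x y] *[of "- i" y x] by (simp add: form_sym)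
qed

text \<open>Exponentials of inhomogeneous elements are controlled only in their lowest order, so the
  argument runs on the descending filtration by degree at least \<open>j\<close>.\<close>

definition Fil :: "int \<Rightarrow> 'g set" where "Fil j = {x. \<forall>k<j. cp k x = 0}"

lemma subspace_Fil: "subspace (Fil j)"
  by (rule subspaceI) (auto simp: Fil_def cp_zero cp_add cp_scale)

lemma Fil_mono: "i \<le> j \<Longrightarrow> x \<in> Fil j \<Longrightarrow> x \<in> Fil i"
  by (auto simp: Fil_def)

lemma \<Gamma>_Fil: "x \<in> \<Gamma> j \<Longrightarrow> x \<in> Fil j"
  by (simp add: Fil_def cp_hom)

lemma Fil_all: "x \<in> Fil (- int N)"
  by (auto simp: Fil_def intro: cp_outside)

lemma Fil_trivial: "x \<in> Fil (int N + 1) \<Longrightarrow> x = 0"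
proof (rule cp_ext)
  fix k assume "x \<in> Fil (int N + 1)"
  then show "cp k x = cp k 0" by (cases "k < int N + 1") (auto simp: Fil_def cp_zero cp_outside)
qed

lemma Fil_br:
  assumes "x \<in> Fil i" "y \<in> Fil j"
  shows "br x y \<in> Fil (i + j)"
proof -
  have "br x y = (\<Sum>a\<in>rng. \<Sum>b\<in>rng. br (cp a x) (cp b y))"
    by (subst cp_expand_rng[of x], subst cp_expand_rng[of y]) (simp add: br_sum, rule sum.swap)
  moreover have "br (cp a x) (cp b y) \<in> Fil (i + j)" for a b
  proof (cases "a < i \<or> b < j")
    case True
    then show ?thesis using assms subspace_0[OF subspace_Fil] by (auto simp: Fil_def br_zero)
  next
    case False
    have "br (cp a x) (cp b y) \<in> Fil (a + b)" by (intro \<Gamma>_Fil \<Gamma>_br cp_props)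
    then show ?thesis by (rule Fil_mono[rotated]) (use False in linarith)
  qed
  ultimately show ?thesis by (auto intro!: subspace_sum[OF subspace_Fil])
qed

lemma Fil_form:
  assumes "x \<in> Fil i" "y \<in> Fil j" "i + j > 0"
  shows "form x y = 0"
proof -
  have "form x y = (\<Sum>a\<in>rng. form (cp a x) y)"
    by (subst cp_expand_rng[of x]) (simp add: form_sum)
  also have "\<dots> = 0"
  proof (intro sum.neutral ballI)
    fix a show "form (cp a x) y = 0"
    proof (cases "a < i")
      case True
      then show ?thesis using assms by (simp add: Fil_def form_zero)
    next
      case False
      then show ?thesis using assms by (simp add: form_cp Fil_def form_zero)
    qed
  qed
  finally show ?thesis .
qed

lemma Fil_funpow_br: "x \<in> Fil i \<Longrightarrow> y \<in> Fil j \<Longrightarrow> (br x ^^ k) y \<in> Fil (int k * i + j)"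
proof (induction k)
  case (Suc k)
  then have "br x ((br x ^^ k) y) \<in> Fil (i + (int k * i + j))" by (intro Fil_br) auto
  then show ?case by (simp add: algebra_simps)
qed simp

text \<open>Each application raises the order by at least one, and \<open>2 * N + 1\<close> of them
  lead from the lowest order \<open>- N\<close> past the highest, \<open>N\<close>. The exponent
  does not depend on \<open>x\<close>, which later makes exponentials polynomial in
  \<open>x\<close>.\<close>

lemma Fil_nilpotent: "x \<in> Fil 1 \<Longrightarrow> (br x ^^ (2 * N + 1)) y = 0"
proof -
  assume "x \<in> Fil 1"
  from Fil_funpow_br[OF this Fil_all, of "2 * N + 1" y]
  show ?thesis by (intro Fil_trivial) (simp add: algebra_simps)
qed

lemma Fil_nilpotent_element: "x \<in> Fil 1 \<Longrightarrow> nilpotent_element br x"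
  unfolding nilpotent_element_def using Fil_nilpotent by blast

end

text \<open>\<open>mp\<close> is the orthogonal complement of \<open>m\<close>; under the identification of the Lie algebra with
  its dual, \<open>f + mp\<close> is the zero fibre of the moment map and \<open>f + s\<close> the slice.\<close>

locale slice_data = lie_graded sc br form \<Gamma> q
  for sc :: "complex \<Rightarrow> 'g::ab_group_add \<Rightarrow> 'g" and br form \<Gamma> q +
  fixes f :: 'g and m s :: "'g set"
  assumes f_Fil: "f \<in> Fil (- 2)"
    and subspace_m: "subspace m" and m_Fil: "m \<subseteq> Fil 1"
    and m_br: "x \<in> m \<Longrightarrow> y \<in> m \<Longrightarrow> br x y \<in> m"
    and f_br: "x \<in> m \<Longrightarrow> y \<in> m \<Longrightarrow> form f (br x y) = 0"
    and subspace_s: "subspace s" and s_perp: "x \<in> s \<Longrightarrow> y \<in> m \<Longrightarrow> form x y = 0"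
    and perp_Fil: "(\<And>y. y \<in> m \<Longrightarrow> form x y = 0) \<Longrightarrow> x \<in> Fil (- 1)"
    and split: "(\<And>y. y \<in> m \<Longrightarrow> form w y = 0) \<Longrightarrow> w \<in> Fil j \<Longrightarrow> j \<ge> - 1 \<Longrightarrow>
      \<exists>u\<in>m. u \<in> Fil (j + 2) \<and> w - br u f \<in> s"
    and transversal: "u \<in> m \<Longrightarrow> br u f \<in> s \<Longrightarrow> u = 0"
begin

section \<open>Descent from the affine space \<open>f + mp\<close> to the slice\<close>

definition mp :: "'g set" where "mp = {x. \<forall>y\<in>m. form x y = 0}"

lemma subspace_mp: "subspace mp"
  by (rule subspaceI) (auto simp: mp_def form_zero form_add form_scale)

lemma br_f_mp: "u \<in> m \<Longrightarrow> br u f \<in> mp"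
proof -
  assume u: "u \<in> m"
  have "form (br u f) y = 0" if "y \<in> m" for y
    using f_br[OF u that] by (simp add: form_br_left form_minus br_minus)
  then show ?thesis by (simp add: mp_def)
qed

text \<open>Modulo \<open>s\<close>, bracketing with \<open>f\<close> is injective on
  \<open>m\<close> by transversality, hence has a linear left inverse. Linearity is the point: the
  correction for \<open>w\<close> is not chosen separately for each \<open>w\<close>, which keeps
  the descent polynomial.\<close>

lemma L_exists:
  "\<exists>L. Vector_Spaces.linear sc sc L \<and> range L \<subseteq> m \<and>
    (\<forall>u\<in>m. \<forall>w. w - br u f \<in> s \<longrightarrow> L w = u)"
proof -
  obtain p where p: "Vector_Spaces.linear sc sc p" "range p \<subseteq> s" "\<And>v. v \<in> s \<Longrightarrow> p v = v"
    using projection_exists[OF subspace_s] by blast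
  have p_lin: "p (x + y) = p x + p y" "p (sc c x) = sc c (p x)" for x y c
    using p(1) by (simp_all add: Vector_Spaces.linear_iff)
  have p_diff: "p (x - y) = p x - p y" for x y
    using p_lin(1)[of "x - y" y] by (simp add: algebra_simps)
  \<comment> \<open>The bracket with \<open>f\<close>, reduced modulo \<open>s\<close> by means of
    the projection \<open>p\<close>.\<close>
  define F where "F u = br u f - p (br u f)" for u
  have F: "Vector_Spaces.linear sc sc F"
    by (simp add: F_def Vector_Spaces.linear_iff vector_space_axioms br_add_left br_scale_left p_lin
        scale_right_diff_distrib algebra_simps)
  have "inj_on F m"
  proof (rule inj_onI)
    fix u v assume uv: "u \<in> m" "v \<in> m" "F u = F v"
    then have "br (u - v) f = p (br (u - v) f)" by (simp add: F_def br_diff p_diff algebra_simps)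
    then have "br (u - v) f \<in> s" using p(2) by (metis range_subsetD)
    then show "u = v" using transversal[OF subspace_diff[OF subspace_m uv(1,2)]] by simp
  qed
  interpret vp: vector_space_pair sc sc by (rule vs_pair)
  obtain G where G: "range G \<subseteq> m" "Vector_Spaces.linear sc sc G" "\<forall>v\<in>m. G (F v) = v"
    using vp.linear_exists_left_inverse_on[OF F subspace_m \<open>inj_on F m\<close>] by blast
  define L where "L w = G (w - p w)" for w
  have "Vector_Spaces.linear sc sc L"
  proof -
    have "L (x + y) = L x + L y" for x y
    proof -
      have e: "x + y - p (x + y) = (x - p x) + (y - p y)" by (simp add: p_lin)
      show ?thesis unfolding L_def e using G(2) by (simp only: Vector_Spaces.linear_iff)
    qed
    moreover have "L (sc c x) = sc c (L x)" for c x
    proof -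
      have e: "sc c x - p (sc c x) = sc c (x - p x)" by (simp add: p_lin scale_right_diff_distrib)
      show ?thesis unfolding L_def e using G(2) by (simp only: Vector_Spaces.linear_iff)
    qed
    ultimately show ?thesis by (simp add: Vector_Spaces.linear_iff vector_space_axioms)
  qed
  moreover have "L w = u" if "u \<in> m" "w - br u f \<in> s" for u w
  proof -
    have "w - p w = F u" using p(3)[OF that(2)] by (simp add: F_def p_diff algebra_simps)
    then show ?thesis using G(3) that(1) by (simp add: L_def)
  qed
  moreover have "range L \<subseteq> m" using G(1) by (auto simp: L_def)
  ultimately show ?thesis by blast
qed

definition L :: "'g \<Rightarrow> 'g" where
  "L = (SOME L. Vector_Spaces.linear sc sc L \<and> range L \<subseteq> m \<and>
    (\<forall>u\<in>m. \<forall>w. w - br u f \<in> s \<longrightarrow> L w = u))"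

lemma L: "Vector_Spaces.linear sc sc L" "L w \<in> m" "u \<in> m \<Longrightarrow> w - br u f \<in> s \<Longrightarrow> L w = u"
  using someI_ex[OF L_exists] unfolding L_def by blast+

text \<open>One map \<open>L\<close> serves all orders: the solution supplied by
  \<open>split\<close> for \<open>w - \<sigma>\<close> has order \<open>j + 2\<close>, subtracting
  an element of \<open>s\<close> does not affect the condition, and uniqueness identifies the
  solution with \<open>L w\<close>.\<close>

lemma L_split:
  assumes "w \<in> mp" "\<sigma> \<in> s" "w - \<sigma> \<in> Fil j" "j \<ge> - 1"
  shows "w - br (L w) f \<in> s" "L w \<in> Fil (j + 2)"
proof -
  have "w - \<sigma> \<in> mp" using assms(1,2) s_perp by (auto simp: mp_def form_diff)
  then obtain u where u: "u \<in> m" "u \<in> Fil (j + 2)" "w - \<sigma> - br u f \<in> s"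
    using split[of "w - \<sigma>" j] assms(3,4) by (auto simp: mp_def)
  have "w - br u f \<in> s" using subspace_add[OF subspace_s u(3) assms(2)] by (simp add: algebra_simps)
  moreover from L(3)[OF u(1) this] have "L w = u" .
  ultimately show "w - br (L w) f \<in> s" "L w \<in> Fil (j + 2)" using u by simp_all
qed

text \<open>Membership in \<open>f + mp\<close> persists because pairing with \<open>f\<close> kills
  brackets in \<open>m\<close>. As for the order, the linear term leaves the bracket of
  \<open>u\<close> with \<open>z - f\<close>, of order \<open>i - 1\<close>, and a term with
  \<open>k \<ge> 2\<close> brackets has order \<open>k * i - 2\<close>, which is no smaller since
  \<open>i \<ge> 1\<close>.\<close>

lemma ead_step:
  assumes u: "u \<in> m" "u \<in> Fil i" "i \<ge> 1" and z: "z - f \<in> mp"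
  shows "ead u z - f \<in> mp" "ead u z - z - br u f \<in> Fil (i - 1)"
proof -
  let ?K = "2 * N + 1"
  have u1: "u \<in> Fil 1" using u m_Fil by blast
  have zF: "z - f \<in> Fil (- 1)" using z perp_Fil by (simp add: mp_def)
  have z2: "z \<in> Fil (- 2)"
    using subspace_add[OF subspace_Fil Fil_mono[OF _ zF] f_Fil] by simp
  have mu: "- u \<in> m" using subspace_neg[OF subspace_m u(1)] .
  have "form (ead u z) y = form f y" if y: "y \<in> m" for y
  proof -
    have my: "(br (- u) ^^ k) y \<in> m" for k using mu y by (induction k) (auto intro: m_br)
    have zf: "form z x = form f x" if "x \<in> m" for x
      using z that by (simp add: mp_def form_diff)
    have vanish: "form f ((br (- u) ^^ Suc k) y) = 0" for k using f_br[OF mu my] by simp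
    have "form z (ead (- u) y) = (\<Sum>k<?K. 1 / fact k * form f ((br (- u) ^^ k) y))"
      using Fil_nilpotent[OF subspace_neg[OF subspace_Fil u1]]
      by (subst ead_eq[where x = "- u" and K = ?K]) (simp_all only: form_sum form_scale zf[OF my])
    also have "\<dots> = form f y"
      unfolding add.commute[of _ 1] plus_1_eq_Suc sum.lessThan_Suc_shift vanish by simp
    finally show ?thesis using form_ead[OF Fil_nilpotent_element[OF u1]] by simp
  qed
  then show "ead u z - f \<in> mp" by (simp add: mp_def form_diff)
  \<comment> \<open>Two terms more than the nilpotency bound, so that the terms of order zero and
    one in \<open>u\<close> can be split off.\<close>
  have e: "ead u z = (\<Sum>k<Suc (Suc ?K). sc (1 / fact k) ((br u ^^ k) z))"
    by (rule ead_eq) (simp add: Fil_nilpotent[OF u1, simplified] br_zero)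
  have "ead u z - z - br u f = br u (z - f) + (\<Sum>k<?K. sc (1 / fact (Suc (Suc k))) ((br u ^^ Suc (Suc k)) z))"
    unfolding e sum.lessThan_Suc_shift by (simp add: br_diff algebra_simps)
  moreover have "br u (z - f) \<in> Fil (i - 1)" using Fil_br[OF u(2) zF] by simp
  moreover have "(br u ^^ Suc (Suc k)) z \<in> Fil (i - 1)" for k
  proof (rule Fil_mono[OF _ Fil_funpow_br[OF u(2) z2, of "Suc (Suc k)"]])
    have "0 \<le> int k * i" using u(3) by simp
    moreover have "int (Suc (Suc k)) * i = int k * i + 2 * i" by (simp add: algebra_simps)
    ultimately show "i - 1 \<le> int (Suc (Suc k)) * i + - 2" using u(3) by linarith
  qed
  ultimately show "ead u z - z - br u f \<in> Fil (i - 1)"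
    by (auto intro!: subspace_add[OF subspace_Fil] subspace_sum[OF subspace_Fil] subspace_scale[OF subspace_Fil])
qed

text \<open>The new slice component is what remains of \<open>z - f\<close> after removing the
  bracket with \<open>f\<close>; it differs from \<open>z' - f\<close> exactly by the error of the
  step. Any \<open>z'\<close> with the right leading term is allowed, to serve both the fixed
  procedure \<open>T\<close> and the freer moves of \<open>reach_slice\<close>.\<close>

lemma slice_step:
  assumes z: "z - f \<in> mp" and \<sigma>: "\<sigma> \<in> s" "z - f - \<sigma> \<in> Fil j" "j \<ge> - 1"
    and z': "z' - z + br (L (z - f)) f \<in> Fil (j + 1)"
  shows "\<exists>\<sigma>'\<in>s. z' - f - \<sigma>' \<in> Fil (j + 1)"
  using L_split(1)[OF z \<sigma>] z'
  by (intro bexI[of _ "z - f - br (L (z - f)) f"]) (simp_all add: algebra_simps)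

text \<open>The step does not mention the order reached so far, since \<open>L\<close> finds it by
  itself. Hence one and the same map is iterated at every point.\<close>

definition T :: "'g \<Rightarrow> 'g" where "T z = ead (- L (z - f)) z"

text \<open>The order starts at \<open>- 1\<close>, where all of \<open>mp\<close> lies, and rises
  by one per step.\<close>

lemma T_iter:
  assumes "z - f \<in> mp"
  shows "(T ^^ n) z - f \<in> mp \<and> (\<exists>\<sigma>\<in>s. (T ^^ n) z - f - \<sigma> \<in> Fil (int n - 1))"
proof (induction n)
  case 0
  have "z - f \<in> Fil (- 1)" using assms perp_Fil by (simp add: mp_def)
  then show ?case using assms subspace_0[OF subspace_s] by (auto intro!: bexI[of _ 0])
next
  case (Suc n)
  let ?z = "(T ^^ n) z"
  obtain \<sigma> where \<sigma>: "\<sigma> \<in> s" "?z - f - \<sigma> \<in> Fil (int n - 1)" using Suc by blast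
  have L': "L (?z - f) \<in> Fil (int n + 1)" using L_split(2)[of "?z - f" \<sigma> "int n - 1"] Suc \<sigma> by (simp add: add.commute)
  have "- L (?z - f) \<in> m" "- L (?z - f) \<in> Fil (int n + 1)"
    using subspace_neg[OF subspace_m L(2)] subspace_neg[OF subspace_Fil L'] by auto
  from ead_step[OF this, of ?z] Suc
  have "T ?z - f \<in> mp" "T ?z - ?z + br (L (?z - f)) f \<in> Fil (int n)"
    by (simp_all add: T_def br_minus)
  then show ?case using slice_step[of ?z \<sigma> "int n - 1" "T ?z"] Suc \<sigma> by simp
qed

text \<open>After \<open>n\<close> steps the defect has order \<open>n - 1\<close>;
  \<open>N + 2\<close> steps bring it to order \<open>N + 1\<close>, where the filtration is
  zero.\<close>

definition toslice :: "'g \<Rightarrow> 'g" where "toslice = T ^^ (N + 2)"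

lemma toslice: "z - f \<in> mp \<Longrightarrow> toslice z - f \<in> s"
proof -
  assume "z - f \<in> mp"
  from T_iter[OF this, of "N + 2"] obtain \<sigma> where \<sigma>: "\<sigma> \<in> s" "toslice z - f - \<sigma> \<in> Fil (int (N + 2) - 1)"
    unfolding toslice_def by blast
  have "int (N + 2) - 1 = int N + 1" by simp
  from Fil_trivial[OF \<sigma>(2)[unfolded this]] \<sigma>(1) show ?thesis by simp
qed

text \<open>The same descent with the exponential replaced by any move inside \<open>Q\<close> that
  has the same leading term. In the two-stage argument the moves are products of two
  exponentials.\<close>

lemma reach_slice:
  assumes z: "z \<in> Q" "z - f \<in> mp"
    and step: "\<And>z u i. z \<in> Q \<Longrightarrow> z - f \<in> mp \<Longrightarrow> u \<in> m \<Longrightarrow> u \<in> Fil i \<Longrightarrow> i \<ge> 1 \<Longrightarrow>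
      \<exists>z'\<in>Q. z' - f \<in> mp \<and> z' - z - br u f \<in> Fil (i - 1)"
  shows "\<exists>z'\<in>Q. z' - f \<in> s"
proof -
  have "\<exists>z'\<in>Q. z' - f \<in> mp \<and> (\<exists>\<sigma>\<in>s. z' - f - \<sigma> \<in> Fil (int n - 1))" for n :: nat
  proof (induction n)
    case 0
    have "z - f \<in> Fil (- 1)" using z perp_Fil by (simp add: mp_def)
    then show ?case using z subspace_0[OF subspace_s] by (intro bexI[of _ z] conjI bexI[of _ 0]) auto
  next
    case (Suc n)
    then obtain z \<sigma> where z: "z \<in> Q" "z - f \<in> mp" and \<sigma>: "\<sigma> \<in> s" "z - f - \<sigma> \<in> Fil (int n - 1)" by blast
    have L': "L (z - f) \<in> Fil (int n + 1)" using L_split(2)[of "z - f" \<sigma> "int n - 1"] z \<sigma> by (simp add: add.commute)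
    have "- L (z - f) \<in> m" "- L (z - f) \<in> Fil (int n + 1)"
      using subspace_neg[OF subspace_m L(2)] subspace_neg[OF subspace_Fil L'] by auto
    from step[OF z this] obtain z' where z': "z' \<in> Q" "z' - f \<in> mp" "z' - z + br (L (z - f)) f \<in> Fil (int n)"
      by (auto simp: br_minus)
    then show ?case using slice_step[of z \<sigma> "int n - 1" z'] z \<sigma> by auto
  qed
  from this[of "N + 2"] obtain z' \<sigma> where z': "z' \<in> Q" "\<sigma> \<in> s" "z' - f - \<sigma> \<in> Fil (int (N + 2) - 1)" by blast
  have N2: "int (N + 2) - 1 = int N + 1" by simp
  have "z' - f - \<sigma> \<in> Fil (int N + 1)" using z'(3) unfolding N2 .
  from Fil_trivial[OF this] z' show ?thesis by auto
qed

text \<open>The order of \<open>u\<close> is pushed up indefinitely: the remainder of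
  \<open>ead u z\<close> beyond \<open>br u f\<close> is, modulo \<open>s\<close>, the bracket of
  some \<open>u'\<close> of higher order with \<open>f\<close>, and transversality then forces
  \<open>u = - u'\<close>.\<close>

lemma slice_unique:
  assumes z: "z - f \<in> s" "ead u z - f \<in> s" and u: "u \<in> m"
  shows "ead u z = z"
proof -
  have smp: "x \<in> mp" if "x \<in> s" for x using s_perp that by (simp add: mp_def)
  have "u \<in> Fil (int n + 1)" for n :: nat
  proof (induction n)
    case 0 then show ?case using u m_Fil by auto
  next
    case (Suc n)
    have d: "ead u z - z \<in> s" using subspace_diff[OF subspace_s z(2,1)] by simp
    let ?r = "ead u z - z - br u f"
    have "?r \<in> Fil (int n)" using ead_step(2)[OF u Suc _ smp[OF z(1)]] by simp
    moreover have "?r \<in> mp" using subspace_diff[OF subspace_mp smp[OF d] br_f_mp[OF u]] .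
    ultimately obtain u' where u': "u' \<in> m" "u' \<in> Fil (int n + 2)" "?r - br u' f \<in> s"
      using split[of ?r "int n"] by (auto simp: mp_def)
    have "br (u + u') f \<in> s"
      using subspace_diff[OF subspace_s d u'(3)] by (simp add: br_add_left algebra_simps)
    then have "u + u' = 0" using transversal subspace_add[OF subspace_m u u'(1)] by blast
    then have "u = - u'" by (simp add: eq_neg_iff_add_eq_0)
    then show ?case using subspace_neg[OF subspace_Fil u'(2)] by (simp add: algebra_simps)
  qed
  from Fil_trivial[OF this] show ?thesis by (simp add: ead_zero)
qed

end

section \<open>Slices for good algebras\<close>

locale good_data = lie_graded sc br form \<Gamma> q
  for sc :: "complex \<Rightarrow> 'g::ab_group_add \<Rightarrow> 'g" and br form \<Gamma> q +
  fixes f :: 'g and m :: "'g set"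
  assumes good: "good_grading sc br f \<Gamma>" and good_alg: "good_algebra sc br (form f) \<Gamma> m"
begin

lemma f_deg: "f \<in> \<Gamma> (- 2)"
  using good by (simp add: good_grading_def)

lemma f_inj: "j \<ge> 1 \<Longrightarrow> u \<in> \<Gamma> j \<Longrightarrow> br u f = 0 \<Longrightarrow> u = 0"
proof -
  assume j: "j \<ge> 1" "u \<in> \<Gamma> j" "br u f = 0"
  then have "br f u = br f 0" using br_swap[of f u] by (simp add: br_zero)
  moreover have "inj_on (br f) (\<Gamma> j)" using good j(1) by (simp add: good_grading_def)
  ultimately show "u = 0" using inj_onD[of "br f" "\<Gamma> j" u 0] j(2) \<Gamma>_zero by blast
qed

lemma f_surj: "j \<le> - 1 \<Longrightarrow> w \<in> \<Gamma> j \<Longrightarrow> \<exists>u\<in>\<Gamma> (j + 2). br f u = w"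
proof -
  assume j: "j \<le> - 1" "w \<in> \<Gamma> j"
  have "\<forall>j\<le>1. br f ` \<Gamma> j = \<Gamma> (j - 2)" using good by (simp add: good_grading_def)
  from this[rule_format, of "j + 2"] j have "w \<in> br f ` \<Gamma> (j + 2)" by simp
  then show ?thesis by blast
qed

text \<open>The span in the definition of a good algebra is traded for a condition on components:
  nothing below degree one, and a degree-one part in the Lagrangian subspace.\<close>

lemma l_exists: "\<exists>l. subspace l \<and> l \<subseteq> \<Gamma> 1 \<and> l = {x \<in> \<Gamma> 1. \<forall>y\<in>l. form f (br x y) = 0} \<and>
    m = {x \<in> Fil 1. cp 1 x \<in> l}"
proof -
  obtain l where l: "subspace l" "l \<subseteq> \<Gamma> 1" "l = {x \<in> \<Gamma> 1. \<forall>y\<in>l. form f (br x y) = 0}"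
    and m: "m = span (l \<union> (\<Union>i\<in>{2..}. \<Gamma> i))"
    using good_alg unfolding good_algebra_def by (elim exE conjE)
  have "m = {x \<in> Fil 1. cp 1 x \<in> l}"
  proof
    have "subspace {x \<in> Fil 1. cp 1 x \<in> l}"
      by (rule subspaceI) (simp_all add: cp_zero cp_add cp_scale subspace_0[OF l(1)] subspace_add[OF l(1)]
        subspace_scale[OF l(1)] subspace_0[OF subspace_Fil] subspace_add[OF subspace_Fil] subspace_scale[OF subspace_Fil])
    moreover have "x \<in> Fil 1 \<and> cp 1 x \<in> l" if gen: "x \<in> l \<union> (\<Union>i\<in>{2..}. \<Gamma> i)" for x
    proof (cases "x \<in> l")
      case True
      then have "x \<in> \<Gamma> 1" using l(2) by blast
      then show ?thesis using True by (simp add: cp_hom \<Gamma>_Fil)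
    next
      case False
      then obtain i where i: "i \<ge> 2" "x \<in> \<Gamma> i" using gen by auto
      then show ?thesis using Fil_mono[OF _ \<Gamma>_Fil[OF i(2)], of 1] subspace_0[OF l(1)] by (simp add: cp_hom)
    qed
    then have "l \<union> (\<Union>i\<in>{2..}. \<Gamma> i) \<subseteq> {x \<in> Fil 1. cp 1 x \<in> l}" by blast
    with calculation show "m \<subseteq> {x \<in> Fil 1. cp 1 x \<in> l}" unfolding m by (intro span_minimal)
    show "{x \<in> Fil 1. cp 1 x \<in> l} \<subseteq> m"
    proof
      fix x assume x: "x \<in> {x \<in> Fil 1. cp 1 x \<in> l}"
      have "cp k x \<in> m" for k
      proof -
        consider "k < 1" | "k = 1" | "k \<ge> 2" by linarith
        then show ?thesis
        proof cases
          case 1 then show ?thesis using x by (simp add: Fil_def m span_zero)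
        next
          case 2 then show ?thesis using x unfolding m by (auto intro: span_base)
        next
          case 3 then show ?thesis using cp_props(1)[of k x] unfolding m by (auto intro: span_base)
        qed
      qed
      then show "x \<in> m" unfolding m by (subst cp_expand_rng[of x]) (intro span_sum, auto)
    qed
  qed
  then show ?thesis by (intro exI[of _ l] conjI l)
qed

definition l :: "'g set" where
  "l = (SOME l. subspace l \<and> l \<subseteq> \<Gamma> 1 \<and> l = {x \<in> \<Gamma> 1. \<forall>y\<in>l. form f (br x y) = 0} \<and>
    m = {x \<in> Fil 1. cp 1 x \<in> l})"

lemma l: "subspace l" "l \<subseteq> \<Gamma> 1" "x \<in> m \<longleftrightarrow> x \<in> Fil 1 \<and> cp 1 x \<in> l"
    "x \<in> l \<longleftrightarrow> x \<in> \<Gamma> 1 \<and> (\<forall>y\<in>l. form f (br x y) = 0)"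
proof -
  note * = someI_ex[OF l_exists, folded l_def]
  show "subspace l" "l \<subseteq> \<Gamma> 1"
    by (rule *[THEN conjunct1], rule *[THEN conjunct2, THEN conjunct1])
  have "m = {x \<in> Fil 1. cp 1 x \<in> l}"
    by (rule *[THEN conjunct2, THEN conjunct2, THEN conjunct2])
  from arg_cong[OF this, of "\<lambda>A. x \<in> A"]
  show "x \<in> m \<longleftrightarrow> x \<in> Fil 1 \<and> cp 1 x \<in> l" by (simp only: mem_Collect_eq)
  have "l = {x \<in> \<Gamma> 1. \<forall>y\<in>l. form f (br x y) = 0}"
    by (rule *[THEN conjunct2, THEN conjunct2, THEN conjunct1])
  from arg_cong[OF this, of "\<lambda>A. x \<in> A"]
  show "x \<in> l \<longleftrightarrow> x \<in> \<Gamma> 1 \<and> (\<forall>y\<in>l. form f (br x y) = 0)" by (simp only: mem_Collect_eq)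
qed

lemma l_m: "l \<subseteq> m"
proof
  fix x assume x: "x \<in> l"
  then have "x \<in> \<Gamma> 1" using l(2) by blast
  then show "x \<in> m" using x unfolding l(3) by (simp add: cp_hom \<Gamma>_Fil)
qed

lemma Fil2_m: "x \<in> Fil 2 \<Longrightarrow> x \<in> m"
proof -
  assume "x \<in> Fil 2"
  then have "x \<in> Fil 1" "cp 1 x = 0" by (auto simp: Fil_def)
  then show "x \<in> m" using subspace_0[OF l(1)] by (simp add: l(3))
qed

lemma subspace_m': "subspace m"
  using good_alg unfolding good_algebra_def by auto

text \<open>Brackets within \<open>m\<close> start in degree two, where \<open>m\<close> is
  everything. The character sees only their component of degree two, a bracket of two elements of
  \<open>l\<close>, and \<open>l\<close> is isotropic.\<close>

lemma m_props:
  assumes "x \<in> m" "y \<in> m"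
  shows "br x y \<in> m" "form f (br x y) = 0"
proof -
  have xy: "x \<in> Fil 1" "y \<in> Fil 1" "cp 1 x \<in> l" "cp 1 y \<in> l" using assms by (auto simp: l(3))
  show "br x y \<in> m" using Fil_br[OF xy(1,2)] by (intro Fil2_m) simp
  have r: "x - cp 1 x \<in> Fil 2" if "x \<in> Fil 1" for x
    using that cp_hom[OF cp_props(1), of _ 1 x] by (auto simp: Fil_def cp_diff)
  have fF: "f \<in> Fil (- 2)" using f_deg by (rule \<Gamma>_Fil)
  have *: "form f (br u v) = 0" if "u \<in> Fil i" "v \<in> Fil j" "i + j > 2" for u v i j
    using Fil_form[OF fF Fil_br[OF that(1,2)]] that(3) by simp
  have "form f (br x y) = form f (br (cp 1 x) (cp 1 y)) + form f (br (cp 1 x) (y - cp 1 y)) + form f (br (x - cp 1 x) y)"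
    by (simp add: br_diff form_diff)
  also have "form f (br (cp 1 x) (y - cp 1 y)) = 0"
    by (rule *[OF \<Gamma>_Fil[OF cp_props(1)] r[OF xy(2)]]) simp
  also have "form f (br (x - cp 1 x) y) = 0"
    by (rule *[OF r[OF xy(1)] xy(2)]) simp
  also have "form f (br (cp 1 x) (cp 1 y)) = 0" using xy(3,4) l(4)[of "cp 1 x"] by blast
  finally show "form f (br x y) = 0" by simp
qed

text \<open>Negative degrees take care of themselves: \<open>mp\<close> starts in degree
  \<open>- 1\<close>, and its component there is already the bracket of an element of
  \<open>l\<close> with \<open>f\<close>. So a slice has to be supplied in degrees
  \<open>k \<ge> 0\<close> only.\<close>

lemma slice_dataI:
  assumes s: "subspace s" "s \<subseteq> Fil 0"
    and split: "\<And>k w. k \<ge> 0 \<Longrightarrow> w \<in> \<Gamma> k \<Longrightarrow> \<exists>u\<in>\<Gamma> (k + 2). w - br u f \<in> s"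
    and transversal: "\<And>u. u \<in> m \<Longrightarrow> br u f \<in> s \<Longrightarrow> u = 0"
  shows "slice_data sc br form \<Gamma> q f m s"
proof unfold_locales
  show "f \<in> Fil (- 2)" using f_deg by (rule \<Gamma>_Fil)
  show "subspace m" by (rule subspace_m')
  show "m \<subseteq> Fil 1" using l(3) by blast
  show "br x y \<in> m" "form f (br x y) = 0" if "x \<in> m" "y \<in> m" for x y using m_props that by auto
  show "form x y = 0" if "x \<in> s" "y \<in> m" for x y
    using that s(2) Fil_form[of x 0 y 1] by (auto simp: l(3))
  show perp: "x \<in> Fil (- 1)" if "\<And>y. y \<in> m \<Longrightarrow> form x y = 0" for x
    unfolding Fil_def
  proof (intro CollectI allI impI)
    fix k :: int assume k: "k < - 1"
    show "cp k x = 0"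
    proof (rule form_nondeg)
      fix y
      have "cp (- k) y \<in> Fil 2" using k Fil_mono[OF _ \<Gamma>_Fil[OF cp_props(1)], of 2 "- k" y] by simp
      then show "form (cp k x) y = 0" unfolding form_cp by (intro that Fil2_m)
    qed
  qed
  show "\<exists>u\<in>m. u \<in> Fil (j + 2) \<and> w - br u f \<in> s"
    if w: "\<And>y. y \<in> m \<Longrightarrow> form w y = 0" "w \<in> Fil j" "j \<ge> - 1" for w j
  proof -
    have "\<exists>u. u \<in> \<Gamma> (k + 2) \<and> u \<in> m \<and> u \<in> Fil (j + 2) \<and> cp k w - br u f \<in> s" for k
    proof (cases "k < j")
      case True
      then have "cp k w = 0" using w(2) by (simp add: Fil_def)
      then show ?thesis using subspace_0[OF s(1)] subspace_0[OF subspace_m'] subspace_0[OF subspace_Fil]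
        by (intro exI[of _ 0]) (simp add: br_zero \<Gamma>_zero)
    next
      case False
      have F: "u \<in> Fil (j + 2)" if "u \<in> \<Gamma> (k + 2)" for u
        using Fil_mono[OF _ \<Gamma>_Fil[OF that], of "j + 2"] False by simp
      show ?thesis
      proof (cases "k \<ge> 0")
        case True
        then obtain u where u: "u \<in> \<Gamma> (k + 2)" "cp k w - br u f \<in> s" using split[OF True cp_props(1)] by blast
        moreover have "u \<in> m" using True Fil_mono[OF _ \<Gamma>_Fil[OF u(1)], of 2] by (intro Fil2_m) simp
        ultimately show ?thesis using F by blast
      next
        \<comment> \<open>In degree \<open>- 1\<close> surjectivity gives some \<open>u\<close> of
          degree one. Orthogonality of \<open>w\<close> to \<open>l\<close> makes \<open>u\<close>
          orthogonal to \<open>l\<close> for the symplectic form, and \<open>l\<close>, being its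
          own orthogonal space, contains \<open>u\<close>.\<close>
        case neg: False
        then have k: "k = - 1" using False w(3) by simp
        obtain u where u: "u \<in> \<Gamma> 1" "br f u = cp k w"
          using f_surj[of k "cp k w"] k cp_props(1) by auto
        have e: "br (- u) f = cp k w" using u(2) br_swap[of f u] by (simp add: br_minus)
        have mu: "- u \<in> \<Gamma> 1" using subspace_neg[OF subspace_\<Gamma> u(1)] .
        have "form f (br (- u) y) = 0" if y: "y \<in> l" for y
        proof -
          have "form f (br (- u) y) = - form (cp k w) y"
            by (simp add: br_minus form_minus u(2)[symmetric] form_br)
          also have "form (cp k w) y = form w y"
            using y l(2) unfolding form_cp k by (auto simp: cp_hom)
          also have "form w y = 0" using y l_m w(1) by blast
          finally show ?thesis by simp
        qed
        then have "- u \<in> l" using mu l(4)[of "- u"] by blast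
        then show ?thesis
          using mu F l_m subspace_0[OF s(1)] by (intro exI[of _ "- u"]) (auto simp: e k)
      qed
    qed
    then obtain u where u: "\<And>k. u k \<in> m" "\<And>k. u k \<in> Fil (j + 2)" "\<And>k. cp k w - br (u k) f \<in> s"
      by metis
    have "w - br (\<Sum>k\<in>rng. u k) f = (\<Sum>k\<in>rng. cp k w - br (u k) f)"
      unfolding sum_subtractf br_sum using cp_expand_rng[of w] by simp
    also have "\<dots> \<in> s" using u(3) by (intro subspace_sum[OF s(1)]) auto
    finally show ?thesis
      using u by (intro bexI[of _ "\<Sum>k\<in>rng. u k"] conjI)
        (auto intro: subspace_sum[OF subspace_Fil] subspace_sum[OF subspace_m'])
  qed
qed (rule s(1), rule transversal, assumption+)

lemma br_f_injective: "u \<in> m \<Longrightarrow> (\<And>k. k \<ge> - 1 \<Longrightarrow> cp k (br u f) = 0) \<Longrightarrow> u = 0"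
proof (rule cp_ext)
  fix k assume u: "u \<in> m" and z: "\<And>k. k \<ge> - 1 \<Longrightarrow> cp k (br u f) = 0"
  show "cp k u = cp k 0"
  proof (cases "k < 1")
    case True then show ?thesis using u by (simp add: l(3) Fil_def cp_zero)
  next
    case False
    then have "br (cp k u) f = 0" using z[of "k - 2"] cp_br(1)[OF f_deg, of "k - 2" u] by simp
    then show ?thesis using f_inj[OF _ cp_props(1), of k u] False by (simp add: cp_zero)
  qed
qed

text \<open>In degree \<open>k \<ge> 0\<close> the complement is the kernel of a projection onto the
  brackets of degree \<open>k + 2\<close> with \<open>f\<close>. It takes the place of a Slodowy
  slice in the first stage, for which no sl2-triple is given.\<close>

lemma slice_exists: "\<exists>s. slice_data sc br form \<Gamma> q f m s"
proof -
  define U where "U k = (\<lambda>u. br u f) ` \<Gamma> (k + 2)" for k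
  have "subspace (U k)" for k
  proof (rule subspaceI)
    show "0 \<in> U k" unfolding U_def by (rule image_eqI[of _ _ 0]) (auto simp: br_zero \<Gamma>_zero)
    show "x + y \<in> U k" if "x \<in> U k" "y \<in> U k" for x y
      using that subspace_add[OF subspace_\<Gamma>] by (auto simp: U_def br_add_left[symmetric])
    show "sc c x \<in> U k" if "x \<in> U k" for x c
      using that subspace_scale[OF subspace_\<Gamma>] by (auto simp: U_def br_scale_left[symmetric])
  qed
  then have "\<exists>p. Vector_Spaces.linear sc sc p \<and> range p \<subseteq> U k \<and> (\<forall>v\<in>U k. p v = v)" for k
    using projection_exists[of "U k"] by metis
  then obtain p where p: "\<And>k. Vector_Spaces.linear sc sc (p k)" "\<And>k. range (p k) \<subseteq> U k"
    "\<And>k v. v \<in> U k \<Longrightarrow> p k v = v" by metis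
  have p_lin: "p k (x + y) = p k x + p k y" "p k (sc c x) = sc c (p k x)" for k x y c
    using p(1)[of k] by (simp_all add: Vector_Spaces.linear_iff)
  have p_zero: "p k 0 = 0" for k using p_lin(2)[of k 0 0] by simp
  have p_diff: "p k (x - y) = p k x - p k y" for k x y
    using p_lin(1)[of k "x - y" y] by (simp add: algebra_simps)
  define s where "s = {x \<in> Fil 0. \<forall>k\<ge>0. p k (cp k x) = 0}"
  have "slice_data sc br form \<Gamma> q f m s"
  proof (rule slice_dataI)
    show "subspace s"
      by (rule subspaceI) (simp_all add: s_def cp_zero cp_add cp_scale p_lin p_zero
        subspace_0[OF subspace_Fil] subspace_add[OF subspace_Fil] subspace_scale[OF subspace_Fil])
    show "s \<subseteq> Fil 0" by (auto simp: s_def)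
    fix k :: int and w assume k: "k \<ge> 0" and w: "w \<in> \<Gamma> k"
    have "p k w \<in> U k" using p(2) by (metis range_subsetD)
    then obtain u where u: "u \<in> \<Gamma> (k + 2)" "p k w = br u f" by (auto simp: U_def)
    have hom: "br u f \<in> \<Gamma> k" using \<Gamma>_br[OF u(1) f_deg] by simp
    have mem: "w - br u f \<in> \<Gamma> k" using subspace_diff[OF subspace_\<Gamma> w hom] .
    have "p k (w - br u f) = 0" using u p(3)[OF \<open>p k w \<in> U k\<close>] by (simp add: p_diff)
    then have "w - br u f \<in> s"
      using Fil_mono[OF k \<Gamma>_Fil[OF mem]] by (auto simp: s_def cp_hom[OF mem] p_zero)
    then show "\<exists>u\<in>\<Gamma> (k + 2). w - br u f \<in> s" using u(1) by blast
  next
    fix u assume u: "u \<in> m" "br u f \<in> s"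
    show "u = 0"
    proof (rule br_f_injective[OF u(1)])
      fix k :: int
      have e: "cp k (br u f) = br (cp (k + 2) u) f" using cp_br(1)[OF f_deg, of k u] by simp
      show "cp k (br u f) = 0"
      proof (cases "k \<ge> 0")
        case True
        have "cp k (br u f) \<in> U k" unfolding e U_def using cp_props(1) by blast
        then show ?thesis using p(3)[of "cp k (br u f)" k] u(2) True by (simp add: s_def)
      next
        case False
        then show ?thesis using u(2) by (simp add: s_def Fil_def)
      qed
    qed
  qed
  then show ?thesis ..
qed

end

subsection \<open>The Slodowy slice\<close>

context lie_form
begin

text \<open>The weight and raising formulas for the string below a highest weight vector
  \<open>u\<close>, whose weight \<kappa> is an arbitrary complex number at this point.\<close>

lemma sl2_lowering:
  assumes h: "br h f = sc (- 2) f" and ef: "br e f = h"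
    and u: "br e u = 0" "br h u = sc \<kappa> u"
  shows "br h ((br f ^^ n) u) = sc (\<kappa> - 2 * of_nat n) ((br f ^^ n) u)"
    and "br e ((br f ^^ Suc n) u) = sc (of_nat (Suc n) * (\<kappa> - of_nat n)) ((br f ^^ n) u)"
proof -
  have jac: "br x (br y z) = br (br x y) z + br y (br x z)" for x y z
    using jacobi[of x y z] by (simp add: br_swap[of z "br x y"] br_swap[of z x] br_minus algebra_simps)
  show 1: "br h ((br f ^^ n) u) = sc (\<kappa> - 2 * of_nat n) ((br f ^^ n) u)" for n
  proof (induction n)
    case 0 show ?case by (simp add: u(2))
  next
    case (Suc n)
    have "br h ((br f ^^ Suc n) u) = sc (- 2) ((br f ^^ Suc n) u) + sc (\<kappa> - 2 * of_nat n) ((br f ^^ Suc n) u)"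
      by (simp only: funpow.simps comp_apply jac[of h f] h Suc br_scale_left br_scale_right)
    also have "\<dots> = sc (\<kappa> - 2 * of_nat (Suc n)) ((br f ^^ Suc n) u)"
      unfolding scale_left_distrib[symmetric] by (rule arg_cong[of _ _ "\<lambda>c. sc c _"]) (simp add: algebra_simps)
    finally show ?case .
  qed
  show "br e ((br f ^^ Suc n) u) = sc (of_nat (Suc n) * (\<kappa> - of_nat n)) ((br f ^^ n) u)"
  proof (induction n)
    case 0 show ?case by (simp add: jac[of e f] ef u br_zero)
  next
    case (Suc n)
    have "br e ((br f ^^ Suc (Suc n)) u) = br h ((br f ^^ Suc n) u) + br f (br e ((br f ^^ Suc n) u))"
      by (simp add: jac[of e f] ef)
    also have "\<dots> = sc (\<kappa> - 2 * of_nat (Suc n)) ((br f ^^ Suc n) u) + sc (of_nat (Suc n) * (\<kappa> - of_nat n)) ((br f ^^ Suc n) u)"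
      unfolding 1 Suc by (simp add: br_scale_right)
    also have "\<dots> = sc (of_nat (Suc (Suc n)) * (\<kappa> - of_nat (Suc n))) ((br f ^^ Suc n) u)"
      unfolding scale_left_distrib[symmetric] by (rule arg_cong[of _ _ "\<lambda>c. sc c _"]) (simp add: algebra_simps)
    finally show ?case .
  qed
qed

text \<open>If \<open>u = e\<^sup>k w\<close> is the top of the \<open>e\<close>-string of \<open>w\<close>, then \<open>u\<close> has weight \<open>k\<close>, and subtracting a
  multiple of \<open>f\<^sup>k u\<close>, which \<open>f\<close> kills, shortens the string without changing \<open>[f, w]\<close>.\<close>

lemma sl2_ker_im:
  assumes he: "br h e = sc 2 e" and hf: "br h f = sc (- 2) f" and ef: "br e f = h"
    and nil: "nilpotent_element br e" "nilpotent_element br f"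
    and v: "br e (br f w) = 0"
  shows "br f w = 0"
proof -
  have jac: "br x (br y z) = br (br x y) z + br y (br x z)" for x y z
    using jacobi[of x y z] by (simp add: br_swap[of z "br x y"] br_swap[of z x] br_minus algebra_simps)
  have hek: "br h ((br e ^^ k) w) = (br e ^^ k) (br h w) + sc (2 * of_nat k) ((br e ^^ k) w)" for k w
    by (induction k) (simp_all add: jac[of h e] he br_scale_left br_scale_right br_add_right
        scale_left_distrib algebra_simps)
  have two: "sc 2 x = x + x" for x
    using scale_left_distrib[of 1 1 x] by simp
  have ekf: "(br e ^^ Suc n) (br f w) = br f ((br e ^^ Suc n) w)
      + sc (of_nat (Suc n)) ((br e ^^ n) (br h w) + sc (of_nat n) ((br e ^^ n) w))" for n w
  proof (induction n)
    case 0 show ?case by (simp add: jac[of e f] ef algebra_simps)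
  next
    case (Suc n)
    have "(br e ^^ Suc (Suc n)) (br f w) = br e ((br e ^^ Suc n) (br f w))" by simp
    also have "\<dots> = br h ((br e ^^ Suc n) w) + br f ((br e ^^ Suc (Suc n)) w)
      + sc (of_nat (Suc n)) ((br e ^^ Suc n) (br h w) + sc (of_nat n) ((br e ^^ Suc n) w))"
      unfolding Suc by (simp add: br_add_right br_scale_right jac[of e f] ef)
    also have "\<dots> = br f ((br e ^^ Suc (Suc n)) w)
      + sc (of_nat (Suc (Suc n))) ((br e ^^ Suc n) (br h w) + sc (of_nat (Suc n)) ((br e ^^ Suc n) w))"
      unfolding hek by (simp add: scale_left_distrib scale_right_distrib algebra_simps two del: funpow.simps)
    finally show ?case .
  qed
  \<comment> \<open>Otherwise the factor \<open>\<kappa> - of_nat n\<close> in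
    \<open>sl2_lowering\<close> never vanishes, so no power of \<open>ad f\<close> would kill
    \<open>u\<close>, against nilpotency.\<close>
  have weight: "u = 0 \<or> (\<exists>n. \<kappa> = of_nat n)" if u: "br e u = 0" "br h u = sc \<kappa> u" for u \<kappa>
  proof (rule ccontr)
    assume neg: "\<not> (u = 0 \<or> (\<exists>n. \<kappa> = of_nat n))"
    have "(br f ^^ n) u \<noteq> 0" for n
    proof (induction n)
      case 0 show ?case using neg by simp
    next
      case (Suc n)
      have "sc (of_nat (Suc n) * (\<kappa> - of_nat n)) ((br f ^^ n) u) \<noteq> 0"
        using Suc neg by (simp del: of_nat_Suc)
      then show ?case using sl2_lowering(2)[OF hf ef u, of n] by (auto simp: br_zero simp del: funpow.simps)
    qed
    moreover obtain K where "\<forall>x. (br f ^^ K) x = 0" using nil(2) unfolding nilpotent_element_def ..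
    ultimately show False by blast
  qed
  have "br f w = 0" if "(br e ^^ k) w = 0" "br e (br f w) = 0" for k w
    using that
  proof (induction k arbitrary: w)
    case 0 then show ?case by (simp add: br_zero)
  next
    case (Suc k)
    define u where "u = (br e ^^ k) w"
    have eu: "br e u = 0" using Suc.prems(1) by (simp add: u_def)
    have ez: "(br e ^^ j) 0 = 0" for j by (rule funpow_br_linear)
    have "(br e ^^ Suc k) (br f w) = 0" using Suc.prems(2) ez by (simp add: funpow_swap1)
    then have "sc (of_nat (Suc k)) ((br e ^^ k) (br h w) + sc (of_nat k) u) = 0"
      using ekf[of k w] Suc.prems(1) by (simp add: br_zero u_def del: funpow.simps of_nat_Suc)
    then have "(br e ^^ k) (br h w) + sc (of_nat k) u = 0" by (simp del: of_nat_Suc add: of_nat_neq_0)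
    then have "(br e ^^ k) (br h w) = - sc (of_nat k) u" by (simp add: eq_neg_iff_add_eq_0)
    then have "br h u = sc (2 * of_nat k) u - sc (of_nat k) u" using hek[of k w] by (simp add: u_def)
    then have hu: "br h u = sc (of_nat k) u" by (simp add: scale_left_diff_distrib[symmetric])
    have "br f ((br f ^^ k) u) = 0"
    proof -
      \<comment> \<open>This vector is killed by \<open>e\<close> and has weight
        \<open>- k - 2\<close>, which is not a natural number, so it must vanish.\<close>
      let ?v = "(br f ^^ Suc k) u"
      have "br e ?v = 0" using sl2_lowering(2)[OF hf ef eu hu, of k] by simp
      moreover have "br h ?v = sc (of_nat k - 2 * of_nat (Suc k)) ?v"
        by (rule sl2_lowering(1)[OF hf ef eu hu])
      ultimately have "?v = 0 \<or> (\<exists>n. of_nat k - 2 * of_nat (Suc k) = (of_nat n :: complex))" by (rule weight)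
      moreover have "of_nat k - 2 * of_nat (Suc k) \<noteq> (of_nat n :: complex)" for n
      proof
        assume "of_nat k - 2 * of_nat (Suc k) = (of_nat n :: complex)"
        then have "of_nat k = (of_nat n + 2 * of_nat (Suc k) :: complex)" by (simp only: diff_eq_eq)
        then have "of_nat k = (of_nat (n + 2 * Suc k) :: complex)" by (simp add: algebra_simps)
        then have "k = n + 2 * Suc k" by (simp only: of_nat_eq_iff)
        then show False by simp
      qed
      ultimately show ?thesis by simp
    qed
    \<comment> \<open>The constants are products of factors \<open>(i + 1) * (k - i)\<close> with
      \<open>i < n\<close>, hence nonzero; the case \<open>n = k\<close> supplies the coefficient of
      the correction in \<open>w'\<close>.\<close>
    have "\<exists>c. c \<noteq> 0 \<and> (br e ^^ n) ((br f ^^ n) u) = sc c u" if "n \<le> k" for n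
      using that
    proof (induction n)
      case 0 show ?case by (rule exI[of _ 1]) simp
    next
      case (Suc n)
      then obtain c where c: "c \<noteq> 0" "(br e ^^ n) ((br f ^^ n) u) = sc c u" by auto
      let ?c = "of_nat (Suc n) * (of_nat k - of_nat n) :: complex"
      have "(br e ^^ Suc n) ((br f ^^ Suc n) u) = (br e ^^ n) (br e ((br f ^^ Suc n) u))"
        by (simp only: funpow_Suc_right comp_apply)
      also have "\<dots> = (br e ^^ n) (sc ?c ((br f ^^ n) u))" unfolding sl2_lowering(2)[OF hf ef eu hu] ..
      also have "\<dots> = sc (?c * c) u" by (simp add: funpow_br_linear c(2))
      finally show ?case using c(1) Suc.prems by (intro exI[of _ "?c * c"]) (simp del: of_nat_Suc)
    qed
    then obtain c where c: "c \<noteq> 0" "(br e ^^ k) ((br f ^^ k) u) = sc c u" by blast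
    define w' where "w' = w + sc (- 1 / c) ((br f ^^ k) u)"
    have "(br e ^^ k) w' = 0"
      unfolding w'_def funpow_br_linear c(2) u_def[symmetric] using c(1) by simp
    moreover have fw: "br f w' = br f w"
      using \<open>br f ((br f ^^ k) u) = 0\<close> by (simp add: w'_def br_diff br_scale_right)
    ultimately show ?case using Suc.IH[of w'] Suc.prems(2) by simp
  qed
  moreover obtain K where "\<forall>x. (br e ^^ K) x = 0" using nil(1) unfolding nilpotent_element_def ..
  ultimately show ?thesis using v by blast
qed

text \<open>By \<open>sl2_ker_im\<close> and its mirror image, each of \<open>ad e\<close> and
  \<open>ad f\<close> is injective on the image of the other. The images then have equal dimension,
  so \<open>ad e\<close> maps the image of \<open>ad f\<close> onto its own image.\<close>

lemma sl2_decompose: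
  assumes he: "br h e = sc 2 e" and hf: "br h f = sc (- 2) f" and ef: "br e f = h"
    and nil: "nilpotent_element br e" "nilpotent_element br f"
  shows "\<exists>v. br e (w - br f v) = 0"
proof -
  interpret vp: finite_dimensional_vector_space_pair_1 sc Bs sc by unfold_locales
  have R: "subspace (range (br x))" for x
    by (rule vp.linear_subspace_image[OF linear_br subspace_UNIV])
  have inj: "inj_on (br e) (range (br f))"
  proof (rule inj_onI)
    fix x y assume "x \<in> range (br f)" "y \<in> range (br f)" and eq: "br e x = br e y"
    then obtain a b where "x = br f a" "y = br f b" by blast
    then have v: "x - y = br f (a - b)" by (simp add: br_diff)
    have "br e (br f (a - b)) = br e x - br e y" by (subst v[symmetric]) (rule br_diff(2))
    also have "\<dots> = 0" unfolding eq by (rule diff_self)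
    finally have "br e (br f (a - b)) = 0" .
    then have "br f (a - b) = 0" by (rule sl2_ker_im[OF he hf ef nil])
    then show "x = y" using v by simp
  qed
  have inj': "inj_on (br f) (range (br e))"
  proof (rule inj_onI)
    fix x y assume "x \<in> range (br e)" "y \<in> range (br e)" and eq: "br f x = br f y"
    then obtain a b where "x = br e a" "y = br e b" by blast
    then have v: "x - y = br e (a - b)" by (simp add: br_diff)
    have "br f (br e (a - b)) = br f x - br f y" by (subst v[symmetric]) (rule br_diff(2))
    also have "\<dots> = 0" unfolding eq by (rule diff_self)
    finally have z: "br f (br e (a - b)) = 0" .
    \<comment> \<open>The triple \<open>f\<close>, \<open>- h\<close>, \<open>e\<close>, which
      exchanges the roles of raising and lowering.\<close>
    have h': "br (- h) f = sc 2 f" "br (- h) e = sc (- 2) e" "br f e = - h"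
      using he hf ef br_swap[of f e] by (simp_all add: br_minus)
    have "br e (a - b) = 0" by (rule sl2_ker_im[OF h' nil(2,1) z])
    then show "x = y" using v by simp
  qed
  have d: "dim (br x ` range (br y)) = dim (range (br y))" if "inj_on (br x) (range (br y))" for x y
    using vp.dim_image_eq[OF linear_br, of x "range (br y)"] that span_eq_iff[THEN iffD2, OF R[of y]] by simp
  have "br e ` range (br f) = range (br e)"
  proof (rule fd.subspace_dim_equal)
    show "subspace (br e ` range (br f))" by (rule vp.linear_subspace_image[OF linear_br R])
    show "subspace (range (br e))" by (rule R)
    show "br e ` range (br f) \<subseteq> range (br e)" by blast
    have "dim (range (br e)) = dim (br f ` range (br e))" using d[OF inj'] by simp
    also have "\<dots> \<le> dim (range (br f))" by (intro fd.dim_subset) blast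
    also have "\<dots> = dim (br e ` range (br f))" using d[OF inj] by simp
    finally show "dim (range (br e)) \<le> dim (br e ` range (br f))" .
  qed
  then have "br e w \<in> br e ` range (br f)" by simp
  then obtain v where "br e w = br e (br f v)" by (elim imageE) simp
  then show ?thesis by (intro exI[of _ v]) (simp add: br_diff)
qed

end

text \<open>The centralizer of \<open>e\<close> lies in non-negative degrees because a component of
  negative degree is in the image of \<open>ad f\<close>, where \<open>ad e\<close> is injective.
  The same injectivity gives transversality, and \<open>sl2_decompose\<close>, cut down to one
  degree, gives the splitting.\<close>

lemma (in good_data) slodowy_slice_data:
  assumes triple: "graded_sl2_triple sc br \<Gamma> e h f" and nil: "nilpotent_element br f"
  shows "slice_data sc br form \<Gamma> q f m {x. br e x = 0}"
proof -
  have he: "br h e = sc 2 e" "br h f = sc (- 2) f" "br e f = h" and e2: "e \<in> \<Gamma> 2"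
    using triple by (simp_all add: graded_sl2_triple_def)
  have nile: "nilpotent_element br e"
    using Fil_mono[OF _ \<Gamma>_Fil[OF e2], of 1] by (intro Fil_nilpotent_element) simp
  have ker_im: "br f w = 0" if "br e (br f w) = 0" for w by (rule sl2_ker_im[OF he nile nil that])
  have cp_e: "br e (cp k x) = cp (k + 2) (br e x)" for k x using cp_br(2)[OF e2, of "k + 2" x] by simp
  show ?thesis
  proof (rule slice_dataI)
    show "subspace {x. br e x = 0}"
      by (auto intro!: subspaceI simp: br_zero br_add_right br_scale_right)
    show "{x. br e x = 0} \<subseteq> Fil 0"
    proof (intro subsetI)
      fix x assume x: "x \<in> {x. br e x = 0}"
      have "cp k x = 0" if neg: "k < 0" for k
      proof -
        have "k \<le> - 1" using neg by simp
        from f_surj[OF this cp_props(1)] obtain u where "br f u = cp k x" ..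
        moreover have "br e (cp k x) = 0" using x by (simp add: cp_e cp_zero)
        ultimately show ?thesis using ker_im[of u] by simp
      qed
      then show "x \<in> Fil 0" by (simp add: Fil_def)
    qed
    fix k :: int and w assume w: "w \<in> \<Gamma> k"
    from sl2_decompose[OF he nile nil, of w] obtain v where v: "br e (w - br f v) = 0" ..
    have "br f (cp (k + 2) v) = cp k (br f v)" using cp_br(2)[OF f_deg, of k v] by simp
    then have "w - br (- cp (k + 2) v) f = cp k (w - br f v)"
      using w by (simp add: cp_diff cp_hom br_minus br_swap[of "cp (k + 2) v" f])
    moreover have "br e (cp k (w - br f v)) = 0" unfolding cp_e v by (rule cp_zero)
    ultimately have "w - br (- cp (k + 2) v) f \<in> {x. br e x = 0}" by simp
    then show "\<exists>u\<in>\<Gamma> (k + 2). w - br u f \<in> {x. br e x = 0}"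
      by (rule bexI) (rule subspace_neg[OF subspace_\<Gamma> cp_props(1)])
  next
    fix u assume u: "u \<in> m" "br u f \<in> {x. br e x = 0}"
    then have "br e (br f (- u)) = 0" by (simp add: br_minus br_swap[of u f])
    then have "br f (- u) = 0" by (rule ker_im)
    then have "br u f = 0" by (simp add: br_minus br_swap[of u f])
    then show "u = 0" by (intro br_f_injective[OF u(1)]) (simp add: cp_zero)
  qed
qed

section \<open>Affine Poisson varieties and their reductions\<close>

text \<open>Axioms pass to the image of a subalgebra \<open>D\<close> under a surjection that
  respects the operations on \<open>D\<close>. The restriction to \<open>D\<close> is there for the
  coset map, whose compatibility with brackets is available for invariants only.\<close>

lemma poisson_algebra_image:
  assumes A: "poisson_algebra A" and D: "D \<subseteq> carrier A"
    "\<one>\<^bsub>A\<^esub> \<in> D" "\<And>X Y. X \<in> D \<Longrightarrow> Y \<in> D \<Longrightarrow> X \<oplus>\<^bsub>A\<^esub> Y \<in> D" "\<And>X Y. X \<in> D \<Longrightarrow> Y \<in> D \<Longrightarrow> X \<otimes>\<^bsub>A\<^esub> Y \<in> D"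
    "\<And>c X. X \<in> D \<Longrightarrow> c \<odot>\<^bsub>A\<^esub> X \<in> D" "\<And>X Y. X \<in> D \<Longrightarrow> Y \<in> D \<Longrightarrow> pbracket A X Y \<in> D"
    and h: "h ` D = carrier C" "h \<one>\<^bsub>A\<^esub> = \<one>\<^bsub>C\<^esub>" "h \<zero>\<^bsub>A\<^esub> = \<zero>\<^bsub>C\<^esub>"
    "\<And>X Y. X \<in> D \<Longrightarrow> Y \<in> D \<Longrightarrow> h X \<oplus>\<^bsub>C\<^esub> h Y = h (X \<oplus>\<^bsub>A\<^esub> Y)"
    "\<And>X Y. X \<in> D \<Longrightarrow> Y \<in> D \<Longrightarrow> h X \<otimes>\<^bsub>C\<^esub> h Y = h (X \<otimes>\<^bsub>A\<^esub> Y)"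
    "\<And>c X. X \<in> D \<Longrightarrow> c \<odot>\<^bsub>C\<^esub> h X = h (c \<odot>\<^bsub>A\<^esub> X)"
    "\<And>X Y. X \<in> D \<Longrightarrow> Y \<in> D \<Longrightarrow> pbracket C (h X) (h Y) = h (pbracket A X Y)"
  shows "poisson_algebra C"
proof -
  interpret A: poisson_algebra A by (rule A)
  have sm: "X \<in> carrier A \<Longrightarrow> c \<odot>\<^bsub>A\<^esub> X \<in> carrier A" for c X
    by (rule A.smult_closed) (auto simp: complex_ring_def)
  have one: "\<one>\<^bsub>complex_ring\<^esub> = 1" "a \<oplus>\<^bsub>complex_ring\<^esub> b = a + b" "a \<otimes>\<^bsub>complex_ring\<^esub> b = a * b"
    "a \<in> carrier complex_ring" for a b by (simp_all add: complex_ring_def)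
  have neg: "\<ominus>\<^bsub>A\<^esub> X = (-1) \<odot>\<^bsub>A\<^esub> X" if "X \<in> carrier A" for X
  proof -
    have "(1 + (-1)) \<odot>\<^bsub>A\<^esub> X = 1 \<odot>\<^bsub>A\<^esub> X \<oplus>\<^bsub>A\<^esub> (-1) \<odot>\<^bsub>A\<^esub> X"
      using A.smult_l_distr[of 1 "-1" X] that by (simp add: one)
    moreover have "1 \<odot>\<^bsub>A\<^esub> X = X" using A.smult_one[OF that] by (simp add: one)
    moreover have "(0::complex) \<odot>\<^bsub>A\<^esub> X = \<zero>\<^bsub>A\<^esub>" using A.smult_l_null[OF that] by (simp add: complex_ring_def)
    ultimately have "X \<oplus>\<^bsub>A\<^esub> (-1) \<odot>\<^bsub>A\<^esub> X = \<zero>\<^bsub>A\<^esub>" by simp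
    then show ?thesis using that sm[OF that] by (metis A.add.m_comm A.minus_equality)
  qed
  have Dc: "X \<in> D \<Longrightarrow> X \<in> carrier A" for X using D(1) by blast
  have neg_D: "X \<in> D \<Longrightarrow> \<ominus>\<^bsub>A\<^esub> X \<in> D" for X using neg D(5) Dc by simp
  have "(0::complex) \<odot>\<^bsub>A\<^esub> \<one>\<^bsub>A\<^esub> = \<zero>\<^bsub>A\<^esub>" using A.smult_l_null[of "\<one>\<^bsub>A\<^esub>"] by (simp add: complex_ring_def)
  then have zero_D: "\<zero>\<^bsub>A\<^esub> \<in> D" using D(5)[OF D(2), of 0] by simp
  have img: "\<exists>X\<in>D. x = h X" if "x \<in> carrier C" for x using h(1) that by blast
  have hC: "X \<in> D \<Longrightarrow> h X \<in> carrier C" for X using h(1) by blast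
  note cl = D(2-6) zero_D neg_D Dc hC
  have cringC: "cring C"
  proof (intro cringI abelian_groupI comm_monoidI)
    fix x assume "x \<in> carrier C"
    then obtain X where X: "X \<in> D" "x = h X" using img by blast
    show "\<exists>y\<in>carrier C. y \<oplus>\<^bsub>C\<^esub> x = \<zero>\<^bsub>C\<^esub>"
      by (rule bexI[of _ "h (\<ominus>\<^bsub>A\<^esub> X)"]) (use X in \<open>simp_all add: h cl A.l_neg\<close>)
    show "\<zero>\<^bsub>C\<^esub> \<oplus>\<^bsub>C\<^esub> x = x" "\<one>\<^bsub>C\<^esub> \<otimes>\<^bsub>C\<^esub> x = x"
      using X by (simp_all add: h(4,5) cl h(2,3)[symmetric])
  next
    fix x y assume "x \<in> carrier C" "y \<in> carrier C"
    then obtain X Y where X: "X \<in> D" "x = h X" "Y \<in> D" "y = h Y" using img by blast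
    show "x \<oplus>\<^bsub>C\<^esub> y \<in> carrier C" "x \<otimes>\<^bsub>C\<^esub> y \<in> carrier C"
      using X by (simp_all add: h(4,5) cl)
    show "x \<oplus>\<^bsub>C\<^esub> y = y \<oplus>\<^bsub>C\<^esub> x"
      unfolding X(2,4) h(4)[OF X(1,3)] h(4)[OF X(3,1)] by (rule arg_cong[OF A.a_comm]) (simp_all add: Dc X)
    show "x \<otimes>\<^bsub>C\<^esub> y = y \<otimes>\<^bsub>C\<^esub> x"
      unfolding X(2,4) h(5)[OF X(1,3)] h(5)[OF X(3,1)] by (rule arg_cong[OF A.m_comm]) (simp_all add: Dc X)
  next
    fix x y z assume xyz: "x \<in> carrier C" "y \<in> carrier C" "z \<in> carrier C"
    obtain X where X1: "X \<in> D" "x = h X" using img[OF xyz(1)] by blast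
    obtain Y where X2: "Y \<in> D" "y = h Y" using img[OF xyz(2)] by blast
    obtain Z where X3: "Z \<in> D" "z = h Z" using img[OF xyz(3)] by blast
    note X = X1 X2 X3
    note Xc = Dc[OF X(1)] Dc[OF X(3)] Dc[OF X(5)]
    show "x \<oplus>\<^bsub>C\<^esub> y \<oplus>\<^bsub>C\<^esub> z = x \<oplus>\<^bsub>C\<^esub> (y \<oplus>\<^bsub>C\<^esub> z)"
      unfolding X(2,4,6) h(4)[OF X(1,3)] h(4)[OF X(3,5)] h(4)[OF D(3)[OF X(1,3)] X(5)] h(4)[OF X(1) D(3)[OF X(3,5)]]
      by (rule arg_cong[OF A.a_assoc[OF Xc]])
    show "x \<otimes>\<^bsub>C\<^esub> y \<otimes>\<^bsub>C\<^esub> z = x \<otimes>\<^bsub>C\<^esub> (y \<otimes>\<^bsub>C\<^esub> z)"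
      unfolding X(2,4,6) h(5)[OF X(1,3)] h(5)[OF X(3,5)] h(5)[OF D(4)[OF X(1,3)] X(5)] h(5)[OF X(1) D(4)[OF X(3,5)]]
      by (rule arg_cong[OF A.m_assoc[OF Xc]])
    show "(x \<oplus>\<^bsub>C\<^esub> y) \<otimes>\<^bsub>C\<^esub> z = x \<otimes>\<^bsub>C\<^esub> z \<oplus>\<^bsub>C\<^esub> y \<otimes>\<^bsub>C\<^esub> z"
      unfolding X(2,4,6) h(4)[OF X(1,3)] h(5)[OF X(1,5)] h(5)[OF X(3,5)] h(5)[OF D(3)[OF X(1,3)] X(5)]
        h(4)[OF D(4)[OF X(1,5)] D(4)[OF X(3,5)]]
      by (rule arg_cong[OF A.l_distr[OF Xc]])
  next
    show "\<zero>\<^bsub>C\<^esub> \<in> carrier C" "\<one>\<^bsub>C\<^esub> \<in> carrier C" using hC[OF zero_D] hC[OF D(2)] by (simp_all add: h)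
  qed
  interpret C: cring C by (rule cringC)
  have hneg: "h (\<ominus>\<^bsub>A\<^esub> X) = \<ominus>\<^bsub>C\<^esub> h X" if "X \<in> D" for X
  proof (rule C.minus_equality[symmetric])
    show "h (\<ominus>\<^bsub>A\<^esub> X) \<oplus>\<^bsub>C\<^esub> h X = \<zero>\<^bsub>C\<^esub>" using that by (simp add: h(4) cl A.l_neg h(3))
  qed (use that in \<open>simp_all add: cl\<close>)
  show ?thesis
  proof (intro poisson_algebra.intro algebraI poisson_algebra_axioms.intro cringC)
    show "cring complex_ring" using A by (simp add: poisson_algebra_def algebra_def module_def)
    fix a b x y assume "x \<in> carrier C" "y \<in> carrier C"
    then obtain X Y where X: "X \<in> D" "x = h X" "Y \<in> D" "y = h Y" using img by blast
    note Xc = X(1,3) Dc[OF X(1)] Dc[OF X(3)]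
    show "a \<odot>\<^bsub>C\<^esub> x \<in> carrier C" using Xc by (simp add: X h(6) cl)
    show "(a \<oplus>\<^bsub>complex_ring\<^esub> b) \<odot>\<^bsub>C\<^esub> x = a \<odot>\<^bsub>C\<^esub> x \<oplus>\<^bsub>C\<^esub> b \<odot>\<^bsub>C\<^esub> x"
      using Xc A.smult_l_distr[of a b X] by (simp add: X h(4,6) cl one)
    show "a \<odot>\<^bsub>C\<^esub> (x \<oplus>\<^bsub>C\<^esub> y) = a \<odot>\<^bsub>C\<^esub> x \<oplus>\<^bsub>C\<^esub> a \<odot>\<^bsub>C\<^esub> y"
      using Xc A.smult_r_distr[of a X Y] by (simp add: X h(4,6) cl one)
    show "(a \<otimes>\<^bsub>complex_ring\<^esub> b) \<odot>\<^bsub>C\<^esub> x = a \<odot>\<^bsub>C\<^esub> (b \<odot>\<^bsub>C\<^esub> x)"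
      using Xc A.smult_assoc1[of a b X] by (simp add: X h(6) cl one)
    show "\<one>\<^bsub>complex_ring\<^esub> \<odot>\<^bsub>C\<^esub> x = x"
      using Xc A.smult_one[of X] by (simp add: X h(6) cl one)
    show "a \<odot>\<^bsub>C\<^esub> x \<otimes>\<^bsub>C\<^esub> y = a \<odot>\<^bsub>C\<^esub> (x \<otimes>\<^bsub>C\<^esub> y)"
      using Xc A.smult_assoc2[of a X Y] by (simp add: X h(5,6) cl one)
    show "pbracket C x y \<in> carrier C" using Xc by (simp add: X h(7) cl)
    show "pbracket C (a \<odot>\<^bsub>C\<^esub> x) y = a \<odot>\<^bsub>C\<^esub> pbracket C x y"
      using Xc A.pb_smult[of X Y a] by (simp add: X h(6,7) cl)
    show "pbracket C x y = \<ominus>\<^bsub>C\<^esub> pbracket C y x"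
      using Xc A.pb_antisym[of X Y] by (simp add: X h(7) cl hneg)
    fix z assume "z \<in> carrier C"
    then obtain Z where Z: "Z \<in> D" "z = h Z" using img by blast
    note Zc = Z(1) Dc[OF Z(1)]
    show "pbracket C (x \<oplus>\<^bsub>C\<^esub> y) z = pbracket C x z \<oplus>\<^bsub>C\<^esub> pbracket C y z"
      using Xc Zc A.pb_add[of X Y Z] by (simp add: X Z h(4,7) cl)
    show "pbracket C x (pbracket C y z) \<oplus>\<^bsub>C\<^esub> pbracket C y (pbracket C z x) \<oplus>\<^bsub>C\<^esub> pbracket C z (pbracket C x y) = \<zero>\<^bsub>C\<^esub>"
      using Xc Zc A.pb_jacobi[of X Y Z] by (simp add: X Z h(4,7) cl h(3))
    show "pbracket C x (y \<otimes>\<^bsub>C\<^esub> z) = pbracket C x y \<otimes>\<^bsub>C\<^esub> z \<oplus>\<^bsub>C\<^esub> y \<otimes>\<^bsub>C\<^esub> pbracket C x z"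
      using Xc Zc A.pb_leibniz[of X Y Z] by (simp add: X Z h(4,5,7) cl)
  qed
qed

text \<open>An affine Poisson variety without finite generation and without the completeness of its
  points. This much is enough to check identities at points, and it is what gets proved first for
  reductions and slices.\<close>

locale faithful_pv =
  fixes V :: "('p, 'b) pvariety"
  assumes poisson: "poisson_algebra (coord_alg V)"
    and faithful: "\<lbrakk>X \<in> carrier (coord_alg V); \<And>p. p \<in> points V \<Longrightarrow> evl V X p = 0\<rbrakk> \<Longrightarrow> X = \<zero>\<^bsub>coord_alg V\<^esub>"
    and characters: "p \<in> points V \<Longrightarrow> (\<lambda>X. evl V X p) \<in> complex_characters (coord_alg V)"
begin

sublocale A: poisson_algebra "coord_alg V" by (rule poisson)

abbreviation "A \<equiv> coord_alg V"
abbreviation "ev \<equiv> evl V"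

lemma smult_closed: "X \<in> carrier A \<Longrightarrow> c \<odot>\<^bsub>A\<^esub> X \<in> carrier A"
  by (rule A.smult_closed) (auto simp: complex_ring_def)

context
  fixes p X Y assumes p: "p \<in> points V" and X: "X \<in> carrier A" and Y: "Y \<in> carrier A"
begin

lemma ev_add: "ev (X \<oplus>\<^bsub>A\<^esub> Y) p = ev X p + ev Y p"
  and ev_mult: "ev (X \<otimes>\<^bsub>A\<^esub> Y) p = ev X p * ev Y p"
proof -
  have h: "(\<lambda>X. ev X p) \<in> ring_hom A complex_ring"
    using characters[OF p] by (simp_all add: complex_characters_def)
  show "ev (X \<oplus>\<^bsub>A\<^esub> Y) p = ev X p + ev Y p" "ev (X \<otimes>\<^bsub>A\<^esub> Y) p = ev X p * ev Y p"
    using ring_hom_add[OF h(1) X Y] ring_hom_mult[OF h(1) X Y] by (simp_all add: complex_ring_def)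
qed

end

lemma ev_smult: "p \<in> points V \<Longrightarrow> X \<in> carrier A \<Longrightarrow> ev (c \<odot>\<^bsub>A\<^esub> X) p = c * ev X p"
  using characters by (simp add: complex_characters_def)

lemma ev_one: "p \<in> points V \<Longrightarrow> ev \<one>\<^bsub>A\<^esub> p = 1"
  using characters[of p] ring_hom_one[of "\<lambda>X. ev X p" A complex_ring]
  by (simp add: complex_characters_def) (simp add: complex_ring_def)

lemma ev_zero: "p \<in> points V \<Longrightarrow> ev \<zero>\<^bsub>A\<^esub> p = 0"
  using ev_add[of p "\<zero>\<^bsub>A\<^esub>" "\<zero>\<^bsub>A\<^esub>"] by simp

lemma ev_minus: "p \<in> points V \<Longrightarrow> X \<in> carrier A \<Longrightarrow> ev (\<ominus>\<^bsub>A\<^esub> X) p = - ev X p"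
  using ev_add[of p "\<ominus>\<^bsub>A\<^esub> X" X] ev_zero[of p] by (simp add: A.l_neg eq_neg_iff_add_eq_0)

lemmas ev_simps = ev_add ev_mult ev_smult ev_one ev_zero ev_minus

lemma eqI:
  assumes "X \<in> carrier A" "Y \<in> carrier A" "\<And>p. p \<in> points V \<Longrightarrow> ev X p = ev Y p"
  shows "X = Y"
proof -
  have "X \<oplus>\<^bsub>A\<^esub> \<ominus>\<^bsub>A\<^esub> Y = \<zero>\<^bsub>A\<^esub>" using assms by (intro faithful) (simp_all add: ev_simps)
  then show ?thesis using assms(1,2) by (metis A.minus_equality A.minus_minus A.a_inv_closed)
qed

lemma pb_add_right:
  assumes "X \<in> carrier A" "Y \<in> carrier A" "Z \<in> carrier A"
  shows "pbracket A Z (X \<oplus>\<^bsub>A\<^esub> Y) = pbracket A Z X \<oplus>\<^bsub>A\<^esub> pbracket A Z Y"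
  using assms A.pb_antisym[of Z "X \<oplus>\<^bsub>A\<^esub> Y"] A.pb_antisym[of Z X] A.pb_antisym[of Z Y] A.pb_add[of X Y Z]
  by (simp add: A.pb_closed A.minus_add)

lemma vanishing_ideal:
  assumes "Z \<subseteq> points V"
  shows "ideal {X \<in> carrier A. \<forall>p\<in>Z. ev X p = 0} A"
proof (intro idealI subgroup.intro)
  have pt: "p \<in> Z \<Longrightarrow> p \<in> points V" for p using assms by blast
  let ?J = "{X \<in> carrier A. \<forall>p\<in>Z. ev X p = 0}"
  show "ring A" by (rule A.ring_axioms)
  show "?J \<subseteq> carrier (add_monoid A)" by auto
  show "inv\<^bsub>add_monoid A\<^esub> X \<in> ?J" if "X \<in> ?J" for X
    using that by (simp add: a_inv_def[symmetric] ev_simps pt)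
  show "X \<otimes>\<^bsub>add_monoid A\<^esub> Y \<in> ?J" if "X \<in> ?J" "Y \<in> ?J" for X Y
    using that by (simp add: ev_simps pt)
  show "\<one>\<^bsub>add_monoid A\<^esub> \<in> ?J" by (simp add: ev_simps pt)
  show "Y \<otimes>\<^bsub>A\<^esub> X \<in> ?J" "X \<otimes>\<^bsub>A\<^esub> Y \<in> ?J" if "X \<in> ?J" "Y \<in> carrier A" for X Y
    using that by (simp_all add: ev_simps pt)
qed

lemma ev_pb_swap:
  "p \<in> points V \<Longrightarrow> X \<in> carrier A \<Longrightarrow> Y \<in> carrier A \<Longrightarrow> ev (pbracket A X Y) p = - ev (pbracket A Y X) p"
  using A.pb_antisym[of X Y] A.pb_closed[of Y X] by (simp add: ev_minus)

end

locale affine_pv = faithful_pv +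
  assumes fin_gen: "\<exists>F. finite F \<and> F \<subseteq> carrier (coord_alg V) \<and>
      generate_ring (coord_alg V) (range (\<lambda>c. c \<odot>\<^bsub>coord_alg V\<^esub> \<one>\<^bsub>coord_alg V\<^esub>) \<union> F) = carrier (coord_alg V)"
    and character_point: "h \<in> complex_characters (coord_alg V) \<Longrightarrow>
      \<exists>!p. p \<in> points V \<and> (\<forall>X\<in>carrier (coord_alg V). h X = evl V X p)"

lemma affine_pv_iff: "affine_pv V \<longleftrightarrow> affine_poisson_variety V"
  unfolding affine_poisson_variety_def Let_def affine_pv_def affine_pv_axioms_def faithful_pv_def
  by (intro iffI; (elim conjE)?; intro conjI) blast+

lemma generate_ring_image:
  assumes "X \<in> generate_ring A K" "ring A" "K \<subseteq> carrier A"
    and E: "\<And>X Y. X \<in> carrier A \<Longrightarrow> Y \<in> carrier A \<Longrightarrow> E (X \<oplus>\<^bsub>A\<^esub> Y) = E X \<oplus>\<^bsub>C\<^esub> E Y"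
      "\<And>X Y. X \<in> carrier A \<Longrightarrow> Y \<in> carrier A \<Longrightarrow> E (X \<otimes>\<^bsub>A\<^esub> Y) = E X \<otimes>\<^bsub>C\<^esub> E Y"
      "\<And>X. X \<in> carrier A \<Longrightarrow> E (\<ominus>\<^bsub>A\<^esub> X) = \<ominus>\<^bsub>C\<^esub> E X" "E \<one>\<^bsub>A\<^esub> = \<one>\<^bsub>C\<^esub>"
  shows "E X \<in> generate_ring C (E ` K)"
  using assms(1)
proof induction
  case one show ?case by (simp add: E generate_ring.one)
next
  case (incl x) then show ?case by (intro generate_ring.incl imageI)
next
  case (a_inv x)
  then show ?case using ring.generate_ring_in_carrier[OF assms(2,3) a_inv.hyps] by (simp add: E generate_ring.a_inv)
next
  case (eng_add x y)
  then show ?case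
    using ring.generate_ring_in_carrier[OF assms(2,3) eng_add.hyps(1)] ring.generate_ring_in_carrier[OF assms(2,3) eng_add.hyps(2)]
    by (simp add: E generate_ring.eng_add)
next
  case (eng_mult x y)
  then show ?case
    using ring.generate_ring_in_carrier[OF assms(2,3) eng_mult.hyps(1)] ring.generate_ring_in_carrier[OF assms(2,3) eng_mult.hyps(2)]
    by (simp add: E generate_ring.eng_mult)
qed

text \<open>\<open>W\<close> is the closed subvariety \<open>\<tau> (points W)\<close> of \<open>V\<close>, with coordinate ring a quotient of that of \<open>V\<close>
  as an algebra (but not as a Poisson algebra).\<close>

lemma closed_subvariety_affine:
  assumes V: "affine_pv V" and W: "faithful_pv W"
    and E: "E ` carrier (coord_alg V) = carrier (coord_alg W)"
      "\<And>X q. X \<in> carrier (coord_alg V) \<Longrightarrow> q \<in> points W \<Longrightarrow> evl W (E X) q = evl V X (\<tau> q)"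
    and \<tau>: "\<And>q. q \<in> points W \<Longrightarrow> \<tau> q \<in> points V" "inj_on \<tau> (points W)"
    and closed: "\<And>p. p \<in> points V \<Longrightarrow>
      (\<And>X. X \<in> carrier (coord_alg V) \<Longrightarrow> (\<And>q. q \<in> points W \<Longrightarrow> evl V X (\<tau> q) = 0) \<Longrightarrow> evl V X p = 0) \<Longrightarrow>
      p \<in> \<tau> ` points W"
  shows "affine_pv W"
proof -
  interpret V: affine_pv V by (rule V)
  interpret W: faithful_pv W by (rule W)
  have EC: "E X \<in> carrier W.A" if "X \<in> carrier V.A" for X using E(1) that by blast
  have Eadd: "E (X \<oplus>\<^bsub>V.A\<^esub> Y) = E X \<oplus>\<^bsub>W.A\<^esub> E Y" if "X \<in> carrier V.A" "Y \<in> carrier V.A" for X Y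
    by (rule W.eqI) (use that in \<open>simp_all add: EC E(2) V.ev_simps W.ev_simps \<tau>(1)\<close>)
  have Emult: "E (X \<otimes>\<^bsub>V.A\<^esub> Y) = E X \<otimes>\<^bsub>W.A\<^esub> E Y" if "X \<in> carrier V.A" "Y \<in> carrier V.A" for X Y
    by (rule W.eqI) (use that in \<open>simp_all add: EC E(2) V.ev_simps W.ev_simps \<tau>(1)\<close>)
  have Eminus: "E (\<ominus>\<^bsub>V.A\<^esub> X) = \<ominus>\<^bsub>W.A\<^esub> E X" if "X \<in> carrier V.A" for X
    by (rule W.eqI) (use that in \<open>simp_all add: EC E(2) V.ev_simps W.ev_simps \<tau>(1)\<close>)
  have Esmult: "E (c \<odot>\<^bsub>V.A\<^esub> X) = c \<odot>\<^bsub>W.A\<^esub> E X" if "X \<in> carrier V.A" for c X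
    by (rule W.eqI) (use that in \<open>simp_all add: EC E(2) V.ev_simps W.ev_simps \<tau>(1) V.smult_closed W.smult_closed\<close>)
  have Eone: "E \<one>\<^bsub>V.A\<^esub> = \<one>\<^bsub>W.A\<^esub>"
    by (rule W.eqI) (simp_all add: EC E(2) V.ev_simps W.ev_simps \<tau>(1))
  show ?thesis
  proof unfold_locales
    obtain F where F: "finite F" "F \<subseteq> carrier V.A"
      "generate_ring V.A (range (\<lambda>c. c \<odot>\<^bsub>V.A\<^esub> \<one>\<^bsub>V.A\<^esub>) \<union> F) = carrier V.A" (is "generate_ring _ ?K = _")
      using V.fin_gen by blast
    have K: "?K \<subseteq> carrier V.A" using F(2) by (auto intro: V.smult_closed)
    have EK: "E ` ?K = range (\<lambda>c. c \<odot>\<^bsub>W.A\<^esub> \<one>\<^bsub>W.A\<^esub>) \<union> E ` F"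
      by (simp add: image_Un image_image Esmult Eone)
    have "carrier W.A \<subseteq> generate_ring W.A (E ` ?K)"
    proof
      fix x assume "x \<in> carrier W.A"
      then obtain X where X: "X \<in> carrier V.A" "x = E X" using E(1) by blast
      then have "X \<in> generate_ring V.A ?K" using F(3) by simp
      from generate_ring_image[OF this V.A.ring_axioms K Eadd Emult Eminus Eone]
      show "x \<in> generate_ring W.A (E ` ?K)" unfolding X(2) .
    qed
    moreover have "generate_ring W.A (E ` ?K) \<subseteq> carrier W.A"
      using K EC by (intro W.A.generate_ring_incl) blast
    ultimately have "generate_ring W.A (range (\<lambda>c. c \<odot>\<^bsub>W.A\<^esub> \<one>\<^bsub>W.A\<^esub>) \<union> E ` F) = carrier W.A"
      unfolding EK by (rule equalityI[rotated])
    moreover have "finite (E ` F)" "E ` F \<subseteq> carrier W.A" using F EC by auto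
    ultimately show "\<exists>F. finite F \<and> F \<subseteq> carrier W.A \<and>
      generate_ring W.A (range (\<lambda>c. c \<odot>\<^bsub>W.A\<^esub> \<one>\<^bsub>W.A\<^esub>) \<union> F) = carrier W.A" by blast
  next
    fix h assume h: "h \<in> complex_characters W.A"
    then have hh: "h \<in> ring_hom W.A complex_ring" "\<And>c X. X \<in> carrier W.A \<Longrightarrow> h (c \<odot>\<^bsub>W.A\<^esub> X) = c * h X"
      by (simp_all add: complex_characters_def)
    \<comment> \<open>The pulled back character is evaluation at a point of \<open>V\<close>;
      functions vanishing on the image of \<open>W\<close> vanish there, so closedness places the
      point in that image.\<close>
    have "(\<lambda>X. h (E X)) \<in> complex_characters V.A"
      unfolding complex_characters_def
      using ring_hom_add[OF hh(1)] ring_hom_mult[OF hh(1)] ring_hom_one[OF hh(1)]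
      by (auto intro!: ring_hom_memI simp: Eadd Emult Esmult Eone EC hh(2)) (simp add: complex_ring_def)
    from V.character_point[OF this] obtain p where p: "p \<in> points V" "\<forall>X\<in>carrier V.A. h (E X) = V.ev X p"
      by blast
    have h0: "h \<zero>\<^bsub>W.A\<^esub> = 0"
      using ring_hom_add[OF hh(1), of "\<zero>\<^bsub>W.A\<^esub>" "\<zero>\<^bsub>W.A\<^esub>"] by (simp add: complex_ring_def)
    have "p \<in> \<tau> ` points W"
    proof (rule closed[OF p(1)])
      fix X assume X: "X \<in> carrier V.A" "\<And>q. q \<in> points W \<Longrightarrow> V.ev X (\<tau> q) = 0"
      have "E X = \<zero>\<^bsub>W.A\<^esub>" by (rule W.faithful) (simp_all add: X E(2) EC)
      then show "V.ev X p = 0" using p(2) X(1) h0 by metis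
    qed
    then obtain q where q: "q \<in> points W" "p = \<tau> q" by blast
    show "\<exists>!q. q \<in> points W \<and> (\<forall>X\<in>carrier W.A. h X = W.ev X q)"
    proof (rule ex1I[of _ q])
      show "q \<in> points W \<and> (\<forall>X\<in>carrier W.A. h X = W.ev X q)"
      proof (intro conjI q(1) ballI)
        fix x assume "x \<in> carrier W.A"
        then obtain X where X: "X \<in> carrier V.A" "x = E X" using E(1) by blast
        then show "h x = W.ev x q" using p(2) E(2)[OF X(1) q(1)] by (simp add: q(2))
      qed
      fix q' assume q': "q' \<in> points W \<and> (\<forall>X\<in>carrier W.A. h X = W.ev X q')"
      have "\<forall>X\<in>carrier V.A. h (E X) = V.ev X (\<tau> q')" using q' E(2) EC by force
      then have "\<tau> q' = p"
        using V.character_point[OF \<open>(\<lambda>X. h (E X)) \<in> complex_characters V.A\<close>] p \<tau>(1) q' by blast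
      then show "q' = q" using \<tau>(2) q q' by (auto dest: inj_onD)
    qed
  qed
qed

text \<open>Functions are determined by their values, so the value formula alone makes
  \<open>\<psi>\<close> an injective algebra homomorphism; only surjectivity and the bracket have to
  be supplied.\<close>

lemma pvariety_isoI:
  assumes V: "affine_pv V" and W: "affine_pv W" and \<iota>: "bij_betw \<iota> (points V) (points W)"
    and \<psi>: "\<And>X. X \<in> carrier (coord_alg W) \<Longrightarrow> \<psi> X \<in> carrier (coord_alg V)"
      "\<And>X p. X \<in> carrier (coord_alg W) \<Longrightarrow> p \<in> points V \<Longrightarrow> evl V (\<psi> X) p = evl W X (\<iota> p)"
    and surj: "\<And>F. F \<in> carrier (coord_alg V) \<Longrightarrow>
      \<exists>X\<in>carrier (coord_alg W). \<forall>p\<in>points V. evl V F p = evl W X (\<iota> p)"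
    and bracket: "\<And>X Y p. X \<in> carrier (coord_alg W) \<Longrightarrow> Y \<in> carrier (coord_alg W) \<Longrightarrow> p \<in> points V \<Longrightarrow>
      evl V (pbracket (coord_alg V) (\<psi> X) (\<psi> Y)) p = evl W (pbracket (coord_alg W) X Y) (\<iota> p)"
  shows "pvariety_iso V W \<iota> \<psi>"
proof -
  interpret V: affine_pv V by (rule V)
  interpret W: affine_pv W by (rule W)
  have \<iota>p: "p \<in> points V \<Longrightarrow> \<iota> p \<in> points W" for p using \<iota> by (auto simp: bij_betw_def)
  have hom: "\<psi> \<in> ring_hom W.A V.A"
  proof (rule ring_hom_memI)
    fix X Y assume "X \<in> carrier W.A" "Y \<in> carrier W.A"
    then show "\<psi> (X \<otimes>\<^bsub>W.A\<^esub> Y) = \<psi> X \<otimes>\<^bsub>V.A\<^esub> \<psi> Y" "\<psi> (X \<oplus>\<^bsub>W.A\<^esub> Y) = \<psi> X \<oplus>\<^bsub>V.A\<^esub> \<psi> Y"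
      by (auto intro!: V.eqI simp: \<psi> V.ev_simps W.ev_simps \<iota>p)
  next
    show "\<psi> \<one>\<^bsub>W.A\<^esub> = \<one>\<^bsub>V.A\<^esub>" by (auto intro!: V.eqI simp: \<psi> V.ev_simps W.ev_simps \<iota>p)
  qed (rule \<psi>)
  have inj: "inj_on \<psi> (carrier W.A)"
  proof (rule inj_onI)
    fix X Y assume XY: "X \<in> carrier W.A" "Y \<in> carrier W.A" "\<psi> X = \<psi> Y"
    show "X = Y"
    proof (rule W.eqI[OF XY(1,2)])
      fix q assume "q \<in> points W"
      then obtain p where "p \<in> points V" "q = \<iota> p" using \<iota> by (auto simp: bij_betw_def)
      then show "W.ev X q = W.ev Y q" using \<psi>(2)[OF XY(1)] \<psi>(2)[OF XY(2)] XY(3) by metis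
    qed
  qed
  have im: "\<psi> ` carrier W.A = carrier V.A"
  proof
    show "carrier V.A \<subseteq> \<psi> ` carrier W.A"
    proof
      fix F assume F: "F \<in> carrier V.A"
      from surj[OF F] obtain X where X: "X \<in> carrier W.A" "\<forall>p\<in>points V. V.ev F p = W.ev X (\<iota> p)" by blast
      then have "F = \<psi> X" using F by (intro V.eqI) (simp_all add: \<psi>)
      then show "F \<in> \<psi> ` carrier W.A" using X(1) by blast
    qed
  qed (use \<psi>(1) in blast)
  have "\<psi> \<in> poisson_iso W.A V.A"
    unfolding poisson_iso_def ring_iso_def
    using hom inj im
    by (auto simp: bij_betw_def \<psi> V.ev_simps W.ev_simps \<iota>p bracket V.smult_closed W.smult_closed V.A.pb_closed W.A.pb_closed
        intro!: V.eqI)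
  then show ?thesis
    unfolding pvariety_iso_def using V W \<iota> \<psi> by (auto simp: affine_pv_iff)
qed

text \<open>The inverse of the first isomorphism followed by the second. It carries the slice
  description of the one-step reduction over to the two-step reduction.\<close>

lemma pvariety_iso_common:
  assumes 1: "pvariety_iso V W \<iota> \<psi>" and 2: "pvariety_iso V W' \<iota>' \<psi>'"
  shows "\<exists>\<kappa> \<theta>. pvariety_iso W W' \<kappa> \<theta>"
proof -
  have aff: "affine_pv V" "affine_pv W" "affine_pv W'" and b: "bij_betw \<iota> (points V) (points W)" "bij_betw \<iota>' (points V) (points W')"
    and ev: "\<And>X p. X \<in> carrier (coord_alg W) \<Longrightarrow> p \<in> points V \<Longrightarrow> evl V (\<psi> X) p = evl W X (\<iota> p)"
      "\<And>X p. X \<in> carrier (coord_alg W') \<Longrightarrow> p \<in> points V \<Longrightarrow> evl V (\<psi>' X) p = evl W' X (\<iota>' p)"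
    and iso: "bij_betw \<psi> (carrier (coord_alg W)) (carrier (coord_alg V))" "bij_betw \<psi>' (carrier (coord_alg W')) (carrier (coord_alg V))"
    and br: "\<And>X Y. X \<in> carrier (coord_alg W) \<Longrightarrow> Y \<in> carrier (coord_alg W) \<Longrightarrow>
        \<psi> (pbracket (coord_alg W) X Y) = pbracket (coord_alg V) (\<psi> X) (\<psi> Y)"
      "\<And>X Y. X \<in> carrier (coord_alg W') \<Longrightarrow> Y \<in> carrier (coord_alg W') \<Longrightarrow>
        \<psi>' (pbracket (coord_alg W') X Y) = pbracket (coord_alg V) (\<psi>' X) (\<psi>' Y)"
    using 1 2 by (auto simp: pvariety_iso_def affine_pv_iff poisson_iso_def ring_iso_def)
  interpret W: affine_pv W by (rule aff)
  interpret W': affine_pv W' by (rule aff)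
  define \<rho> where "\<rho> = inv_into (points V) \<iota>"
  define \<theta> where "\<theta> = inv_into (carrier W.A) \<psi>"
  have \<rho>: "\<rho> q \<in> points V" "\<iota> (\<rho> q) = q" if "q \<in> points W" for q
    using b(1) that by (auto simp: \<rho>_def bij_betw_def inv_into_into f_inv_into_f)
  have \<theta>: "\<theta> F \<in> carrier W.A" "\<psi> (\<theta> F) = F" if "F \<in> carrier (coord_alg V)" for F
    using iso(1) that by (auto simp: \<theta>_def bij_betw_def inv_into_into f_inv_into_f)
  have \<psi>'c: "\<psi>' X \<in> carrier (coord_alg V)" if "X \<in> carrier W'.A" for X using iso(2) that by (auto simp: bij_betw_def)
  have \<psi>c: "\<psi> X \<in> carrier (coord_alg V)" if "X \<in> carrier W.A" for X using iso(1) that by (auto simp: bij_betw_def)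
  have val: "W.ev (\<theta> (\<psi>' X)) q = W'.ev X (\<iota>' (\<rho> q))" if "X \<in> carrier W'.A" "q \<in> points W" for X q
    using ev(1)[OF \<theta>(1)[OF \<psi>'c[OF that(1)]] \<rho>(1)[OF that(2)]] ev(2)[OF that(1) \<rho>(1)[OF that(2)]] \<theta>(2)[OF \<psi>'c[OF that(1)]] \<rho>(2)[OF that(2)]
    by simp
  have "pvariety_iso W W' (\<lambda>q. \<iota>' (\<rho> q)) (\<lambda>X. \<theta> (\<psi>' X))"
  proof (rule pvariety_isoI[OF aff(2,3)])
    have "bij_betw \<rho> (points W) (points V)" unfolding \<rho>_def by (rule bij_betw_inv_into[OF b(1)])
    from bij_betw_trans[OF this b(2)] show "bij_betw (\<lambda>q. \<iota>' (\<rho> q)) (points W) (points W')" by (simp add: comp_def)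
    show "\<theta> (\<psi>' X) \<in> carrier W.A" if "X \<in> carrier W'.A" for X using \<theta> \<psi>'c that by blast
    show "W.ev (\<theta> (\<psi>' X)) q = W'.ev X (\<iota>' (\<rho> q))" if "X \<in> carrier W'.A" "q \<in> points W" for X q
      by (rule val[OF that])
    show "\<exists>X\<in>carrier W'.A. \<forall>q\<in>points W. W.ev F q = W'.ev X (\<iota>' (\<rho> q))" if F: "F \<in> carrier W.A" for F
    proof -
      obtain X where X: "X \<in> carrier W'.A" "\<psi>' X = \<psi> F"
        using iso(2) \<psi>c[OF F] by (auto simp: bij_betw_def) (metis imageE)
      have "\<theta> (\<psi>' X) = F" unfolding X(2) \<theta>_def using iso(1) F by (simp add: bij_betw_def)
      then show ?thesis using val[OF X(1)] X(1) by (intro bexI[of _ X]) auto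
    qed
    fix X Y q assume X: "X \<in> carrier W'.A" "Y \<in> carrier W'.A" and q: "q \<in> points W"
    have "\<psi> (pbracket W.A (\<theta> (\<psi>' X)) (\<theta> (\<psi>' Y))) = \<psi>' (pbracket W'.A X Y)"
      using X by (simp add: br \<theta> \<psi>'c)
    moreover have "\<psi> (\<theta> (\<psi>' (pbracket W'.A X Y))) = \<psi>' (pbracket W'.A X Y)"
      using X by (simp add: \<theta> \<psi>'c W'.A.pb_closed)
    ultimately have "pbracket W.A (\<theta> (\<psi>' X)) (\<theta> (\<psi>' Y)) = \<theta> (\<psi>' (pbracket W'.A X Y))"
      by (intro inj_onD[OF bij_betw_imp_inj_on[OF iso(1)]])
        (use X in \<open>simp_all add: \<theta> \<psi>'c W.A.pb_closed W'.A.pb_closed\<close>)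
    then show "W.ev (pbracket W.A (\<theta> (\<psi>' X)) (\<theta> (\<psi>' Y))) q = W'.ev (pbracket W'.A X Y) (\<iota>' (\<rho> q))"
      using val[OF W'.A.pb_closed[OF X] q] by simp
  qed
  then show ?thesis by blast
qed

text \<open>Hamiltonian reduction in the presence of a section: \<open>\<pi>\<close> sends a point of the zero fibre \<open>Z\<close> to
  the representative of its orbit in a closed slice, and \<open>ext X\<close> is the invariant function \<open>X \<circ> \<pi>\<close>.\<close>

locale slice_reduction = affine_pv V for V :: "('p, 'b) pvariety" +
  fixes Z :: "'p set" and H :: "'h set" and act :: "'h \<Rightarrow> 'p \<Rightarrow> 'p" and J Y :: "'b set"
    and \<pi> :: "'p \<Rightarrow> 'p" and ext :: "'b \<Rightarrow> 'b"
  assumes Z_points: "Z \<subseteq> points V"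
    and J_vanishing: "J = {X \<in> carrier (coord_alg V). \<forall>p\<in>Z. evl V X p = 0}"
    and act_Z: "g \<in> H \<Longrightarrow> p \<in> Z \<Longrightarrow> act g p \<in> Z"
    and orbit_self: "p \<in> Z \<Longrightarrow> p \<in> orbit H act p"
    and orbit_eq: "p \<in> Z \<Longrightarrow> r \<in> orbit H act p \<Longrightarrow> orbit H act r = orbit H act p"
    and Y_inv: "Y \<subseteq> carrier (coord_alg V)" "y \<in> Y \<Longrightarrow> y' \<in> Y \<Longrightarrow> pbracket (coord_alg V) y y' \<in> J"
    and invariant: "X \<in> carrier (coord_alg V) \<Longrightarrow> (\<And>y. y \<in> Y \<Longrightarrow> pbracket (coord_alg V) y X \<in> J) \<Longrightarrow>
      g \<in> H \<Longrightarrow> p \<in> Z \<Longrightarrow> evl V X (act g p) = evl V X p"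
    and pb_J: "X \<in> carrier (coord_alg V) \<Longrightarrow> (\<And>y. y \<in> Y \<Longrightarrow> pbracket (coord_alg V) y X \<in> J) \<Longrightarrow>
      F \<in> J \<Longrightarrow> pbracket (coord_alg V) F X \<in> J"
    and ext_carrier: "X \<in> carrier (coord_alg V) \<Longrightarrow> ext X \<in> carrier (coord_alg V)"
    and ext_inv: "X \<in> carrier (coord_alg V) \<Longrightarrow> y \<in> Y \<Longrightarrow> pbracket (coord_alg V) y (ext X) \<in> J"
    and ext_ev: "X \<in> carrier (coord_alg V) \<Longrightarrow> p \<in> Z \<Longrightarrow> evl V (ext X) p = evl V X (\<pi> p)"
    and \<pi>_orbit: "p \<in> Z \<Longrightarrow> \<pi> p \<in> orbit H act p"
    and \<pi>_const: "p \<in> Z \<Longrightarrow> r \<in> orbit H act p \<Longrightarrow> \<pi> r = \<pi> p"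
    and slice_closed: "p \<in> points V \<Longrightarrow>
      (\<And>X. X \<in> carrier (coord_alg V) \<Longrightarrow> (\<And>r. r \<in> Z \<Longrightarrow> evl V X (\<pi> r) = 0) \<Longrightarrow> evl V X p = 0) \<Longrightarrow> p \<in> \<pi> ` Z"
begin

section \<open>The reduced Poisson algebra and its points\<close>

definition invs :: "'b set" where "invs = {X \<in> carrier A. \<forall>y\<in>Y. pbracket A y X \<in> J}"

abbreviation "R \<equiv> hamiltonian_reduction V Z H act J Y"
abbreviation cl :: "'b \<Rightarrow> 'b set" where "cl X \<equiv> J +>\<^bsub>A\<^esub> X"
abbreviation "orb \<equiv> orbit H act"

lemma J_iff: "X \<in> J \<longleftrightarrow> X \<in> carrier A \<and> (\<forall>p\<in>Z. ev X p = 0)"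
  using J_vanishing by simp

lemma Z_pt: "p \<in> Z \<Longrightarrow> p \<in> points V" using Z_points by blast

lemma ideal_J: "ideal J A"
  unfolding J_vanishing by (rule vanishing_ideal[OF Z_points])

sublocale I: ideal J A by (rule ideal_J)

lemma inv_iff: "X \<in> invs \<longleftrightarrow> X \<in> carrier A \<and> (\<forall>y\<in>Y. \<forall>p\<in>Z. ev (pbracket A y X) p = 0)"
proof (cases "X \<in> carrier A")
  case True
  then have "pbracket A y X \<in> carrier A" if "y \<in> Y" for y using that Y_inv(1) A.pb_closed by blast
  with True show ?thesis by (auto simp: invs_def J_iff)
qed (simp add: invs_def)

lemma inv_carrier: "X \<in> invs \<Longrightarrow> X \<in> carrier A" by (simp add: invs_def)

lemma inv_pb_J: "X \<in> invs \<Longrightarrow> F \<in> J \<Longrightarrow> pbracket A F X \<in> J"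
  using pb_J by (simp add: invs_def)

lemma inv_pb_J': "X \<in> invs \<Longrightarrow> F \<in> J \<Longrightarrow> pbracket A X F \<in> J"
proof -
  assume XF: "X \<in> invs" "F \<in> J"
  then have c: "X \<in> carrier A" "F \<in> carrier A" by (simp_all add: inv_carrier J_iff)
  show ?thesis
    using inv_pb_J[OF XF] A.pb_antisym[OF c] I.a_inv_closed by simp
qed

lemma inv_add: "X \<in> invs \<Longrightarrow> X' \<in> invs \<Longrightarrow> X \<oplus>\<^bsub>A\<^esub> X' \<in> invs"
  using Y_inv(1) by (auto simp: inv_iff pb_add_right ev_simps Z_pt A.pb_closed subset_iff)

lemma inv_mult: "X \<in> invs \<Longrightarrow> X' \<in> invs \<Longrightarrow> X \<otimes>\<^bsub>A\<^esub> X' \<in> invs"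
  using Y_inv(1) by (auto simp: inv_iff A.pb_leibniz ev_simps Z_pt A.pb_closed subset_iff)

lemma inv_smult: "X \<in> invs \<Longrightarrow> c \<odot>\<^bsub>A\<^esub> X \<in> invs"
proof -
  assume X: "X \<in> invs"
  have "ev (pbracket A y (c \<odot>\<^bsub>A\<^esub> X)) p = 0" if y: "y \<in> Y" "p \<in> Z" for y p
  proof -
    have yA: "y \<in> carrier A" using y Y_inv(1) by blast
    have "ev (pbracket A y (c \<odot>\<^bsub>A\<^esub> X)) p = - (c * ev (pbracket A X y) p)"
      using ev_pb_swap[of p y "c \<odot>\<^bsub>A\<^esub> X"] y yA X
      by (simp add: Z_pt inv_carrier smult_closed A.pb_smult ev_simps A.pb_closed)
    moreover have "ev (pbracket A X y) p = 0"
      using ev_pb_swap[of p X y] X y yA by (simp add: inv_iff Z_pt)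
    ultimately show ?thesis by simp
  qed
  then show ?thesis using X by (simp add: inv_iff smult_closed)
qed

lemma inv_one: "\<one>\<^bsub>A\<^esub> \<in> invs"
proof -
  have "ev (pbracket A y \<one>\<^bsub>A\<^esub>) p = 0" if y: "y \<in> Y" "p \<in> Z" for y p
  proof -
    have yA: "y \<in> carrier A" using y Y_inv(1) by blast
    have "ev (pbracket A y (\<one>\<^bsub>A\<^esub> \<otimes>\<^bsub>A\<^esub> \<one>\<^bsub>A\<^esub>)) p = ev (pbracket A y \<one>\<^bsub>A\<^esub>) p + ev (pbracket A y \<one>\<^bsub>A\<^esub>) p"
      unfolding A.pb_leibniz[OF yA A.one_closed A.one_closed]
      using y yA by (simp add: ev_simps Z_pt A.pb_closed del: A.l_one A.r_one)
    then show ?thesis by simp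
  qed
  then show ?thesis by (simp add: inv_iff)
qed

text \<open>The Jacobi identity leaves brackets of an invariant with an element of \<open>J\<close>,
  and these lie in \<open>J\<close> by \<open>pb_J\<close>.\<close>

lemma inv_pb: "X \<in> invs \<Longrightarrow> X' \<in> invs \<Longrightarrow> pbracket A X X' \<in> invs"
proof -
  assume X: "X \<in> invs" and X': "X' \<in> invs"
  note c = inv_carrier[OF X] inv_carrier[OF X']
  have "ev (pbracket A y (pbracket A X X')) p = 0" if y: "y \<in> Y" "p \<in> Z" for y p
  proof -
    have yA: "y \<in> carrier A" using y Y_inv(1) by blast
    have "pbracket A y X' \<in> J" "pbracket A y X \<in> J" using X X' y by (simp_all add: invs_def)
    then have j: "pbracket A X' y \<in> J" "pbracket A y X \<in> J"
      using A.pb_antisym[OF c(2) yA] I.a_inv_closed by simp_all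
    have "ev (pbracket A X (pbracket A X' y)) p = 0" "ev (pbracket A X' (pbracket A y X)) p = 0"
      using inv_pb_J'[OF X j(1)] inv_pb_J'[OF X' j(2)] y by (simp_all add: J_iff)
    moreover have "ev (pbracket A y (pbracket A X X')) p + ev (pbracket A X (pbracket A X' y)) p
        + ev (pbracket A X' (pbracket A y X)) p = 0"
      using arg_cong[OF A.pb_jacobi[OF yA c], of "\<lambda>F. ev F p"] yA c y
      by (simp add: ev_simps Z_pt A.pb_closed)
    ultimately show ?thesis by simp
  qed
  then show ?thesis using c by (simp add: inv_iff A.pb_closed)
qed

lemma Y_subset_inv: "Y \<subseteq> invs"
  using Y_inv by (auto simp: invs_def)

lemma cl_iff: "X \<in> carrier A \<Longrightarrow> X' \<in> cl X \<longleftrightarrow> X' \<in> carrier A \<and> (\<forall>p\<in>Z. ev X' p = ev X p)"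
proof
  assume X: "X \<in> carrier A"
  show "X' \<in> carrier A \<and> (\<forall>p\<in>Z. ev X' p = ev X p)" if "X' \<in> cl X"
  proof -
    obtain j where "j \<in> J" "X' = j \<oplus>\<^bsub>A\<^esub> X" using \<open>X' \<in> cl X\<close> by (auto simp: a_r_coset_def')
    then show ?thesis using X by (simp add: J_iff ev_simps Z_pt)
  qed
  show "X' \<in> cl X" if "X' \<in> carrier A \<and> (\<forall>p\<in>Z. ev X' p = ev X p)"
  proof -
    have "X' = (X' \<oplus>\<^bsub>A\<^esub> \<ominus>\<^bsub>A\<^esub> X) \<oplus>\<^bsub>A\<^esub> X" using X that by (simp add: A.a_assoc A.l_neg)
    moreover have "X' \<oplus>\<^bsub>A\<^esub> \<ominus>\<^bsub>A\<^esub> X \<in> J" using X that by (simp add: J_iff ev_simps Z_pt)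
    ultimately show ?thesis unfolding a_r_coset_def' by blast
  qed
qed

lemma cl_self: "X \<in> carrier A \<Longrightarrow> X \<in> cl X" by (simp add: cl_iff)

lemma cl_eq_iff: "X \<in> carrier A \<Longrightarrow> X' \<in> carrier A \<Longrightarrow> cl X = cl X' \<longleftrightarrow> (\<forall>p\<in>Z. ev X p = ev X' p)"
proof
  assume c: "X \<in> carrier A" "X' \<in> carrier A"
  show "\<forall>p\<in>Z. ev X p = ev X' p" if "cl X = cl X'" using cl_self[OF c(1)] c that by (simp add: cl_iff)
  show "cl X = cl X'" if "\<forall>p\<in>Z. ev X p = ev X' p" using c that by (auto simp: cl_iff)
qed

text \<open>Invariance is a property of the class: the Hamiltonians in \<open>Y\<close> are
  themselves invariant, so their brackets with elements of \<open>J\<close> remain in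
  \<open>J\<close>.\<close>

lemma cl_inv: "X \<in> invs \<Longrightarrow> X' \<in> cl X \<Longrightarrow> X' \<in> invs"
proof -
  assume X: "X \<in> invs" and "X' \<in> cl X"
  note c = inv_carrier[OF X]
  have c': "X' \<in> carrier A" and eq: "\<forall>p\<in>Z. ev X' p = ev X p" using \<open>X' \<in> cl X\<close> c by (simp_all add: cl_iff)
  have j: "X' \<oplus>\<^bsub>A\<^esub> \<ominus>\<^bsub>A\<^esub> X \<in> J" using c c' eq by (simp add: J_iff ev_simps Z_pt)
  have "pbracket A y (X' \<oplus>\<^bsub>A\<^esub> \<ominus>\<^bsub>A\<^esub> X) \<in> J" if "y \<in> Y" for y
    using inv_pb_J'[OF subsetD[OF Y_subset_inv that] j] .
  then have "X' \<oplus>\<^bsub>A\<^esub> \<ominus>\<^bsub>A\<^esub> X \<in> invs" using c c' by (simp add: invs_def)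
  from inv_add[OF this X] show ?thesis using c c' by (simp add: A.a_assoc A.l_neg)
qed

lemma R_points: "points R = orb ` Z" by (simp add: hamiltonian_reduction_def)

lemma R_carrier: "carrier (coord_alg R) = cl ` invs"
  by (auto simp: hamiltonian_reduction_def reduced_algebra_def invs_def)

lemma inv_orbit: "X \<in> invs \<Longrightarrow> p \<in> Z \<Longrightarrow> r \<in> orb p \<Longrightarrow> ev X r = ev X p"
  using invariant by (auto simp: invs_def orbit_def)

lemma orb_Z: "p \<in> Z \<Longrightarrow> r \<in> orb p \<Longrightarrow> r \<in> Z"
  using act_Z by (auto simp: orbit_def)

lemma R_ev: "X \<in> invs \<Longrightarrow> p \<in> Z \<Longrightarrow> evl R (cl X) (orb p) = ev X p"
proof -
  assume X: "X \<in> invs" and p: "p \<in> Z"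
  have "(\<Union>X'\<in>cl X. ev X' ` orb p) = {ev X p}"
  proof
    show "(\<Union>X'\<in>cl X. ev X' ` orb p) \<subseteq> {ev X p}"
    proof
      fix v assume "v \<in> (\<Union>X'\<in>cl X. ev X' ` orb p)"
      then obtain X' r where "X' \<in> cl X" "r \<in> orb p" "v = ev X' r" by blast
      then show "v \<in> {ev X p}"
        using orb_Z[OF p] inv_orbit[OF X p] by (simp add: cl_iff[OF inv_carrier[OF X]])
    qed
    show "{ev X p} \<subseteq> (\<Union>X'\<in>cl X. ev X' ` orb p)"
      using cl_self[OF inv_carrier[OF X]] orbit_self[OF p] by blast
  qed
  then show ?thesis by (simp add: hamiltonian_reduction_def)
qed

lemma R_ops:
  "\<one>\<^bsub>coord_alg R\<^esub> = cl \<one>\<^bsub>A\<^esub>" "\<zero>\<^bsub>coord_alg R\<^esub> = cl \<zero>\<^bsub>A\<^esub>"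
  "X \<in> invs \<Longrightarrow> X' \<in> invs \<Longrightarrow> cl X \<oplus>\<^bsub>coord_alg R\<^esub> cl X' = cl (X \<oplus>\<^bsub>A\<^esub> X')"
  "X \<in> invs \<Longrightarrow> X' \<in> invs \<Longrightarrow> cl X \<otimes>\<^bsub>coord_alg R\<^esub> cl X' = cl (X \<otimes>\<^bsub>A\<^esub> X')"
  "X \<in> invs \<Longrightarrow> c \<odot>\<^bsub>coord_alg R\<^esub> cl X = cl (c \<odot>\<^bsub>A\<^esub> X)"
  "X \<in> invs \<Longrightarrow> X' \<in> invs \<Longrightarrow> pbracket (coord_alg R) (cl X) (cl X') = cl (pbracket A X X')"
proof -
  show "\<one>\<^bsub>coord_alg R\<^esub> = cl \<one>\<^bsub>A\<^esub>"
    by (simp add: hamiltonian_reduction_def reduced_algebra_def FactRing_def)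
  have "cl \<zero>\<^bsub>A\<^esub> = J" by (auto simp: cl_iff J_iff ev_zero Z_pt)
  then show "\<zero>\<^bsub>coord_alg R\<^esub> = cl \<zero>\<^bsub>A\<^esub>"
    by (simp add: hamiltonian_reduction_def reduced_algebra_def FactRing_def)
  assume X: "X \<in> invs"
  note c = inv_carrier[OF X]
  have "(\<Union>X'\<in>cl X. cl (c \<odot>\<^bsub>A\<^esub> X')) = cl (c \<odot>\<^bsub>A\<^esub> X)"
  proof -
    have "cl (c \<odot>\<^bsub>A\<^esub> X') = cl (c \<odot>\<^bsub>A\<^esub> X)" if "X' \<in> cl X" for X'
      using that c by (auto simp: cl_eq_iff cl_iff smult_closed ev_smult Z_pt)
    then show ?thesis using cl_self[OF c] by blast
  qed
  then show "c \<odot>\<^bsub>coord_alg R\<^esub> cl X = cl (c \<odot>\<^bsub>A\<^esub> X)"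
    by (simp add: hamiltonian_reduction_def reduced_algebra_def)
  assume X': "X' \<in> invs"
  note c' = inv_carrier[OF X']
  show "cl X \<oplus>\<^bsub>coord_alg R\<^esub> cl X' = cl (X \<oplus>\<^bsub>A\<^esub> X')"
    using I.a_rcos_sum[OF c c'] by (simp add: hamiltonian_reduction_def reduced_algebra_def FactRing_def)
  show "cl X \<otimes>\<^bsub>coord_alg R\<^esub> cl X' = cl (X \<otimes>\<^bsub>A\<^esub> X')"
    using I.rcoset_mult_add[OF c c'] by (simp add: hamiltonian_reduction_def reduced_algebra_def FactRing_def)
  \<comment> \<open>The representatives are changed one after the other; each difference lies in
    \<open>J\<close>, and so does its bracket with an invariant.\<close>
  have *: "cl (pbracket A U W) = cl (pbracket A X X')" if U: "U \<in> cl X" and W: "W \<in> cl X'" for U W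
  proof -
    have Ui: "U \<in> invs" and Wi: "W \<in> invs" using cl_inv X X' U W by blast+
    note Uc = inv_carrier[OF Ui] and Wc = inv_carrier[OF Wi]
    have jU: "U \<oplus>\<^bsub>A\<^esub> \<ominus>\<^bsub>A\<^esub> X \<in> J" using U c Uc by (simp add: J_iff cl_iff ev_simps Z_pt)
    have jW: "W \<oplus>\<^bsub>A\<^esub> \<ominus>\<^bsub>A\<^esub> X' \<in> J" using W c' Wc by (simp add: J_iff cl_iff ev_simps Z_pt)
    have eU: "U = (U \<oplus>\<^bsub>A\<^esub> \<ominus>\<^bsub>A\<^esub> X) \<oplus>\<^bsub>A\<^esub> X" using c Uc by (simp add: A.a_assoc A.l_neg)
    have eW: "W = (W \<oplus>\<^bsub>A\<^esub> \<ominus>\<^bsub>A\<^esub> X') \<oplus>\<^bsub>A\<^esub> X'" using c' Wc by (simp add: A.a_assoc A.l_neg)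
    have "ev (pbracket A U W) p = ev (pbracket A X X') p" if p: "p \<in> Z" for p
    proof -
      have "pbracket A U W = pbracket A (U \<oplus>\<^bsub>A\<^esub> \<ominus>\<^bsub>A\<^esub> X) W \<oplus>\<^bsub>A\<^esub> pbracket A X W"
        by (subst eU) (use c Uc Wc in \<open>simp add: A.pb_add\<close>)
      moreover have "pbracket A X W = pbracket A X (W \<oplus>\<^bsub>A\<^esub> \<ominus>\<^bsub>A\<^esub> X') \<oplus>\<^bsub>A\<^esub> pbracket A X X'"
        by (subst eW) (use c c' Wc in \<open>simp add: pb_add_right\<close>)
      moreover have "ev (pbracket A (U \<oplus>\<^bsub>A\<^esub> \<ominus>\<^bsub>A\<^esub> X) W) p = 0" "ev (pbracket A X (W \<oplus>\<^bsub>A\<^esub> \<ominus>\<^bsub>A\<^esub> X')) p = 0"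
        using inv_pb_J[OF Wi jU] inv_pb_J'[OF X jW] p by (simp_all add: J_iff)
      ultimately show ?thesis using c c' Uc Wc p by (simp add: ev_simps Z_pt A.pb_closed)
    qed
    then show ?thesis using c c' Uc Wc by (simp add: cl_eq_iff A.pb_closed)
  qed
  have "(\<Union>U\<in>cl X. \<Union>W\<in>cl X'. cl (pbracket A U W)) = cl (pbracket A X X')"
    using * cl_self[OF c] cl_self[OF c'] by blast
  then show "pbracket (coord_alg R) (cl X) (cl X') = cl (pbracket A X X')"
    by (simp add: hamiltonian_reduction_def reduced_algebra_def)
qed

lemma R_poisson: "poisson_algebra (coord_alg R)"
  by (rule poisson_algebra_image[where h = cl and D = invs, OF poisson])
    (auto simp: inv_carrier inv_one inv_add inv_mult inv_smult inv_pb R_carrier R_ops)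

lemma R_faithful: "faithful_pv R"
proof (rule faithful_pv.intro)
  show "poisson_algebra (coord_alg R)" by (rule R_poisson)
  show "B = \<zero>\<^bsub>coord_alg R\<^esub>" if B: "B \<in> carrier (coord_alg R)" and z: "\<And>Q. Q \<in> points R \<Longrightarrow> evl R B Q = 0" for B
  proof -
    obtain X where X: "X \<in> invs" "B = cl X" using B by (auto simp: R_carrier)
    have "\<forall>p\<in>Z. ev X p = 0" using z R_ev[OF X(1)] by (auto simp: R_points X(2))
    then show ?thesis using X by (simp add: R_ops cl_eq_iff inv_carrier ev_zero Z_pt)
  qed
  fix Q assume "Q \<in> points R"
  then obtain p where p: "p \<in> Z" "Q = orb p" by (auto simp: R_points)
  show "(\<lambda>B. evl R B Q) \<in> complex_characters (coord_alg R)"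
    unfolding complex_characters_def
  proof (intro CollectI conjI allI ballI ring_hom_memI)
    fix B assume "B \<in> carrier (coord_alg R)"
    then obtain X where X: "X \<in> invs" "B = cl X" by (auto simp: R_carrier)
    show "evl R B Q \<in> carrier complex_ring" by (simp add: complex_ring_def)
    show "evl R (c \<odot>\<^bsub>coord_alg R\<^esub> B) Q = c * evl R B Q" for c
      using X p by (simp add: R_ops R_ev inv_smult ev_smult Z_pt inv_carrier)
    fix B' assume "B' \<in> carrier (coord_alg R)"
    then obtain X' where X': "X' \<in> invs" "B' = cl X'" by (auto simp: R_carrier)
    show "evl R (B \<otimes>\<^bsub>coord_alg R\<^esub> B') Q = evl R B Q \<otimes>\<^bsub>complex_ring\<^esub> evl R B' Q"
      "evl R (B \<oplus>\<^bsub>coord_alg R\<^esub> B') Q = evl R B Q \<oplus>\<^bsub>complex_ring\<^esub> evl R B' Q"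
      using X X' p by (simp_all add: R_ops R_ev inv_mult inv_add ev_mult ev_add Z_pt inv_carrier complex_ring_def)
  next
    show "evl R \<one>\<^bsub>coord_alg R\<^esub> Q = \<one>\<^bsub>complex_ring\<^esub>"
      using p by (simp add: R_ops R_ev inv_one ev_one Z_pt) (simp add: complex_ring_def)
  qed
qed

lemma ext_in_inv: "X \<in> carrier A \<Longrightarrow> ext X \<in> invs"
  using ext_carrier ext_inv by (simp add: invs_def)

text \<open>The slice point on the orbit \<open>Q\<close>; the choice of \<open>p\<close> is
  immaterial because \<open>\<pi>\<close> is constant on orbits.\<close>

definition rep :: "'p set \<Rightarrow> 'p" where "rep Q = \<pi> (SOME p. p \<in> Z \<and> Q = orb p)"

lemma rep: "p \<in> Z \<Longrightarrow> rep (orb p) = \<pi> p"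
proof -
  assume p: "p \<in> Z"
  define r where "r = (SOME r. r \<in> Z \<and> orb p = orb r)"
  have "r \<in> Z \<and> orb p = orb r" unfolding r_def by (rule someI[of _ p]) (simp add: p)
  then have "r \<in> orb p" using orbit_self by blast
  then show ?thesis using \<pi>_const[OF p] by (simp add: rep_def r_def)
qed

lemma \<pi>_Z: "p \<in> Z \<Longrightarrow> \<pi> p \<in> Z" using \<pi>_orbit orb_Z by blast

text \<open>The reduction is identified with the closed slice inside \<open>V\<close>:
  \<open>rep\<close> embeds the orbits, and a function on \<open>V\<close> induces the class of its
  invariant extension. Finite generation and completeness of points are inherited from
  \<open>V\<close>.\<close>

lemma R_affine: "affine_pv R"
proof (rule closed_subvariety_affine[where E = "\<lambda>X. cl (ext X)" and \<tau> = rep, OF affine_pv_axioms R_faithful])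
  \<comment> \<open>An invariant agrees on \<open>Z\<close> with its own extension, whence
    surjectivity of the comorphism.\<close>
  have "cl (ext X) = cl X" if X: "X \<in> invs" for X
    using X inv_orbit[OF X _ \<pi>_orbit] by (simp add: cl_eq_iff ext_carrier ext_ev inv_carrier)
  then show "(\<lambda>X. cl (ext X)) ` carrier A = carrier (coord_alg R)"
    unfolding R_carrier using ext_in_inv by (auto simp: image_iff) (metis inv_carrier)
  show "evl R (cl (ext X)) Q = ev X (rep Q)" if "X \<in> carrier A" "Q \<in> points R" for X Q
    using that by (auto simp: R_points rep R_ev ext_in_inv ext_ev)
  show "rep Q \<in> points V" if "Q \<in> points R" for Q
    using that by (auto simp: R_points rep \<pi>_Z Z_pt)
  show "inj_on rep (points R)"
  proof (rule inj_onI)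
    fix Q Q' assume "Q \<in> points R" "Q' \<in> points R" "rep Q = rep Q'"
    then obtain p p' where "p \<in> Z" "p' \<in> Z" "Q = orb p" "Q' = orb p'" "\<pi> p = \<pi> p'"
      by (auto simp: R_points rep)
    then show "Q = Q'" using orbit_eq[OF _ \<pi>_orbit] by metis
  qed
  fix p assume p: "p \<in> points V"
    and v: "\<And>X. X \<in> carrier A \<Longrightarrow> (\<And>Q. Q \<in> points R \<Longrightarrow> ev X (rep Q) = 0) \<Longrightarrow> ev X p = 0"
  have "p \<in> \<pi> ` Z"
    by (rule slice_closed[OF p], rule v) (auto simp: R_points rep)
  then obtain r where "r \<in> Z" "p = \<pi> r" by blast
  then show "p \<in> rep ` points R"
    by (intro image_eqI[of _ _ "orb r"]) (simp_all add: R_points rep)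
qed

lemma well_defined: "reduction_well_defined V Z H act J Y"
  unfolding reduction_well_defined_def Let_def
proof (intro conjI ideal_J Z_points ballI act_Z)
  show "affine_poisson_variety R" using R_affine by (simp add: affine_pv_iff)
  fix B assume "B \<in> carrier (coord_alg R)"
  then obtain X where X: "X \<in> invs" "B = cl X" by (auto simp: R_carrier)
  show "evl R B (orb p) = ev U p" if "U \<in> B" "p \<in> Z" for U p
    using X that by (simp add: R_ev cl_iff inv_carrier)
  fix C U U' assume "C \<in> carrier (coord_alg R)" and U: "U \<in> B" "U' \<in> C"
  then obtain X' where X': "X' \<in> invs" "C = cl X'" by (auto simp: R_carrier)
  have "U \<in> invs" "U' \<in> invs" using cl_inv U X X' by auto
  moreover have "cl U = B" "cl U' = C"
    using U X X' calculation by (auto simp: cl_eq_iff cl_iff inv_carrier)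
  ultimately show "pbracket (coord_alg R) B C = cl (pbracket A U U')"
    using R_ops(6)[of U U'] by simp
qed

end

section \<open>Polynomial maps of the dual space\<close>

context lie_form
begin

declare restrict_apply [simp del] restrict_apply' [simp]

lemma pb_lin_shift: "pb (lin_shift sc chi y) X = pb (lin sc y) X"
proof
  fix \<xi>
  show "pb (lin_shift sc chi y) X \<xi> = pb (lin sc y) X \<xi>"
  proof (cases "\<xi> \<in> dual")
    case True
    have "d (lin_shift sc chi y) \<xi> = y"
      unfolding lin_shift_def
      using has_diff_add[OF has_diff_eval[of y \<xi>] has_diff_const[of "- chi y" \<xi>]]
      by (intro differential_eqI) (simp add: has_diff_restrict True)
    then show ?thesis by (simp add: pb_at True d_lin)
  qed (simp add: pb_outside)
qed

lemma lin_shift_in_reg: "lin_shift sc chi y \<in> reg"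
proof -
  have "(\<lambda>\<xi>\<in>dual. lin sc y \<xi> + (\<lambda>\<xi>\<in>dual. - chi y) \<xi>) = lin_shift sc chi y"
    unfolding lin_shift_def lin_def by (rule restrict_ext) simp
  then show ?thesis using add_in_reg[OF lin_in_reg const_in_reg] by metis
qed

lemma reg_sum: "finite I \<Longrightarrow> (\<And>i. i \<in> I \<Longrightarrow> (\<lambda>\<xi>\<in>dual. F i \<xi>) \<in> reg) \<Longrightarrow> (\<lambda>\<xi>\<in>dual. \<Sum>i\<in>I. F i \<xi>) \<in> reg"
proof (induction I rule: finite_induct)
  case empty show ?case using const_in_reg[of 0] by simp
next
  case (insert i I)
  have "(\<lambda>\<xi>\<in>dual. (\<lambda>\<xi>\<in>dual. F i \<xi>) \<xi> + (\<lambda>\<xi>\<in>dual. \<Sum>i\<in>I. F i \<xi>) \<xi>) \<in> reg"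
    using insert by (intro add_in_reg) auto
  also have "(\<lambda>\<xi>\<in>dual. (\<lambda>\<xi>\<in>dual. F i \<xi>) \<xi> + (\<lambda>\<xi>\<in>dual. \<Sum>i\<in>I. F i \<xi>) \<xi>) = (\<lambda>\<xi>\<in>dual. \<Sum>i\<in>insert i I. F i \<xi>)"
    using insert by (intro restrict_ext) simp
  finally show ?case .
qed

lemma reg_mult: "(\<lambda>\<xi>\<in>dual. F \<xi>) \<in> reg \<Longrightarrow> (\<lambda>\<xi>\<in>dual. H \<xi>) \<in> reg \<Longrightarrow> (\<lambda>\<xi>\<in>dual. F \<xi> * H \<xi>) \<in> reg"
  and reg_add: "(\<lambda>\<xi>\<in>dual. F \<xi>) \<in> reg \<Longrightarrow> (\<lambda>\<xi>\<in>dual. H \<xi>) \<in> reg \<Longrightarrow> (\<lambda>\<xi>\<in>dual. F \<xi> + H \<xi>) \<in> reg"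
proof -
  assume F: "(\<lambda>\<xi>\<in>dual. F \<xi>) \<in> reg" "(\<lambda>\<xi>\<in>dual. H \<xi>) \<in> reg"
  have 1: "(\<lambda>\<xi>\<in>dual. (\<lambda>\<xi>\<in>dual. F \<xi>) \<xi> * (\<lambda>\<xi>\<in>dual. H \<xi>) \<xi>) = (\<lambda>\<xi>\<in>dual. F \<xi> * H \<xi>)"
    "(\<lambda>\<xi>\<in>dual. (\<lambda>\<xi>\<in>dual. F \<xi>) \<xi> + (\<lambda>\<xi>\<in>dual. H \<xi>) \<xi>) = (\<lambda>\<xi>\<in>dual. F \<xi> + H \<xi>)"
    by (rule restrict_ext, simp)+
  show "(\<lambda>\<xi>\<in>dual. F \<xi> * H \<xi>) \<in> reg" using mult_in_reg[OF F] unfolding 1 .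
  show "(\<lambda>\<xi>\<in>dual. F \<xi> + H \<xi>) \<in> reg" using add_in_reg[OF F] unfolding 1 .
qed

lemma reg_restrict: "X \<in> reg \<Longrightarrow> (\<lambda>\<xi>\<in>dual. X \<xi>) = X"
  by (auto simp: regular_functions_def)

lemma reg_cmul: "(\<lambda>\<xi>\<in>dual. F \<xi>) \<in> reg \<Longrightarrow> (\<lambda>\<xi>\<in>dual. c * F \<xi>) \<in> reg"
  using reg_mult[OF const_in_reg[of c]] by simp

lemma reg_compose:
  assumes "X \<in> reg" and p: "\<And>\<xi>. \<xi> \<in> dual \<Longrightarrow> p \<xi> \<in> dual" "\<And>x. (\<lambda>\<xi>\<in>dual. p \<xi> x) \<in> reg"
  shows "(\<lambda>\<xi>\<in>dual. X (p \<xi>)) \<in> reg"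
  using assms(1)
proof (induction rule: reg_induct)
  case (const c)
  have "(\<lambda>\<xi>\<in>dual. (\<lambda>\<xi>\<in>dual. c) (p \<xi>)) = (\<lambda>\<xi>\<in>dual. c)" by (rule restrict_ext) (simp add: p)
  then show ?case using const_in_reg by metis
next
  case (lin x)
  have "(\<lambda>\<xi>\<in>dual. lin sc x (p \<xi>)) = (\<lambda>\<xi>\<in>dual. p \<xi> x)" by (rule restrict_ext) (simp add: p lin_def)
  then show ?case using p(2) by metis
next
  case (add F H)
  have "(\<lambda>\<xi>\<in>dual. (\<lambda>\<xi>\<in>dual. F \<xi> + H \<xi>) (p \<xi>)) = (\<lambda>\<xi>\<in>dual. F (p \<xi>) + H (p \<xi>))" by (rule restrict_ext) (simp add: p)
  then show ?case using reg_add[OF add.IH] by metis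
next
  case (mult F H)
  have "(\<lambda>\<xi>\<in>dual. (\<lambda>\<xi>\<in>dual. F \<xi> * H \<xi>) (p \<xi>)) = (\<lambda>\<xi>\<in>dual. F (p \<xi>) * H (p \<xi>))" by (rule restrict_ext) (simp add: p)
  then show ?case using reg_mult[OF mult.IH] by metis
qed

text \<open>\<open>differential\<close> is defined along straight lines; orbits are curved, so a
  chain rule for arbitrary curves in the dual is needed.\<close>

lemma reg_curve:
  assumes "X \<in> reg" and c: "\<And>s. c s \<in> dual" and \<eta>: "\<eta> \<in> dual"
    and der: "\<And>x. ((\<lambda>s. c s x) has_field_derivative \<eta> x) (at t)"
  shows "((\<lambda>s. X (c s)) has_field_derivative \<eta> (d X (c t))) (at t)"
  using assms(1)
proof (induction rule: reg_induct)
  case (const k) show ?case using c \<eta> by (simp add: d_const dual_0)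
next
  case (lin x) show ?case using c der[of x] by (simp add: d_lin) (simp add: lin_def)
next
  case (add F H)
  have "\<eta> (d (\<lambda>\<xi>\<in>dual. F \<xi> + H \<xi>) (c t)) = \<eta> (d F (c t)) + \<eta> (d H (c t))"
    unfolding d_add[OF add.hyps(1,2) c] using \<eta> by (simp only: dual_iff)
  then show ?case using DERIV_add[OF add.IH] c by simp
next
  case (mult F H)
  have "\<eta> (d (\<lambda>\<xi>\<in>dual. F \<xi> * H \<xi>) (c t)) = \<eta> (d F (c t)) * H (c t) + \<eta> (d H (c t)) * F (c t)"
    unfolding d_mult[OF mult.hyps(1,2) c] using \<eta> by (simp only: dual_iff mult.commute)
  then show ?case using DERIV_mult[OF mult.IH] c by simp
qed

text \<open>Polynomial maps into the Lie algebra, tested through the pairing with fixed elements; by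
  nondegeneracy these pairings include all coordinates.\<close>

definition pm :: "(('g \<Rightarrow> complex) \<Rightarrow> 'g) \<Rightarrow> bool" where
  "pm u \<longleftrightarrow> (\<forall>x. (\<lambda>\<xi>\<in>dual. form (u \<xi>) x) \<in> reg)"

lemma pm_sharp: "pm sharp"
  unfolding pm_def
proof
  fix x
  have "(\<lambda>\<xi>\<in>dual. form (sharp \<xi>) x) = lin sc x" unfolding lin_def by (rule restrict_ext) (simp add: form_sharp)
  then show "(\<lambda>\<xi>\<in>dual. form (sharp \<xi>) x) \<in> reg" using lin_in_reg by simp
qed

lemma pm_const: "pm (\<lambda>_. c)"
  using const_in_reg by (simp add: pm_def)

lemma pm_add: "pm u \<Longrightarrow> pm v \<Longrightarrow> pm (\<lambda>\<xi>. u \<xi> + v \<xi>)"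
  by (simp add: pm_def form_add reg_add)

lemma pm_scale: "pm u \<Longrightarrow> pm (\<lambda>\<xi>. sc c (u \<xi>))"
  by (simp add: pm_def form_scale reg_cmul)

lemma pm_minus: "pm u \<Longrightarrow> pm (\<lambda>\<xi>. - u \<xi>)"
  using pm_scale[of u "-1"] by simp

lemma pm_diff: "pm u \<Longrightarrow> pm v \<Longrightarrow> pm (\<lambda>\<xi>. u \<xi> - v \<xi>)"
  using pm_add[OF _ pm_minus, of u v] by simp

lemma pm_sum: "finite I \<Longrightarrow> (\<And>i. i \<in> I \<Longrightarrow> pm (u i)) \<Longrightarrow> pm (\<lambda>\<xi>. \<Sum>i\<in>I. u i \<xi>)"
  by (simp add: pm_def form_sum reg_sum)

lemma pm_linear: "Vector_Spaces.linear sc sc L \<Longrightarrow> pm u \<Longrightarrow> pm (\<lambda>\<xi>. L (u \<xi>))"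
  unfolding pm_def
proof
  fix x assume L: "Vector_Spaces.linear sc sc L" and u: "\<forall>x. (\<lambda>\<xi>\<in>dual. form (u \<xi>) x) \<in> reg"
  obtain x' where "\<forall>y. form (L y) x = form y x'" using adjoint_exists[OF L] by blast
  then show "(\<lambda>\<xi>\<in>dual. form (L (u \<xi>)) x) \<in> reg" using u by simp
qed

lemma expand_form: "x = (\<Sum>b\<in>Bs. sc (form x (sharp (\<lambda>x. representation Bs x b))) b)"
proof -
  have "form x (sharp (\<lambda>x. representation Bs x b)) = representation Bs x b" for b
    using form_sharp[OF coord_dual[of b]] by (metis form_sym)
  then show ?thesis using expand[of x] by simp
qed

lemma pm_br: "pm u \<Longrightarrow> pm v \<Longrightarrow> pm (\<lambda>\<xi>. br (u \<xi>) (v \<xi>))"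
  unfolding pm_def
proof
  fix x assume u: "\<forall>x. (\<lambda>\<xi>\<in>dual. form (u \<xi>) x) \<in> reg" and v: "\<forall>x. (\<lambda>\<xi>\<in>dual. form (v \<xi>) x) \<in> reg"
  let ?c = "\<lambda>b. sharp (\<lambda>x. representation Bs x b)"
  have "form (br (u \<xi>) (v \<xi>)) x = (\<Sum>b\<in>Bs. form (v \<xi>) (?c b) * form (u \<xi>) (br b x))" for \<xi>
  proof -
    have "form (br (u \<xi>) (v \<xi>)) x = form (br (u \<xi>) (\<Sum>b\<in>Bs. sc (form (v \<xi>) (?c b)) b)) x"
      using expand_form[of "v \<xi>"] by simp
    then show ?thesis by (simp add: br_sum form_sum br_scale_right form_scale form_br)
  qed
  then show "(\<lambda>\<xi>\<in>dual. form (br (u \<xi>) (v \<xi>)) x) \<in> reg"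
    using u v by (simp only:) (intro reg_sum reg_mult; simp add: Bs)
qed

text \<open>One bound \<open>K\<close> for all points makes the exponential a fixed finite sum of
  iterated brackets, hence polynomial.\<close>

lemma pm_ead:
  assumes "pm u" "pm v" and K: "\<And>\<xi> y. (br (u \<xi>) ^^ K) y = 0"
  shows "pm (\<lambda>\<xi>. ead (u \<xi>) (v \<xi>))"
proof -
  have "pm (\<lambda>\<xi>. (br (u \<xi>) ^^ k) (v \<xi>))" for k
    by (induction k) (simp_all add: assms pm_br)
  then show ?thesis unfolding ead_eq[OF K] by (intro pm_sum pm_scale) auto
qed

text \<open>Test \<open>x\<close> on \<open>z - z'\<close>, where \<open>z'\<close> is the image of
  \<open>z\<close> under the adjoint of a projection \<open>p\<close> onto \<open>W\<close>: this
  vector is orthogonal to \<open>W\<close>, and pairing it with \<open>x\<close> is pairing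
  \<open>z\<close> with \<open>x - p x\<close>.\<close>

lemma double_perp:
  assumes W: "subspace W" and x: "\<And>y. (\<And>w. w \<in> W \<Longrightarrow> form w y = 0) \<Longrightarrow> form x y = 0"
  shows "x \<in> W"
proof -
  obtain p where p: "Vector_Spaces.linear sc sc p" "range p \<subseteq> W" "\<And>v. v \<in> W \<Longrightarrow> p v = v"
    using projection_exists[OF W] by blast
  have "form (x - p x) z = 0" for z
  proof -
    obtain z' where z': "\<forall>y. form (p y) z = form y z'" using adjoint_exists[OF p(1)] by blast
    have e: "form y (z - z') = form (y - p y) z" for y by (simp add: form_diff z')
    have "form x (z - z') = 0"
    proof (rule x)
      fix w assume "w \<in> W"
      then show "form w (z - z') = 0" unfolding e by (simp add: p(3) form_zero)
    qed
    then show ?thesis unfolding e .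
  qed
  then have "x - p x = 0" by (rule form_nondeg)
  then show ?thesis using p(2) by (metis eq_iff_diff_eq_0 range_subsetD)
qed

subsection \<open>The dual space as an affine Poisson variety\<close>

abbreviation "S \<equiv> sym_alg sc br"
abbreviation "DV \<equiv> dual_variety sc br"

lemma DV_simps: "points DV = dual" "coord_alg DV = S" "evl DV X \<xi> = X \<xi>"
  by (simp_all add: dual_variety_def)

lemma DV_faithful: "faithful_pv DV"
proof (rule faithful_pv.intro)
  show "poisson_algebra (coord_alg DV)" using sym_alg_poisson by (simp add: DV_simps)
  show "X = \<zero>\<^bsub>coord_alg DV\<^esub>" if "X \<in> carrier (coord_alg DV)" "\<And>p. p \<in> points DV \<Longrightarrow> evl DV X p = 0" for X
    using that reg_ext[OF _ const_in_reg[of 0], of X] by (simp add: DV_simps sym_alg_simps)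
  show "(\<lambda>X. evl DV X p) \<in> complex_characters (coord_alg DV)" if "p \<in> points DV" for p
    using that by (auto simp: complex_characters_def DV_simps sym_alg_simps intro!: ring_hom_memI)
      (simp_all add: complex_ring_def)
qed

text \<open>A character of the polynomial algebra is determined by its values on the linear
  functions, and these values form a linear functional, which is the desired point.\<close>

lemma DV_affine: "affine_pv DV"
proof (rule affine_pv.intro[OF DV_faithful], unfold_locales, unfold DV_simps)
  interpret F: faithful_pv DV by (rule DV_faithful)
  interpret C: cring S by (rule sym_alg_cring)
  let ?K = "range (\<lambda>c. c \<odot>\<^bsub>S\<^esub> \<one>\<^bsub>S\<^esub>) \<union> lin sc ` Bs"
  have K: "?K \<subseteq> carrier S"
    using lin_in_reg const_in_reg smult_in_reg[OF const_in_reg[of 1]] by (auto simp: sym_alg_simps)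
  have constK: "(\<lambda>\<xi>\<in>dual. c) \<in> generate_ring S ?K" for c
  proof -
    have "c \<odot>\<^bsub>S\<^esub> \<one>\<^bsub>S\<^esub> = (\<lambda>\<xi>\<in>dual. c)" unfolding sym_alg_simps by (rule restrict_ext) simp
    moreover have "c \<odot>\<^bsub>S\<^esub> \<one>\<^bsub>S\<^esub> \<in> ?K" by blast
    ultimately show ?thesis using generate_ring.incl by metis
  qed
  have linK: "lin sc x \<in> generate_ring S ?K" for x
  proof -
    have "(\<lambda>\<xi>\<in>dual. \<Sum>b\<in>I. representation Bs x b * \<xi> b) \<in> generate_ring S ?K" if "finite I" "I \<subseteq> Bs" for I
      using that
    proof (induction I rule: finite_induct)
      case empty show ?case using constK[of 0] by simp
    next
      case (insert b I)
      have b: "lin sc b \<in> generate_ring S ?K" using insert.prems by (intro generate_ring.incl) auto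
      have IH: "(\<lambda>\<xi>\<in>dual. \<Sum>b\<in>I. representation Bs x b * \<xi> b) \<in> generate_ring S ?K"
        using insert by blast
      have "(\<lambda>\<xi>\<in>dual. \<Sum>b\<in>insert b I. representation Bs x b * \<xi> b)
        = ((\<lambda>\<xi>\<in>dual. representation Bs x b) \<otimes>\<^bsub>S\<^esub> lin sc b) \<oplus>\<^bsub>S\<^esub> (\<lambda>\<xi>\<in>dual. \<Sum>b\<in>I. representation Bs x b * \<xi> b)"
        unfolding sym_alg_simps by (rule restrict_ext) (simp add: insert lin_def)
      then show ?case
        using generate_ring.eng_add[OF generate_ring.eng_mult[OF constK[of "representation Bs x b"] b] IH]
        by (simp only:)
    qed
    note sumK = this[OF Bs(1) order_refl]
    have "(\<lambda>\<xi>\<in>dual. \<Sum>b\<in>Bs. representation Bs x b * \<xi> b) = lin sc x"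
      unfolding lin_def
    proof (rule restrict_ext)
      fix \<xi> assume "\<xi> \<in> dual"
      then have "\<xi> (\<Sum>b\<in>Bs. sc (representation Bs x b) b) = (\<Sum>b\<in>Bs. representation Bs x b * \<xi> b)"
        by (simp add: dual_sum dual_iff)
      then show "(\<Sum>b\<in>Bs. representation Bs x b * \<xi> b) = \<xi> x" using expand[of x] by simp
    qed
    then show ?thesis using sumK by (simp only:)
  qed
  have "X \<in> generate_ring S ?K" if "X \<in> reg" for X
    using that
  proof (induction rule: reg_induct)
    case (add F H) then show ?case using generate_ring.eng_add[of F S ?K H] by (simp only: sym_alg_simps(5))
  next
    case (mult F H) then show ?case using generate_ring.eng_mult[of F S ?K H] by (simp only: sym_alg_simps(2))
  qed (rule constK linK)+
  then have "generate_ring S ?K = carrier S"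
    using C.generate_ring_incl[OF K] by (auto simp: sym_alg_simps)
  moreover have "finite (lin sc ` Bs)" "lin sc ` Bs \<subseteq> carrier S"
    using Bs(1) lin_in_reg by (auto simp: sym_alg_simps)
  ultimately show "\<exists>F. finite F \<and> F \<subseteq> carrier S \<and> generate_ring S (range (\<lambda>c. c \<odot>\<^bsub>S\<^esub> \<one>\<^bsub>S\<^esub>) \<union> F) = carrier S"
    by blast
next
  fix h assume h: "h \<in> complex_characters S"
  then have hh: "h \<in> ring_hom S complex_ring" "\<And>c X. X \<in> reg \<Longrightarrow> h (\<lambda>p\<in>dual. c * X p) = c * h X"
    by (auto simp: complex_characters_def sym_alg_simps)
  have hadd: "h (\<lambda>p\<in>dual. X p + Y p) = h X + h Y" and hmult: "h (\<lambda>p\<in>dual. X p * Y p) = h X * h Y"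
    if "X \<in> reg" "Y \<in> reg" for X Y
    using ring_hom_add[OF hh(1), of X Y] ring_hom_mult[OF hh(1), of X Y] that
    by (simp_all add: sym_alg_simps) (simp_all add: complex_ring_def)
  have hone: "h (\<lambda>p\<in>dual. 1) = 1"
    using ring_hom_one[OF hh(1)] by (simp add: sym_alg_simps) (simp add: complex_ring_def)
  define \<xi> where "\<xi> x = h (lin sc x)" for x
  have \<xi>: "\<xi> \<in> dual"
  proof -
    have "lin sc (x + y) = (\<lambda>p\<in>dual. lin sc x p + lin sc y p)" for x y
      unfolding lin_def by (rule restrict_ext) (simp add: dual_iff)
    moreover have "lin sc (sc c x) = (\<lambda>p\<in>dual. c * lin sc x p)" for c x
      unfolding lin_def by (rule restrict_ext) (simp add: dual_iff)
    ultimately show ?thesis by (simp add: dual_iff \<xi>_def hadd hh(2) lin_in_reg)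
  qed
  have "h X = X \<xi>" if "X \<in> reg" for X
    using that
  proof (induction rule: reg_induct)
    case (const c)
    have "(\<lambda>p\<in>dual. c) = (\<lambda>p\<in>dual. c * (\<lambda>p\<in>dual. 1) p)" by (rule restrict_ext) simp
    then have "h (\<lambda>p\<in>dual. c) = c" using hh(2)[OF const_in_reg[of 1], of c] hone by (simp only: mult_1_right)
    then show ?case using \<xi> by simp
  next
    case (lin x)
    have "lin sc x \<xi> = \<xi> x" using \<xi> by (simp add: lin_def)
    then show ?case unfolding \<xi>_def[of x] by (rule sym)
  qed (simp_all add: hadd hmult \<xi>)
  then have "\<xi> \<in> dual \<and> (\<forall>X\<in>carrier S. h X = X \<xi>)" using \<xi> by (simp add: sym_alg_simps(1))
  moreover have "\<eta> = \<xi>" if "\<eta> \<in> dual" "\<forall>X\<in>carrier S. h X = X \<eta>" for \<eta>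
  proof
    fix x
    have "h (lin sc x) = lin sc x \<eta>" using that(2) lin_in_reg by (simp add: sym_alg_simps)
    then show "\<eta> x = \<xi> x" using that(1) by (simp add: \<xi>_def lin_def)
  qed
  ultimately show "\<exists>!p. p \<in> dual \<and> (\<forall>X\<in>carrier S. h X = X p)"
    by (intro ex1I[of _ \<xi>]) blast+
qed

lemma moment_fibre_dual: "moment_fibre sc chi m \<subseteq> dual" by (auto simp: moment_fibre_def)

text \<open>\<open>\<rho>\<close> retracts the dual space onto the affine subspace; \<open>X - X \<circ> \<rho>\<close> lies in the ideal.\<close>

lemma moment_ideal_vanishing:
  assumes m: "subspace m" and chi: "chi \<in> dual"
  shows "moment_ideal sc br chi m = {X \<in> carrier S. \<forall>\<xi>\<in>moment_fibre sc chi m. X \<xi> = 0}"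
proof
  interpret F: faithful_pv DV by (rule DV_faithful)
  interpret C: cring S by (rule sym_alg_cring)
  let ?Z = "moment_fibre sc chi m"
  have gens: "lin_shift sc chi ` m \<subseteq> carrier S" using lin_shift_in_reg by (auto simp: sym_alg_simps)
  have "ideal {X \<in> carrier S. \<forall>\<xi>\<in>?Z. X \<xi> = 0} S"
    using F.vanishing_ideal[of ?Z] moment_fibre_dual by (simp add: DV_simps)
  then show "moment_ideal sc br chi m \<subseteq> {X \<in> carrier S. \<forall>\<xi>\<in>?Z. X \<xi> = 0}"
    unfolding moment_ideal_def
    by (rule C.genideal_minimal) (use gens in \<open>auto simp: lin_shift_def moment_fibre_def\<close>)
  interpret I: ideal "moment_ideal sc br chi m" S
    unfolding moment_ideal_def by (rule C.genideal_ideal[OF gens])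
  obtain p where p: "Vector_Spaces.linear sc sc p" "range p \<subseteq> m" "\<And>v. v \<in> m \<Longrightarrow> p v = v"
    using projection_exists[OF m] by blast
  have p_lin: "p (x + y) = p x + p y" "p (sc c x) = sc c (p x)" for x y c
    using p(1) by (simp_all add: Vector_Spaces.linear_iff)
  \<comment> \<open>The defect of \<open>\<xi>\<close> on \<open>m\<close> is subtracted along
    \<open>p\<close>; thus a linear function at \<open>x\<close> differs from its composite with
    \<open>\<rho>\<close> by the ideal generator at \<open>p x\<close>.\<close>
  define \<rho> where "\<rho> \<xi> x = \<xi> x - (\<xi> (p x) - chi (p x))" for \<xi> :: "'g \<Rightarrow> complex" and x
  have \<rho>_dual: "\<rho> \<xi> \<in> dual" if "\<xi> \<in> dual" for \<xi>
    using that chi by (simp add: \<rho>_def dual_iff p_lin algebra_simps)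
  have \<rho>_Z: "\<rho> \<xi> \<in> ?Z" if "\<xi> \<in> dual" for \<xi>
    using \<rho>_dual[OF that] by (auto simp: moment_fibre_def \<rho>_def p(3))
  have \<rho>_reg: "(\<lambda>\<xi>\<in>dual. \<rho> \<xi> x) \<in> reg" for x
  proof -
    have "(\<lambda>\<xi>\<in>dual. lin sc x \<xi> + (- 1) * lin_shift sc chi (p x) \<xi>) \<in> reg"
      by (intro reg_add reg_cmul) (simp_all add: reg_restrict lin_in_reg lin_shift_in_reg)
    also have "(\<lambda>\<xi>\<in>dual. lin sc x \<xi> + (- 1) * lin_shift sc chi (p x) \<xi>) = (\<lambda>\<xi>\<in>dual. \<rho> \<xi> x)"
      by (rule restrict_ext) (simp add: \<rho>_def lin_def lin_shift_def)
    finally show ?thesis .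
  qed
  have comp: "(\<lambda>\<xi>\<in>dual. X (\<rho> \<xi>)) \<in> reg" if "X \<in> reg" for X
    using reg_compose[OF that \<rho>_dual \<rho>_reg] by simp
  let ?I = "moment_ideal sc br chi m"
  have Iadd: "(\<lambda>\<xi>\<in>dual. X \<xi> + Y \<xi>) \<in> ?I" if "X \<in> ?I" "Y \<in> ?I" for X Y
    using I.a_closed[OF that] by (simp add: sym_alg_simps)
  have Imult: "(\<lambda>\<xi>\<in>dual. X \<xi> * Y \<xi>) \<in> ?I" if "X \<in> reg" "Y \<in> ?I" for X Y
    using I.I_l_closed[OF that(2), of X] that(1) by (simp add: sym_alg_simps)
  have zI: "(\<lambda>\<xi>\<in>dual. 0) \<in> ?I" using I.zero_closed by (simp add: sym_alg_simps)
  have main: "(\<lambda>\<xi>\<in>dual. X \<xi> - X (\<rho> \<xi>)) \<in> ?I" if "X \<in> reg" for X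
    using that
  proof (induction rule: reg_induct)
    case (const c)
    have "(\<lambda>\<xi>\<in>dual. (\<lambda>\<xi>\<in>dual. c) \<xi> - (\<lambda>\<xi>\<in>dual. c) (\<rho> \<xi>)) = (\<lambda>\<xi>\<in>dual. 0)"
      by (rule restrict_ext) (simp add: \<rho>_dual)
    then show ?case using zI by simp
  next
    case (lin x)
    have "(\<lambda>\<xi>\<in>dual. lin sc x \<xi> - lin sc x (\<rho> \<xi>)) = lin_shift sc chi (p x)"
      unfolding lin_shift_def by (rule restrict_ext) (simp add: lin_def \<rho>_dual, simp add: \<rho>_def)
    moreover have "lin_shift sc chi (p x) \<in> ?I"
      unfolding moment_ideal_def using C.genideal_self[OF gens] p(2) by blast
    ultimately show ?case by simp
  next
    case (add F H)
    have "(\<lambda>\<xi>\<in>dual. (\<lambda>\<xi>\<in>dual. F \<xi> - F (\<rho> \<xi>)) \<xi> + (\<lambda>\<xi>\<in>dual. H \<xi> - H (\<rho> \<xi>)) \<xi>)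
      = (\<lambda>\<xi>\<in>dual. (\<lambda>\<xi>\<in>dual. F \<xi> + H \<xi>) \<xi> - (\<lambda>\<xi>\<in>dual. F \<xi> + H \<xi>) (\<rho> \<xi>))"
      by (rule restrict_ext) (simp add: \<rho>_dual)
    then show ?case using Iadd[OF add.IH] by simp
  next
    case (mult F H)
    have "(\<lambda>\<xi>\<in>dual. (\<lambda>\<xi>\<in>dual. F \<xi> * (\<lambda>\<xi>\<in>dual. H \<xi> - H (\<rho> \<xi>)) \<xi>) \<xi>
        + (\<lambda>\<xi>\<in>dual. (\<lambda>\<xi>\<in>dual. H (\<rho> \<xi>)) \<xi> * (\<lambda>\<xi>\<in>dual. F \<xi> - F (\<rho> \<xi>)) \<xi>) \<xi>)
      = (\<lambda>\<xi>\<in>dual. (\<lambda>\<xi>\<in>dual. F \<xi> * H \<xi>) \<xi> - (\<lambda>\<xi>\<in>dual. F \<xi> * H \<xi>) (\<rho> \<xi>))"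
      by (rule restrict_ext) (simp add: \<rho>_dual algebra_simps)
    then show ?case
      using Iadd[OF Imult[OF mult.hyps(1) mult.IH(2)] Imult[OF comp[OF mult.hyps(2)] mult.IH(1)]] by simp
  qed
  show "{X \<in> carrier S. \<forall>\<xi>\<in>?Z. X \<xi> = 0} \<subseteq> ?I"
  proof
    fix X assume "X \<in> {X \<in> carrier S. \<forall>\<xi>\<in>?Z. X \<xi> = 0}"
    then have X: "X \<in> reg" "\<And>\<xi>. \<xi> \<in> ?Z \<Longrightarrow> X \<xi> = 0" by (simp_all add: sym_alg_simps)
    have "(\<lambda>\<xi>\<in>dual. X \<xi> - X (\<rho> \<xi>)) = (\<lambda>\<xi>\<in>dual. X \<xi>)" by (rule restrict_ext) (simp add: X(2) \<rho>_Z)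
    then show "X \<in> ?I" using main[OF X(1)] reg_restrict[OF X(1)] by simp
  qed
qed

end

context slice_data
begin

text \<open>\<open>T\<close> is built from the linear map \<open>L\<close> and an exponential with
  the uniform bound \<open>2 * N + 1\<close>, and the number of iterations is fixed.\<close>

lemma pm_toslice: "pm u \<Longrightarrow> pm (\<lambda>\<xi>. toslice (u \<xi>))"
proof -
  assume u: "pm u"
  have T: "pm (\<lambda>\<xi>. T (v \<xi>))" if v: "pm v" for v
    unfolding T_def
  proof (rule pm_ead[where K = "2 * N + 1"])
    show "pm (\<lambda>\<xi>. - L (v \<xi> - f))" by (intro pm_minus pm_linear[OF L(1)] pm_diff v pm_const)
    have "- L (v \<xi> - f) \<in> Fil 1" for \<xi> using subspace_neg[OF subspace_m L(2)] m_Fil by blast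
    then show "(br (- L (v \<xi> - f)) ^^ (2 * N + 1)) y = 0" for \<xi> y by (rule Fil_nilpotent)
  qed (rule v)
  have "pm (\<lambda>\<xi>. (T ^^ n) (u \<xi>))" for n by (induction n) (simp_all add: u T)
  then show ?thesis unfolding toslice_def .
qed

end

section \<open>The adjoint group\<close>

locale lie_group = lie_form sc br form
  for sc :: "complex \<Rightarrow> 'g::ab_group_add \<Rightarrow> 'g" and br form +
  fixes G :: "(complex^'n^'n) set" and \<phi> :: "'g \<Rightarrow> complex^'n^'n"
  assumes G: "connected_algebraic_group G" and ident: "lie_algebra_identification sc br G \<phi>"
begin

lemma \<phi>_add: "\<phi> (x + y) = \<phi> x + \<phi> y" and \<phi>_scale: "\<phi> (sc c x) = mscale c (\<phi> x)"
  and \<phi>_br: "\<phi> (br x y) = \<phi> x ** \<phi> y - \<phi> y ** \<phi> x" and \<phi>_inj: "\<phi> x = \<phi> y \<Longrightarrow> x = y"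
  and \<phi>_range: "range \<phi> = lie_algebra_of G"
  using ident by (auto simp: lie_algebra_identification_def Vector_Spaces.linear_iff inj_def)

lemma G_invertible: "g \<in> G \<Longrightarrow> invertible g"
  using G GL_closed_invertible unfolding connected_algebraic_group_def by blast

lemma G_one: "mat 1 \<in> G" and G_mult: "g \<in> G \<Longrightarrow> h \<in> G \<Longrightarrow> g ** h \<in> G" and G_inv: "g \<in> G \<Longrightarrow> matrix_inv g \<in> G"
  using G unfolding connected_algebraic_group_def by blast+

lemma G_inverse: "g \<in> G \<Longrightarrow> g ** matrix_inv g = mat 1" "g \<in> G \<Longrightarrow> matrix_inv g ** g = mat 1"
  using matrix_inv_mult G_invertible by blast+

lemma G_inv_inv: "g \<in> G \<Longrightarrow> matrix_inv (matrix_inv g) = g"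
  using matrix_inv_eqI(1)[OF G_inverse(2,1)] .

lemma \<phi>_Ad: "g \<in> G \<Longrightarrow> \<phi> (Ad \<phi> g x) = g ** \<phi> x ** matrix_inv g"
proof -
  assume g: "g \<in> G"
  have "g ** \<phi> x ** matrix_inv g \<in> lie_algebra_of G"
    using conj_lie_algebra[of G g "matrix_inv g" "\<phi> x"] G_mult G_inv g G_inverse \<phi>_range by blast
  then have "g ** \<phi> x ** matrix_inv g \<in> range \<phi>" by (simp add: \<phi>_range)
  then show ?thesis unfolding Ad_def by (rule f_inv_into_f)
qed

text \<open>Turns claims about \<open>Ad\<close> into intertwining relations between matrices, free
  of \<open>inv_into\<close> and of matrix inverses.\<close>

lemma Ad_eqI: "g \<in> G \<Longrightarrow> g ** \<phi> x = \<phi> y ** g \<Longrightarrow> Ad \<phi> g x = y"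
proof -
  assume g: "g \<in> G" and e: "g ** \<phi> x = \<phi> y ** g"
  have "\<phi> y ** g ** matrix_inv g = \<phi> y"
    using g by (simp add: matrix_mul_assoc[symmetric] G_inverse)
  then have "\<phi> (Ad \<phi> g x) = \<phi> y" by (simp add: \<phi>_Ad g e)
  then show ?thesis by (rule \<phi>_inj)
qed

lemma Ad_swap: "g \<in> G \<Longrightarrow> g ** \<phi> x = \<phi> (Ad \<phi> g x) ** g"
  by (simp add: \<phi>_Ad matrix_mul_assoc[symmetric] G_inverse)

lemma Ad_add: "g \<in> G \<Longrightarrow> Ad \<phi> g (x + y) = Ad \<phi> g x + Ad \<phi> g y"
  by (rule Ad_eqI) (simp_all add: \<phi>_add matrix_add_ldistrib matrix_add_rdistrib Ad_swap)

lemma Ad_scale: "g \<in> G \<Longrightarrow> Ad \<phi> g (sc c x) = sc c (Ad \<phi> g x)"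
  by (rule Ad_eqI) (simp_all add: \<phi>_scale mscale_mult Ad_swap)

lemma Ad_br: "g \<in> G \<Longrightarrow> Ad \<phi> g (br x y) = br (Ad \<phi> g x) (Ad \<phi> g y)"
proof (rule Ad_eqI)
  assume g: "g \<in> G"
  have *: "g ** (\<phi> x ** \<phi> y) = \<phi> (Ad \<phi> g x) ** \<phi> (Ad \<phi> g y) ** g" for x y
  proof -
    have "g ** (\<phi> x ** \<phi> y) = (g ** \<phi> x) ** \<phi> y" by (simp add: matrix_mul_assoc)
    also have "\<dots> = \<phi> (Ad \<phi> g x) ** (g ** \<phi> y)" unfolding Ad_swap[OF g, of x] by (simp only: matrix_mul_assoc)
    also have "\<dots> = \<phi> (Ad \<phi> g x) ** \<phi> (Ad \<phi> g y) ** g" unfolding Ad_swap[OF g, of y] by (simp only: matrix_mul_assoc)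
    finally show ?thesis .
  qed
  show "g ** \<phi> (br x y) = \<phi> (br (Ad \<phi> g x) (Ad \<phi> g y)) ** g"
    by (simp add: \<phi>_br matrix_diff_ldistrib matrix_diff_rdistrib *)
qed

lemma Ad_mult: "g \<in> G \<Longrightarrow> h \<in> G \<Longrightarrow> Ad \<phi> (g ** h) x = Ad \<phi> g (Ad \<phi> h x)"
proof (rule Ad_eqI)
  assume g: "g \<in> G" and h: "h \<in> G"
  have "g ** h ** \<phi> x = g ** (\<phi> (Ad \<phi> h x) ** h)" by (simp add: Ad_swap[OF h, symmetric] matrix_mul_assoc)
  also have "\<dots> = \<phi> (Ad \<phi> g (Ad \<phi> h x)) ** (g ** h)" by (simp add: matrix_mul_assoc Ad_swap[OF g])
  finally show "g ** h ** \<phi> x = \<phi> (Ad \<phi> g (Ad \<phi> h x)) ** (g ** h)" .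
qed (simp add: G_mult)

lemma Ad_one: "Ad \<phi> (mat 1) x = x"
  by (rule Ad_eqI) (simp_all add: G_one)

lemma matrix_inv_one: "matrix_inv (mat 1 :: complex^'n^'n) = mat 1"
  by (rule matrix_inv_eqI(1)) simp_all

lemma coAd_one: "coAd \<phi> (mat 1) \<xi> = \<xi>"
  by (simp add: coAd_def matrix_inv_one Ad_one)

lemma coAd_mult: "g \<in> G \<Longrightarrow> h \<in> G \<Longrightarrow> coAd \<phi> (g ** h) \<xi> = coAd \<phi> g (coAd \<phi> h \<xi>)"
  by (simp add: coAd_def matrix_inv_prod G_invertible Ad_mult G_inv)

lemma coAd_inverse: "g \<in> G \<Longrightarrow> coAd \<phi> g (coAd \<phi> (matrix_inv g) \<xi>) = \<xi>" "g \<in> G \<Longrightarrow> coAd \<phi> (matrix_inv g) (coAd \<phi> g \<xi>) = \<xi>"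
  by (simp_all add: coAd_mult[symmetric] G_inv G_inverse coAd_one)

lemma coAd_dual: "g \<in> G \<Longrightarrow> \<xi> \<in> dual \<Longrightarrow> coAd \<phi> g \<xi> \<in> dual"
  by (simp add: dual_iff coAd_def Ad_add Ad_scale G_inv)

lemma coAd_reg: "g \<in> G \<Longrightarrow> X \<in> reg \<Longrightarrow> (\<lambda>\<xi>\<in>dual. X (coAd \<phi> g \<xi>)) \<in> reg"
proof -
  assume g: "g \<in> G" and X: "X \<in> reg"
  have "(\<lambda>\<xi>\<in>dual. coAd \<phi> g \<xi> x) \<in> reg" for x
    using lin_in_reg[of "Ad \<phi> (matrix_inv g) x"] by (simp add: lin_def coAd_def)
  from reg_compose[OF X coAd_dual[OF g] this] show ?thesis .
qed

lemma d_coAd: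
  assumes g: "g \<in> G" and X: "X \<in> reg" and \<xi>: "\<xi> \<in> dual"
  shows "d (\<lambda>\<xi>\<in>dual. X (coAd \<phi> g \<xi>)) \<xi> = Ad \<phi> (matrix_inv g) (d X (coAd \<phi> g \<xi>))"
proof (rule differential_eqI, unfold has_diff_restrict[OF \<xi>], unfold has_diff_def, intro ballI)
  fix \<eta> assume \<eta>: "\<eta> \<in> dual"
  have e: "coAd \<phi> g (\<lambda>y. \<xi> y + t * \<eta> y) = (\<lambda>y. coAd \<phi> g \<xi> y + t * coAd \<phi> g \<eta> y)" for t
    by (simp add: coAd_def)
  have "((\<lambda>t. X (\<lambda>y. coAd \<phi> g \<xi> y + t * coAd \<phi> g \<eta> y)) has_field_derivative coAd \<phi> g \<eta> (d X (coAd \<phi> g \<xi>))) (at 0)"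
    using reg_has_diff[OF X coAd_dual[OF g \<xi>]] coAd_dual[OF g \<eta>] unfolding has_diff_def by blast
  then show "((\<lambda>t. X (coAd \<phi> g (\<lambda>y. \<xi> y + t * \<eta> y))) has_field_derivative \<eta> (Ad \<phi> (matrix_inv g) (d X (coAd \<phi> g \<xi>)))) (at 0)"
    unfolding e by (simp add: coAd_def)
qed

text \<open>Coadjoint translations are Poisson because \<open>Ad\<close> of a group element
  transports differentials and preserves the Lie bracket.\<close>

lemma pb_coAd:
  assumes g: "g \<in> G" and XY: "X \<in> reg" "Y \<in> reg" and \<xi>: "\<xi> \<in> dual"
  shows "pb (\<lambda>\<xi>\<in>dual. X (coAd \<phi> g \<xi>)) (\<lambda>\<xi>\<in>dual. Y (coAd \<phi> g \<xi>)) \<xi> = pb X Y (coAd \<phi> g \<xi>)"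
  using \<xi> coAd_dual[OF g \<xi>] by (simp add: pb_at d_coAd g XY Ad_br[symmetric] G_inv) (simp add: coAd_def)

lemma ead_deriv:
  assumes \<lambda>: "\<mu> \<in> dual" and nil: "nilpotent_element br x"
  shows "((\<lambda>t. \<mu> (ead (sc t x) z)) has_field_derivative \<mu> (br x (ead (sc t x) z))) (at t)"
proof -
  obtain K where K: "\<And>y. (br x ^^ K) y = 0" using nil unfolding nilpotent_element_def by blast
  have KS: "(br (sc t x) ^^ Suc K) y = 0" for t y
    unfolding funpow_br_linear(3) by (simp add: K br_zero)
  define B where "B k = \<mu> ((br x ^^ k) z)" for k
  have e: "ead (sc t x) z = (\<Sum>k<Suc K. sc (t ^ k / fact k) ((br x ^^ k) z))" for t
    unfolding ead_eq[OF KS] funpow_br_linear(3) by simp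
  have \<mu>e: "\<mu> (ead (sc t x) z) = (\<Sum>k<Suc K. t ^ k / fact k * B k)" for t
    unfolding e B_def dual_sum[OF \<lambda>] using \<lambda> by (simp add: dual_iff)
  have "\<mu> (br x (ead (sc t x) z)) = (\<Sum>k<Suc K. t ^ k / fact k * B (Suc k))"
    unfolding e B_def br_sum br_scale_right dual_sum[OF \<lambda>] using \<lambda> by (simp add: dual_iff)
  also have "\<dots> = (\<Sum>k<K. t ^ k / fact k * B (Suc k))"
    using K dual_0[OF \<lambda>] by (simp add: B_def br_zero)
  also have "\<dots> = (\<Sum>k<Suc K. of_nat k * t ^ (k - 1) / fact k * B k)"
    unfolding sum.lessThan_Suc_shift by (auto intro!: sum.cong simp: divide_simps simp del: of_nat_Suc)
  finally have t: "\<mu> (br x (ead (sc t x) z)) = (\<Sum>k<Suc K. of_nat k * t ^ (k - 1) / fact k * B k)" .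
  show ?thesis
    unfolding \<mu>e t
    by (intro DERIV_sum) (auto intro!: derivative_eq_intros)
qed

text \<open>The matrix of \<open>ead (sc t x) y\<close> satisfies the equation required by
  \<open>one_param_conj_curve\<close>, so its conjugate by the inverse of \<open>\<gamma> t\<close>
  is constant.\<close>

lemma Ad_one_param:
  assumes \<gamma>: "one_param \<gamma> (\<phi> x)" "range \<gamma> \<subseteq> G" and nil: "nilpotent_element br x"
  shows "Ad \<phi> (\<gamma> t) y = ead (sc t x) y"
proof (rule Ad_eqI)
  show "\<gamma> t \<in> G" using \<gamma>(2) by blast
  have "mderiv (\<lambda>t. \<phi> (ead (sc t x) y)) (\<phi> x ** \<phi> (ead (sc t x) y) - \<phi> (ead (sc t x) y) ** \<phi> x) t" for t
    unfolding mderiv_def \<phi>_br[symmetric]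
  proof (intro allI)
    fix i j
    have "(\<lambda>y. \<phi> y $ i $ j) \<in> dual" by (simp add: dual_iff \<phi>_add \<phi>_scale)
    from ead_deriv[OF this nil] show "((\<lambda>t. \<phi> (ead (sc t x) y) $ i $ j) has_field_derivative \<phi> (br x (ead (sc t x) y)) $ i $ j) (at t)" .
  qed
  from one_param_conj_curve[OF \<gamma>(1,1) this, of t]
  have "\<gamma> (- t) ** \<phi> (ead (sc t x) y) ** \<gamma> t = \<phi> y" by (simp add: ead_zero)
  then have "\<gamma> t ** \<phi> y = (\<gamma> t ** \<gamma> (- t)) ** \<phi> (ead (sc t x) y) ** \<gamma> t"
    by (metis matrix_mul_assoc)
  then show "\<gamma> t ** \<phi> y = \<phi> (ead (sc t x) y) ** \<gamma> t"
    using one_param_inverse(2)[OF \<gamma>(1)] by simp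
qed

lemma coAd_one_param:
  assumes \<gamma>: "one_param \<gamma> (\<phi> x)" "range \<gamma> \<subseteq> G" and nil: "nilpotent_element br x"
  shows "coAd \<phi> (\<gamma> t) (form z) = form (ead (sc t x) z)"
proof
  fix y
  have "coAd \<phi> (\<gamma> t) (form z) y = form z (ead (sc (- t) x) y)"
    by (simp add: coAd_def one_param_matrix_inv[OF \<gamma>(1)] Ad_one_param[OF assms])
  also have "\<dots> = form (ead (sc t x) z) y"
    using form_ead[OF nilpotent_element_scale(1)[OF nil], of t z y] by simp
  finally show "coAd \<phi> (\<gamma> t) (form z) y = form (ead (sc t x) z) y" .
qed

text \<open>The derivative is given at every \<open>t\<close>, not only at the identity, because
  invariance is later obtained by integrating along the whole curve. The minus sign comes from
  moving \<open>br x\<close> across the form.\<close>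

lemma coAd_curve_deriv:
  assumes \<gamma>: "one_param \<gamma> (\<phi> x)" "range \<gamma> \<subseteq> G" and nil: "nilpotent_element br x"
    and X: "X \<in> reg" and \<xi>: "\<xi> \<in> dual"
  shows "((\<lambda>s. X (coAd \<phi> (\<gamma> s) \<xi>)) has_field_derivative - pb (lin sc x) X (coAd \<phi> (\<gamma> t) \<xi>)) (at t)"
proof -
  define z where "z = sharp \<xi>"
  have z: "coAd \<phi> (\<gamma> s) \<xi> = form (ead (sc s x) z)" for s
    using coAd_one_param[OF \<gamma> nil, of s z] form_sharp[OF \<xi>] by (simp add: z_def)
  have "((\<lambda>s. form (ead (sc s x) z) y) has_field_derivative form (br x (ead (sc t x) z)) y) (at t)" for y
    using ead_deriv[OF form_dual[of y] nil, of z t] by (simp add: form_sym[of y])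
  from reg_curve[OF X form_dual form_dual this]
  have "((\<lambda>s. X (coAd \<phi> (\<gamma> s) \<xi>)) has_field_derivative form (br x (ead (sc t x) z)) (d X (form (ead (sc t x) z)))) (at t)"
    unfolding z .
  moreover have "form (br x u) w = - form u (br x w)" for u w by (simp add: form_br_left br_minus form_minus)
  ultimately show ?thesis unfolding z by (simp add: pb_at form_dual d_lin)
qed

end

text \<open>\<open>nilpotent_m\<close> makes \<open>ead x\<close> a finite sum for \<open>x \<in> m\<close>, hence equal to \<open>Ad (exp x)\<close>.\<close>

locale unipotent_group = lie_group sc br form G \<phi>
  for sc :: "complex \<Rightarrow> 'g::ab_group_add \<Rightarrow> 'g" and br form and G :: "(complex^'n^'n) set" and \<phi> +
  fixes m :: "'g set" and M :: "(complex^'n^'n) set"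
  assumes M: "connected_unipotent_subgroup G \<phi> m M"
    and nilpotent_m: "x \<in> m \<Longrightarrow> nilpotent_element br x"
begin

lemma M_G: "g \<in> M \<Longrightarrow> g \<in> G"
  using M by (auto simp: connected_unipotent_subgroup_def)

lemma M_one: "mat 1 \<in> M" and M_mult: "g \<in> M \<Longrightarrow> h \<in> M \<Longrightarrow> g ** h \<in> M" and M_inv: "g \<in> M \<Longrightarrow> matrix_inv g \<in> M"
  and M_closed: "GL_closed M"
  using M by (auto simp: connected_unipotent_subgroup_def connected_algebraic_group_def)

text \<open>Unipotence enters here. Together with \<open>M_exp\<close> it lets statements about the
  action of \<open>M\<close> be read as statements about \<open>ead x\<close> with \<open>x\<close>
  in \<open>m\<close>.\<close>

lemma M_elem:
  assumes "g \<in> M"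
  obtains \<gamma> x where "one_param \<gamma> (\<phi> x)" "range \<gamma> \<subseteq> M" "range \<gamma> \<subseteq> G" "\<gamma> 1 = g" "x \<in> m" "nilpotent_element br x"
proof -
  have "unipotent_matrix g" using M assms by (auto simp: connected_unipotent_subgroup_def)
  then obtain \<gamma> X where *: "one_param \<gamma> X" "range \<gamma> \<subseteq> M" "\<gamma> 1 = g" "X \<in> lie_algebra_of M"
    using unipotent_one_param[OF M_closed M_one M_mult assms] by blast
  then obtain x where "x \<in> m" "X = \<phi> x" using M by (auto simp: connected_unipotent_subgroup_def)
  then show ?thesis using that[of \<gamma> x] * nilpotent_m M_G by blast
qed

lemma M_exp:
  assumes "x \<in> m"
  obtains \<gamma> where "one_param \<gamma> (\<phi> x)" "range \<gamma> \<subseteq> M" "range \<gamma> \<subseteq> G"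
proof -
  have "\<phi> x \<in> lie_algebra_of M" using M assms by (auto simp: connected_unipotent_subgroup_def)
  then have "range (mexp (\<phi> x)) \<subseteq> M" using mexp_in_group[OF M_closed M_one M_mult] by blast
  then show ?thesis using that[OF one_param_mexp] M_G by blast
qed

lemma M_coAd: "g \<in> M \<Longrightarrow> \<exists>x\<in>m. \<forall>z. coAd \<phi> g (form z) = form (ead x z)"
proof -
  assume "g \<in> M"
  then obtain \<gamma> x where *: "one_param \<gamma> (\<phi> x)" "range \<gamma> \<subseteq> G" "\<gamma> 1 = g" "x \<in> m" "nilpotent_element br x"
    by (rule M_elem)
  show ?thesis using coAd_one_param[OF *(1,2,5), of 1] *(3,4) by (intro bexI[of _ x]) auto
qed

lemma M_exp_coAd: "x \<in> m \<Longrightarrow> \<exists>g\<in>M. \<forall>z. coAd \<phi> g (form z) = form (ead x z)"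
proof -
  assume x: "x \<in> m"
  then obtain \<gamma> where \<gamma>: "one_param \<gamma> (\<phi> x)" "range \<gamma> \<subseteq> M" "range \<gamma> \<subseteq> G" by (rule M_exp)
  show ?thesis using coAd_one_param[OF \<gamma>(1,3) nilpotent_m[OF x], of 1] \<gamma>(2) by (intro bexI[of _ "\<gamma> 1"]) auto
qed

abbreviation "orb \<equiv> orbit M (coAd \<phi>)"

lemma orb_self: "\<xi> \<in> orb \<xi>"
  unfolding orbit_def using M_one coAd_one by (metis image_eqI)

lemma orb_iff: "\<eta> \<in> orb \<xi> \<longleftrightarrow> (\<exists>g\<in>M. \<eta> = coAd \<phi> g \<xi>)"
  by (auto simp: orbit_def)

lemma orb_eq: "\<eta> \<in> orb \<xi> \<Longrightarrow> orb \<eta> = orb \<xi>"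
proof -
  have sub: "orb \<eta> \<subseteq> orb \<xi>" if "\<eta> \<in> orb \<xi>" for \<eta> \<xi>
  proof
    fix \<zeta> assume "\<zeta> \<in> orb \<eta>"
    then obtain g where "g \<in> M" "\<zeta> = coAd \<phi> g \<eta>" by (auto simp: orb_iff)
    moreover obtain h where "h \<in> M" "\<eta> = coAd \<phi> h \<xi>" using \<open>\<eta> \<in> orb \<xi>\<close> by (auto simp: orb_iff)
    ultimately show "\<zeta> \<in> orb \<xi>" using M_mult M_G by (auto simp: orb_iff coAd_mult[symmetric])
  qed
  assume "\<eta> \<in> orb \<xi>"
  then obtain g where g: "g \<in> M" "\<eta> = coAd \<phi> g \<xi>" by (auto simp: orb_iff)
  then have "\<xi> = coAd \<phi> (matrix_inv g) \<eta>" using M_G by (simp add: coAd_inverse)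
  then have "\<xi> \<in> orb \<eta>" using g(1) M_inv by (auto simp: orb_iff)
  then show "orb \<eta> = orb \<xi>" using sub \<open>\<eta> \<in> orb \<xi>\<close> by blast
qed

end

section \<open>The reduction of the dual space by a good algebra\<close>

locale stage = slice_data sc br form \<Gamma> q f m s + unipotent_group sc br form G \<phi> m M
  for sc :: "complex \<Rightarrow> 'g::ab_group_add \<Rightarrow> 'g" and br form \<Gamma> q f m s
    and G :: "(complex^'n^'n) set" and \<phi> M
begin

abbreviation "chi \<equiv> form f"
abbreviation "Z \<equiv> moment_fibre sc chi m"
abbreviation "I \<equiv> moment_ideal sc br chi m"

text \<open>The retraction onto the slice, transported to the dual by the form. It is defined and
  polynomial on the whole dual, so that composing with it is an operation on polynomials.\<close>

definition \<pi> :: "('g \<Rightarrow> complex) \<Rightarrow> 'g \<Rightarrow> complex" where "\<pi> \<xi> = form (toslice (sharp \<xi>))"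

definition slice :: "('g \<Rightarrow> complex) set" where "slice = {form z | z. z - f \<in> s}"

lemma Z_iff: "form z \<in> Z \<longleftrightarrow> z - f \<in> mp"
  by (simp add: moment_fibre_def mp_def form_diff form_dual)

lemma Z_elem: "\<xi> \<in> Z \<Longrightarrow> \<exists>z. \<xi> = form z \<and> z - f \<in> mp"
  using form_surj Z_iff moment_fibre_dual[of chi m] by (metis subsetD)

lemma Z_dual: "\<xi> \<in> Z \<Longrightarrow> \<xi> \<in> dual" using moment_fibre_dual by blast

lemma Z_val: "\<xi> \<in> Z \<Longrightarrow> y \<in> m \<Longrightarrow> \<xi> y = chi y" by (simp add: moment_fibre_def)

lemma s_mp: "z \<in> s \<Longrightarrow> z \<in> mp" using s_perp by (simp add: mp_def)

lemma slice_Z: "slice \<subseteq> Z" by (auto simp: slice_def Z_iff s_mp)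

lemma I_vanishing: "I = {X \<in> carrier S. \<forall>\<xi>\<in>Z. X \<xi> = 0}"
  by (rule moment_ideal_vanishing[OF subspace_m form_dual])

lemma I_iff: "X \<in> I \<longleftrightarrow> X \<in> reg \<and> (\<forall>\<xi>\<in>Z. X \<xi> = 0)"
  by (simp add: I_vanishing sym_alg_simps)

lemma m_ead_mp: "u \<in> m \<Longrightarrow> z - f \<in> mp \<Longrightarrow> ead u z - f \<in> mp"
  using ead_step(1)[of u 1 z] m_Fil by auto

lemma act_Z: "g \<in> M \<Longrightarrow> \<xi> \<in> Z \<Longrightarrow> coAd \<phi> g \<xi> \<in> Z"
proof -
  assume "g \<in> M" "\<xi> \<in> Z"
  then obtain z x where z: "\<xi> = form z" "z - f \<in> mp" "x \<in> m" "coAd \<phi> g (form z) = form (ead x z)"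
    using Z_elem M_coAd by metis
  then show ?thesis using m_ead_mp by (simp add: Z_iff)
qed

lemma orb_Z: "\<eta> \<in> orb \<xi> \<Longrightarrow> \<xi> \<in> Z \<Longrightarrow> \<eta> \<in> Z"
  using act_Z by (auto simp: orb_iff)

lemma \<pi>_slice: "\<xi> \<in> Z \<Longrightarrow> \<pi> \<xi> \<in> slice"
proof -
  assume "\<xi> \<in> Z"
  then obtain z where "\<xi> = form z" "z - f \<in> mp" using Z_elem by blast
  then show ?thesis using toslice by (auto simp: \<pi>_def slice_def sharp_form)
qed

text \<open>Each step of the procedure is the exponential of an element of \<open>m\<close>, so the
  iteration never leaves the orbit.\<close>

lemma \<pi>_orb: "\<xi> \<in> Z \<Longrightarrow> \<pi> \<xi> \<in> orb \<xi>"
proof -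
  assume "\<xi> \<in> Z"
  then obtain z where z: "\<xi> = form z" "z - f \<in> mp" using Z_elem by blast
  have T: "form (T z) \<in> orb (form z)" for z
  proof -
    have "- L (z - f) \<in> m" using subspace_neg[OF subspace_m L(2)] .
    then obtain g where "g \<in> M" "\<forall>z'. coAd \<phi> g (form z') = form (ead (- L (z - f)) z')"
      using M_exp_coAd by blast
    then show ?thesis by (auto simp: T_def orb_iff intro!: bexI[of _ g])
  qed
  have "form ((T ^^ n) z) \<in> orb (form z)" for n
  proof (induction n)
    case 0 show ?case using orb_self by simp
  next
    case (Suc n)
    then show ?case using orb_eq[OF Suc] T[of "(T ^^ n) z"] by simp
  qed
  from this[of "N + 2"] show ?thesis unfolding \<pi>_def z(1) sharp_form toslice_def .
qed

lemma slice_orb_unique: "\<xi> \<in> slice \<Longrightarrow> \<eta> \<in> slice \<Longrightarrow> \<eta> \<in> orb \<xi> \<Longrightarrow> \<eta> = \<xi>"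
proof -
  assume \<xi>: "\<xi> \<in> slice" and \<eta>: "\<eta> \<in> slice" "\<eta> \<in> orb \<xi>"
  obtain g where g: "g \<in> M" "\<eta> = coAd \<phi> g \<xi>" using \<eta> by (auto simp: orb_iff)
  obtain x where x: "x \<in> m" "\<And>z. coAd \<phi> g (form z) = form (ead x z)" using M_coAd[OF g(1)] by blast
  obtain z z' where z: "\<xi> = form z" "z - f \<in> s" "\<eta> = form z'" "z' - f \<in> s" using \<xi> \<eta>(1) by (auto simp: slice_def)
  have "form z' = form (ead x z)" using g(2) x(2) z by simp
  then have "z' = ead x z" by (metis sharp_form)
  then show ?thesis using slice_unique[OF z(2) _ x(1)] z by simp
qed

lemma \<pi>_const: "\<xi> \<in> Z \<Longrightarrow> \<eta> \<in> orb \<xi> \<Longrightarrow> \<pi> \<eta> = \<pi> \<xi>"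
proof (rule slice_orb_unique)
  assume \<xi>: "\<xi> \<in> Z" and \<eta>: "\<eta> \<in> orb \<xi>"
  have \<eta>Z: "\<eta> \<in> Z" using orb_Z \<xi> \<eta> by blast
  show "\<pi> \<xi> \<in> slice" "\<pi> \<eta> \<in> slice" using \<pi>_slice \<xi> \<eta>Z by auto
  show "\<pi> \<eta> \<in> orb (\<pi> \<xi>)" using \<pi>_orb[OF \<eta>Z] orb_eq[OF \<eta>] orb_eq[OF \<pi>_orb[OF \<xi>]] by simp
qed

lemma \<pi>_fix: "\<xi> \<in> slice \<Longrightarrow> \<pi> \<xi> = \<xi>"
proof -
  assume \<xi>: "\<xi> \<in> slice"
  then have "\<xi> \<in> Z" using slice_Z by blast
  from slice_orb_unique[OF \<xi> \<pi>_slice[OF this] \<pi>_orb[OF this]] show ?thesis .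
qed

lemma \<pi>_image: "\<pi> ` Z = slice"
proof
  show "\<pi> ` Z \<subseteq> slice" using \<pi>_slice by blast
  show "slice \<subseteq> \<pi> ` Z"
  proof
    fix \<xi> assume \<xi>: "\<xi> \<in> slice"
    show "\<xi> \<in> \<pi> ` Z" using imageI[OF subsetD[OF slice_Z \<xi>], of \<pi>] \<pi>_fix[OF \<xi>] by simp
  qed
qed

lemma slice_dual: "slice \<subseteq> dual" using slice_Z moment_fibre_dual by (rule order_trans)

lemma dual_slice: "dual \<inter> slice = slice" using slice_dual by (rule Int_absorb1)

lemma \<pi>_dual: "\<pi> \<xi> \<in> dual" by (simp add: \<pi>_def form_dual)

lemma \<pi>_reg: "X \<in> reg \<Longrightarrow> (\<lambda>\<xi>\<in>dual. X (\<pi> \<xi>)) \<in> reg"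
proof -
  assume X: "X \<in> reg"
  have "(\<lambda>\<xi>\<in>dual. \<pi> \<xi> x) \<in> reg" for x using pm_toslice[OF pm_sharp] by (simp add: pm_def \<pi>_def)
  from reg_compose[OF X \<pi>_dual this] show ?thesis .
qed

text \<open>A group element lies on a one-parameter curve from the identity, along which the
  derivative of \<open>X\<close> is a bracket with a linear function and hence zero. The brackets
  must therefore vanish on the whole orbit of \<open>\<xi>\<close>, not just at
  \<open>\<xi>\<close>.\<close>

lemma infinitesimal_invariant:
  assumes X: "X \<in> reg" and inv: "\<And>y \<eta>. y \<in> m \<Longrightarrow> \<eta> \<in> orb \<xi> \<Longrightarrow> pb (lin sc y) X \<eta> = 0"
    and \<xi>: "\<xi> \<in> dual" and g: "g \<in> M"
  shows "X (coAd \<phi> g \<xi>) = X \<xi>"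
proof -
  obtain \<gamma> x where \<gamma>: "one_param \<gamma> (\<phi> x)" "range \<gamma> \<subseteq> M" "range \<gamma> \<subseteq> G" "\<gamma> 1 = g" "x \<in> m" "nilpotent_element br x"
    using M_elem[OF g] .
  have "pb (lin sc x) X (coAd \<phi> (\<gamma> t) \<xi>) = 0" for t
    by (rule inv[OF \<gamma>(5)]) (use \<gamma>(2) in \<open>unfold orb_iff, blast\<close>)
  then have "((\<lambda>s. X (coAd \<phi> (\<gamma> s) \<xi>)) has_field_derivative 0) (at t)" for t
    using coAd_curve_deriv[OF \<gamma>(1,3,6) X \<xi>, of t] by simp
  then have "\<exists>c. \<forall>t\<in>UNIV. X (coAd \<phi> (\<gamma> t) \<xi>) = c"
    by (intro has_field_derivative_zero_constant) auto
  then have "X (coAd \<phi> (\<gamma> 1) \<xi>) = X (coAd \<phi> (\<gamma> 0) \<xi>)" by auto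
  then show ?thesis using \<gamma>(1,4) by (simp add: one_param_def coAd_one)
qed

lemma invariant_infinitesimal:
  assumes X: "X \<in> reg" and inv: "\<And>g. g \<in> M \<Longrightarrow> X (coAd \<phi> g \<xi>) = X \<xi>"
    and \<xi>: "\<xi> \<in> dual" and y: "y \<in> m"
  shows "pb (lin sc y) X \<xi> = 0"
proof -
  obtain \<gamma> where \<gamma>: "one_param \<gamma> (\<phi> y)" "range \<gamma> \<subseteq> M" "range \<gamma> \<subseteq> G" using M_exp[OF y] .
  have "X (coAd \<phi> (\<gamma> s) \<xi>) = X \<xi>" for s using inv \<gamma>(2) by blast
  then have "((\<lambda>s. X \<xi>) has_field_derivative - pb (lin sc y) X (coAd \<phi> (\<gamma> 0) \<xi>)) (at 0)"
    using coAd_curve_deriv[OF \<gamma>(1,3) nilpotent_m[OF y] X \<xi>, of 0] by simp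
  then have "- pb (lin sc y) X (coAd \<phi> (\<gamma> 0) \<xi>) = 0" using DERIV_const DERIV_unique by blast
  then show ?thesis using \<gamma>(1) by (simp add: one_param_def coAd_one)
qed

text \<open>The differential of a function vanishing on \<open>Z = chi + m\<^sup>\<bottom>\<close> lies in \<open>m\<close>.\<close>

lemma d_vanishing:
  assumes F: "F \<in> I" and \<xi>: "\<xi> \<in> Z"
  shows "d F \<xi> \<in> m"
proof (rule double_perp[OF subspace_m])
  fix y assume y: "\<And>w. w \<in> m \<Longrightarrow> form w y = 0"
  have "(\<lambda>x. \<xi> x + t * form y x) \<in> Z" for t
  proof -
    have "form y w = 0" if "w \<in> m" for w using y[OF that] by (simp add: form_sym)
    then show ?thesis using \<xi> dual_line[OF Z_dual[OF \<xi>] form_dual] by (simp add: moment_fibre_def)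
  qed
  then have "((\<lambda>t. F (\<lambda>x. \<xi> x + t * form y x)) has_field_derivative 0) (at 0)"
    using F by (simp add: I_iff)
  moreover have "((\<lambda>t. F (\<lambda>x. \<xi> x + t * form y x)) has_field_derivative form y (d F \<xi>)) (at 0)"
    using reg_has_diff[of F \<xi>] F Z_dual[OF \<xi>] form_dual[of y] by (simp add: I_iff has_diff_def)
  ultimately have "form y (d F \<xi>) = 0" using DERIV_unique by blast
  then show "form (d F \<xi>) y = 0" by (simp add: form_sym)
qed

lemma slice_reduction: "slice_reduction DV Z M (coAd \<phi>) I (lin sc ` m) \<pi> (\<lambda>X. \<lambda>\<xi>\<in>dual. X (\<pi> \<xi>))"
proof (rule slice_reduction.intro[OF DV_affine], rule slice_reduction_axioms.intro, unfold DV_simps sym_alg_simps)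
  fix X g \<xi> assume X: "X \<in> reg" and inv: "\<And>y. y \<in> lin sc ` m \<Longrightarrow> pb y X \<in> I" and g: "g \<in> M" and \<xi>: "\<xi> \<in> Z"
  show "X (coAd \<phi> g \<xi>) = X \<xi>"
    using inv orb_Z[OF _ \<xi>] by (intro infinitesimal_invariant[OF X _ Z_dual[OF \<xi>] g]) (auto simp: I_iff)
next
  fix X F assume X: "X \<in> reg" and inv: "\<And>y. y \<in> lin sc ` m \<Longrightarrow> pb y X \<in> I" and F: "F \<in> I"
  have "pb F X \<xi> = 0" if \<xi>: "\<xi> \<in> Z" for \<xi>
  proof -
    \<comment> \<open>At the single point \<open>\<xi>\<close> the bracket depends on
      \<open>F\<close> only through its differential, which lies in \<open>m\<close>; so
      \<open>F\<close> may be replaced by a linear Hamiltonian.\<close>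
    have "pb (lin sc (d F \<xi>)) X \<xi> = 0" using inv d_vanishing[OF F \<xi>] \<xi> by (auto simp: I_iff)
    then show ?thesis by (simp add: pb_at Z_dual[OF \<xi>] d_lin)
  qed
  then show "pb F X \<in> I" using F X by (simp add: I_iff pb_in_reg)
next
  fix X y assume X: "X \<in> reg" and y: "y \<in> lin sc ` m"
  let ?X = "\<lambda>\<xi>\<in>dual. X (\<pi> \<xi>)"
  have "pb (lin sc y') ?X \<xi> = 0" if y': "y' \<in> m" and \<xi>: "\<xi> \<in> Z" for \<xi> y'
  proof (rule invariant_infinitesimal[OF \<pi>_reg[OF X] _ Z_dual[OF \<xi>] y'])
    fix g assume g: "g \<in> M"
    have "\<pi> (coAd \<phi> g \<xi>) = \<pi> \<xi>" by (rule \<pi>_const[OF \<xi>]) (auto simp: orb_iff g)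
    then show "?X (coAd \<phi> g \<xi>) = ?X \<xi>" by (simp add: Z_dual \<xi> act_Z[OF g])
  qed
  then show "pb y ?X \<in> I" using y X by (auto simp: I_iff pb_in_reg \<pi>_reg lin_in_reg)
next
  fix \<xi> assume \<xi>: "\<xi> \<in> dual" and v: "\<And>X. X \<in> reg \<Longrightarrow> (\<And>\<eta>. \<eta> \<in> Z \<Longrightarrow> X (\<pi> \<eta>) = 0) \<Longrightarrow> X \<xi> = 0"
  define z where "z = sharp \<xi>"
  have z: "\<xi> = form z" using form_sharp[OF \<xi>] by (simp add: z_def)
  have "z - f \<in> s"
  \<comment> \<open>The slice is an affine subspace, cut out by the functions
    \<open>lin_shift sc chi y\<close> with \<open>y\<close> orthogonal to \<open>s\<close>.\<close>
  proof (rule double_perp[OF subspace_s])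
    fix y assume y: "\<And>w. w \<in> s \<Longrightarrow> form w y = 0"
    have "lin_shift sc chi y \<xi> = 0"
    proof (rule v[OF lin_shift_in_reg])
      fix \<eta> assume "\<eta> \<in> Z"
      then obtain w where w: "\<pi> \<eta> = form w" "w - f \<in> s" using \<pi>_slice by (auto simp: slice_def)
      show "lin_shift sc chi y (\<pi> \<eta>) = 0"
        using y[OF w(2)] by (simp add: w(1) lin_shift_def form_dual form_diff)
    qed
    then show "form (z - f) y = 0" using \<xi> by (simp add: lin_shift_def form_diff z)
  qed
  then show "\<xi> \<in> \<pi> ` Z" unfolding \<pi>_image slice_def z by blast
next
  fix y y' assume "y \<in> lin sc ` m" "y' \<in> lin sc ` m"
  then obtain x x' where x: "x \<in> m" "x' \<in> m" "y = lin sc x" "y' = lin sc x'" by blast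
  show "pb y y' \<in> I"
    unfolding x pb_lin_lin using x m_br f_br lin_in_reg by (simp add: I_iff lin_def Z_dual Z_val)
next
  show "I = {X \<in> reg. \<forall>\<xi>\<in>Z. X \<xi> = 0}" using I_vanishing by (simp add: sym_alg_simps)
  show "lin sc ` m \<subseteq> reg" using lin_in_reg by blast
qed ((rule moment_fibre_dual act_Z orb_self orb_eq \<pi>_reg \<pi>_orb \<pi>_const; assumption) | simp add: Z_dual)+

sublocale sr: slice_reduction DV Z M "coAd \<phi>" I "lin sc ` m" \<pi> "\<lambda>X. \<lambda>\<xi>\<in>dual. X (\<pi> \<xi>)"
  by (rule slice_reduction)

abbreviation "V1 \<equiv> slodowy_reduction sc br \<phi> chi m M"

lemma V1_eq: "V1 = sr.R" by (simp add: slodowy_reduction_def)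

lemma invs_iff: "X \<in> sr.invs \<longleftrightarrow> X \<in> reg \<and> (\<forall>y\<in>m. \<forall>\<xi>\<in>Z. pb (lin sc y) X \<xi> = 0)"
  unfolding sr.inv_iff by (simp add: DV_simps sym_alg_simps)

lemma invsI: "X \<in> reg \<Longrightarrow> (\<And>\<xi> g. \<xi> \<in> Z \<Longrightarrow> g \<in> M \<Longrightarrow> X (coAd \<phi> g \<xi>) = X \<xi>) \<Longrightarrow> X \<in> sr.invs"
  using invariant_infinitesimal Z_dual by (auto simp: invs_iff)

lemma invs_orb: "X \<in> sr.invs \<Longrightarrow> \<xi> \<in> Z \<Longrightarrow> \<eta> \<in> orb \<xi> \<Longrightarrow> X \<eta> = X \<xi>"
  using sr.inv_orbit by (simp add: DV_simps)

lemma V1_points: "points V1 = orb ` Z" by (simp add: V1_eq sr.R_points)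

lemma V1_carrier: "carrier (coord_alg V1) = (\<lambda>X. I +>\<^bsub>S\<^esub> X) ` sr.invs"
  unfolding V1_eq using sr.R_carrier by (simp add: DV_simps)

lemma V1_ev: "X \<in> sr.invs \<Longrightarrow> \<xi> \<in> Z \<Longrightarrow> evl V1 (I +>\<^bsub>S\<^esub> X) (orb \<xi>) = X \<xi>"
  unfolding V1_eq using sr.R_ev by (simp add: DV_simps)

lemma V1_pb: "X \<in> sr.invs \<Longrightarrow> Y \<in> sr.invs \<Longrightarrow>
    pbracket (coord_alg V1) (I +>\<^bsub>S\<^esub> X) (I +>\<^bsub>S\<^esub> Y) = I +>\<^bsub>S\<^esub> pb X Y"
  unfolding V1_eq using sr.R_ops(6) by (simp add: DV_simps sym_alg_simps)

lemma V1_affine: "affine_pv V1" unfolding V1_eq by (rule sr.R_affine)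

lemma cl_eq: "X \<in> reg \<Longrightarrow> Y \<in> reg \<Longrightarrow> (\<And>\<xi>. \<xi> \<in> Z \<Longrightarrow> X \<xi> = Y \<xi>) \<Longrightarrow> I +>\<^bsub>S\<^esub> X = I +>\<^bsub>S\<^esub> Y"
  using sr.cl_eq_iff by (simp add: DV_simps sym_alg_simps)

lemma cl_mem: "X \<in> reg \<Longrightarrow> Y \<in> I +>\<^bsub>S\<^esub> X \<longleftrightarrow> Y \<in> reg \<and> (\<forall>\<xi>\<in>Z. Y \<xi> = X \<xi>)"
  using sr.cl_iff by (simp add: DV_simps sym_alg_simps)

lemma ext_invs: "X \<in> reg \<Longrightarrow> (\<lambda>\<xi>\<in>dual. X (\<pi> \<xi>)) \<in> sr.invs"
  using sr.ext_in_inv by (simp add: DV_simps sym_alg_simps)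

subsection \<open>The slice as a Poisson variety\<close>

abbreviation "SV \<equiv> slice_variety slice (coord_alg V1)"
abbreviation "res \<equiv> slice_restriction slice"

lemma res_cl: "X \<in> sr.invs \<Longrightarrow> res (I +>\<^bsub>S\<^esub> X) = restrict X slice"
proof -
  assume X: "X \<in> sr.invs"
  have "(\<lambda>X. X \<xi>) ` (I +>\<^bsub>S\<^esub> X) = {X \<xi>}" if \<xi>: "\<xi> \<in> slice" for \<xi>
  proof -
    have Xr: "X \<in> reg" using X by (simp add: invs_iff)
    have "X \<in> I +>\<^bsub>S\<^esub> X" using Xr by (simp add: cl_mem[OF Xr])
    moreover have "Y \<xi> = X \<xi>" if "Y \<in> I +>\<^bsub>S\<^esub> X" for Y
      using subsetD[OF slice_Z \<xi>] that by (simp add: cl_mem[OF Xr])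
    ultimately show ?thesis by blast
  qed
  then show ?thesis unfolding slice_restriction_def by (intro restrict_ext) simp
qed

text \<open>A function on the slice extends to an invariant by composition with
  \<open>\<pi>\<close>, which fixes the slice pointwise.\<close>

lemma res_image: "res ` carrier (coord_alg V1) = regular_functions slice"
proof
  show "res ` carrier (coord_alg V1) \<subseteq> regular_functions slice"
  proof
    fix a assume "a \<in> res ` carrier (coord_alg V1)"
    then obtain X where X: "X \<in> sr.invs" "a = restrict X slice" by (auto simp: V1_carrier res_cl)
    then obtain F where "F \<in> poly_functions evals" "X = restrict F dual" using reg_poly[of X] by (auto simp: invs_iff)
    then have "a = restrict F slice" using X(2) by (simp add: dual_slice)
    then show "a \<in> regular_functions slice" using \<open>F \<in> _\<close> by (simp add: regular_functions_def)
  qed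
  show "regular_functions slice \<subseteq> res ` carrier (coord_alg V1)"
  proof
    fix a assume "a \<in> regular_functions slice"
    then obtain F where F: "F \<in> poly_functions evals" "a = restrict F slice" by (auto simp: regular_functions_def)
    define X where "X = (\<lambda>\<xi>\<in>dual. restrict F dual (\<pi> \<xi>))"
    have X: "X \<in> sr.invs" unfolding X_def by (rule ext_invs[OF poly_reg[OF F(1)]])
    have "restrict X slice = a"
      unfolding F(2) X_def restrict_restrict dual_slice by (rule restrict_ext) (simp add: \<pi>_fix subsetD[OF slice_dual])
    then have "a = res (I +>\<^bsub>S\<^esub> X)" using res_cl[OF X] by simp
    then show "a \<in> res ` carrier (coord_alg V1)" unfolding V1_carrier using X by blast
  qed
qed

lemma invs_ext_slice:
  assumes "X \<in> sr.invs" "Y \<in> sr.invs" "\<And>\<xi>. \<xi> \<in> slice \<Longrightarrow> X \<xi> = Y \<xi>" "\<xi> \<in> Z"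
  shows "X \<xi> = Y \<xi>"
  using invs_orb[OF assms(1,4) \<pi>_orb[OF assms(4)]] invs_orb[OF assms(2,4) \<pi>_orb[OF assms(4)]]
    assms(3)[OF \<pi>_slice[OF assms(4)]] by simp

lemma res_inj: "inj_on res (carrier (coord_alg V1))"
proof (rule inj_onI)
  fix B B' assume "B \<in> carrier (coord_alg V1)" "B' \<in> carrier (coord_alg V1)" and eq: "res B = res B'"
  then obtain X Y where X: "X \<in> sr.invs" "B = I +>\<^bsub>S\<^esub> X" and Y: "Y \<in> sr.invs" "B' = I +>\<^bsub>S\<^esub> Y"
    by (auto simp: V1_carrier)
  have "restrict X slice = restrict Y slice" using eq X Y by (simp add: res_cl)
  then have "X \<xi> = Y \<xi>" if "\<xi> \<in> slice" for \<xi> using that by (metis restrict_apply')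
  then show "B = B'" unfolding X(2) Y(2) using X(1) Y(1) invs_ext_slice by (intro cl_eq) (auto simp: invs_iff)
qed

lemma SV_simps: "points SV = slice" "evl SV a \<xi> = a \<xi>" "carrier (coord_alg SV) = regular_functions slice"
  by (simp_all add: slice_variety_def Let_def function_algebra_def)

lemma res_ops:
  "res \<one>\<^bsub>coord_alg V1\<^esub> = \<one>\<^bsub>coord_alg SV\<^esub>" "res \<zero>\<^bsub>coord_alg V1\<^esub> = \<zero>\<^bsub>coord_alg SV\<^esub>"
  "B \<in> carrier (coord_alg V1) \<Longrightarrow> B' \<in> carrier (coord_alg V1) \<Longrightarrow> res B \<oplus>\<^bsub>coord_alg SV\<^esub> res B' = res (B \<oplus>\<^bsub>coord_alg V1\<^esub> B')"
  "B \<in> carrier (coord_alg V1) \<Longrightarrow> B' \<in> carrier (coord_alg V1) \<Longrightarrow> res B \<otimes>\<^bsub>coord_alg SV\<^esub> res B' = res (B \<otimes>\<^bsub>coord_alg V1\<^esub> B')"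
  "B \<in> carrier (coord_alg V1) \<Longrightarrow> c \<odot>\<^bsub>coord_alg SV\<^esub> res B = res (c \<odot>\<^bsub>coord_alg V1\<^esub> B)"
  "B \<in> carrier (coord_alg V1) \<Longrightarrow> B' \<in> carrier (coord_alg V1) \<Longrightarrow>
    pbracket (coord_alg SV) (res B) (res B') = res (pbracket (coord_alg V1) B B')"
proof -
  have sd: "\<xi> \<in> slice \<Longrightarrow> \<xi> \<in> dual" for \<xi> using slice_Z Z_dual by blast
  have ops: "\<one>\<^bsub>coord_alg V1\<^esub> = I +>\<^bsub>S\<^esub> (\<lambda>\<xi>\<in>dual. 1)" "\<zero>\<^bsub>coord_alg V1\<^esub> = I +>\<^bsub>S\<^esub> (\<lambda>\<xi>\<in>dual. 0)"
    "X \<in> sr.invs \<Longrightarrow> Y \<in> sr.invs \<Longrightarrow> (I +>\<^bsub>S\<^esub> X) \<oplus>\<^bsub>coord_alg V1\<^esub> (I +>\<^bsub>S\<^esub> Y) = I +>\<^bsub>S\<^esub> (\<lambda>\<xi>\<in>dual. X \<xi> + Y \<xi>)"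
    "X \<in> sr.invs \<Longrightarrow> Y \<in> sr.invs \<Longrightarrow> (I +>\<^bsub>S\<^esub> X) \<otimes>\<^bsub>coord_alg V1\<^esub> (I +>\<^bsub>S\<^esub> Y) = I +>\<^bsub>S\<^esub> (\<lambda>\<xi>\<in>dual. X \<xi> * Y \<xi>)"
    "X \<in> sr.invs \<Longrightarrow> c \<odot>\<^bsub>coord_alg V1\<^esub> (I +>\<^bsub>S\<^esub> X) = I +>\<^bsub>S\<^esub> (\<lambda>\<xi>\<in>dual. c * X \<xi>)" for X Y c
    unfolding V1_eq using sr.R_ops(1-5) by (simp_all add: DV_simps sym_alg_simps)
  have cl: "(\<lambda>\<xi>\<in>dual. 1) \<in> sr.invs" "(\<lambda>\<xi>\<in>dual. 0) \<in> sr.invs"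
    "X \<in> sr.invs \<Longrightarrow> Y \<in> sr.invs \<Longrightarrow> (\<lambda>\<xi>\<in>dual. X \<xi> + Y \<xi>) \<in> sr.invs"
    "X \<in> sr.invs \<Longrightarrow> Y \<in> sr.invs \<Longrightarrow> (\<lambda>\<xi>\<in>dual. X \<xi> * Y \<xi>) \<in> sr.invs"
    "X \<in> sr.invs \<Longrightarrow> (\<lambda>\<xi>\<in>dual. c * X \<xi>) \<in> sr.invs" for X Y c
    using sr.inv_one sr.inv_smult[OF sr.inv_one, of 0] sr.inv_add sr.inv_mult sr.inv_smult
    by (simp_all add: DV_simps sym_alg_simps cong: restrict_cong)
  show "res \<one>\<^bsub>coord_alg V1\<^esub> = \<one>\<^bsub>coord_alg SV\<^esub>" "res \<zero>\<^bsub>coord_alg V1\<^esub> = \<zero>\<^bsub>coord_alg SV\<^esub>"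
    unfolding ops res_cl[OF cl(1)] res_cl[OF cl(2)] slice_variety_def Let_def function_algebra_def
    by (simp_all add: sd cong: restrict_cong)
  assume "B \<in> carrier (coord_alg V1)"
  then obtain X where X: "X \<in> sr.invs" "B = I +>\<^bsub>S\<^esub> X" by (auto simp: V1_carrier)
  show "c \<odot>\<^bsub>coord_alg SV\<^esub> res B = res (c \<odot>\<^bsub>coord_alg V1\<^esub> B)"
    unfolding X(2) ops(5)[OF X(1)] res_cl[OF X(1)] res_cl[OF cl(5)[OF X(1)]] slice_variety_def Let_def function_algebra_def
    by (simp add: sd cong: restrict_cong)
  assume "B' \<in> carrier (coord_alg V1)"
  then obtain Y where Y: "Y \<in> sr.invs" "B' = I +>\<^bsub>S\<^esub> Y" by (auto simp: V1_carrier)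
  show "res B \<oplus>\<^bsub>coord_alg SV\<^esub> res B' = res (B \<oplus>\<^bsub>coord_alg V1\<^esub> B')"
    unfolding X(2) Y(2) ops(3)[OF X(1) Y(1)] res_cl[OF X(1)] res_cl[OF Y(1)] res_cl[OF cl(3)[OF X(1) Y(1)]] slice_variety_def Let_def function_algebra_def
    by (simp add: sd cong: restrict_cong)
  show "res B \<otimes>\<^bsub>coord_alg SV\<^esub> res B' = res (B \<otimes>\<^bsub>coord_alg V1\<^esub> B')"
    unfolding X(2) Y(2) ops(4)[OF X(1) Y(1)] res_cl[OF X(1)] res_cl[OF Y(1)] res_cl[OF cl(4)[OF X(1) Y(1)]] slice_variety_def Let_def function_algebra_def
    by (simp add: sd cong: restrict_cong)
  show "pbracket (coord_alg SV) (res B) (res B') = res (pbracket (coord_alg V1) B B')"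
    using \<open>B \<in> carrier (coord_alg V1)\<close> \<open>B' \<in> carrier (coord_alg V1)\<close>
    by (simp add: slice_variety_def Let_def function_algebra_def inv_into_f_f[OF res_inj])
qed

lemma SV_poisson: "poisson_algebra (coord_alg SV)"
proof -
  interpret V: affine_pv V1 by (rule V1_affine)
  show ?thesis
    by (rule poisson_algebra_image[where h = res and D = "carrier (coord_alg V1)", OF V.poisson])
      (simp_all add: res_ops res_image SV_simps V.smult_closed V.A.pb_closed)
qed

lemma SV_affine: "affine_pv SV"
proof (rule closed_subvariety_affine[where E = "\<lambda>X. restrict X slice" and \<tau> = "\<lambda>\<xi>. \<xi>", OF DV_affine])
  have sd: "\<xi> \<in> slice \<Longrightarrow> \<xi> \<in> dual" for \<xi> using slice_Z Z_dual by blast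
  show "faithful_pv SV"
  proof (rule faithful_pv.intro[OF SV_poisson])
    show "a = \<zero>\<^bsub>coord_alg SV\<^esub>" if a: "a \<in> carrier (coord_alg SV)" and z: "\<And>p. p \<in> points SV \<Longrightarrow> evl SV a p = 0" for a
    proof -
      obtain F where F: "a = restrict F slice" using a unfolding SV_simps regular_functions_def by blast
      have "F \<xi> = 0" if "\<xi> \<in> slice" for \<xi> using z[of \<xi>] that by (simp add: SV_simps F)
      then have "a = (\<lambda>\<xi>\<in>slice. 0)" unfolding F by (rule restrict_ext)
      then show ?thesis by (simp add: slice_variety_def Let_def function_algebra_def)
    qed
    show "(\<lambda>a. evl SV a \<xi>) \<in> complex_characters (coord_alg SV)" if "\<xi> \<in> points SV" for \<xi>
      using that unfolding complex_characters_def
      by (auto simp: slice_variety_def Let_def function_algebra_def intro!: ring_hom_memI) (simp_all add: complex_ring_def)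
  qed
  show "(\<lambda>X. restrict X slice) ` carrier (coord_alg DV) = carrier (coord_alg SV)"
  proof -
    have "restrict (restrict F dual) slice = restrict F slice" for F :: "('g \<Rightarrow> complex) \<Rightarrow> complex"
      by (rule restrict_ext) (simp add: sd)
    then show ?thesis by (simp add: SV_simps DV_simps sym_alg_simps regular_functions_def image_image)
  qed
  show "\<xi> \<in> points DV" if "\<xi> \<in> points SV" for \<xi> using that sd by (simp add: SV_simps DV_simps)
  fix \<xi> assume \<xi>: "\<xi> \<in> points DV" and v: "\<And>X. X \<in> carrier (coord_alg DV) \<Longrightarrow> (\<And>\<eta>. \<eta> \<in> points SV \<Longrightarrow> evl DV X \<eta> = 0) \<Longrightarrow> evl DV X \<xi> = 0"
  have "\<xi> \<in> \<pi> ` Z"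
  proof (rule sr.slice_closed[OF \<xi>], rule v)
    fix X \<eta> assume X: "\<And>r. r \<in> Z \<Longrightarrow> evl DV X (\<pi> r) = 0" and "\<eta> \<in> points SV"
    then have "\<eta> \<in> \<pi> ` Z" by (simp add: SV_simps \<pi>_image)
    then show "evl DV X \<eta> = 0" using X by blast
  qed
  then show "\<xi> \<in> (\<lambda>\<xi>. \<xi>) ` points SV" by (simp add: SV_simps \<pi>_image)
qed (auto simp: SV_simps DV_simps)

text \<open>The Gan-Ginzburg isomorphism for varieties: an orbit goes to its slice point, and the
  comorphism inverts restriction. Brackets agree because the one on the slice was transported along
  restriction.\<close>

lemma V1_SV_iso: "\<exists>\<iota> \<psi>. pvariety_iso V1 SV \<iota> \<psi>"
proof -
  have "pvariety_iso V1 SV sr.rep (inv_into (carrier (coord_alg V1)) res)"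
  proof (rule pvariety_isoI[OF V1_affine SV_affine])
    have rep: "sr.rep (orb \<xi>) = \<pi> \<xi>" if "\<xi> \<in> Z" for \<xi> using sr.rep[OF that] .
    have inv: "inv_into (carrier (coord_alg V1)) res (restrict X slice) = I +>\<^bsub>S\<^esub> X" if "X \<in> sr.invs" for X
      using inv_into_f_f[OF res_inj, of "I +>\<^bsub>S\<^esub> X"] that by (simp add: res_cl V1_carrier)
    have elem: "\<exists>X\<in>sr.invs. a = restrict X slice" if "a \<in> carrier (coord_alg SV)" for a
      using that unfolding SV_simps res_image[symmetric] by (auto simp: V1_carrier res_cl)
    show "bij_betw sr.rep (points V1) (points SV)"
    proof (rule bij_betw_imageI)
      show "inj_on sr.rep (points V1)"
        unfolding V1_points
      proof (rule inj_onI)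
        fix Q Q' assume "Q \<in> orb ` Z" "Q' \<in> orb ` Z" "sr.rep Q = sr.rep Q'"
        then obtain p p' where "p \<in> Z" "p' \<in> Z" "Q = orb p" "Q' = orb p'" "\<pi> p = \<pi> p'" by (auto simp: rep)
        then show "Q = Q'" using orb_eq[OF \<pi>_orb] by metis
      qed
      show "sr.rep ` points V1 = points SV"
      proof -
        have "sr.rep ` orb ` Z = \<pi> ` Z" unfolding image_image by (rule image_cong) (simp_all add: rep)
        then show ?thesis by (simp only: V1_points SV_simps \<pi>_image)
      qed
    qed
    fix a assume "a \<in> carrier (coord_alg SV)"
    then obtain X where X: "X \<in> sr.invs" "a = restrict X slice" using elem by blast
    show "inv_into (carrier (coord_alg V1)) res a \<in> carrier (coord_alg V1)"
    proof -
      have "I +>\<^bsub>S\<^esub> X \<in> carrier (coord_alg V1)" unfolding V1_carrier using X(1) by blast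
      then show ?thesis using inv[OF X(1)] X(2) by (simp only:)
    qed
    show "evl V1 (inv_into (carrier (coord_alg V1)) res a) Q = evl SV a (sr.rep Q)" if Q: "Q \<in> points V1" for Q
    proof -
      obtain \<xi> where \<xi>: "\<xi> \<in> Z" "Q = orb \<xi>" using Q by (auto simp: V1_points)
      then show ?thesis using X invs_orb[OF X(1) \<xi>(1) \<pi>_orb[OF \<xi>(1)]]
        by (simp add: inv V1_ev SV_simps rep \<pi>_slice)
    qed
    fix b Q assume "b \<in> carrier (coord_alg SV)" and Q: "Q \<in> points V1"
    then obtain Y where Y: "Y \<in> sr.invs" "b = restrict Y slice" using elem by blast
    obtain \<xi> where \<xi>: "\<xi> \<in> Z" "Q = orb \<xi>" using Q by (auto simp: V1_points)
    have XY: "pb X Y \<in> sr.invs" using sr.inv_pb[OF X(1) Y(1)] by (simp add: DV_simps sym_alg_simps)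
    have "pbracket (coord_alg SV) a b = restrict (pb X Y) slice"
      using res_ops(6)[of "I +>\<^bsub>S\<^esub> X" "I +>\<^bsub>S\<^esub> Y"] X Y XY by (simp add: V1_carrier res_cl V1_pb)
    then show "evl V1 (pbracket (coord_alg V1) (inv_into (carrier (coord_alg V1)) res a) (inv_into (carrier (coord_alg V1)) res b)) Q
        = evl SV (pbracket (coord_alg SV) a b) (sr.rep Q)"
      using X Y \<xi> XY invs_orb[OF XY \<xi>(1) \<pi>_orb[OF \<xi>(1)]]
      by (simp add: inv V1_pb V1_ev SV_simps rep \<pi>_slice)
  next
    fix F assume "F \<in> carrier (coord_alg V1)"
    then obtain X where X: "X \<in> sr.invs" "F = I +>\<^bsub>S\<^esub> X" by (auto simp: V1_carrier)
    have "restrict X slice \<in> carrier (coord_alg SV)"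
      unfolding SV_simps res_image[symmetric] using X(1) by (auto simp: V1_carrier res_cl[symmetric])
    moreover have "evl V1 F Q = evl SV (restrict X slice) (sr.rep Q)" if Q: "Q \<in> points V1" for Q
    proof -
      obtain \<xi> where \<xi>: "\<xi> \<in> Z" "Q = orb \<xi>" using Q by (auto simp: V1_points)
      then show ?thesis using X invs_orb[OF X(1) \<xi>(1) \<pi>_orb[OF \<xi>(1)]]
        by (simp add: V1_ev SV_simps sr.rep \<pi>_slice)
    qed
    ultimately show "\<exists>a\<in>carrier (coord_alg SV). \<forall>Q\<in>points V1. evl V1 F Q = evl SV a (sr.rep Q)" by blast
  qed
  then show ?thesis by blast
qed

end

section \<open>Regularity of the coadjoint action and derivatives along arbitrary curves in the
  group\<close>

lemma poly_functions_prod: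
  assumes "finite I" "\<And>i. i \<in> I \<Longrightarrow> F i \<in> poly_functions C"
  shows "(\<lambda>p. \<Prod>i\<in>I. F i p) \<in> poly_functions C"
  using assms by (induction I rule: finite_induct) (auto intro: poly_functions.intros)

lemma matrix_polys_det:
  assumes "\<And>i j. (\<lambda>A. h A $ i $ j) \<in> matrix_polys"
  shows "(\<lambda>A. det (h A)) \<in> matrix_polys"
  unfolding det_def matrix_polys_def
  by (intro poly_functions_sum poly_functions.mult poly_functions.const poly_functions_prod)
    (use assms in \<open>simp_all add: matrix_polys_def finite_permutations\<close>)

text \<open>By Cramer's rule the inverse is differentiable; its derivative is then read off from \<open>\<gamma> \<delta> = 1\<close>.\<close>

lemma mderiv_inverse:
  fixes \<gamma> :: "complex \<Rightarrow> complex^'n^'n"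
  assumes \<gamma>: "mderiv \<gamma> X 0" "\<gamma> 0 = mat 1" and inv: "\<And>t. \<gamma> t ** \<delta> t = mat 1"
  shows "mderiv \<delta> (- X) 0"
proof -
  have det: "det (\<gamma> t) \<noteq> 0" for t
  proof
    assume "det (\<gamma> t) = 0"
    then have "det (\<gamma> t ** \<delta> t) = 0" by (simp add: det_mul)
    then show False by (simp add: inv)
  qed
  define h :: "'n \<Rightarrow> 'n \<Rightarrow> complex^'n^'n \<Rightarrow> complex^'n^'n" where
    "h k j A = (\<chi> i l. if l = k then axis j 1 $ i else A $ i $ l)" for k j A
  have entry: "\<delta> t $ k $ j = det (h k j (\<gamma> t)) / det (\<gamma> t)" for t k j
  proof -
    have "\<gamma> t *v (\<delta> t *v axis j 1) = axis j 1" by (simp add: matrix_vector_mul_assoc inv)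
    then have "\<delta> t *v axis j 1 = (\<chi> k. det (h k j (\<gamma> t)) / det (\<gamma> t))"
      unfolding cramer[OF det] h_def .
    from arg_cong[OF this, of "\<lambda>v. v $ k"] show ?thesis by (simp add: matrix_vector_mult_def axis_def if_distrib cong: if_cong)
  qed
  have polys: "(\<lambda>A. det (h k j A)) \<in> matrix_polys" "(\<lambda>A::complex^'n^'n. det A) \<in> matrix_polys" for k j
  proof -
    show "(\<lambda>A. det (h k j A)) \<in> matrix_polys"
    proof (rule matrix_polys_det)
      show "(\<lambda>A. h k j A $ i $ l) \<in> matrix_polys" for i l
        by (cases "l = k") (simp_all add: h_def matrix_polys_const matrix_polys_entry)
    qed
    show "(\<lambda>A::complex^'n^'n. det A) \<in> matrix_polys"
      by (rule matrix_polys_det[of "\<lambda>A. A"]) (rule matrix_polys_entry)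
  qed
  have diff: "\<exists>c. ((\<lambda>t. P (\<gamma> t)) has_field_derivative c) (at 0)" if "P \<in> matrix_polys" for P
    using matrix_polys_deriv[OF that] \<gamma>(1) by blast
  have "\<exists>c. ((\<lambda>t. \<delta> t $ k $ j) has_field_derivative c) (at 0)" for k j
  proof -
    obtain a b where "((\<lambda>t. det (h k j (\<gamma> t))) has_field_derivative a) (at 0)" "((\<lambda>t. det (\<gamma> t)) has_field_derivative b) (at 0)"
      using diff[OF polys(1)] diff[OF polys(2)] by blast
    from DERIV_divide[OF this det] show ?thesis unfolding entry by blast
  qed
  then obtain c where c: "\<And>k j. ((\<lambda>t. \<delta> t $ k $ j) has_field_derivative c k j) (at 0)" by metis
  define D where "D = (\<chi> k j. c k j)"
  have D: "mderiv \<delta> D 0" using c by (simp add: mderiv_def D_def)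
  have \<delta>0: "\<delta> 0 = mat 1" using inv[of 0] by (simp add: \<gamma>(2))
  have "mderiv (\<lambda>t. \<gamma> t ** \<delta> t) (X + D) 0" using mderiv_mult[OF \<gamma>(1) D] by (simp add: \<gamma>(2) \<delta>0)
  then have "mderiv (\<lambda>t. mat 1) (X + D) 0" by (simp add: inv)
  then have "(X + D) $ i $ j = 0" for i j
    using mderiv_const[of "mat 1 :: complex^'n^'n" 0] DERIV_unique unfolding mderiv_def by fastforce
  then have "X + D = 0" by (simp add: vec_eq_iff)
  then have "D = - X" by (simp add: eq_neg_iff_add_eq_0 add.commute)
  then show ?thesis using D by simp
qed

context lie_group
begin

definition unit_matrix :: "'n \<Rightarrow> 'n \<Rightarrow> complex^'n^'n" where
  "unit_matrix k l = (\<chi> i j. if i = k \<and> j = l then 1 else 0)"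

lemma unit_matrix_expand: "A = (\<Sum>k\<in>UNIV. \<Sum>l\<in>UNIV. mscale (A $ k $ l) (unit_matrix k l))"
proof -
  have "(\<Sum>k\<in>UNIV. \<Sum>l\<in>UNIV. mscale (A $ k $ l) (unit_matrix k l)) $ i $ j = A $ i $ j" for i j
  proof -
    have "(\<Sum>k\<in>UNIV. \<Sum>l\<in>UNIV. mscale (A $ k $ l) (unit_matrix k l)) $ i $ j
      = (\<Sum>k\<in>UNIV. \<Sum>l\<in>UNIV. A $ k $ l * (if i = k \<and> j = l then 1 else 0))"
      by (simp add: unit_matrix_def)
    also have "\<dots> = (\<Sum>k\<in>UNIV. if i = k then A $ k $ j else 0)"
      by (rule sum.cong[OF refl]) (auto simp: if_distrib cong: if_cong)
    finally show ?thesis by simp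
  qed
  then show ?thesis by (simp add: vec_eq_iff)
qed

text \<open>A linear left inverse of \<open>\<phi>\<close>, defined on all matrices, expresses
  \<open>\<xi> x\<close> through the entries of \<open>\<phi> x\<close> and values of
  \<open>\<xi>\<close> at fixed elements. Regularity and differentiability in the group variable can
  then be read off from entries.\<close>

lemma matrix_coefficients:
  "\<exists>\<psi>. \<forall>\<xi>\<in>dual. \<forall>x. \<xi> x = (\<Sum>k\<in>UNIV. \<Sum>l\<in>UNIV. \<phi> x $ k $ l * \<xi> (\<psi> k l))"
proof -
  interpret vp: vector_space_pair sc "mscale :: complex \<Rightarrow> complex^'n^'n \<Rightarrow> complex^'n^'n"
    by (intro vector_space_pair.intro vector_space_axioms vector_space_mscale)
  have "Vector_Spaces.linear sc mscale \<phi>" "inj \<phi>" using ident by (auto simp: lie_algebra_identification_def)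
  then obtain \<psi> where \<psi>: "Vector_Spaces.linear mscale sc \<psi>" "\<psi> \<circ> \<phi> = id"
    using vp.linear_injective_left_inverse by blast
  have \<psi>_lin: "\<psi> (A + B) = \<psi> A + \<psi> B" "\<psi> (mscale c A) = sc c (\<psi> A)" for A B c
    using \<psi>(1) by (simp_all add: Vector_Spaces.linear_iff)
  have \<psi>0: "\<psi> 0 = 0" using \<psi>_lin(2)[of 0 0] by (simp add: vec_eq_iff mscale_def zero_vec_def)
  have \<psi>_sum: "\<psi> (sum F I) = (\<Sum>i\<in>I. \<psi> (F i))" for F and I :: "'n set"
    by (induction I rule: infinite_finite_induct) (simp_all add: \<psi>0 \<psi>_lin)
  have "\<xi> x = (\<Sum>k\<in>UNIV. \<Sum>l\<in>UNIV. \<phi> x $ k $ l * \<xi> (\<psi> (unit_matrix k l)))" if \<xi>: "\<xi> \<in> dual" for \<xi> x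
  proof -
    have "x = \<psi> (\<phi> x)" using \<psi>(2) by (simp add: fun_eq_iff)
    also have "\<dots> = (\<Sum>k\<in>UNIV. \<Sum>l\<in>UNIV. sc (\<phi> x $ k $ l) (\<psi> (unit_matrix k l)))"
      by (subst unit_matrix_expand[of "\<phi> x"]) (simp only: \<psi>_sum \<psi>_lin)
    finally have "\<xi> x = \<xi> (\<Sum>k\<in>UNIV. \<Sum>l\<in>UNIV. sc (\<phi> x $ k $ l) (\<psi> (unit_matrix k l)))" by simp
    then show ?thesis using \<xi> by (simp add: dual_sum dual_iff)
  qed
  then show ?thesis by (intro exI[of _ "\<lambda>k l. \<psi> (unit_matrix k l)"] ballI allI)
qed

text \<open>Regularity in the group element and the point jointly, as a finite sum of products. With
  lists, sums become concatenations and products become \<open>List.product\<close>.\<close>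

definition separated :: "(complex^'n^'n \<Rightarrow> ('g \<Rightarrow> complex) \<Rightarrow> complex) \<Rightarrow> bool" where
  "separated h \<longleftrightarrow> (\<exists>xs. (\<forall>(a, b)\<in>set xs. a \<in> GL_regular_functions \<and> b \<in> reg) \<and>
    (\<forall>g\<in>G. \<forall>\<xi>\<in>dual. h g \<xi> = (\<Sum>(a, b)\<leftarrow>xs. a g * b \<xi>)))"

lemma separated_add: "separated h \<Longrightarrow> separated k \<Longrightarrow> separated (\<lambda>g \<xi>. h g \<xi> + k g \<xi>)"
proof -
  assume "separated h" "separated k"
  then obtain xs ys where "\<forall>(a, b)\<in>set xs. a \<in> GL_regular_functions \<and> b \<in> reg"
    "\<forall>(a, b)\<in>set ys. a \<in> GL_regular_functions \<and> b \<in> reg"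
    "\<forall>g\<in>G. \<forall>\<xi>\<in>dual. h g \<xi> = (\<Sum>(a, b)\<leftarrow>xs. a g * b \<xi>)"
    "\<forall>g\<in>G. \<forall>\<xi>\<in>dual. k g \<xi> = (\<Sum>(a, b)\<leftarrow>ys. a g * b \<xi>)"
    unfolding separated_def by (elim exE conjE)
  then show ?thesis unfolding separated_def by (intro exI[of _ "xs @ ys"]) (simp add: ball_Un)
qed

lemma sum_list_product:
  fixes F :: "'x \<Rightarrow> complex" and H :: "'y \<Rightarrow> complex"
  shows "sum_list (map F xs) * sum_list (map H ys) = (\<Sum>z\<leftarrow>List.product xs ys. F (fst z) * H (snd z))"
proof (induction xs)
  case (Cons x xs)
  have "(\<Sum>y\<leftarrow>ys. F x * H y) = F x * sum_list (map H ys)" by (simp add: sum_list_const_mult)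
  then show ?case using Cons by (simp add: distrib_right comp_def)
qed simp

lemma separated_mult: "separated h \<Longrightarrow> separated k \<Longrightarrow> separated (\<lambda>g \<xi>. h g \<xi> * k g \<xi>)"
proof -
  assume "separated h" "separated k"
  then obtain xs ys where *: "\<forall>(a, b)\<in>set xs. a \<in> GL_regular_functions \<and> b \<in> reg"
    "\<forall>(a, b)\<in>set ys. a \<in> GL_regular_functions \<and> b \<in> reg"
    "\<forall>g\<in>G. \<forall>\<xi>\<in>dual. h g \<xi> = (\<Sum>(a, b)\<leftarrow>xs. a g * b \<xi>)"
    "\<forall>g\<in>G. \<forall>\<xi>\<in>dual. k g \<xi> = (\<Sum>(a, b)\<leftarrow>ys. a g * b \<xi>)"
    unfolding separated_def by (elim exE conjE)
  let ?zs = "map (\<lambda>z. (\<lambda>g. fst (fst z) g * fst (snd z) g, \<lambda>\<xi>\<in>dual. snd (fst z) \<xi> * snd (snd z) \<xi>)) (List.product xs ys)"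
  have "\<forall>(a, b)\<in>set ?zs. a \<in> GL_regular_functions \<and> b \<in> reg"
  proof
    fix z assume "z \<in> set ?zs"
    then obtain x y where xy: "x \<in> set xs" "y \<in> set ys" "z = (\<lambda>g. fst x g * fst y g, \<lambda>\<xi>\<in>dual. snd x \<xi> * snd y \<xi>)"
      by auto
    have "fst x \<in> GL_regular_functions" "snd x \<in> reg" "fst y \<in> GL_regular_functions" "snd y \<in> reg"
      using *(1,2) xy(1,2) by (auto simp: case_prod_beta)
    then show "case z of (a, b) \<Rightarrow> a \<in> GL_regular_functions \<and> b \<in> reg"
      unfolding xy(3) GL_regular_functions_def by (simp add: poly_functions.mult mult_in_reg)
  qed
  moreover have "h g \<xi> * k g \<xi> = (\<Sum>(a, b)\<leftarrow>?zs. a g * b \<xi>)" if "g \<in> G" "\<xi> \<in> dual" for g \<xi>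
  proof -
    have "h g \<xi> * k g \<xi> = (\<Sum>x\<leftarrow>xs. fst x g * snd x \<xi>) * (\<Sum>y\<leftarrow>ys. fst y g * snd y \<xi>)"
      using *(3,4) that by (simp add: case_prod_unfold)
    also have "\<dots> = (\<Sum>z\<leftarrow>List.product xs ys. (fst (fst z) g * snd (fst z) \<xi>) * (fst (snd z) g * snd (snd z) \<xi>))"
      by (rule sum_list_product)
    finally show ?thesis using that by (simp add: comp_def case_prod_unfold mult_ac)
  qed
  ultimately show ?thesis unfolding separated_def by blast
qed

lemma separated_single: "a \<in> GL_regular_functions \<Longrightarrow> b \<in> reg \<Longrightarrow>
    (\<And>g \<xi>. g \<in> G \<Longrightarrow> \<xi> \<in> dual \<Longrightarrow> h g \<xi> = a g * b \<xi>) \<Longrightarrow> separated h"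
  unfolding separated_def by (intro exI[of _ "[(a, b)]"]) simp

lemma separated_sum: "finite J \<Longrightarrow> (\<And>j. j \<in> J \<Longrightarrow> separated (h j)) \<Longrightarrow> separated (\<lambda>g \<xi>. \<Sum>j\<in>J. h j g \<xi>)"
proof (induction J rule: finite_induct)
  case empty show ?case unfolding separated_def by (intro exI[of _ "[]"]) simp
qed (simp add: separated_add)

lemma separated_cong: "separated h \<Longrightarrow> (\<And>g \<xi>. g \<in> G \<Longrightarrow> \<xi> \<in> dual \<Longrightarrow> k g \<xi> = h g \<xi>) \<Longrightarrow> separated k"
  unfolding separated_def by auto

lemma GL_entry: "(\<lambda>A. A $ i $ j) \<in> GL_regular_functions" "(\<lambda>A. matrix_inv A $ i $ j) \<in> GL_regular_functions"
  unfolding GL_regular_functions_def by (rule poly_functions.coord; blast)+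

text \<open>For linear functions it holds because the entries of
  \<open>matrix_inv g ** \<phi> x ** g\<close> are regular in \<open>g\<close>; sums and products
  follow.\<close>

lemma separated_coAd: "X \<in> reg \<Longrightarrow> separated (\<lambda>g \<xi>. X (coAd \<phi> g \<xi>))"
proof (induction rule: reg_induct)
  case (const c)
  show ?case
    by (rule separated_single[of "\<lambda>_. c" "\<lambda>\<xi>\<in>dual. 1"])
      (simp_all add: GL_regular_functions_def poly_functions.const const_in_reg coAd_dual)
next
  case (lin x)
  obtain \<psi> where \<psi>: "\<forall>\<xi>\<in>dual. \<forall>x. \<xi> x = (\<Sum>k\<in>UNIV. \<Sum>l\<in>UNIV. \<phi> x $ k $ l * \<xi> (\<psi> k l))"
    using matrix_coefficients by blast
  have "separated (\<lambda>g \<xi>. \<Sum>k\<in>UNIV. \<Sum>l\<in>UNIV. (matrix_inv g ** \<phi> x ** g) $ k $ l * \<xi> (\<psi> k l))"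
  proof (intro separated_sum finite)
    fix k l
    have "(\<lambda>g. (matrix_inv g ** \<phi> x ** g) $ k $ l) \<in> GL_regular_functions"
      unfolding matrix_matrix_mult_def vec_lambda_beta using GL_entry unfolding GL_regular_functions_def
      by (intro poly_functions_sum poly_functions.mult poly_functions.const finite_UNIV finite)
    then show "separated (\<lambda>g \<xi>. (matrix_inv g ** \<phi> x ** g) $ k $ l * \<xi> (\<psi> k l))"
      by (rule separated_single[OF _ lin_in_reg[of "\<psi> k l"]]) (simp add: lin_def)
  qed
  then show ?case
  proof (rule separated_cong)
    fix g \<xi> assume g: "g \<in> G" and \<xi>: "\<xi> \<in> dual"
    have "lin sc x (coAd \<phi> g \<xi>) = \<xi> (Ad \<phi> (matrix_inv g) x)" using coAd_dual[OF g \<xi>] by (simp add: lin_def) (simp add: coAd_def)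
    also have "\<dots> = (\<Sum>k\<in>UNIV. \<Sum>l\<in>UNIV. \<phi> (Ad \<phi> (matrix_inv g) x) $ k $ l * \<xi> (\<psi> k l))" using \<psi> \<xi> by blast
    finally show "lin sc x (coAd \<phi> g \<xi>) = (\<Sum>k\<in>UNIV. \<Sum>l\<in>UNIV. (matrix_inv g ** \<phi> x ** g) $ k $ l * \<xi> (\<psi> k l))"
      unfolding \<phi>_Ad[OF G_inv[OF g]] G_inv_inv[OF g] .
  qed
next
  case (add F H)
  show ?case by (rule separated_cong[OF separated_add[OF add.IH]]) (simp add: coAd_dual)
next
  case (mult F H)
  show ?case by (rule separated_cong[OF separated_mult[OF mult.IH]]) (simp add: coAd_dual)
qed

lemma separatedE:
  assumes "separated h"
  obtains n :: nat and a b where "\<And>i. i < n \<Longrightarrow> a i \<in> GL_regular_functions" "\<And>i. i < n \<Longrightarrow> b i \<in> reg"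
    "\<And>g \<xi>. g \<in> G \<Longrightarrow> \<xi> \<in> dual \<Longrightarrow> h g \<xi> = (\<Sum>i<n. a i g * b i \<xi>)"
proof -
  obtain xs where xs: "\<forall>(a, b)\<in>set xs. a \<in> GL_regular_functions \<and> b \<in> reg"
    "\<forall>g\<in>G. \<forall>\<xi>\<in>dual. h g \<xi> = (\<Sum>(a, b)\<leftarrow>xs. a g * b \<xi>)" using assms unfolding separated_def by blast
  show ?thesis
  proof (rule that[of "length xs" "\<lambda>i. fst (xs ! i)" "\<lambda>i. snd (xs ! i)"])
    fix i assume "i < length xs"
    then have "xs ! i \<in> set xs" by simp
    then show "fst (xs ! i) \<in> GL_regular_functions" "snd (xs ! i) \<in> reg" using xs(1) by (auto simp: case_prod_beta)
  next
    fix g \<xi> assume "g \<in> G" "\<xi> \<in> dual"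
    then show "h g \<xi> = (\<Sum>i<length xs. fst (xs ! i) g * snd (xs ! i) \<xi>)"
      using xs(2) by (simp add: sum_list_sum_nth atLeast0LessThan case_prod_beta)
  qed
qed

text \<open>The moment map condition quantifies over all curves in the group with the given
  velocity, not just one-parameter subgroups. Differentiating the adjoint action brings in the
  inverse of the curve, which \<open>mderiv_inverse\<close> handles.\<close>

lemma coAd_tangent_deriv:
  assumes \<gamma>: "\<And>t. \<gamma> t \<in> G" "\<gamma> 0 = mat 1" "mderiv \<gamma> (\<phi> y) 0" and X: "X \<in> reg" and \<xi>: "\<xi> \<in> dual"
  shows "((\<lambda>t. X (coAd \<phi> (\<gamma> t) \<xi>)) has_field_derivative - pb (lin sc y) X \<xi>) (at 0)"
proof -
  obtain \<psi> where \<psi>: "\<forall>\<xi>\<in>dual. \<forall>x. \<xi> x = (\<Sum>k\<in>UNIV. \<Sum>l\<in>UNIV. \<phi> x $ k $ l * \<xi> (\<psi> k l))"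
    using matrix_coefficients by blast
  have inv: "mderiv (\<lambda>t. matrix_inv (\<gamma> t)) (- \<phi> y) 0"
    by (rule mderiv_inverse[OF \<gamma>(3,2)]) (rule G_inverse(1)[OF \<gamma>(1)])
  have c0: "coAd \<phi> (\<gamma> 0) \<xi> = \<xi>" by (simp add: \<gamma>(2) coAd_one)
  have \<eta>: "(\<lambda>w. - \<xi> (br y w)) \<in> dual"
    using \<xi> by (simp add: dual_iff br_add_right br_scale_right)
  have "((\<lambda>t. coAd \<phi> (\<gamma> t) \<xi> w) has_field_derivative - \<xi> (br y w)) (at 0)" for w
  proof -
    have e: "coAd \<phi> (\<gamma> t) \<xi> w = (\<Sum>k\<in>UNIV. \<Sum>l\<in>UNIV. (matrix_inv (\<gamma> t) ** \<phi> w ** \<gamma> t) $ k $ l * \<xi> (\<psi> k l))" for t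
    proof -
      have "coAd \<phi> (\<gamma> t) \<xi> w = (\<Sum>k\<in>UNIV. \<Sum>l\<in>UNIV. \<phi> (Ad \<phi> (matrix_inv (\<gamma> t)) w) $ k $ l * \<xi> (\<psi> k l))"
        unfolding coAd_def using \<psi> \<xi> by blast
      then show ?thesis unfolding \<phi>_Ad[OF G_inv[OF \<gamma>(1)]] G_inv_inv[OF \<gamma>(1)] .
    qed
    have "mderiv (\<lambda>t. matrix_inv (\<gamma> t) ** \<phi> w ** \<gamma> t) (\<phi> (- br y w)) 0"
    proof -
      have 1: "matrix_inv (\<gamma> 0) = mat 1" by (simp add: \<gamma>(2) matrix_inv_one)
      have "\<phi> (- br y w) = - \<phi> y ** \<phi> w + \<phi> w ** \<phi> y"
        using \<phi>_br[of w y] br_swap[of y w] by (simp add: matrix_mult_minus_left)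
      then show ?thesis
        using mderiv_mult[OF mderiv_mult[OF inv mderiv_const[of "\<phi> w"]] \<gamma>(3)] by (simp add: 1 \<gamma>(2) matrix_mult_zero matrix_inv_one)
    qed
    then have "((\<lambda>t. \<Sum>k\<in>UNIV. \<Sum>l\<in>UNIV. (matrix_inv (\<gamma> t) ** \<phi> w ** \<gamma> t) $ k $ l * \<xi> (\<psi> k l)) has_field_derivative
        (\<Sum>k\<in>UNIV. \<Sum>l\<in>UNIV. \<phi> (- br y w) $ k $ l * \<xi> (\<psi> k l))) (at 0)"
      unfolding mderiv_def by (intro DERIV_sum DERIV_cmult_right) blast
    also have "(\<Sum>k\<in>UNIV. \<Sum>l\<in>UNIV. \<phi> (- br y w) $ k $ l * \<xi> (\<psi> k l)) = \<xi> (- br y w)"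
      by (rule \<psi>[rule_format, OF \<xi>, symmetric])
    finally show ?thesis unfolding e dual_minus[OF \<xi>] .
  qed
  from reg_curve[OF X coAd_dual[OF \<gamma>(1) \<xi>] \<eta> this]
  show ?thesis using \<xi> by (simp add: c0 pb_at d_lin)
qed

end

section \<open>Exponentials acting on ideals, and inclusions between unipotent subgroups\<close>

context lie_form
begin

lemma funpow_br_stable:
  assumes "\<And>v. v \<in> J \<Longrightarrow> br y v \<in> J" "w \<in> J"
  shows "(br y ^^ k) w \<in> J"
  using assms by (induction k) auto

text \<open>All terms of \<open>ead y w - w\<close> are iterates applied to \<open>br y w\<close>,
  so a single membership suffices. It serves for ideals and for the kernel of a character
  alike.\<close>

lemma ead_ideal:
  assumes J: "subspace J" and nil: "nilpotent_element br y"
    and stable: "\<And>v. v \<in> J \<Longrightarrow> br y v \<in> J" and w: "br y w \<in> J"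
  shows "ead y w - w \<in> J"
proof -
  obtain K where "\<And>v. (br y ^^ K) v = 0" using nil unfolding nilpotent_element_def by blast
  then have K: "(br y ^^ Suc K) v = 0" for v by (simp add: br_zero)
  have "ead y w - w = (\<Sum>k<K. sc (1 / fact (Suc k)) ((br y ^^ Suc k) w))"
    unfolding ead_eq[OF K] sum.lessThan_Suc_shift by simp
  moreover have "(br y ^^ Suc k) w \<in> J" for k
    using funpow_br_stable[OF stable w, of k] by (simp add: funpow_swap1)
  ultimately show ?thesis by (auto intro!: subspace_sum[OF J] subspace_scale[OF J])
qed

lemma ead_stable:
  assumes J: "subspace J" and nil: "nilpotent_element br y"
    and stable: "\<And>v. v \<in> J \<Longrightarrow> br y v \<in> J" and w: "w \<in> J"
  shows "ead y w \<in> J"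
  using subspace_add[OF J ead_ideal[OF J nil stable stable[OF w]] w] by simp

end

context unipotent_group
begin

lemma M_Ad: "g \<in> M \<Longrightarrow> \<exists>x\<in>m. \<forall>w. Ad \<phi> g w = ead x w"
proof -
  assume "g \<in> M"
  then obtain \<gamma> x where *: "one_param \<gamma> (\<phi> x)" "range \<gamma> \<subseteq> G" "\<gamma> 1 = g" "x \<in> m" "nilpotent_element br x"
    by (rule M_elem)
  show ?thesis using Ad_one_param[OF *(1,2,5), of 1] *(3,4) by (intro bexI[of _ x]) auto
qed

lemma M_coAd_apply: "g \<in> M \<Longrightarrow> \<exists>x\<in>m. \<forall>\<xi> w. coAd \<phi> g \<xi> w = \<xi> (ead x w)"
  using M_Ad[OF M_inv] unfolding coAd_def by metis

text \<open>A one-parameter subgroup is determined by its velocity, so the curve in \<open>M\<close>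
  through \<open>g\<close> is the one that exponentiation provides in \<open>M'\<close>.\<close>

lemma subgroup_mono:
  assumes "unipotent_group sc br form G \<phi> m' M'" "m \<subseteq> m'"
  shows "M \<subseteq> M'"
proof
  interpret M': unipotent_group sc br form G \<phi> m' M' by (rule assms)
  fix g assume "g \<in> M"
  then obtain \<gamma> x where *: "one_param \<gamma> (\<phi> x)" "\<gamma> 1 = g" "x \<in> m" by (rule M_elem)
  then have "x \<in> m'" using assms(2) by blast
  then obtain \<delta> where \<delta>: "one_param \<delta> (\<phi> x)" "range \<delta> \<subseteq> M'" by (rule M'.M_exp)
  have "\<delta> 1 = g" using one_param_unique[OF \<delta>(1) *(1)] *(2) by simp
  then show "g \<in> M'" using \<delta>(2) by blast
qed

lemma normalized:
  assumes g: "g \<in> G" and stable: "\<And>x. x \<in> m \<Longrightarrow> Ad \<phi> g x \<in> m" and h: "h \<in> M"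
  shows "g ** h ** matrix_inv g \<in> M"
proof -
  obtain \<gamma> x where \<gamma>: "one_param \<gamma> (\<phi> x)" "\<gamma> 1 = h" "x \<in> m" using M_elem[OF h] .
  obtain \<delta> where \<delta>: "one_param \<delta> (\<phi> (Ad \<phi> g x))" "range \<delta> \<subseteq> M" using M_exp[OF stable[OF \<gamma>(3)]] .
  have "one_param (\<lambda>t. g ** \<gamma> t ** matrix_inv g) (\<phi> (Ad \<phi> g x))"
    unfolding \<phi>_Ad[OF g] by (rule one_param_conj[OF \<gamma>(1) G_inverse[OF g]])
  from one_param_unique[OF \<delta>(1) this] have "\<delta> 1 = g ** h ** matrix_inv g" by (simp add: \<gamma>(2))
  then show ?thesis using \<delta>(2) by (metis range_subsetD)
qed

end

section \<open>Reduction in two stages\<close>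

text \<open>The last assumption is the shape in which the commutation of \<open>q1\<close> and
  \<open>q2\<close> is used: passing to degree zero for the first grading does not lower the order
  for the second.\<close>

locale two_stage = lie_group sc br form G \<phi>
  + one: stage sc br form \<Gamma>1 q1 f1 m1 t1 G \<phi> M1
  + two: stage sc br form \<Gamma>2 q2 f2 m2 t2 G \<phi> M2
  + zero: unipotent_group sc br form G \<phi> m0 M0
  for sc :: "complex \<Rightarrow> 'g::ab_group_add \<Rightarrow> 'g" and br form and G :: "(complex^'n^'n) set" and \<phi>
    and \<Gamma>1 q1 f1 m1 t1 M1 \<Gamma>2 q2 f2 m2 t2 M2 m0 M0 +
  assumes m2_eq: "m2 = {x + y | x y. x \<in> m1 \<and> y \<in> m0}"
    and subspace_m0: "subspace m0" and m0_br: "x \<in> m0 \<Longrightarrow> y \<in> m0 \<Longrightarrow> br x y \<in> m0"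
    and m1_ideal: "x \<in> m2 \<Longrightarrow> y \<in> m1 \<Longrightarrow> br x y \<in> m1"
    and m0_deg: "m0 \<subseteq> \<Gamma>1 0" and f0_deg: "f2 - f1 \<in> \<Gamma>1 0"
    and cp_Fil: "x \<in> two.Fil i \<Longrightarrow> one.cp 0 x \<in> two.Fil i"
begin

lemma m1_m2: "m1 \<subseteq> m2" and m0_m2: "m0 \<subseteq> m2"
proof -
  have z: "0 \<in> m1" "0 \<in> m0" using one.subspace_m subspace_m0 subspace_0 by auto
  show "m1 \<subseteq> m2"
  proof
    fix x assume "x \<in> m1"
    then show "x \<in> m2" unfolding m2_eq using z by (intro CollectI exI[of _ x] exI[of _ 0]) simp
  qed
  show "m0 \<subseteq> m2"
  proof
    fix y assume "y \<in> m0"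
    then show "y \<in> m2" unfolding m2_eq using z by (intro CollectI exI[of _ 0] exI[of _ y]) simp
  qed
qed

lemma m2E: assumes "u \<in> m2" obtains x y where "x \<in> m1" "y \<in> m0" "u = x + y"
  using assms unfolding m2_eq by auto

text \<open>For the first grading \<open>f2 - f1\<close> has degree zero and \<open>m1\<close>
  positive degrees, so the two are orthogonal.\<close>

lemma chi_m1: "w \<in> m1 \<Longrightarrow> two.chi w = one.chi w"
  using one.Fil_form[OF one.\<Gamma>_Fil[OF f0_deg], of w 1] one.m_Fil by (auto simp: form_diff)

lemma chi2_ead: "y \<in> m2 \<Longrightarrow> w \<in> m2 \<Longrightarrow> two.chi (ead y w) = two.chi w"
proof -
  assume y: "y \<in> m2" and w: "w \<in> m2"
  have J: "subspace {v \<in> m2. two.chi v = 0}"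
    using two.subspace_m by (auto simp: subspace_def form_zero form_add form_scale)
  have "ead y w - w \<in> {v \<in> m2. two.chi v = 0}"
    by (rule ead_ideal[OF J two.nilpotent_m[OF y]]) (use y w two.m_br two.f_br in auto)
  then show ?thesis by (simp add: form_diff)
qed

lemma ead_m1: "y \<in> m2 \<Longrightarrow> w \<in> m1 \<Longrightarrow> ead y w \<in> m1"
  by (rule ead_stable[OF one.subspace_m two.nilpotent_m]) (auto intro: m1_ideal)

lemma ead_m0: "y \<in> m0 \<Longrightarrow> w \<in> m0 \<Longrightarrow> ead y w \<in> m0"
  by (rule ead_stable[OF subspace_m0 zero.nilpotent_m]) (auto intro: m0_br)

lemma ead_m1_m0: "x \<in> m1 \<Longrightarrow> y \<in> m0 \<Longrightarrow> ead x y - y \<in> m1"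
proof (rule ead_ideal[OF one.subspace_m one.nilpotent_m])
  assume "x \<in> m1" "y \<in> m0"
  then have "br y x \<in> m1" using m1_ideal m0_m2 by blast
  then show "br x y \<in> m1" using br_swap[of x y] subspace_neg[OF one.subspace_m] by simp
qed (auto intro: one.m_br)

lemma M0_G: "g \<in> M0 \<Longrightarrow> g \<in> G" by (rule zero.M_G)
lemma M1_G: "g \<in> M1 \<Longrightarrow> g \<in> G" by (rule one.M_G)

lemma M1_M2: "M1 \<subseteq> M2"
  by (rule one.subgroup_mono[OF two.unipotent_group_axioms m1_m2])

lemma M0_M2: "M0 \<subseteq> M2"
  by (rule zero.subgroup_mono[OF two.unipotent_group_axioms m0_m2])

text \<open>\<open>M0\<close> normalizes \<open>M1\<close> because \<open>m1\<close> is an ideal of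
  \<open>m2\<close>; this is what lets \<open>M0\<close> act on \<open>M1\<close>-orbits.\<close>

lemma M1_normal: "g \<in> M0 \<Longrightarrow> h \<in> M1 \<Longrightarrow> g ** h ** matrix_inv g \<in> M1"
proof (rule one.normalized[OF M0_G])
  fix x assume g: "g \<in> M0" and x: "x \<in> m1"
  obtain y where "y \<in> m0" "\<forall>w. Ad \<phi> g w = ead y w" using zero.M_Ad[OF g] by blast
  then show "Ad \<phi> g x \<in> m1" using ead_m1[OF _ x] m0_m2 by auto
qed

lemma swap_M0_M1: "g \<in> M0 \<Longrightarrow> h \<in> M1 \<Longrightarrow> \<exists>k\<in>M1. coAd \<phi> g (coAd \<phi> h \<xi>) = coAd \<phi> k (coAd \<phi> g \<xi>)"
proof -
  assume g: "g \<in> M0" and h: "h \<in> M1"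
  note G = M0_G[OF g] M1_G[OF h] G_inv[OF M0_G[OF g]]
  have "coAd \<phi> (g ** h ** matrix_inv g) (coAd \<phi> g \<xi>) = coAd \<phi> g (coAd \<phi> h (coAd \<phi> (matrix_inv g) (coAd \<phi> g \<xi>)))"
    using G by (simp add: coAd_mult G_mult)
  then show ?thesis using M1_normal[OF g h] coAd_inverse(2)[OF G(1)] by (intro bexI[of _ "g ** h ** matrix_inv g"]) simp_all
qed

lemma orb_coAd: "g \<in> M0 \<Longrightarrow> \<eta> \<in> one.orb \<xi> \<Longrightarrow> coAd \<phi> g \<eta> \<in> one.orb (coAd \<phi> g \<xi>)"
  using swap_M0_M1[of g _ \<xi>] unfolding one.orb_iff by metis

lemma class_orb: "g \<in> M0 \<Longrightarrow> class_action \<phi> g (one.orb \<xi>) = one.orb (coAd \<phi> g \<xi>)"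
  unfolding class_action_def
proof
  assume g: "g \<in> M0"
  show "coAd \<phi> g ` one.orb \<xi> \<subseteq> one.orb (coAd \<phi> g \<xi>)" using orb_coAd[OF g] by blast
  show "one.orb (coAd \<phi> g \<xi>) \<subseteq> coAd \<phi> g ` one.orb \<xi>"
  proof
    fix \<eta> assume "\<eta> \<in> one.orb (coAd \<phi> g \<xi>)"
    from orb_coAd[OF zero.M_inv[OF g] this] have "coAd \<phi> (matrix_inv g) \<eta> \<in> one.orb \<xi>"
      by (simp add: coAd_inverse M0_G[OF g])
    then show "\<eta> \<in> coAd \<phi> g ` one.orb \<xi>"
      using coAd_inverse(1)[OF M0_G[OF g], of \<eta>] by (metis image_eqI)
  qed
qed

lemma act_Z1: "g \<in> M0 \<Longrightarrow> \<xi> \<in> one.Z \<Longrightarrow> coAd \<phi> g \<xi> \<in> one.Z"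
proof -
  assume g: "g \<in> M0" and \<xi>: "\<xi> \<in> one.Z"
  obtain y where y: "y \<in> m0" "\<And>\<xi> w. coAd \<phi> g \<xi> w = \<xi> (ead y w)" using zero.M_coAd_apply[OF g] by blast
  have ym: "y \<in> m2" using y(1) m0_m2 by blast
  have "coAd \<phi> g \<xi> w = one.chi w" if w: "w \<in> m1" for w
    using one.Z_val[OF \<xi> ead_m1[OF ym w]] chi2_ead[OF ym, of w] chi_m1[OF w] chi_m1[OF ead_m1[OF ym w]] m1_m2 w
    by (auto simp: y(2))
  then show ?thesis using coAd_dual[OF M0_G[OF g] one.Z_dual[OF \<xi>]] by (simp add: moment_fibre_def)
qed

lemma Z2_iff: "\<xi> \<in> two.Z \<longleftrightarrow> \<xi> \<in> one.Z \<and> (\<forall>y\<in>m0. \<xi> y = two.chi y)"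
proof
  assume \<xi>: "\<xi> \<in> two.Z"
  have "\<xi> w = one.chi w" if "w \<in> m1" for w
    using two.Z_val[OF \<xi>, of w] that m1_m2 chi_m1 by auto
  moreover have "\<xi> y = two.chi y" if "y \<in> m0" for y using two.Z_val[OF \<xi>] that m0_m2 by blast
  ultimately show "\<xi> \<in> one.Z \<and> (\<forall>y\<in>m0. \<xi> y = two.chi y)" using two.Z_dual[OF \<xi>] by (simp add: moment_fibre_def)
next
  assume *: "\<xi> \<in> one.Z \<and> (\<forall>y\<in>m0. \<xi> y = two.chi y)"
  then have d: "\<xi> \<in> dual" using one.Z_dual by blast
  have "\<xi> u = two.chi u" if u: "u \<in> m2" for u
  proof -
    obtain x y where "x \<in> m1" "y \<in> m0" "u = x + y" using m2E[OF u] .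
    then show ?thesis using * d one.Z_val[of \<xi> x] by (simp add: dual_iff chi_m1 form_add)
  qed
  then show "\<xi> \<in> two.Z" using d by (simp add: moment_fibre_def)
qed

lemma Z2_Z1: "\<xi> \<in> two.Z \<Longrightarrow> \<xi> \<in> one.Z" by (simp add: Z2_iff)

lemma orb1_orb2: "\<eta> \<in> one.orb \<xi> \<Longrightarrow> \<eta> \<in> two.orb \<xi>"
  using M1_M2 by (auto simp: one.orb_iff two.orb_iff)

lemma act0_orb2: "g \<in> M0 \<Longrightarrow> coAd \<phi> g \<xi> \<in> two.orb \<xi>"
  using M0_M2 by (auto simp: two.orb_iff)

text \<open>Exponentials of \<open>m1\<close> change \<open>y\<close> by an element of
  \<open>m1\<close>, on which \<open>\<xi>\<close> agrees with \<open>two.chi\<close>, and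
  \<open>two.chi\<close> is invariant under exponentials of \<open>m2\<close>. So the second moment
  map is well defined on classes.\<close>

lemma orb_m0: "\<xi> \<in> one.Z \<Longrightarrow> \<eta> \<in> one.orb \<xi> \<Longrightarrow> y \<in> m0 \<Longrightarrow> \<eta> y = \<xi> y"
proof -
  assume \<xi>: "\<xi> \<in> one.Z" and "\<eta> \<in> one.orb \<xi>" and y: "y \<in> m0"
  then obtain h where h: "h \<in> M1" "\<eta> = coAd \<phi> h \<xi>" by (auto simp: one.orb_iff)
  obtain x where x: "x \<in> m1" "\<And>\<xi> w. coAd \<phi> h \<xi> w = \<xi> (ead x w)" using one.M_coAd_apply[OF h(1)] by blast
  have "\<xi> (ead x y - y) = two.chi (ead x y - y)"
    using one.Z_val[OF \<xi> ead_m1_m0[OF x(1) y]] chi_m1[OF ead_m1_m0[OF x(1) y]] by simp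
  also have "\<dots> = 0" using chi2_ead[of x y] x(1) y m1_m2 m0_m2 by (auto simp: form_diff)
  finally have "\<xi> (ead x y - y) = 0" .
  moreover have "\<xi> (ead x y - y + y) = \<xi> (ead x y - y) + \<xi> y" using one.Z_dual[OF \<xi>] by (simp only: dual_iff)
  ultimately show ?thesis by (simp add: h(2) x(2))
qed

lemma class_moment_orb: "\<xi> \<in> one.Z \<Longrightarrow> class_moment two.chi m0 (one.orb \<xi>) = (\<lambda>y\<in>m0. \<xi> y - two.chi y)"
proof -
  assume \<xi>: "\<xi> \<in> one.Z"
  have "(\<lambda>y\<in>m0. \<eta> y - two.chi y) = (\<lambda>y\<in>m0. \<xi> y - two.chi y)" if "\<eta> \<in> one.orb \<xi>" for \<eta>
    by (rule restrict_ext) (simp add: orb_m0[OF \<xi> that])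
  then have "(\<lambda>\<eta>. \<lambda>y\<in>m0. \<eta> y - two.chi y) ` one.orb \<xi> = (\<lambda>_. \<lambda>y\<in>m0. \<xi> y - two.chi y) ` one.orb \<xi>"
    by (intro image_cong refl)
  also have "\<dots> = {\<lambda>y\<in>m0. \<xi> y - two.chi y}" by (rule image_constant[OF one.orb_self])
  finally have "(\<lambda>\<eta>. \<lambda>y\<in>m0. \<eta> y - two.chi y) ` one.orb \<xi> = {\<lambda>y\<in>m0. \<xi> y - two.chi y}" .
  then show ?thesis by (simp add: class_moment_def)
qed

text \<open>The union of the \<open>M1\<close>-orbits of the \<open>M0\<close>-translates of
  \<open>\<xi>\<close>. It replaces a factorization of \<open>M2\<close> into \<open>M1\<close> and
  \<open>M0\<close>, which is established only on orbits in the second fibre.\<close>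

definition rel :: "('g \<Rightarrow> complex) \<Rightarrow> ('g \<Rightarrow> complex) set" where
  "rel \<xi> = {\<eta>. \<exists>g\<in>M0. \<eta> \<in> one.orb (coAd \<phi> g \<xi>)}"

lemma rel_M0: "g \<in> M0 \<Longrightarrow> \<eta> \<in> rel \<xi> \<Longrightarrow> coAd \<phi> g \<eta> \<in> rel \<xi>"
proof -
  assume g: "g \<in> M0" and "\<eta> \<in> rel \<xi>"
  then obtain k where k: "k \<in> M0" "\<eta> \<in> one.orb (coAd \<phi> k \<xi>)" by (auto simp: rel_def)
  have "coAd \<phi> g \<eta> \<in> one.orb (coAd \<phi> (g ** k) \<xi>)"
    using orb_coAd[OF g k(2)] coAd_mult[OF M0_G[OF g] M0_G[OF k(1)]] by simp
  then show ?thesis using zero.M_mult[OF g k(1)] unfolding rel_def by (intro CollectI bexI[of _ "g ** k"])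
qed

lemma rel_M1: "h \<in> M1 \<Longrightarrow> \<eta> \<in> rel \<xi> \<Longrightarrow> coAd \<phi> h \<eta> \<in> rel \<xi>"
proof -
  assume h: "h \<in> M1" and "\<eta> \<in> rel \<xi>"
  then obtain g where g: "g \<in> M0" "\<eta> \<in> one.orb (coAd \<phi> g \<xi>)" by (auto simp: rel_def)
  have "coAd \<phi> h \<eta> \<in> one.orb \<eta>" using h by (auto simp: one.orb_iff)
  then show ?thesis using g one.orb_eq[OF g(2)] by (auto simp: rel_def)
qed

lemma rel_self: "\<xi> \<in> rel \<xi>"
  using zero.M_one one.orb_self by (auto simp: rel_def coAd_one intro!: bexI[of _ "mat 1"])

lemma rel_orb2: "\<eta> \<in> rel \<xi> \<Longrightarrow> \<eta> \<in> two.orb \<xi>"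
proof -
  assume "\<eta> \<in> rel \<xi>"
  then obtain g where g: "g \<in> M0" "\<eta> \<in> one.orb (coAd \<phi> g \<xi>)" by (auto simp: rel_def)
  then show ?thesis using orb1_orb2[OF g(2)] two.orb_eq[OF act0_orb2[OF g(1), of \<xi>]] by simp
qed

text \<open>For the first grading \<open>m1\<close> lives in positive degrees and \<open>m0\<close>
  in degree zero, so the projection of \<open>m2\<close> onto \<open>m0\<close> along
  \<open>m1\<close> is the degree-zero component.\<close>

lemma m2_split: "u \<in> m2 \<Longrightarrow> one.cp 0 u \<in> m0 \<and> u - one.cp 0 u \<in> m1"
proof -
  assume "u \<in> m2"
  then obtain x y where xy: "x \<in> m1" "y \<in> m0" "u = x + y" by (rule m2E)
  have "one.cp 0 x = 0" using xy(1) one.m_Fil by (auto simp: one.Fil_def)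
  moreover have "one.cp 0 y = y" using xy(2) m0_deg one.cp_hom[of y 0 0] by auto
  ultimately show ?thesis using xy by (simp add: one.cp_add)
qed

text \<open>Each step of the descent to the slice may be performed by an element of \<open>M0\<close> followed by one of
  \<open>M1\<close>; since every orbit meets the slice only once this shows \<open>M2 = M1 M0\<close> on orbits.\<close>

lemma \<pi>2_rel: "\<xi> \<in> two.Z \<Longrightarrow> two.\<pi> \<xi> \<in> rel \<xi>"
proof -
  assume \<xi>: "\<xi> \<in> two.Z"
  then obtain z where z: "\<xi> = form z" "z - f2 \<in> two.mp" using two.Z_elem by blast
  have "\<exists>z'\<in>{z. form z \<in> rel \<xi>}. z' - f2 \<in> t2"
  proof (rule two.reach_slice)
    show "z \<in> {z. form z \<in> rel \<xi>}" using rel_self z(1) by simp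
    show "z - f2 \<in> two.mp" by (rule z)
    fix z u i assume z: "z \<in> {z. form z \<in> rel \<xi>}" "z - f2 \<in> two.mp" and u: "u \<in> m2" "u \<in> two.Fil i" "i \<ge> 1"
    \<comment> \<open>By \<open>cp_Fil\<close> both factors have the order \<open>i\<close> of
      \<open>u\<close>. Their leading terms add up to \<open>br u f2\<close>, and both errors have
      order \<open>i - 1\<close>.\<close>
    define y where "y = one.cp 0 u"
    define x where "x = u - y"
    have xy: "y \<in> m0" "x \<in> m1" "u = x + y" using m2_split[OF u(1)] by (auto simp: y_def x_def)
    have F: "y \<in> two.Fil i" "x \<in> two.Fil i"
      using cp_Fil[OF u(2)] subspace_diff[OF two.subspace_Fil u(2)] by (auto simp: y_def x_def)
    have m2: "y \<in> m2" "x \<in> m2" using xy m0_m2 m1_m2 by auto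
    note s1 = two.ead_step[OF m2(1) F(1) u(3) z(2)]
    note s2 = two.ead_step[OF m2(2) F(2) u(3) s1(1)]
    obtain g where g: "g \<in> M0" "\<And>z. coAd \<phi> g (form z) = form (ead y z)" using zero.M_exp_coAd[OF xy(1)] by blast
    obtain h where h: "h \<in> M1" "\<And>z. coAd \<phi> h (form z) = form (ead x z)" using one.M_exp_coAd[OF xy(2)] by blast
    have "form (ead x (ead y z)) \<in> rel \<xi>"
      using rel_M1[OF h(1) rel_M0[OF g(1)], of "form z" \<xi>] z(1) by (simp add: g h)
    moreover
    have e: "ead x (ead y z) - z - br u f2 = (ead x (ead y z) - ead y z - br x f2) + (ead y z - z - br y f2)"
      unfolding xy(3) br_add_left by (simp add: algebra_simps)
    have "ead x (ead y z) - z - br u f2 \<in> two.Fil (i - 1)" unfolding e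
      using subspace_add[OF two.subspace_Fil s2(2) s1(2)] by (simp only:)
    ultimately show "\<exists>z'\<in>{z. form z \<in> rel \<xi>}. z' - f2 \<in> two.mp \<and> z' - z - br u f2 \<in> two.Fil (i - 1)"
      using s2(1) by (intro bexI[of _ "ead x (ead y z)"]) auto
  qed
  then obtain z' where z': "form z' \<in> rel \<xi>" "form z' \<in> two.slice" by (auto simp: two.slice_def)
  \<comment> \<open>The slice point reached in this way lies on the \<open>M2\<close>-orbit of
    \<open>two.\<pi> \<xi>\<close>, hence equals it.\<close>
  have "form z' \<in> two.orb (two.\<pi> \<xi>)" using rel_orb2[OF z'(1)] two.orb_eq[OF two.\<pi>_orb[OF \<xi>]] by simp
  from two.slice_orb_unique[OF two.\<pi>_slice[OF \<xi>] z'(2) this] show ?thesis using z'(1) by simp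
qed

text \<open>Two points of an \<open>M2\<close>-orbit have the same slice point; it is reached from
  each of them by \<open>\<pi>2_rel\<close>, and one of the two paths is reversed.\<close>

lemma orb2_rel: "\<xi> \<in> two.Z \<Longrightarrow> \<eta> \<in> two.orb \<xi> \<Longrightarrow> \<eta> \<in> rel \<xi>"
proof -
  assume \<xi>: "\<xi> \<in> two.Z" and \<eta>: "\<eta> \<in> two.orb \<xi>"
  have "two.\<pi> \<xi> \<in> rel \<eta>" using \<pi>2_rel[OF two.orb_Z[OF \<eta> \<xi>]] two.\<pi>_const[OF \<xi> \<eta>] by simp
  then obtain g where g: "g \<in> M0" "two.\<pi> \<xi> \<in> one.orb (coAd \<phi> g \<eta>)" by (auto simp: rel_def)
  then have "coAd \<phi> g \<eta> \<in> one.orb (two.\<pi> \<xi>)" using one.orb_self one.orb_eq by metis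
  then obtain h where "h \<in> M1" "coAd \<phi> g \<eta> = coAd \<phi> h (two.\<pi> \<xi>)" by (auto simp: one.orb_iff)
  then have "coAd \<phi> g \<eta> \<in> rel \<xi>" using rel_M1 \<pi>2_rel[OF \<xi>] by simp
  from rel_M0[OF zero.M_inv[OF g(1)] this] show ?thesis by (simp add: coAd_inverse M0_G[OF g(1)])
qed

end

section \<open>The second reduction\<close>

context two_stage
begin

abbreviation "P1 \<equiv> coord_alg one.V1"
abbreviation "cl1 X \<equiv> one.I +>\<^bsub>S\<^esub> X"
abbreviation "Z0 \<equiv> one.orb ` two.Z"
abbreviation "I0 \<equiv> genideal P1 ((\<lambda>y. cl1 (lin_shift sc two.chi y)) ` m0)"
abbreviation "Y0 \<equiv> (\<lambda>y. cl1 (lin sc y)) ` m0"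
abbreviation "act0 \<equiv> class_action \<phi>"

lemma Z0_eq: "Z0 = {Q \<in> points one.V1. class_moment two.chi m0 Q = (\<lambda>y\<in>m0. 0)}"
proof -
  have *: "(\<lambda>y\<in>m0. \<xi> y - two.chi y) = (\<lambda>y\<in>m0. 0) \<longleftrightarrow> (\<forall>y\<in>m0. \<xi> y = two.chi y)" for \<xi>
  proof
    assume e: "(\<lambda>y\<in>m0. \<xi> y - two.chi y) = (\<lambda>y\<in>m0. 0)"
    show "\<forall>y\<in>m0. \<xi> y = two.chi y"
    proof
      fix y assume "y \<in> m0"
      then show "\<xi> y = two.chi y" using fun_cong[OF e, of y] by simp
    qed
  next
    assume "\<forall>y\<in>m0. \<xi> y = two.chi y"
    then show "(\<lambda>y\<in>m0. \<xi> y - two.chi y) = (\<lambda>y\<in>m0. 0)" by (intro restrict_ext) simp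
  qed
  show ?thesis
  proof
    show "Z0 \<subseteq> {Q \<in> points one.V1. class_moment two.chi m0 Q = (\<lambda>y\<in>m0. 0)}"
    proof
      fix Q assume "Q \<in> Z0"
      then obtain \<xi> where \<xi>: "\<xi> \<in> two.Z" "Q = one.orb \<xi>" by (elim imageE)
      then show "Q \<in> {Q \<in> points one.V1. class_moment two.chi m0 Q = (\<lambda>y\<in>m0. 0)}"
        using * by (simp add: one.V1_points class_moment_orb Z2_iff)
    qed
    show "{Q \<in> points one.V1. class_moment two.chi m0 Q = (\<lambda>y\<in>m0. 0)} \<subseteq> Z0"
    proof
      fix Q assume Q: "Q \<in> {Q \<in> points one.V1. class_moment two.chi m0 Q = (\<lambda>y\<in>m0. 0)}"
      then obtain \<xi> where \<xi>: "\<xi> \<in> one.Z" "Q = one.orb \<xi>" by (auto simp: one.V1_points)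
      then have "\<xi> \<in> two.Z" using Q * by (simp add: class_moment_orb Z2_iff)
      then show "Q \<in> Z0" unfolding \<xi>(2) by (rule imageI)
    qed
  qed
qed

sublocale V1: affine_pv one.V1 by (rule one.V1_affine)

definition rp :: "(('g \<Rightarrow> complex) \<Rightarrow> complex) set \<Rightarrow> ('g \<Rightarrow> complex) \<Rightarrow> complex" where
  "rp B = (SOME X. X \<in> one.sr.invs \<and> B = cl1 X)"

lemma rp: assumes "B \<in> carrier P1" shows "rp B \<in> one.sr.invs" "cl1 (rp B) = B"
proof -
  obtain X where "X \<in> one.sr.invs" "B = cl1 X" using assms unfolding one.V1_carrier by (elim imageE)
  then have "\<exists>X. X \<in> one.sr.invs \<and> B = cl1 X" by (intro exI[of _ X] conjI)
  from someI_ex[OF this] show "rp B \<in> one.sr.invs" "cl1 (rp B) = B" unfolding rp_def by simp_all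
qed

lemma invs_reg: "X \<in> one.sr.invs \<Longrightarrow> X \<in> reg" by (simp add: one.invs_iff)

lemma cl1_carrier: "X \<in> one.sr.invs \<Longrightarrow> cl1 X \<in> carrier P1"
  unfolding one.V1_carrier by (rule imageI)

lemma invs_pb: "X \<in> one.sr.invs \<Longrightarrow> Y \<in> one.sr.invs \<Longrightarrow> pb X Y \<in> one.sr.invs"
  using one.sr.inv_pb by (simp add: DV_simps sym_alg_simps)

text \<open>\<open>cl1 \<circ> proj\<close> is the comorphism of the embedding of the first reduction as a slice; it is the identity on invariants.\<close>

definition proj :: "(('g \<Rightarrow> complex) \<Rightarrow> complex) \<Rightarrow> ('g \<Rightarrow> complex) \<Rightarrow> complex" where
  "proj X = (\<lambda>\<xi>\<in>dual. X (one.\<pi> \<xi>))"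

lemma proj_invs: "X \<in> reg \<Longrightarrow> proj X \<in> one.sr.invs"
  unfolding proj_def by (rule one.ext_invs)

lemma proj_at: "\<xi> \<in> one.Z \<Longrightarrow> proj X \<xi> = X (one.\<pi> \<xi>)"
  by (simp add: proj_def one.Z_dual)

lemma proj_ev: "X \<in> reg \<Longrightarrow> \<xi> \<in> one.Z \<Longrightarrow> evl one.V1 (cl1 (proj X)) (one.orb \<xi>) = X (one.\<pi> \<xi>)"
  by (simp add: one.V1_ev proj_invs proj_at)

lemma cl1_proj: "X \<in> one.sr.invs \<Longrightarrow> cl1 (proj X) = cl1 X"
  using one.invs_orb[OF _ _ one.\<pi>_orb]
  by (intro one.cl_eq) (simp_all add: proj_at invs_reg proj_invs)

text \<open>Brackets of \<open>m1\<close> with \<open>y\<close> stay in the ideal \<open>m1\<close>,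
  where points of the first fibre take the values of \<open>two.chi\<close>, and these vanish on
  brackets in \<open>m2\<close>.\<close>

lemma lin_m0_invs: "y \<in> m0 \<Longrightarrow> lin sc y \<in> one.sr.invs"
proof -
  assume y: "y \<in> m0"
  have "pb (lin sc x) (lin sc y) \<xi> = 0" if x: "x \<in> m1" and \<xi>: "\<xi> \<in> one.Z" for x \<xi>
  proof -
    have m2: "x \<in> m2" "y \<in> m2" using x y m1_m2 m0_m2 by auto
    have b: "br x y \<in> m1" using m1_ideal[OF m2(2) x] br_swap[of x y] subspace_neg[OF one.subspace_m] by simp
    have "\<xi> (br x y) = two.chi (br x y)" using one.Z_val[OF \<xi> b] chi_m1[OF b] by simp
    then show ?thesis using two.f_br[OF m2] one.Z_dual[OF \<xi>] unfolding pb_lin_lin by (simp add: lin_def)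
  qed
  then show ?thesis by (simp add: one.invs_iff lin_in_reg)
qed

lemma lin_shift_m0_invs: "y \<in> m0 \<Longrightarrow> lin_shift sc two.chi y \<in> one.sr.invs"
  using lin_m0_invs by (simp add: one.invs_iff lin_shift_in_reg)
    (metis lin_in_reg lin_shift_in_reg one.Z_dual pb_lin_shift pb_swap_at)

lemma cl1_vanish: "X \<in> one.sr.invs \<Longrightarrow> (\<forall>Q\<in>Z0. evl one.V1 (cl1 X) Q = 0) \<longleftrightarrow> (\<forall>\<xi>\<in>two.Z. X \<xi> = 0)"
  by (simp add: one.V1_ev Z2_Z1)

lemma ring_hom_proj: "ring_hom_ring S P1 (\<lambda>X. cl1 (proj X))"
proof (rule ring_hom_ringI2)
  interpret C: cring S by (rule sym_alg_cring)
  show "ring S" by (rule C.ring_axioms)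
  show "ring P1" by (rule V1.A.ring_axioms)
  have \<pi>: "\<xi> \<in> one.Z \<Longrightarrow> one.\<pi> \<xi> \<in> dual" for \<xi> by (rule one.\<pi>_dual)
  show "(\<lambda>X. cl1 (proj X)) \<in> ring_hom S P1"
  proof (rule ring_hom_memI, unfold sym_alg_simps)
    fix X assume X: "X \<in> reg"
    show "cl1 (proj X) \<in> carrier P1" by (rule cl1_carrier[OF proj_invs[OF X]])
    fix Y assume Y: "Y \<in> reg"
    note c = cl1_carrier[OF proj_invs[OF X]] cl1_carrier[OF proj_invs[OF Y]]
    show "cl1 (proj (\<lambda>p\<in>dual. X p * Y p)) = cl1 (proj X) \<otimes>\<^bsub>P1\<^esub> cl1 (proj Y)"
    proof (rule V1.eqI)
      fix Q assume Q: "Q \<in> points one.V1"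
      then obtain \<xi> where \<xi>: "\<xi> \<in> one.Z" "Q = one.orb \<xi>" by (auto simp: one.V1_points)
      show "evl one.V1 (cl1 (proj (\<lambda>p\<in>dual. X p * Y p))) Q = evl one.V1 (cl1 (proj X) \<otimes>\<^bsub>P1\<^esub> cl1 (proj Y)) Q"
        unfolding V1.ev_mult[OF Q c] unfolding \<xi>(2) by (simp add: proj_ev X Y \<xi>(1) mult_in_reg one.\<pi>_dual)
    qed (simp_all add: c cl1_carrier proj_invs mult_in_reg X Y)
    show "cl1 (proj (\<lambda>p\<in>dual. X p + Y p)) = cl1 (proj X) \<oplus>\<^bsub>P1\<^esub> cl1 (proj Y)"
    proof (rule V1.eqI)
      fix Q assume Q: "Q \<in> points one.V1"
      then obtain \<xi> where \<xi>: "\<xi> \<in> one.Z" "Q = one.orb \<xi>" by (auto simp: one.V1_points)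
      show "evl one.V1 (cl1 (proj (\<lambda>p\<in>dual. X p + Y p))) Q = evl one.V1 (cl1 (proj X) \<oplus>\<^bsub>P1\<^esub> cl1 (proj Y)) Q"
        unfolding V1.ev_add[OF Q c] unfolding \<xi>(2) by (simp add: proj_ev X Y \<xi>(1) add_in_reg one.\<pi>_dual)
    qed (simp_all add: c cl1_carrier proj_invs add_in_reg X Y)
  next
    show "cl1 (proj (\<lambda>p\<in>dual. 1)) = \<one>\<^bsub>P1\<^esub>"
    proof (rule V1.eqI)
      fix Q assume Q: "Q \<in> points one.V1"
      then obtain \<xi> where \<xi>: "\<xi> \<in> one.Z" "Q = one.orb \<xi>" by (auto simp: one.V1_points)
      show "evl one.V1 (cl1 (proj (\<lambda>p\<in>dual. 1))) Q = evl one.V1 \<one>\<^bsub>P1\<^esub> Q"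
        unfolding V1.ev_one[OF Q] unfolding \<xi>(2) by (simp add: proj_ev \<xi>(1) const_in_reg one.\<pi>_dual)
    qed (simp_all add: cl1_carrier proj_invs const_in_reg)
  qed
qed

lemma I0_gens: "(\<lambda>y. cl1 (lin_shift sc two.chi y)) ` m0 \<subseteq> carrier P1"
  using cl1_carrier lin_shift_m0_invs by blast

lemma Z0_points: "Z0 \<subseteq> points one.V1"
  unfolding one.V1_points using Z2_Z1 by blast

lemma I0_sub: "I0 \<subseteq> {B \<in> carrier P1. \<forall>Q\<in>Z0. evl one.V1 B Q = 0}"
proof (rule V1.A.genideal_minimal[OF V1.vanishing_ideal[OF Z0_points]])
  show "(\<lambda>y. cl1 (lin_shift sc two.chi y)) ` m0 \<subseteq> {B \<in> carrier P1. \<forall>Q\<in>Z0. evl one.V1 B Q = 0}"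
  proof
    fix B assume "B \<in> (\<lambda>y. cl1 (lin_shift sc two.chi y)) ` m0"
    then obtain y where y: "y \<in> m0" "B = cl1 (lin_shift sc two.chi y)" by (elim imageE)
    then show "B \<in> {B \<in> carrier P1. \<forall>Q\<in>Z0. evl one.V1 B Q = 0}"
      using lin_shift_m0_invs[OF y(1)] by (simp add: cl1_carrier one.V1_ev Z2_Z1)
        (simp add: lin_shift_def two.Z_dual Z2_iff[of _])
  qed
qed

text \<open>The preimage of \<open>I0\<close> under \<open>cl1 \<circ> proj\<close> is an ideal containing the generators of \<open>I2\<close>.\<close>

lemma I2_I0: "X \<in> two.I \<Longrightarrow> cl1 (proj X) \<in> I0"
proof -
  interpret C: cring S by (rule sym_alg_cring)
  interpret H: ring_hom_ring S P1 "\<lambda>X. cl1 (proj X)" by (rule ring_hom_proj)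
  have ideal: "ideal {X \<in> carrier S. cl1 (proj X) \<in> I0} S"
    by (rule H.ideal_vimage[OF V1.A.genideal_ideal[OF I0_gens]])
  have "lin_shift sc two.chi ` m2 \<subseteq> {X \<in> carrier S. cl1 (proj X) \<in> I0}"
  proof
    fix X assume "X \<in> lin_shift sc two.chi ` m2"
    then obtain u where u: "u \<in> m2" "X = lin_shift sc two.chi u" by (elim imageE)
    obtain x y where xy: "x \<in> m1" "y \<in> m0" "u = x + y" using m2E[OF u(1)] .
    have "cl1 (proj X) = cl1 (lin_shift sc two.chi y)"
    proof (rule one.cl_eq)
      fix \<xi> assume \<xi>: "\<xi> \<in> one.Z"
      have \<pi>Z: "one.\<pi> \<xi> \<in> one.Z" using one.orb_Z[OF one.\<pi>_orb[OF \<xi>] \<xi>] .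
      \<comment> \<open>The retraction stays in the first fibre, which fixes the value on
        \<open>x\<close>, and on the \<open>M1\<close>-orbit of \<open>\<xi>\<close>, which keeps
        the value on \<open>y\<close>.\<close>
      have "one.\<pi> \<xi> u = two.chi x + \<xi> y"
        using one.\<pi>_dual[of \<xi>] one.Z_val[OF \<pi>Z xy(1)] chi_m1[OF xy(1)] orb_m0[OF \<xi> one.\<pi>_orb[OF \<xi>] xy(2)]
        by (simp add: xy(3) dual_iff)
      then show "proj X \<xi> = lin_shift sc two.chi y \<xi>"
        by (simp add: proj_at \<xi> u(2) lin_shift_def one.\<pi>_dual one.Z_dual) (simp add: xy(3) form_add)
    qed (simp_all add: invs_reg proj_invs lin_shift_in_reg u(2))
    moreover have "cl1 (lin_shift sc two.chi y) \<in> I0"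
      by (rule subsetD[OF V1.A.genideal_self[OF I0_gens]]) (rule imageI[OF xy(2)])
    ultimately show "X \<in> {X \<in> carrier S. cl1 (proj X) \<in> I0}" by (simp add: u(2) sym_alg_simps lin_shift_in_reg)
  qed
  from C.genideal_minimal[OF ideal this] show "cl1 (proj X) \<in> I0" if "X \<in> two.I"
    using that unfolding moment_ideal_def by blast
qed

text \<open>A class vanishing on \<open>Z0\<close> has a representative that vanishes on the second
  fibre, hence lies in \<open>two.I\<close> and is carried into \<open>I0\<close> by
  \<open>I2_I0\<close>.\<close>

lemma I0_vanishing: "I0 = {B \<in> carrier P1. \<forall>Q\<in>Z0. evl one.V1 B Q = 0}"
proof
  show "{B \<in> carrier P1. \<forall>Q\<in>Z0. evl one.V1 B Q = 0} \<subseteq> I0"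
  proof
    fix B assume "B \<in> {B \<in> carrier P1. \<forall>Q\<in>Z0. evl one.V1 B Q = 0}"
    then have B: "B \<in> carrier P1" "\<forall>Q\<in>Z0. evl one.V1 B Q = 0" by simp_all
    note X = rp[OF B(1)]
    have "rp B \<in> two.I"
      unfolding two.I_iff using B(2) cl1_vanish[OF X(1)] invs_reg[OF X(1)] by (simp only: X(2))
    from I2_I0[OF this] show "B \<in> I0" by (simp add: cl1_proj X)
  qed
qed (rule I0_sub)

lemma cl1_I0: "X \<in> one.sr.invs \<Longrightarrow> cl1 X \<in> I0 \<longleftrightarrow> (\<forall>\<xi>\<in>two.Z. X \<xi> = 0)"
  unfolding I0_vanishing using cl1_vanish cl1_carrier by simp

lemma act0_mult: "g \<in> G \<Longrightarrow> h \<in> G \<Longrightarrow> act0 (g ** h) Q = act0 g (act0 h Q)"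
  by (simp add: class_action_def image_image coAd_mult)

lemma act0_one: "act0 (mat 1) Q = Q"
  by (simp add: class_action_def coAd_one)

abbreviation "orb0 \<equiv> orbit M0 act0"

lemma orb0_iff: "Q' \<in> orb0 (one.orb \<xi>) \<longleftrightarrow> (\<exists>g\<in>M0. Q' = one.orb (coAd \<phi> g \<xi>))"
  using class_orb[of _ \<xi>] by (simp add: orbit_def[of M0 act0] image_iff cong: bex_cong)

lemma orb0_self: "Q \<in> orb0 Q"
  unfolding orbit_def by (rule image_eqI[of _ "\<lambda>g. act0 g Q", OF act0_one[symmetric] zero.M_one])

lemma orb0_eq: "Q' \<in> orb0 Q \<Longrightarrow> orb0 Q' = orb0 Q"
proof -
  have sub: "orb0 (act0 g Q) \<subseteq> orb0 Q" if "g \<in> M0" for g Q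
    unfolding orbit_def using that zero.M_mult act0_mult[OF M0_G M0_G[OF that]] by (auto simp flip: act0_mult[OF M0_G M0_G[OF that]])
  assume "Q' \<in> orb0 Q"
  then obtain g where g: "g \<in> M0" "Q' = act0 g Q" unfolding orbit_def by (elim imageE)
  have "act0 (matrix_inv g) Q' = Q"
    using g M0_G[OF g(1)] by (simp add: act0_mult[symmetric] G_inv G_inverse act0_one)
  then have "orb0 Q \<subseteq> orb0 Q'" using sub[OF zero.M_inv[OF g(1)], of Q'] by simp
  then show ?thesis using sub[OF g(1), of Q] g(2) by blast
qed

lemma invs2_of:
  assumes X: "X \<in> one.sr.invs" and v: "\<And>y. y \<in> m0 \<Longrightarrow> \<forall>\<xi>\<in>two.Z. pb (lin sc y) X \<xi> = 0"
  shows "X \<in> two.sr.invs"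
proof -
  have "pb (lin sc u) X \<xi> = 0" if u: "u \<in> m2" and \<xi>: "\<xi> \<in> two.Z" for u \<xi>
  proof -
    obtain x y where xy: "x \<in> m1" "y \<in> m0" "u = x + y" using m2E[OF u] .
    have "pb (lin sc u) X \<xi> = pb (lin sc x) X \<xi> + pb (lin sc y) X \<xi>"
      using two.Z_dual[OF \<xi>] by (simp add: pb_at d_lin xy(3) br_add_left dual_iff)
    then show ?thesis using v[OF xy(2)] \<xi> X xy(1) Z2_Z1[OF \<xi>] by (simp add: one.invs_iff)
  qed
  then show ?thesis using invs_reg[OF X] by (simp add: two.invs_iff)
qed

text \<open>The bracket is additive in its linear argument. For a function already invariant under
  \<open>m1\<close> on the first fibre, invariance under \<open>m0\<close> on the smaller second
  fibre therefore amounts to invariance under \<open>m2\<close> there.\<close>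

lemma invs2_iff:
  assumes X: "X \<in> one.sr.invs"
  shows "(\<forall>y\<in>Y0. pbracket P1 y (cl1 X) \<in> I0) \<longleftrightarrow> X \<in> two.sr.invs"
proof -
  have "pbracket P1 (cl1 (lin sc y)) (cl1 X) \<in> I0 \<longleftrightarrow> (\<forall>\<xi>\<in>two.Z. pb (lin sc y) X \<xi> = 0)" if "y \<in> m0" for y
    using X lin_m0_invs[OF that] by (simp add: one.V1_pb cl1_I0 invs_pb)
  then have "(\<forall>y\<in>Y0. pbracket P1 y (cl1 X) \<in> I0) \<longleftrightarrow> (\<forall>y\<in>m0. \<forall>\<xi>\<in>two.Z. pb (lin sc y) X \<xi> = 0)" by simp
  then show ?thesis using invs2_of[OF X] m0_m2 by (auto simp: two.invs_iff)
qed

lemma invs2_cong: "X \<in> two.sr.invs \<Longrightarrow> Y \<in> reg \<Longrightarrow> (\<And>\<xi>. \<xi> \<in> two.Z \<Longrightarrow> Y \<xi> = X \<xi>) \<Longrightarrow> Y \<in> two.sr.invs"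
  using two.sr.cl_inv[of X Y] two.cl_mem[of X Y] by (simp add: DV_simps two.invs_iff)

definition \<pi>0 :: "('g \<Rightarrow> complex) set \<Rightarrow> ('g \<Rightarrow> complex) set" where
  "\<pi>0 Q = one.orb (two.\<pi> (SOME \<eta>. \<eta> \<in> Q))"

lemma \<pi>0: "\<xi> \<in> two.Z \<Longrightarrow> \<pi>0 (one.orb \<xi>) = one.orb (two.\<pi> \<xi>)"
proof -
  assume \<xi>: "\<xi> \<in> two.Z"
  have "(SOME \<eta>. \<eta> \<in> one.orb \<xi>) \<in> one.orb \<xi>" by (rule someI[of "\<lambda>\<eta>. \<eta> \<in> one.orb \<xi>"], rule one.orb_self)
  then show ?thesis unfolding \<pi>0_def using two.\<pi>_const[OF \<xi> orb1_orb2] by simp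
qed

text \<open>Composition with \<open>two.\<pi>\<close> gives invariance under \<open>M2\<close> on
  the second fibre, and \<open>proj\<close> then gives invariance under \<open>M1\<close> on all of
  the first; by \<open>\<pi>2_\<pi>1\<close> the latter does not change the values on the second
  fibre.\<close>

definition ext0 :: "(('g \<Rightarrow> complex) \<Rightarrow> complex) set \<Rightarrow> (('g \<Rightarrow> complex) \<Rightarrow> complex) set" where
  "ext0 B = cl1 (proj (\<lambda>\<xi>\<in>dual. rp B (two.\<pi> \<xi>)))"

lemma \<pi>2_\<pi>1: "\<xi> \<in> two.Z \<Longrightarrow> two.\<pi> (one.\<pi> \<xi>) = two.\<pi> \<xi>"
  using two.\<pi>_const[OF _ orb1_orb2[OF one.\<pi>_orb]] Z2_Z1 by blast

lemma \<pi>2_Z: "\<xi> \<in> two.Z \<Longrightarrow> two.\<pi> \<xi> \<in> two.Z"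
  using two.orb_Z[OF two.\<pi>_orb] by blast

lemma ext0:
  assumes B: "B \<in> carrier P1"
  shows "ext0 B \<in> carrier P1" "\<xi> \<in> two.Z \<Longrightarrow> evl one.V1 (ext0 B) (one.orb \<xi>) = evl one.V1 B (one.orb (two.\<pi> \<xi>))"
    "proj (\<lambda>\<xi>\<in>dual. rp B (two.\<pi> \<xi>)) \<in> two.sr.invs"
proof -
  have X: "(\<lambda>\<xi>\<in>dual. rp B (two.\<pi> \<xi>)) \<in> reg" by (rule two.\<pi>_reg[OF invs_reg[OF rp(1)[OF B]]])
  show "ext0 B \<in> carrier P1" unfolding ext0_def by (rule cl1_carrier[OF proj_invs[OF X]])
  have v: "proj (\<lambda>\<xi>\<in>dual. rp B (two.\<pi> \<xi>)) \<xi> = rp B (two.\<pi> \<xi>)" if "\<xi> \<in> two.Z" for \<xi>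
    using that by (simp add: proj_at Z2_Z1 one.\<pi>_dual \<pi>2_\<pi>1)
  show "evl one.V1 (ext0 B) (one.orb \<xi>) = evl one.V1 B (one.orb (two.\<pi> \<xi>))" if \<xi>: "\<xi> \<in> two.Z"
  proof -
    have "evl one.V1 (cl1 (rp B)) (one.orb (two.\<pi> \<xi>)) = rp B (two.\<pi> \<xi>)"
      by (rule one.V1_ev[OF rp(1)[OF B] Z2_Z1[OF \<pi>2_Z[OF \<xi>]]])
    then show ?thesis unfolding ext0_def rp(2)[OF B] using v[OF \<xi>] one.V1_ev[OF proj_invs[OF X] Z2_Z1[OF \<xi>]] by simp
  qed
  show "proj (\<lambda>\<xi>\<in>dual. rp B (two.\<pi> \<xi>)) \<in> two.sr.invs"
    by (rule invs2_cong[OF two.ext_invs[OF invs_reg[OF rp(1)[OF B]]] invs_reg[OF proj_invs[OF X]]])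
      (simp add: v two.Z_dual)
qed

lemma second_reduction: "slice_reduction one.V1 Z0 M0 act0 I0 Y0 \<pi>0 ext0"
proof (rule slice_reduction.intro[OF one.V1_affine], rule slice_reduction_axioms.intro)
  show "Z0 \<subseteq> points one.V1" by (rule Z0_points)
  show "I0 = {B \<in> carrier P1. \<forall>Q\<in>Z0. evl one.V1 B Q = 0}" by (rule I0_vanishing)
  show "Y0 \<subseteq> carrier P1" using cl1_carrier lin_m0_invs by blast
next
  fix g Q assume g: "g \<in> M0" and "Q \<in> Z0"
  then obtain \<xi> where \<xi>: "\<xi> \<in> two.Z" "Q = one.orb \<xi>" by (elim imageE)
  then show "act0 g Q \<in> Z0" using two.orb_Z[OF act0_orb2[OF g] \<xi>(1)] by (simp add: class_orb g)
next
  fix Q Q' assume "Q' \<in> orb0 Q"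
  then show "orb0 Q' = orb0 Q" by (rule orb0_eq)
next
  fix Y Y' assume "Y \<in> Y0" "Y' \<in> Y0"
  then obtain y y' where y: "y \<in> m0" "Y = cl1 (lin sc y)" "y' \<in> m0" "Y' = cl1 (lin sc y')" by (elim imageE)
  have i: "pb (lin sc y) (lin sc y') \<in> one.sr.invs" using y invs_pb lin_m0_invs by blast
  have "pb (lin sc y) (lin sc y') \<xi> = 0" if \<xi>: "\<xi> \<in> two.Z" for \<xi>
    unfolding pb_lin_lin using \<xi> y m0_m2 two.m_br two.f_br by (simp add: lin_def two.Z_dual two.Z_val subset_iff)
  then show "pbracket P1 Y Y' \<in> I0" using y i lin_m0_invs by (simp add: one.V1_pb cl1_I0)
next
  fix B g Q assume B: "B \<in> carrier P1" and v: "\<And>y. y \<in> Y0 \<Longrightarrow> pbracket P1 y B \<in> I0" and g: "g \<in> M0" and "Q \<in> Z0"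
  then obtain \<xi> where \<xi>: "\<xi> \<in> two.Z" "Q = one.orb \<xi>" by (elim imageE)
  note X = rp[OF B]
  \<comment> \<open>Second-stage invariance of a class is read as \<open>m2\<close>-invariance of
    its representative, to which the one-step results apply.\<close>
  have X2: "rp B \<in> two.sr.invs" using invs2_iff[OF X(1)] v by (simp add: X(2))
  have "evl one.V1 (cl1 (rp B)) (one.orb (coAd \<phi> g \<xi>)) = evl one.V1 (cl1 (rp B)) (one.orb \<xi>)"
    using two.invs_orb[OF X2 \<xi>(1) act0_orb2[OF g]] two.orb_Z[OF act0_orb2[OF g] \<xi>(1)] \<xi>(1) X(1)
    by (simp add: one.V1_ev Z2_Z1)
  then show "evl one.V1 B (act0 g Q) = evl one.V1 B Q" by (simp add: X(2) \<xi>(2) class_orb g)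
next
  fix B F assume B: "B \<in> carrier P1" and v: "\<And>y. y \<in> Y0 \<Longrightarrow> pbracket P1 y B \<in> I0" and F: "F \<in> I0"
  note X = rp[OF B]
  have X2: "rp B \<in> two.sr.invs" using invs2_iff[OF X(1)] v by (simp add: X(2))
  have Fc: "F \<in> carrier P1" using F I0_sub by blast
  note Y = rp[OF Fc]
  \<comment> \<open>The bracket is computed with representatives, where stability of
    \<open>two.I\<close> under brackets with invariants is known from the one-step
    reduction.\<close>
  have "rp F \<in> two.I" using F cl1_I0[OF Y(1)] invs_reg[OF Y(1)] by (simp add: Y(2) two.I_iff)
  then have "pb (rp F) (rp B) \<in> two.I" using two.sr.inv_pb_J[OF X2] by (simp add: DV_simps sym_alg_simps)
  then have "cl1 (pb (rp F) (rp B)) \<in> I0" using cl1_I0[OF invs_pb[OF Y(1) X(1)]] by (simp add: two.I_iff)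
  then show "pbracket P1 F B \<in> I0" using one.V1_pb[OF Y(1) X(1)] by (simp add: X(2) Y(2))
next
  fix B assume B: "B \<in> carrier P1"
  show "ext0 B \<in> carrier P1" by (rule ext0(1)[OF B])
  have i: "proj (\<lambda>\<xi>\<in>dual. rp B (two.\<pi> \<xi>)) \<in> one.sr.invs"
    by (rule proj_invs[OF two.\<pi>_reg[OF invs_reg[OF rp(1)[OF B]]]])
  show "pbracket P1 y (ext0 B) \<in> I0" if "y \<in> Y0" for y
    using invs2_iff[OF i] ext0(3)[OF B] that unfolding ext0_def by blast
  fix Q assume "Q \<in> Z0"
  then obtain \<xi> where \<xi>: "\<xi> \<in> two.Z" "Q = one.orb \<xi>" by (elim imageE)
  show "evl one.V1 (ext0 B) Q = evl one.V1 B (\<pi>0 Q)" using ext0(2)[OF B \<xi>(1)] by (simp add: \<xi> \<pi>0)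
next
  fix Q assume "Q \<in> Z0"
  then obtain \<xi> where \<xi>: "\<xi> \<in> two.Z" "Q = one.orb \<xi>" by (elim imageE)
  obtain g where g: "g \<in> M0" "two.\<pi> \<xi> \<in> one.orb (coAd \<phi> g \<xi>)" using \<pi>2_rel[OF \<xi>(1)] by (auto simp: rel_def)
  show "\<pi>0 Q \<in> orb0 Q" unfolding \<xi>(2) \<pi>0[OF \<xi>(1)] orb0_iff using g one.orb_eq[OF g(2)] by (intro bexI[of _ g])
  fix Q' assume "Q' \<in> orb0 Q"
  then obtain g where g: "g \<in> M0" "Q' = one.orb (coAd \<phi> g \<xi>)" unfolding \<xi>(2) orb0_iff by (elim bexE)
  show "\<pi>0 Q' = \<pi>0 Q"
    using two.\<pi>_const[OF \<xi>(1) act0_orb2[OF g(1)]] two.orb_Z[OF act0_orb2[OF g(1)] \<xi>(1)]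
    by (simp add: \<xi> g(2) \<pi>0)
next
  fix Q assume "Q \<in> points one.V1"
    and v: "\<And>B. B \<in> carrier P1 \<Longrightarrow> (\<And>R. R \<in> Z0 \<Longrightarrow> evl one.V1 B (\<pi>0 R) = 0) \<Longrightarrow> evl one.V1 B Q = 0"
  then obtain \<xi> where \<xi>: "\<xi> \<in> one.Z" "Q = one.orb \<xi>" by (auto simp: one.V1_points)
  have v': "X \<xi> = 0" if X: "X \<in> one.sr.invs" and z: "\<And>\<eta>. \<eta> \<in> two.Z \<Longrightarrow> X (two.\<pi> \<eta>) = 0" for X
  proof -
    have "evl one.V1 (cl1 X) Q = 0"
    proof (rule v[OF cl1_carrier[OF X]])
      fix R assume "R \<in> Z0"
      then obtain \<eta> where \<eta>: "\<eta> \<in> two.Z" "R = one.orb \<eta>" by (elim imageE)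
      show "evl one.V1 (cl1 X) (\<pi>0 R) = 0"
        using z[OF \<eta>(1)] one.V1_ev[OF X Z2_Z1[OF \<pi>2_Z[OF \<eta>(1)]]] by (simp add: \<eta> \<pi>0)
    qed
    then show ?thesis by (simp add: \<xi> one.V1_ev X)
  qed
  \<comment> \<open>Closedness comes in two parts: the functions
    \<open>lin_shift sc two.chi y\<close> force \<open>\<xi>\<close> into the second fibre, and a
    comparison of first-stage slice points then forces \<open>\<xi>\<close> and
    \<open>two.\<pi> \<xi>\<close> into the same class.\<close>
  have "\<xi> y = two.chi y" if y: "y \<in> m0" for y
    using v'[OF lin_shift_m0_invs[OF y]] \<pi>2_Z two.Z_val y m0_m2 one.Z_dual[OF \<xi>(1)]
    by (auto simp: lin_shift_def two.\<pi>_dual)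
  then have \<xi>2: "\<xi> \<in> two.Z" using \<xi>(1) by (simp add: Z2_iff)
  have "one.\<pi> \<xi> x = one.\<pi> (two.\<pi> \<xi>) x" for x
  proof -
    \<comment> \<open>Up to \<open>proj\<close>, one coordinate of the difference between the
      first-stage slice points of \<open>\<zeta>\<close> and of \<open>two.\<pi> \<zeta>\<close>. It
      vanishes at all points \<open>two.\<pi> \<eta>\<close> because \<open>two.\<pi>\<close> fixes
      them.\<close>
    define F where "F = (\<lambda>\<zeta>\<in>dual. lin sc x \<zeta> + (- 1) * (\<lambda>\<zeta>\<in>dual. proj (lin sc x) (two.\<pi> \<zeta>)) \<zeta>)"
    have F: "F \<in> reg"
      unfolding F_def by (intro reg_add reg_cmul) (simp_all add: reg_restrict lin_in_reg two.\<pi>_reg invs_reg proj_invs)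
    have Fv: "proj F \<zeta> = one.\<pi> \<zeta> x - one.\<pi> (two.\<pi> \<zeta>) x" if "\<zeta> \<in> two.Z" for \<zeta>
      using that by (simp add: proj_at Z2_Z1 F_def one.\<pi>_dual two.\<pi>_dual \<pi>2_\<pi>1 \<pi>2_Z) (simp add: lin_def one.\<pi>_dual)
    have "proj F \<xi> = 0"
    proof (rule v'[OF proj_invs[OF F]])
      fix \<eta> assume \<eta>: "\<eta> \<in> two.Z"
      have "two.\<pi> (two.\<pi> \<eta>) = two.\<pi> \<eta>" using two.\<pi>_fix[OF two.\<pi>_slice[OF \<eta>]] .
      then show "proj F (two.\<pi> \<eta>) = 0" by (simp add: Fv \<pi>2_Z \<eta>)
    qed
    then show ?thesis by (simp add: Fv \<xi>2)
  qed
  then have "one.\<pi> \<xi> = one.\<pi> (two.\<pi> \<xi>)" by (rule ext)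
  then have "one.orb \<xi> = one.orb (two.\<pi> \<xi>)"
    using one.orb_eq[OF one.\<pi>_orb[OF \<xi>(1)]] one.orb_eq[OF one.\<pi>_orb[OF Z2_Z1[OF \<pi>2_Z[OF \<xi>2]]]] by simp
  then have "Q = \<pi>0 (one.orb \<xi>)" unfolding \<pi>0[OF \<xi>2] \<xi>(2) .
  then show "Q \<in> \<pi>0 ` Z0" using imageI[OF \<xi>2] by (rule image_eqI)
qed (rule orb0_self)

sublocale red: slice_reduction one.V1 Z0 M0 act0 I0 Y0 \<pi>0 ext0
  by (rule second_reduction)

end

section \<open>Comparison of the one-step and the two-step reduction\<close>

context two_stage
begin

abbreviation "V0 \<equiv> hamiltonian_reduction one.V1 Z0 M0 act0 I0 Y0"

lemma red_invs_iff: "X \<in> one.sr.invs \<Longrightarrow> cl1 X \<in> red.invs \<longleftrightarrow> X \<in> two.sr.invs"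
  unfolding red.invs_def using invs2_iff cl1_carrier by simp

lemma V0_elem:
  assumes "B \<in> carrier (coord_alg V0)"
  obtains X where "X \<in> one.sr.invs" "X \<in> two.sr.invs" "B = I0 +>\<^bsub>P1\<^esub> cl1 X"
proof -
  obtain F where F: "F \<in> red.invs" "B = I0 +>\<^bsub>P1\<^esub> F" using assms unfolding red.R_carrier by (elim imageE)
  note X = rp[OF red.inv_carrier[OF F(1)]]
  show ?thesis by (rule that[of "rp F"]) (use X F red_invs_iff[OF X(1)] in simp_all)
qed

lemma V0_ev:
  assumes "X \<in> one.sr.invs" "X \<in> two.sr.invs" "\<xi> \<in> two.Z"
  shows "evl V0 (I0 +>\<^bsub>P1\<^esub> cl1 X) (orb0 (one.orb \<xi>)) = X \<xi>"
  using red.R_ev[of "cl1 X" "one.orb \<xi>"] assms by (simp add: red_invs_iff one.V1_ev Z2_Z1)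

definition \<iota> :: "('g \<Rightarrow> complex) set \<Rightarrow> ('g \<Rightarrow> complex) set set" where
  "\<iota> P = orb0 (one.orb (SOME \<xi>. \<xi> \<in> P))"

lemma orb0_orb2: "\<xi> \<in> two.Z \<Longrightarrow> \<eta> \<in> two.orb \<xi> \<Longrightarrow> orb0 (one.orb \<eta>) = orb0 (one.orb \<xi>)"
proof -
  assume "\<xi> \<in> two.Z" "\<eta> \<in> two.orb \<xi>"
  then obtain g where g: "g \<in> M0" "\<eta> \<in> one.orb (coAd \<phi> g \<xi>)" using orb2_rel unfolding rel_def by blast
  have "one.orb \<eta> \<in> orb0 (one.orb \<xi>)" unfolding orb0_iff using one.orb_eq[OF g(2)] g(1) by (intro bexI[of _ g])
  then show ?thesis by (rule orb0_eq)
qed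

lemma \<iota>: "\<xi> \<in> two.Z \<Longrightarrow> \<iota> (two.orb \<xi>) = orb0 (one.orb \<xi>)"
proof -
  assume \<xi>: "\<xi> \<in> two.Z"
  have "(SOME \<eta>. \<eta> \<in> two.orb \<xi>) \<in> two.orb \<xi>" by (rule someI[of "\<lambda>\<eta>. \<eta> \<in> two.orb \<xi>"], rule two.orb_self)
  then show ?thesis unfolding \<iota>_def by (rule orb0_orb2[OF \<xi>])
qed

text \<open>Described by values on the second fibre instead of by a representative, so that it is
  independent of choices from the start.\<close>

definition \<Psi> :: "(('g \<Rightarrow> complex) \<Rightarrow> complex) set set \<Rightarrow> (('g \<Rightarrow> complex) \<Rightarrow> complex) set" where
  "\<Psi> B = {X \<in> reg. \<forall>\<xi>\<in>two.Z. X \<xi> = evl V0 B (orb0 (one.orb \<xi>))}"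

lemma \<Psi>: "X \<in> one.sr.invs \<Longrightarrow> X \<in> two.sr.invs \<Longrightarrow> \<Psi> (I0 +>\<^bsub>P1\<^esub> cl1 X) = two.I +>\<^bsub>S\<^esub> X"
  by (intro Set.set_eqI) (simp add: \<Psi>_def two.cl_mem invs_reg V0_ev)

text \<open>All members of an invariant class are invariant, so any representative \<open>X\<close>
  of a double class is invariant at both stages and \<open>\<Psi>\<close> applies.\<close>

lemma \<Psi>_class:
  assumes X: "X \<in> reg" and c: "cl1 X \<in> carrier P1" "I0 +>\<^bsub>P1\<^esub> cl1 X \<in> carrier (coord_alg V0)"
  shows "\<Psi> (I0 +>\<^bsub>P1\<^esub> cl1 X) = two.I +>\<^bsub>S\<^esub> X"
proof -
  have "X \<in> cl1 X" using X by (simp add: one.cl_mem)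
  then have "X \<in> cl1 (rp (cl1 X))" by (simp add: rp[OF c(1)])
  then have X1: "X \<in> one.sr.invs"
    using one.sr.cl_inv[OF rp(1)[OF c(1)]] by (simp add: DV_simps)
  obtain F where F: "F \<in> red.invs" "I0 +>\<^bsub>P1\<^esub> cl1 X = I0 +>\<^bsub>P1\<^esub> F" using c(2) unfolding red.R_carrier by (elim imageE)
  have "cl1 X \<in> I0 +>\<^bsub>P1\<^esub> F" using red.cl_self[OF c(1)] F(2) by simp
  from red.cl_inv[OF F(1) this] have "X \<in> two.sr.invs" using red_invs_iff[OF X1] by simp
  then show ?thesis by (rule \<Psi>[OF X1])
qed

lemma stage_iso: "pvariety_iso two.V1 V0 \<iota> \<Psi>"
proof (rule pvariety_isoI[OF two.V1_affine red.R_affine])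
  show "bij_betw \<iota> (points two.V1) (points V0)"
  proof (rule bij_betw_imageI)
    show "inj_on \<iota> (points two.V1)"
    proof (rule inj_onI)
      fix P P' assume "P \<in> points two.V1" "P' \<in> points two.V1" and e: "\<iota> P = \<iota> P'"
      then obtain \<xi> \<eta> where *: "\<xi> \<in> two.Z" "P = two.orb \<xi>" "\<eta> \<in> two.Z" "P' = two.orb \<eta>"
        by (auto simp: two.V1_points)
      have "one.orb \<eta> \<in> orb0 (one.orb \<xi>)" using e orb0_self[of "one.orb \<eta>"] by (simp add: * \<iota>)
      then obtain g where g: "g \<in> M0" "one.orb \<eta> = one.orb (coAd \<phi> g \<xi>)" unfolding orb0_iff by (elim bexE)
      have "\<eta> \<in> one.orb (coAd \<phi> g \<xi>)" using one.orb_self[of \<eta>] g(2) by simp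
      then have "\<eta> \<in> two.orb \<xi>" using g(1) by (intro rel_orb2) (auto simp: rel_def)
      from two.orb_eq[OF this] show "P = P'" by (simp add: *)
    qed
    have "\<iota> ` two.orb ` two.Z = orb0 ` Z0" unfolding image_image by (rule image_cong) (simp_all add: \<iota>)
    then show "\<iota> ` points two.V1 = points V0" by (simp only: two.V1_points red.R_points)
  qed
next
  fix B assume "B \<in> carrier (coord_alg V0)"
  then obtain X where X: "X \<in> one.sr.invs" "X \<in> two.sr.invs" "B = I0 +>\<^bsub>P1\<^esub> cl1 X" by (rule V0_elem)
  show "\<Psi> B \<in> carrier (coord_alg two.V1)"
    unfolding X(3) \<Psi>[OF X(1,2)] two.V1_carrier by (rule imageI[OF X(2)])
  fix P assume "P \<in> points two.V1"
  then obtain \<xi> where \<xi>: "\<xi> \<in> two.Z" "P = two.orb \<xi>" by (auto simp: two.V1_points)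
  show "evl two.V1 (\<Psi> B) P = evl V0 B (\<iota> P)"
    unfolding X(3) \<Psi>[OF X(1,2)] \<xi>(2) \<iota>[OF \<xi>(1)] V0_ev[OF X(1,2) \<xi>(1)] by (rule two.V1_ev[OF X(2) \<xi>(1)])
  fix C assume "C \<in> carrier (coord_alg V0)"
  then obtain Y where Y: "Y \<in> one.sr.invs" "Y \<in> two.sr.invs" "C = I0 +>\<^bsub>P1\<^esub> cl1 Y" by (rule V0_elem)
  have XY: "pb X Y \<in> two.sr.invs" using two.sr.inv_pb[OF X(2) Y(2)] by (simp add: DV_simps sym_alg_simps)
  have XY1: "pb X Y \<in> one.sr.invs" by (rule invs_pb[OF X(1) Y(1)])
  have b: "pbracket (coord_alg V0) B C = I0 +>\<^bsub>P1\<^esub> cl1 (pb X Y)"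
    using red.R_ops(6)[of "cl1 X" "cl1 Y"] X Y by (simp add: red_invs_iff one.V1_pb)
  show "evl two.V1 (pbracket (coord_alg two.V1) (\<Psi> B) (\<Psi> C)) P = evl V0 (pbracket (coord_alg V0) B C) (\<iota> P)"
    unfolding b unfolding X(3) Y(3) \<Psi>[OF X(1,2)] \<Psi>[OF Y(1,2)] \<xi>(2) \<iota>[OF \<xi>(1)] V0_ev[OF XY1 XY \<xi>(1)] two.V1_pb[OF X(2) Y(2)]
    by (rule two.V1_ev[OF XY \<xi>(1)])
next
  fix F assume "F \<in> carrier (coord_alg two.V1)"
  then obtain X where X: "X \<in> two.sr.invs" "F = two.I +>\<^bsub>S\<^esub> X" unfolding two.V1_carrier by (elim imageE)
  have Xr: "X \<in> reg" using X(1) by (simp add: two.invs_iff)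
  \<comment> \<open>An invariant of the one-step reduction need not be invariant under
    \<open>M1\<close> on the larger first fibre; \<open>proj X\<close> is, and it has the same
    values on the second fibre.\<close>
  have v: "proj X \<xi> = X \<xi>" if "\<xi> \<in> two.Z" for \<xi>
    using two.invs_orb[OF X(1) that orb1_orb2[OF one.\<pi>_orb[OF Z2_Z1[OF that]]]] by (simp add: proj_at Z2_Z1 that)
  note p1 = proj_invs[OF Xr]
  have p2: "proj X \<in> two.sr.invs" by (rule invs2_cong[OF X(1) invs_reg[OF p1] v])
  have "I0 +>\<^bsub>P1\<^esub> cl1 (proj X) \<in> carrier (coord_alg V0)"
    unfolding red.R_carrier using red_invs_iff[OF p1] p2 by simp
  moreover have "evl two.V1 F P = evl V0 (I0 +>\<^bsub>P1\<^esub> cl1 (proj X)) (\<iota> P)" if "P \<in> points two.V1" for P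
  proof -
    obtain \<xi> where \<xi>: "\<xi> \<in> two.Z" "P = two.orb \<xi>" using \<open>P \<in> _\<close> unfolding two.V1_points by (elim imageE)
    show ?thesis unfolding X(2) \<xi>(2) \<iota>[OF \<xi>(1)] V0_ev[OF p1 p2 \<xi>(1)] v[OF \<xi>(1)] by (rule two.V1_ev[OF X(1) \<xi>(1)])
  qed
  ultimately show "\<exists>B\<in>carrier (coord_alg V0). \<forall>P\<in>points two.V1. evl two.V1 F P = evl V0 B (\<iota> P)" by blast
qed

lemma V0_SV_iso: "\<exists>\<kappa> \<theta>. pvariety_iso V0 two.SV \<kappa> \<theta>"
proof -
  obtain \<kappa> \<theta> where "pvariety_iso two.V1 two.SV \<kappa> \<theta>" using two.V1_SV_iso by blast
  from pvariety_iso_common[OF stage_iso this] show ?thesis .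
qed

section \<open>The Hamiltonian action of \<open>M0\<close> on the first reduction\<close>

definition shift :: "complex^'n^'n \<Rightarrow> (('g \<Rightarrow> complex) \<Rightarrow> complex) \<Rightarrow> ('g \<Rightarrow> complex) \<Rightarrow> complex" where
  "shift g X = (\<lambda>\<xi>\<in>dual. X (coAd \<phi> g \<xi>))"

lemma shift_invs: assumes g: "g \<in> M0" and X: "X \<in> one.sr.invs" shows "shift g X \<in> one.sr.invs"
proof (rule one.invsI)
  show "shift g X \<in> reg" unfolding shift_def by (rule coAd_reg[OF M0_G[OF g] invs_reg[OF X]])
  fix \<xi> h assume \<xi>: "\<xi> \<in> one.Z" and h: "h \<in> M1"
  have "coAd \<phi> g (coAd \<phi> h \<xi>) \<in> one.orb (coAd \<phi> g \<xi>)" using h by (intro orb_coAd[OF g]) (auto simp: one.orb_iff)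
  from one.invs_orb[OF X act_Z1[OF g \<xi>] this] show "shift g X (coAd \<phi> h \<xi>) = shift g X \<xi>"
    using one.Z_dual[OF \<xi>] coAd_dual[OF M1_G[OF h] one.Z_dual[OF \<xi>]] by (simp add: shift_def)
qed

lemma class_points: "Q \<in> points one.V1 \<Longrightarrow> g \<in> M0 \<Longrightarrow> act0 g Q \<in> points one.V1"
  unfolding one.V1_points by (auto simp del: orbit_def simp: class_orb act_Z1)

text \<open>The comorphism is translation of a representative; surjectivity comes from translating
  by \<open>matrix_inv g\<close>, and brackets are respected by \<open>pb_coAd\<close>.\<close>

lemma class_iso: assumes g: "g \<in> M0" shows "pvariety_iso one.V1 one.V1 (act0 g) (\<lambda>B. cl1 (shift g (rp B)))"
proof (rule pvariety_isoI[OF one.V1_affine one.V1_affine])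
  have ev: "evl one.V1 (cl1 (shift g X)) (one.orb \<xi>) = evl one.V1 (cl1 X) (act0 g (one.orb \<xi>))"
    if "X \<in> one.sr.invs" "\<xi> \<in> one.Z" for X \<xi>
    using that by (simp add: class_orb[OF g] one.V1_ev shift_invs[OF g] act_Z1[OF g]) (simp add: shift_def one.Z_dual)
  have pt: "\<exists>\<xi>\<in>one.Z. Q = one.orb \<xi>" if "Q \<in> points one.V1" for Q using that unfolding one.V1_points by blast
  have gi: "act0 g (act0 (matrix_inv g) Q) = Q" "act0 (matrix_inv g) (act0 g Q) = Q" for Q
    using M0_G[OF g] by (simp_all add: act0_mult[symmetric] G_inv G_inverse act0_one)
  show "bij_betw (act0 g) (points one.V1) (points one.V1)"
    by (rule bij_betw_byWitness[where f' = "act0 (matrix_inv g)"])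
      (use gi class_points g zero.M_inv[OF g] in auto)
  fix B assume B: "B \<in> carrier P1"
  show "cl1 (shift g (rp B)) \<in> carrier P1" by (rule cl1_carrier[OF shift_invs[OF g rp(1)[OF B]]])
  fix Q assume "Q \<in> points one.V1"
  then obtain \<xi> where \<xi>: "\<xi> \<in> one.Z" "Q = one.orb \<xi>" using pt by blast
  show "evl one.V1 (cl1 (shift g (rp B))) Q = evl one.V1 B (act0 g Q)"
    using ev[OF rp(1)[OF B] \<xi>(1)] unfolding \<xi>(2) rp(2)[OF B] .
  fix C assume C: "C \<in> carrier P1"
  note X = rp[OF B] and Y = rp[OF C]
  have b: "pbracket P1 B C = cl1 (pb (rp B) (rp C))" using one.V1_pb[OF X(1) Y(1)] by (simp add: X(2) Y(2))
  have "evl one.V1 (cl1 (pb (shift g (rp B)) (shift g (rp C)))) Q = pb (shift g (rp B)) (shift g (rp C)) \<xi>"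
    unfolding \<xi>(2) by (rule one.V1_ev[OF invs_pb[OF shift_invs[OF g X(1)] shift_invs[OF g Y(1)]] \<xi>(1)])
  also have "\<dots> = pb (rp B) (rp C) (coAd \<phi> g \<xi>)"
    unfolding shift_def by (rule pb_coAd[OF M0_G[OF g] invs_reg[OF X(1)] invs_reg[OF Y(1)] one.Z_dual[OF \<xi>(1)]])
  also have "\<dots> = evl one.V1 (pbracket P1 B C) (act0 g Q)"
    unfolding b \<xi>(2) class_orb[OF g] by (rule one.V1_ev[OF invs_pb[OF X(1) Y(1)] act_Z1[OF g \<xi>(1)], symmetric])
  finally show "evl one.V1 (pbracket P1 (cl1 (shift g (rp B))) (cl1 (shift g (rp C)))) Q
      = evl one.V1 (pbracket P1 B C) (act0 g Q)"
    unfolding one.V1_pb[OF shift_invs[OF g X(1)] shift_invs[OF g Y(1)]] .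
next
  fix F assume F: "F \<in> carrier P1"
  note X = rp[OF F] and g' = zero.M_inv[OF g]
  have "evl one.V1 F Q = evl one.V1 (cl1 (shift (matrix_inv g) (rp F))) (act0 g Q)" if "Q \<in> points one.V1" for Q
  proof -
    obtain \<xi> where \<xi>: "\<xi> \<in> one.Z" "Q = one.orb \<xi>" using \<open>Q \<in> _\<close> unfolding one.V1_points by (elim imageE)
    have "evl one.V1 (cl1 (shift (matrix_inv g) (rp F))) (act0 g Q) = rp F \<xi>"
      using one.V1_ev[OF shift_invs[OF g' X(1)] act_Z1[OF g \<xi>(1)]] coAd_dual[OF M0_G[OF g] one.Z_dual[OF \<xi>(1)]]
      by (simp add: \<xi>(2) class_orb[OF g]) (simp add: shift_def coAd_inverse M0_G[OF g])
    moreover have "evl one.V1 F Q = rp F \<xi>" using one.V1_ev[OF X(1) \<xi>(1)] unfolding X(2) \<xi>(2) .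
    ultimately show ?thesis by simp
  qed
  then show "\<exists>B\<in>carrier P1. \<forall>Q\<in>points one.V1. evl one.V1 F Q = evl one.V1 B (act0 g Q)"
    using cl1_carrier[OF shift_invs[OF g' X(1)]] by blast
qed

text \<open>The coefficients \<open>b i\<close> of the action on the dual need not be invariant.
  Evaluating them at the slice point \<open>one.\<pi> \<xi>\<close> of the class turns them into
  functions on the first reduction.\<close>

lemma class_separated:
  assumes F: "F \<in> carrier P1"
  shows "\<exists>(n::nat) a b. (\<forall>i<n. a i \<in> GL_regular_functions \<and> b i \<in> carrier P1) \<and>
    (\<forall>g\<in>M0. \<forall>Q\<in>points one.V1. evl one.V1 F (act0 g Q) = (\<Sum>i<n. a i g * evl one.V1 (b i) Q))"
proof -
  note X = rp[OF F]
  obtain n :: nat and a b where ab: "\<And>i. i < n \<Longrightarrow> a i \<in> GL_regular_functions" "\<And>i. i < n \<Longrightarrow> b i \<in> reg"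
    "\<And>g \<xi>. g \<in> G \<Longrightarrow> \<xi> \<in> dual \<Longrightarrow> rp F (coAd \<phi> g \<xi>) = (\<Sum>i<n. a i g * b i \<xi>)"
    using separatedE[OF separated_coAd[OF invs_reg[OF X(1)]]] by blast
  have "evl one.V1 F (act0 g Q) = (\<Sum>i<n. a i g * evl one.V1 (cl1 (proj (b i))) Q)" if g: "g \<in> M0" and "Q \<in> points one.V1" for g Q
  proof -
    obtain \<xi> where \<xi>: "\<xi> \<in> one.Z" "Q = one.orb \<xi>" using \<open>Q \<in> _\<close> unfolding one.V1_points by (elim imageE)
    have "evl one.V1 (cl1 (rp F)) (one.orb (coAd \<phi> g \<xi>)) = rp F (coAd \<phi> g \<xi>)" by (rule one.V1_ev[OF X(1) act_Z1[OF g \<xi>(1)]])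
    also have "\<dots> = rp F (coAd \<phi> g (one.\<pi> \<xi>))"
      by (rule one.invs_orb[OF X(1) act_Z1[OF g \<xi>(1)] orb_coAd[OF g one.\<pi>_orb[OF \<xi>(1)]], symmetric])
    also have "\<dots> = (\<Sum>i<n. a i g * b i (one.\<pi> \<xi>))" by (rule ab(3)[OF M0_G[OF g] one.\<pi>_dual])
    also have "\<dots> = (\<Sum>i<n. a i g * evl one.V1 (cl1 (proj (b i))) Q)" using ab(2) by (simp add: \<xi> proj_ev)
    finally show ?thesis unfolding X(2) \<xi>(2) class_orb[OF g] .
  qed
  then show ?thesis
    using ab(1,2) cl1_carrier[OF proj_invs] by (intro exI[of _ n] exI[of _ a] exI[of _ "\<lambda>i. cl1 (proj (b i))"] conjI) blast+
qed

text \<open>The Hamiltonian of \<open>y\<close> is the class of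
  \<open>lin_shift sc two.chi y\<close>: the constant makes it the component of the moment map and
  does not affect brackets.\<close>

lemma class_hamiltonian: "hamiltonian_action one.V1 \<phi> m0 M0 act0 (class_moment two.chi m0)"
  unfolding hamiltonian_action_def
proof (intro conjI ballI)
  fix Q assume Q: "Q \<in> points one.V1"
  show "act0 (mat 1) Q = Q" by (rule act0_one)
  fix g assume g: "g \<in> M0"
  show "act0 g Q \<in> points one.V1" by (rule class_points[OF Q g])
  show "act0 (g ** h) Q = act0 g (act0 h Q)" if "h \<in> M0" for h by (rule act0_mult[OF M0_G[OF g] M0_G[OF that]])
next
  fix g assume g: "g \<in> M0"
  show "\<exists>\<psi>. pvariety_iso one.V1 one.V1 (act0 g) \<psi>" using class_iso[OF g] by (rule exI[of "\<lambda>\<psi>. pvariety_iso one.V1 one.V1 (act0 g) \<psi>"])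
next
  fix g Q y assume g: "g \<in> M0" and Q: "Q \<in> points one.V1" and y: "y \<in> m0"
  obtain \<xi> where \<xi>: "\<xi> \<in> one.Z" "Q = one.orb \<xi>" using Q unfolding one.V1_points by (elim imageE)
  obtain x where x: "x \<in> m0" "\<forall>w. Ad \<phi> (matrix_inv g) w = ead x w" using zero.M_Ad[OF zero.M_inv[OF g]] by blast
  have "ead x y \<in> m0" by (rule ead_m0[OF x(1) y])
  moreover have "two.chi (ead x y) = two.chi y" using chi2_ead x(1) y m0_m2 by blast
  ultimately show "class_moment two.chi m0 (act0 g Q) y = class_moment two.chi m0 Q (Ad \<phi> (matrix_inv g) y)"
    using y by (simp add: \<xi> class_orb[OF g] class_moment_orb act_Z1[OF g]) (simp add: coAd_def x(2))
next
  fix y assume y: "y \<in> m0"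
  note k = lin_shift_m0_invs[OF y]
  show "\<exists>k\<in>carrier P1. (\<forall>Q\<in>points one.V1. evl one.V1 k Q = class_moment two.chi m0 Q y) \<and>
        (\<forall>F\<in>carrier P1. \<forall>Q\<in>points one.V1. \<forall>\<gamma> :: complex \<Rightarrow> complex^'n^'n.
           range \<gamma> \<subseteq> M0 \<and> \<gamma> 0 = mat 1 \<and>
           (\<forall>i j. ((\<lambda>t. \<gamma> t $ i $ j) has_field_derivative \<phi> y $ i $ j) (at 0)) \<longrightarrow>
           ((\<lambda>t. evl one.V1 F (act0 (\<gamma> t) Q)) has_field_derivative - evl one.V1 (pbracket P1 k F) Q) (at 0))"
  proof (rule bexI[OF _ cl1_carrier[OF k]], intro conjI ballI allI impI)
    fix Q assume Q: "Q \<in> points one.V1"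
    obtain \<xi> where \<xi>: "\<xi> \<in> one.Z" "Q = one.orb \<xi>" using Q unfolding one.V1_points by (elim imageE)
    show "evl one.V1 (cl1 (lin_shift sc two.chi y)) Q = class_moment two.chi m0 Q y"
      using y by (simp add: \<xi> one.V1_ev[OF k] class_moment_orb) (simp add: lin_shift_def one.Z_dual \<xi>(1))
    fix F and \<gamma> :: "complex \<Rightarrow> complex^'n^'n" assume F: "F \<in> carrier P1" and \<gamma>: "range \<gamma> \<subseteq> M0 \<and> \<gamma> 0 = mat 1 \<and>
           (\<forall>i j. ((\<lambda>t. \<gamma> t $ i $ j) has_field_derivative \<phi> y $ i $ j) (at 0))"
    note X = rp[OF F]
    have \<gamma>M: "\<gamma> t \<in> M0" for t using \<gamma> by blast
    have e: "evl one.V1 F (act0 (\<gamma> t) Q) = rp F (coAd \<phi> (\<gamma> t) \<xi>)" for t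
      using one.V1_ev[OF X(1) act_Z1[OF \<gamma>M \<xi>(1)]] unfolding X(2) \<xi>(2) class_orb[OF \<gamma>M] .
    have "evl one.V1 (pbracket P1 (cl1 (lin_shift sc two.chi y)) F) Q = pb (lin_shift sc two.chi y) (rp F) \<xi>"
      using one.V1_ev[OF invs_pb[OF k X(1)] \<xi>(1)] unfolding \<xi>(2) one.V1_pb[OF k X(1), symmetric] X(2) .
    then have b: "evl one.V1 (pbracket P1 (cl1 (lin_shift sc two.chi y)) F) Q = pb (lin sc y) (rp F) \<xi>"
      by (simp only: pb_lin_shift)
    show "((\<lambda>t. evl one.V1 F (act0 (\<gamma> t) Q)) has_field_derivative
        - evl one.V1 (pbracket P1 (cl1 (lin_shift sc two.chi y)) F) Q) (at 0)"
      unfolding e b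
      by (rule coAd_tangent_deriv[OF M0_G[OF \<gamma>M] _ _ invs_reg[OF X(1)] one.Z_dual[OF \<xi>(1)]])
        (use \<gamma> in \<open>simp_all add: mderiv_def\<close>)
  qed
qed (rule class_separated)

end

text \<open>An element of a nilpotent subalgebra containing \<open>q\<close> is killed by a power of \<open>ad q\<close>; as \<open>ad q\<close>
  is diagonalisable it then commutes with \<open>q\<close>.\<close>

lemma (in lie_graded) cartan_commute:
  assumes h: "cartan_subalgebra sc br \<hh>" "q \<in> \<hh>" "x \<in> \<hh>"
  shows "br q x = 0"
proof -
  have "(br q ^^ n) x \<in> lower_central sc br \<hh> n" for n
  proof (induction n)
    case (Suc n)
    have "br q ((br q ^^ n) x) \<in> {br x y |x y. x \<in> \<hh> \<and> y \<in> lower_central sc br \<hh> n}" using h(2) Suc by blast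
    from span_base[OF this] show ?case by simp
  qed (simp add: h(3))
  moreover obtain n where "lower_central sc br \<hh> n = {0}" using h(1) unfolding cartan_subalgebra_def by blast
  ultimately have n: "(br q ^^ n) x = 0" by blast
  \<comment> \<open>\<open>ad q\<close> multiplies the component of degree \<open>k\<close> by
    \<open>k\<close>, so a vanishing power leaves only the component of degree zero.\<close>
  have "(br q ^^ i) x = (\<Sum>k\<in>rng. sc (of_int k ^ i) (cp k x))" for i
  proof (induction i)
    case 0 show ?case using cp_expand_rng[of x] by simp
  next
    case (Suc i)
    have "br q (cp k x) = sc (of_int k) (cp k x)" for k using cp_props(1)[of k x] by (simp add: \<Gamma>_eigen)
    then show ?case using Suc by (simp add: br_sum br_scale_right mult.commute)
  qed
  then have z: "(\<Sum>k\<in>rng. sc (of_int k ^ n) (cp k x)) = 0" using n by simp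
  have s: "sc (of_int k ^ n) (cp k x) = 0" if k: "k \<in> rng" for k
  proof -
    have "cp k (\<Sum>j\<in>rng. sc (of_int j ^ n) (cp j x)) = sc (of_int k ^ n) (cp k x)"
      by (rule cp_unique[where I = rng and c = "\<lambda>j. if j \<in> rng then sc (of_int j ^ n) (cp j x) else 0", THEN trans])
        (use k cp_props(1) subspace_scale[OF subspace_\<Gamma>] \<Gamma>_zero in \<open>auto simp: rng_def\<close>)
    then show ?thesis by (simp add: z cp_zero)
  qed
  have "cp k x = 0" if "k \<in> rng" "k \<noteq> 0" for k using s[OF that(1)] that(2) by simp
  then have "x = (\<Sum>k\<in>rng. if k = 0 then cp k x else 0)" by (subst cp_expand_rng[of x]) (rule sum.cong, auto)
  also have "\<dots> = cp 0 x" by (simp add: rng_def)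
  finally have "x \<in> \<Gamma> 0" using cp_props(1)[of 0 x] by simp
  then show ?thesis by (simp add: \<Gamma>_eigen)
qed

text \<open>Since \<open>q'\<close> has degree zero, \<open>cp 0\<close> commutes with
  \<open>ad q'\<close> and preserves each of its eigenspaces; hence it commutes with taking
  components for the other grading.\<close>

lemma (in lie_graded) cp_Fil_commute:
  assumes "lie_graded sc br form \<Gamma>' q'" and q: "br q q' = 0" and x: "x \<in> lie_graded.Fil \<Gamma>' i"
  shows "cp 0 x \<in> lie_graded.Fil \<Gamma>' i"
proof -
  interpret other: lie_graded sc br form \<Gamma>' q' by (rule assms(1))
  have q0: "q' \<in> \<Gamma> 0" using q by (simp add: \<Gamma>_eigen)
  have deg: "cp 0 w \<in> \<Gamma>' j" if "w \<in> \<Gamma>' j" for w j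
    using cp_br(2)[OF q0, of 0 w] that by (simp add: other.\<Gamma>_eigen cp_scale)
  have "other.cp k (cp 0 x) = cp 0 (other.cp k x)" for k
  proof (rule other.cp_unique[where I = other.rng])
    show "cp 0 (other.cp j x) \<in> \<Gamma>' j" for j by (rule deg[OF other.cp_props(1)])
    show "finite other.rng" by (simp add: other.rng_def)
    show "cp 0 (other.cp j x) = 0" if "j \<notin> other.rng" for j
      using other.cp_outside[of j x] that by (auto simp: other.rng_def cp_zero)
    show "cp 0 x = (\<Sum>j\<in>other.rng. cp 0 (other.cp j x))"
      by (subst other.cp_expand_rng[of x]) (rule cp_sum)
  qed
  then show ?thesis using x by (simp add: other.Fil_def cp_zero)
qed

text \<open>Invariance turns the coadjoint kernel condition on \<open>form w\<close> into
  orthogonality of \<open>br e w\<close> to everything, which nondegeneracy makes into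
  \<open>br e w = 0\<close>.\<close>

lemma (in lie_form) slodowy_slice_eq: "slodowy_slice sc br (form f) e = {form z | z. br e (z - f) = 0}"
proof -
  have ker: "(\<forall>x. - form w (br e x) = 0) \<longleftrightarrow> br e w = 0" for w
  proof -
    have "form w (br e x) = - form (br e w) x" for x
      using form_br[of w e x] br_swap[of w e] by (simp add: form_minus)
    then show ?thesis using form_nondeg[of "br e w"] by (auto simp: form_zero)
  qed
  have sum: "(\<lambda>x. form f x + form w x) = form (f + w)" for w by (rule ext) (simp add: form_add)
  show ?thesis
  proof (intro Set.set_eqI iffI)
    fix \<xi> assume "\<xi> \<in> slodowy_slice sc br (form f) e"
    then obtain \<eta> where \<eta>: "\<xi> = (\<lambda>x. form f x + \<eta> x)" "\<eta> \<in> dual" "\<forall>x. - \<eta> (br e x) = 0"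
      unfolding slodowy_slice_def by (elim CollectE exE conjE)
    obtain w where w: "form w = \<eta>" using form_surj[OF \<eta>(2)] by blast
    have "\<xi> = form (f + w)" unfolding \<eta>(1) w[symmetric] by (rule sum)
    moreover have "br e (f + w - f) = 0" using \<eta>(3) ker[of w] unfolding w[symmetric] by simp
    ultimately show "\<xi> \<in> {form z | z. br e (z - f) = 0}" by (intro CollectI exI[of _ "f + w"] conjI)
  next
    fix \<xi> assume "\<xi> \<in> {form z | z. br e (z - f) = 0}"
    then obtain z where z: "\<xi> = form z" "br e (z - f) = 0" by (elim CollectE exE conjE)
    have "\<xi> = (\<lambda>x. form f x + form (z - f) x)" unfolding sum by (simp add: z(1))
    then show "\<xi> \<in> slodowy_slice sc br (form f) e"
      unfolding slodowy_slice_def using ker[of "z - f"] z(2) form_dual by (intro CollectI exI[of _ "form (z - f)"]) simp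
  qed
qed

theorem theorem2:
  fixes sc :: "complex \<Rightarrow> 'g::ab_group_add \<Rightarrow> 'g"
    and br :: "'g \<Rightarrow> 'g \<Rightarrow> 'g"
    and form :: "'g \<Rightarrow> 'g \<Rightarrow> complex"
    and G M0 M1 M2 :: "(complex^'n^'n) set"
    and \<phi> :: "'g \<Rightarrow> complex^'n^'n"
    and f1 f2 q1 q2 e2 h2 :: 'g
    and \<Gamma>1 \<Gamma>2 :: "int \<Rightarrow> 'g set"
    and \<hh> m0 m1 m2 :: "'g set"
  assumes simple: "fd_simple_lie_algebra sc br"
    and group: "connected_algebraic_group G" "lie_algebra_identification sc br G \<phi>"
    and form: "nondeg_invariant_form sc br form"
    and nilpotent: "nilpotent_element br f1" "nilpotent_element br f2"
    and gradings: "good_grading sc br f1 \<Gamma>1" "good_grading sc br f2 \<Gamma>2"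
    and grading_elements: "grading_element sc br \<Gamma>1 q1" "grading_element sc br \<Gamma>2 q2"
    and cartan: "cartan_subalgebra sc br \<hh>" "q1 \<in> \<hh>" "q2 \<in> \<hh>"
    and good_algebras: "good_algebra sc br (form f1) \<Gamma>1 m1" "good_algebra sc br (form f2) \<Gamma>2 m2"
    and groups: "connected_unipotent_subgroup G \<phi> m1 M1" "connected_unipotent_subgroup G \<phi> m2 M2"
    and triple: "graded_sl2_triple sc br \<Gamma>2 e2 h2 f2"
    and decomposition: "m2 = {x + y | x y. x \<in> m1 \<and> y \<in> m0}" "m1 \<inter> m0 = {0}"
      "lie_subalgebra sc br m0" "\<forall>x\<in>\<hh>. \<forall>y\<in>m0. br x y \<in> m0" "lie_ideal sc br m1 m2"
    and degree_0: "nilpotent_element br (f2 - f1)" "f2 - f1 \<in> \<Gamma>1 0" "m0 \<subseteq> \<Gamma>1 0"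
    and commute: "br (q2 - q1) f1 = 0"
    and group0: "connected_unipotent_subgroup G \<phi> m0 M0"
  shows
    "let chi1 = form f1; chi2 = form f2;
         S = sym_alg sc br;
         Z1 = moment_fibre sc chi1 m1; Z2 = moment_fibre sc chi2 m2;
         I1 = moment_ideal sc br chi1 m1; I2 = moment_ideal sc br chi2 m2;
         V1 = slodowy_reduction sc br \<phi> chi1 m1 M1; V2 = slodowy_reduction sc br \<phi> chi2 m2 M2;
         P1 = coord_alg V1; P2 = coord_alg V2;
         act0 = class_action \<phi>; \<mu>0 = class_moment chi2 m0;
         Z0 = {Q \<in> points V1. \<mu>0 Q = (\<lambda>y\<in>m0. 0)};
         I0 = genideal P1 ((\<lambda>y. I1 +>\<^bsub>S\<^esub> lin_shift sc chi2 y) ` m0);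
         Y0 = (\<lambda>y. I1 +>\<^bsub>S\<^esub> lin sc y) ` m0;
         V0 = hamiltonian_reduction V1 Z0 M0 act0 I0 Y0;
         cls1 = orbit M1 (coAd \<phi>); cls2 = orbit M2 (coAd \<phi>); cls0 = orbit M0 act0;
         S2 = slodowy_slice sc br chi2 e2
     in
       reduction_well_defined (dual_variety sc br) Z1 M1 (coAd \<phi>) I1 (lin sc ` m1) \<and>
       reduction_well_defined (dual_variety sc br) Z2 M2 (coAd \<phi>) I2 (lin sc ` m2) \<and>
       (\<forall>\<xi>\<in>Z1. \<mu>0 (cls1 \<xi>) = (\<lambda>y\<in>m0. \<xi> y - chi2 y) \<and>
          (\<forall>g\<in>M0. coAd \<phi> g \<xi> \<in> Z1 \<and> act0 g (cls1 \<xi>) = cls1 (coAd \<phi> g \<xi>))) \<and>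
       hamiltonian_action V1 \<phi> m0 M0 act0 \<mu>0 \<and>
       reduction_well_defined V1 Z0 M0 act0 I0 Y0 \<and>
       (\<exists>\<iota> \<psi>. pvariety_iso V0 (slice_variety S2 P2) \<iota> \<psi>) \<and>
       Z2 \<subseteq> Z1 \<and>
       (\<exists>\<iota> \<Psi>.
          (\<forall>\<xi>\<in>Z2. \<iota> (cls2 \<xi>) = cls0 (cls1 \<xi>)) \<and>
          (\<forall>X\<in>carrier S. I1 +>\<^bsub>S\<^esub> X \<in> carrier P1 \<and> I0 +>\<^bsub>P1\<^esub> (I1 +>\<^bsub>S\<^esub> X) \<in> carrier (coord_alg V0) \<longrightarrow>
             \<Psi> (I0 +>\<^bsub>P1\<^esub> (I1 +>\<^bsub>S\<^esub> X)) = I2 +>\<^bsub>S\<^esub> X) \<and>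
          pvariety_iso V2 V0 \<iota> \<Psi>)"
proof -
  interpret L: fd_simple_lie_algebra sc br by (rule simple)
  interpret lie_form sc br form
    by unfold_locales (use L.finite_dim form in blast)+
  interpret lie_group sc br form G \<phi> by unfold_locales (rule group)+
  interpret a1: good_data sc br form \<Gamma>1 q1 f1 m1
    using gradings(1) grading_elements(1) good_algebras(1) by unfold_locales (simp_all add: good_grading_def)
  interpret a2: good_data sc br form \<Gamma>2 q2 f2 m2
    using gradings(2) grading_elements(2) good_algebras(2) by unfold_locales (simp_all add: good_grading_def)
  let ?t = "{x. br e2 x = 0}"
  obtain t1 where t1: "slice_data sc br form \<Gamma>1 q1 f1 m1 t1" using a1.slice_exists by blast
  have t2: "slice_data sc br form \<Gamma>2 q2 f2 m2 ?t"
    by (rule a2.slodowy_slice_data[OF triple nilpotent(2)])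
  interpret d1: slice_data sc br form \<Gamma>1 q1 f1 m1 t1 by (rule t1)
  interpret d2: slice_data sc br form \<Gamma>2 q2 f2 m2 ?t by (rule t2)
  have "0 \<in> m1" by (rule L.subspace_0[OF d1.subspace_m])
  then have m0: "m0 \<subseteq> m2" unfolding decomposition(1) by force
  have nil: "x \<in> m1 \<Longrightarrow> nilpotent_element br x" "x \<in> m2 \<Longrightarrow> nilpotent_element br x"
    "x \<in> m0 \<Longrightarrow> nilpotent_element br x" for x
    using d1.m_Fil d2.m_Fil m0 a1.Fil_nilpotent_element a2.Fil_nilpotent_element by blast+
  have m0_props: "L.subspace m0" "x \<in> m0 \<Longrightarrow> y \<in> m0 \<Longrightarrow> br x y \<in> m0" for x y
    using decomposition(3) by (simp_all add: lie_subalgebra_def)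
  have ideal: "x \<in> m2 \<Longrightarrow> y \<in> m1 \<Longrightarrow> br x y \<in> m1" for x y using decomposition(5) by (simp add: lie_ideal_def)
  \<comment> \<open>This is where the common Cartan subalgebra makes the two gradings
    compatible.\<close>
  have qq: "br q1 q2 = 0" by (rule a1.cartan_commute[OF cartan])
  have cp: "x \<in> a2.Fil i \<Longrightarrow> a1.cp 0 x \<in> a2.Fil i" for x i
    by (rule a1.cp_Fil_commute[OF a2.lie_graded_axioms qq])
  interpret two_stage sc br form G \<phi> \<Gamma>1 q1 f1 m1 t1 M1 \<Gamma>2 q2 f2 m2 ?t M2 m0 M0
    by unfold_locales (rule groups group0 decomposition degree_0 m0_props ideal cp nil; assumption?)+
  have S2: "slodowy_slice sc br (form f2) e2 = two.slice"
    by (simp add: slodowy_slice_eq two.slice_def)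
  show ?thesis
    unfolding Let_def S2 Z0_eq[symmetric]
  proof (intro conjI ballI)
    show "reduction_well_defined (dual_variety sc br) (moment_fibre sc (form f1) m1) M1 (coAd \<phi>)
      (moment_ideal sc br (form f1) m1) (lin sc ` m1)" by (rule one.sr.well_defined)
    show "reduction_well_defined (dual_variety sc br) (moment_fibre sc (form f2) m2) M2 (coAd \<phi>)
      (moment_ideal sc br (form f2) m2) (lin sc ` m2)" by (rule two.sr.well_defined)
    show "hamiltonian_action one.V1 \<phi> m0 M0 act0 (class_moment two.chi m0)" by (rule class_hamiltonian)
    show "reduction_well_defined one.V1 Z0 M0 act0 I0 Y0" by (rule red.well_defined)
    show "\<exists>\<iota> \<psi>. pvariety_iso V0 two.SV \<iota> \<psi>" by (rule V0_SV_iso)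
    show "two.Z \<subseteq> one.Z" using Z2_Z1 by blast
    show "\<exists>\<iota> \<Psi>. (\<forall>\<xi>\<in>two.Z. \<iota> (two.orb \<xi>) = orb0 (one.orb \<xi>)) \<and>
          (\<forall>X\<in>carrier S. cl1 X \<in> carrier P1 \<and> I0 +>\<^bsub>P1\<^esub> cl1 X \<in> carrier (coord_alg V0) \<longrightarrow>
             \<Psi> (I0 +>\<^bsub>P1\<^esub> cl1 X) = two.I +>\<^bsub>S\<^esub> X) \<and> pvariety_iso two.V1 V0 \<iota> \<Psi>"
      using \<iota> \<Psi>_class stage_iso by (intro exI[of _ \<iota>] exI[of _ \<Psi>]) (simp add: L.sym_alg_simps)
    fix \<xi> assume \<xi>: "\<xi> \<in> one.Z"
    show "class_moment two.chi m0 (one.orb \<xi>) = (\<lambda>y\<in>m0. \<xi> y - two.chi y)" by (rule class_moment_orb[OF \<xi>])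
    fix g assume g: "g \<in> M0"
    show "coAd \<phi> g \<xi> \<in> one.Z" by (rule act_Z1[OF g \<xi>])
    show "act0 g (one.orb \<xi>) = one.orb (coAd \<phi> g \<xi>)" by (rule class_orb[OF g])
  qed
qed

end
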